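(* Up to projective transformations of $\mathbb{RP}^2$, there exist exactly four line arrangements in $\mathbb{RP}^2$ with the following property: for some integer $n\ge 1$ the arrangement consists of $3n$ lines, and each line of the arrangement intersects the other lines of the arrangement in exactly $n+1$ points. These four arrangements are the reflection arrangements of the Coxeter groups corresponding to the spherical triangles with angles $(\frac{\pi}{2},\frac{\pi}{2},\frac{\pi}{2})$, $(\frac{\pi}{2},\frac{\pi}{3},\frac{\pi}{3})$, $(\frac{\pi}{2},\frac{\pi}{3},\frac{\pi}{4})$, $(\frac{\pi}{2},\frac{\pi}{3},\frac{\pi}{5})$.
   Context: A line arrangement is a finite set of pairwise distinct projective lines. Given a spherical triangle in the unit sphere $\mathbb S^2\subset\mathbb R^3$ with one of the listed angle triples, the corresponding Coxeter group is the finite group generated by the orthogonal reflections of $\mathbb R^3$ in the three planes through the origin spanned by the sides of the triangle. Its reflection arrangement is the set of lines in $\mathbb{RP}^2=\mathbb P(\mathbb R^3)$ that are the projectivizations of the mirror planes of all reflections in the group. (These arrangements have $3$, $6$, $9$ and $15$ lines respectively.) *)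

theory Defs
  imports "HOL-Analysis.Analysis" "HOL-Algebra.Generated_Groups" "HOL-Algebra.Bij"
begin

section \<open>The real projective plane\<close>

text \<open>A point of the projective plane is a one-dimensional subspace of \<^typ>\<open>real^3\<close>, and a line
  is the set of points contained in a two-dimensional subspace.\<close>

definition RP2 :: "(real^3) set set" where
  "RP2 = {p. subspace p \<and> dim p = 1}"

definition projectivization :: "(real^3) set \<Rightarrow> (real^3) set set" where
  "projectivization P = {p \<in> RP2. p \<subseteq> P}"

definition projective_line :: "(real^3) set set \<Rightarrow> bool" where
  "projective_line L \<longleftrightarrow> (\<exists>P. subspace P \<and> dim P = 2 \<and> L = projectivization P)"

definition projective_transformation :: "((real^3) set \<Rightarrow> (real^3) set) \<Rightarrow> bool" where
  "projective_transformation \<phi> \<longleftrightarrow>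
     (\<exists>f :: real^3 \<Rightarrow> real^3. linear f \<and> bij f \<and> \<phi> = (\<lambda>p. f ` p))"


section \<open>Line arrangements\<close>

definition line_arrangement :: "(real^3) set set set \<Rightarrow> bool" where
  "line_arrangement A \<longleftrightarrow> finite A \<and> (\<forall>L\<in>A. projective_line L)"

definition projectively_equivalent :: "((real^3) set set set \<times> (real^3) set set set) set" where
  "projectively_equivalent =
     {(A, B). line_arrangement A \<and> line_arrangement B \<and>
        (\<exists>\<phi>. projective_transformation \<phi> \<and> B = (\<lambda>L. \<phi> ` L) ` A)}"

definition intersection_points ::
    "(real^3) set set set \<Rightarrow> (real^3) set set \<Rightarrow> (real^3) set set" where
  "intersection_points A L = (\<Union>M \<in> A - {L}. L \<inter> M)"

definition special_arrangements :: "(real^3) set set set set" where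
  "special_arrangements =
     {A. line_arrangement A \<and>
        (\<exists>n::nat. n \<ge> 1 \<and> card A = 3 * n \<and> (\<forall>L\<in>A. card (intersection_points A L) = n + 1))}"

lemma equiv_projectively_equivalent:
  "equiv {A. line_arrangement A} projectively_equivalent"
proof (rule equivI)
  show "projectively_equivalent \<subseteq> {A. line_arrangement A} \<times> {A. line_arrangement A}"
    by (auto simp: projectively_equivalent_def)
  have "projective_transformation (\<lambda>p. p)"
    unfolding projective_transformation_def
    by (intro exI[of _ "\<lambda>x. x"]) (simp add: linear_iff bij_def fun_eq_iff)
  then show "refl_on {A. line_arrangement A} projectively_equivalent"
    by (force simp: refl_on_def projectively_equivalent_def)
  have inverse: "\<exists>\<psi>. projective_transformation \<psi> \<and> (\<forall>p. \<psi> (\<phi> p) = p)"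
    if "projective_transformation \<phi>" for \<phi>
  proof -
    from that obtain f :: "real^3 \<Rightarrow> real^3" where f: "linear f" "bij f" "\<phi> = (\<lambda>p. f ` p)"
      by (auto simp: projective_transformation_def)
    obtain g where g: "linear g" "g \<circ> f = id"
      using linear_injective_left_inverse[OF f(1)] f(2) by (auto simp: bij_def)
    moreover have "bij g"
      using bij_betw_comp_iff[OF f(2), of g UNIV] g(2) by simp
    ultimately show ?thesis using f
      by (intro exI[of _ "\<lambda>p. g ` p"])
         (auto simp: projective_transformation_def image_comp)
  qed
  show "sym projectively_equivalent"
  proof (rule symI)
    fix A B assume AB: "(A, B) \<in> projectively_equivalent"
    then obtain \<phi> where \<phi>: "projective_transformation \<phi>" "B = (\<lambda>L. \<phi> ` L) ` A"
      by (auto simp: projectively_equivalent_def)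
    with inverse obtain \<psi> where "projective_transformation \<psi>" "\<forall>p. \<psi> (\<phi> p) = p"
      by blast
    then show "(B, A) \<in> projectively_equivalent"
      using AB \<phi> by (auto simp: projectively_equivalent_def image_image intro!: exI[of _ \<psi>])
  qed
  have comp: "projective_transformation (\<psi> \<circ> \<phi>)"
    if "projective_transformation \<phi>" "projective_transformation \<psi>" for \<phi> \<psi>
  proof -
    from that obtain f g :: "real^3 \<Rightarrow> real^3"
      where "linear f" "bij f" "\<phi> = (\<lambda>p. f ` p)" "linear g" "bij g" "\<psi> = (\<lambda>p. g ` p)"
      by (auto simp: projective_transformation_def)
    then show ?thesis
      unfolding projective_transformation_def
      by (intro exI[of _ "g \<circ> f"]) (auto simp: linear_compose bij_comp image_comp)
  qed
  show "trans projectively_equivalent"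
  proof (rule transI)
    fix A B C
    assume AB: "(A, B) \<in> projectively_equivalent" and BC: "(B, C) \<in> projectively_equivalent"
    then obtain \<phi> \<psi> where "projective_transformation \<phi>" "B = (\<lambda>L. \<phi> ` L) ` A"
      "projective_transformation \<psi>" "C = (\<lambda>L. \<psi> ` L) ` B"
      by (auto simp: projectively_equivalent_def)
    then show "(A, C) \<in> projectively_equivalent"
      using AB BC comp[of \<phi> \<psi>]
      by (auto simp: projectively_equivalent_def image_image intro!: exI[of _ "\<psi> \<circ> \<phi>"])
  qed
qed


section \<open>Spherical triangles and their Coxeter groups\<close>

definition vector_angle :: "real^3 \<Rightarrow> real^3 \<Rightarrow> real" where
  "vector_angle x y = arccos ((x \<bullet> y) / (norm x * norm y))"

text \<open>Three unit vectors are the vertices of a spherical triangle iff they do not lie on a common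
  great circle; the sides are the shorter great circle arcs.  The arc from \<open>u\<close> to \<open>v\<close> leaves \<open>u\<close> in
  the direction of the component of \<open>v\<close> orthogonal to \<open>u\<close>, and the angle at a vertex is the angle
  between the directions of the two sides meeting there.\<close>

definition spherical_triangle :: "real^3 \<Rightarrow> real^3 \<Rightarrow> real^3 \<Rightarrow> bool" where
  "spherical_triangle u v w \<longleftrightarrow> {u, v, w} \<subseteq> sphere 0 1 \<and> dim {u, v, w} = 3"

definition side_direction :: "real^3 \<Rightarrow> real^3 \<Rightarrow> real^3" where
  "side_direction u v = v - (v \<bullet> u) *\<^sub>R u"

definition spherical_angle :: "real^3 \<Rightarrow> real^3 \<Rightarrow> real^3 \<Rightarrow> real" where
  "spherical_angle u v w = vector_angle (side_direction u v) (side_direction u w)"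

definition triangle_angles :: "real^3 \<Rightarrow> real^3 \<Rightarrow> real^3 \<Rightarrow> real \<times> real \<times> real" where
  "triangle_angles u v w =
     (spherical_angle u v w, spherical_angle v w u, spherical_angle w u v)"

text \<open>For \<open>a \<noteq> 0\<close>, the orthogonal reflection whose mirror is the plane with normal vector \<open>a\<close>.\<close>

definition mirror :: "real^3 \<Rightarrow> (real^3) set" where
  "mirror a = {x. a \<bullet> x = 0}"

definition reflection :: "real^3 \<Rightarrow> real^3 \<Rightarrow> real^3" where
  "reflection a x = x - (2 * (a \<bullet> x) / (a \<bullet> a)) *\<^sub>R a"

definition coxeter_group :: "real^3 \<Rightarrow> real^3 \<Rightarrow> real^3 \<Rightarrow> (real^3 \<Rightarrow> real^3) set" where
  "coxeter_group u v w =
     generate (BijGroup UNIV)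
       {reflection a | a. a \<noteq> 0 \<and> mirror a \<in> {span {u, v}, span {v, w}, span {w, u}}}"

definition reflection_arrangement :: "real^3 \<Rightarrow> real^3 \<Rightarrow> real^3 \<Rightarrow> (real^3) set set set" where
  "reflection_arrangement u v w =
     {projectivization (mirror a) | a. a \<noteq> 0 \<and> reflection a \<in> coxeter_group u v w}"

definition special_angles :: "(real \<times> real \<times> real) set" where
  "special_angles =
     {(pi/2, pi/2, pi/2), (pi/2, pi/3, pi/3), (pi/2, pi/3, pi/4), (pi/2, pi/3, pi/5)}"

end

theory Submission
  imports Defs
begin

text \<open>For \<open>n = 1\<close> the three normals are linearly independent. For \<open>n \<ge> 2\<close>, an invertible \<open>T\<close> maximising
  \<open>\<bar>det T\<bar>\<^sup>n / (\<Prod>v. norm (T v))\<close> over the normals \<open>v\<close> brings them into isotropic position,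
  \<open>(\<Sum>v. (T v \<bullet> y)\<^sup>2 / (norm (T v))\<^sup>2) = n * (y \<bullet> y)\<close>. Let \<open>S\<close> consist of the \<open>6n\<close> unit vectors parallel
  to the \<open>T v\<close>. The points on a line correspond to the planes spanned by \<open>S\<close> through its normal, and
  double counting the squared inner products turns a Cauchy-Schwarz inequality into an equality: \<open>S \<inter> P\<close>
  is a tight frame in every such plane \<open>P\<close>. Hence the chambers of the arrangement are spherical triangles
  without obtuse angles, whose right angles are exactly the double points. A weight on angles that is
  nonnegative on triangles and nonpositive on pencils shows that every chamber has exactly one right
  angle and that at most five lines pass through a point, so that \<open>n \<in> {2, 3, 4, 5}\<close> with known numbers
  of points of each multiplicity. The case \<open>n = 4\<close> is impossible, and in the other cases \<open>S\<close> is closed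
  under its reflections and is the root system of type \<open>A\<^sub>3\<close>, \<open>B\<^sub>3\<close> or \<open>H\<^sub>3\<close>.

  Conversely, the Coxeter group of a triangle preserves a tetrahedron, an octahedron or an icosahedron;
  every mirror is orthogonal to a difference of two vertices, which determines the arrangement. It has
  the required property because a system of vectors closed under reflections is a tight frame both in
  space and in every plane.\<close>

section \<open>Symmetric systems of unit vectors\<close>

text \<open>The numbers \<open>3 * n\<close> and \<open>n + 1\<close> are exactly what makes the
  double count tight. Counted plane by plane, the planes through \<open>a\<close> in
  \<open>S\<close> have \<open>8 * n\<close> elements, whose squared inner products with
  \<open>a\<close> add up to \<open>4 * n\<close>; but in a plane with \<open>k\<close> elements the
  squared inner products of all pairs add up to at least \<open>k * k / 2\<close>. So no plane has
  any slack, provided that the normals are isotropic in space, which a projective transformation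
  must first achieve.

  The obstacle is that tightness determines the angles at a point only if two or three lines pass
  through it: four lines form two orthogonal pairs with a free parameter, and five are more flexible
  still. Angles at such points are therefore only compared in total, by a weight whose steps at
  \<open>pi / 6\<close>, \<open>pi / 3\<close> and \<open>pi / 2\<close> are fitted to the bound
  \<open>weight s + 1 < 6 * s / pi\<close>, which limits the gaps of a half turn, and to the angle
  excess of spherical triangles. For the same reason closure under reflections for
  \<open>n = 5\<close> has to be won from the incidences of the six fivefold points, before their
  angles are known to be \<open>pi / 5\<close>.\<close>

definition planes :: "(real^3) set \<Rightarrow> (real^3) set set" where
  "planes S = {span {a, b} | a b. a \<in> S \<and> b \<in> S \<and> b \<noteq> a \<and> b \<noteq> - a}"

text \<open>Each line contributes both of its unit normals, so that no sign has to be chosen; a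
  plane with \<open>2 * k\<close> elements is thus a point through which \<open>k\<close> lines
  pass.\<close>

locale unit_system =
  fixes S :: "(real^3) set"
  assumes finite_S: "finite S"
    and unit: "x \<in> S \<Longrightarrow> norm x = 1"
    and neg: "x \<in> S \<Longrightarrow> - x \<in> S"
begin

lemma dot_self: "x \<in> S \<Longrightarrow> x \<bullet> x = 1"
  using unit by (simp add: norm_eq_1)

lemma nonzero: "x \<in> S \<Longrightarrow> x \<noteq> 0"
  using unit by force

lemma neq_neg: "x \<in> S \<Longrightarrow> x \<noteq> - x"
  using dot_self[of x] by (metis inner_minus_left one_neq_neg_one)

lemma neg_iff: "- x \<in> S \<longleftrightarrow> x \<in> S"
  using neg[of x] neg[of "- x"] by auto

lemma parallel_in_S: "x \<in> S \<Longrightarrow> c *\<^sub>R x \<in> S \<Longrightarrow> c *\<^sub>R x = x \<or> c *\<^sub>R x = - x"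
proof -
  assume "x \<in> S" "c *\<^sub>R x \<in> S"
  then have "\<bar>c\<bar> = 1" using unit[of x] unit[of "c *\<^sub>R x"] by simp
  then have "c = 1 \<or> c = -1" by linarith
  then show ?thesis by auto
qed

lemma abs_dot_less_1:
  assumes "a \<in> S" "b \<in> S" "b \<noteq> a" "b \<noteq> - a"
  shows "\<bar>a \<bullet> b\<bar> < 1"
proof -
  have "\<bar>a \<bullet> b\<bar> \<le> 1" using Cauchy_Schwarz_ineq2[of a b] assms unit by simp
  moreover have "\<bar>a \<bullet> b\<bar> \<noteq> 1"
  proof
    assume "\<bar>a \<bullet> b\<bar> = 1"
    then have "\<bar>a \<bullet> b\<bar> = norm a * norm b" using assms unit by simp
    then have "a = b \<or> a = - b" using assms unit norm_cauchy_schwarz_abs_eq[of a b] by simp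
    then show False using assms by auto
  qed
  ultimately show ?thesis by simp
qed

lemma planesI: "a \<in> S \<Longrightarrow> b \<in> S \<Longrightarrow> b \<noteq> a \<Longrightarrow> b \<noteq> - a \<Longrightarrow> span {a, b} \<in> planes S"
  unfolding planes_def by blast

lemma finite_planes: "finite (planes S)"
proof -
  have "planes S \<subseteq> (\<lambda>(a, b). span {a, b}) ` (S \<times> S)"
    unfolding planes_def by auto
  then show ?thesis using finite_S finite_subset by blast
qed

lemma subspace_plane: "P \<in> planes S \<Longrightarrow> subspace P"
  unfolding planes_def by auto

text \<open>Gram-Schmidt. The sign \<open>b \<bullet> e > 0\<close> makes \<open>e\<close> a
  functional that vanishes on one edge of the cone of \<open>a\<close> and \<open>b\<close> and is
  positive on the other.\<close>

lemma span_basis: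
  assumes "a \<in> S" "b \<in> S" "b \<noteq> a" "b \<noteq> - a"
  obtains e where "e \<in> span {a, b}" "norm e = 1" "a \<bullet> e = 0" "b \<bullet> e > 0"
    "\<forall>x\<in>span {a, b}. x = (x \<bullet> a) *\<^sub>R a + (x \<bullet> e) *\<^sub>R e"
proof -
  define f where "f = b - (a \<bullet> b) *\<^sub>R a"
  have f0: "f \<noteq> 0" using parallel_in_S[of a "a \<bullet> b"] assms by (auto simp: f_def)
  define e where "e = f /\<^sub>R norm f"
  have ne: "norm e = 1" using f0 by (simp add: e_def)
  have af: "a \<bullet> f = 0" using assms dot_self by (simp add: f_def algebra_simps)
  then have ae: "a \<bullet> e = 0" by (simp add: e_def)
  have bf: "b \<bullet> f = f \<bullet> f" using af by (simp add: f_def algebra_simps inner_commute)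
  have be: "b \<bullet> e > 0" using f0 bf by (simp add: e_def)
  have fs: "f \<in> span {a, b}" unfolding f_def
    by (intro span_diff span_mul span_base) auto
  then have es: "e \<in> span {a, b}" unfolding e_def by (intro span_mul)
  have b: "b = (a \<bullet> b) *\<^sub>R a + norm f *\<^sub>R e" using f0 by (simp add: e_def f_def)
  have "x = (x \<bullet> a) *\<^sub>R a + (x \<bullet> e) *\<^sub>R e" if "x \<in> span {a, b}" for x
  proof -
    from that obtain s t where x: "x = s *\<^sub>R a + t *\<^sub>R b"
      by (auto simp: span_insert algebra_simps)
    have "x = (s + t * (a \<bullet> b)) *\<^sub>R a + (t * norm f) *\<^sub>R e"
      unfolding x by (subst b) (simp add: algebra_simps)
    moreover from this have "x \<bullet> a = s + t * (a \<bullet> b)" "x \<bullet> e = t * norm f"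
      using ae ne dot_self[OF assms(1)] by (simp_all add: inner_left_distrib inner_commute[of e a] norm_eq_1)
    ultimately show ?thesis by metis
  qed
  then show ?thesis using that es ne ae be by blast
qed

lemma plane_eq_span:
  assumes P: "P \<in> planes S" and x: "x \<in> S" "x \<in> P" and y: "y \<in> S" "y \<in> P" "y \<noteq> x" "y \<noteq> - x"
  shows "P = span {x, y}"
proof
  show "span {x, y} \<subseteq> P" using subspace_plane[OF P] x y by (intro span_minimal) auto
  from P obtain a b where ab: "P = span {a, b}" "a \<in> S" "b \<in> S" "b \<noteq> a" "b \<noteq> - a"
    by (auto simp: planes_def)
  have ind: "independent {x, y}"
  proof -
    have "x \<notin> span {y}"
    proof
      assume "x \<in> span {y}"
      then obtain c where "x = c *\<^sub>R y" by (auto simp: span_singleton)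
      then show False using parallel_in_S[of y c] x y by auto
    qed
    then show ?thesis using y nonzero[of y] independent_insertI[of x "{y}"] by simp
  qed
  have "dim P \<le> 2"
    using dim_le_card'[of "{a, b}"] card_insert_le_m1[of 2 "{b}" a] unfolding ab by simp
  moreover have "dim (span {x, y}) = 2" using ind y dim_span_eq_card_independent[OF ind] by simp
  ultimately show "P \<subseteq> span {x, y}"
    using \<open>span {x, y} \<subseteq> P\<close> subspace_plane[OF P] subspace_dim_equal[of "span {x,y}" P] by auto
qed

lemma plane_partner:
  assumes P: "P \<in> planes S" and x: "x \<in> S" "x \<in> P"
  obtains y where "y \<in> S" "y \<in> P" "y \<noteq> x" "y \<noteq> - x" "P = span {x, y}"
proof -
  from P obtain a b where ab: "P = span {a, b}" "a \<in> S" "b \<in> S" "b \<noteq> a" "b \<noteq> - a"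
    by (auto simp: planes_def)
  have "a \<in> P" "b \<in> P" unfolding ab by (auto intro: span_base)
  show ?thesis
  proof (cases "a = x \<or> a = - x")
    case True
    then have "b \<noteq> x" "b \<noteq> - x" using ab by auto
    then show ?thesis using that[of b] plane_eq_span[OF P x, of b] ab \<open>b \<in> P\<close> by blast
  next
    case False
    then show ?thesis using that[of a] plane_eq_span[OF P x, of a] ab \<open>a \<in> P\<close> by blast
  qed
qed

lemma plane_basis:
  assumes P: "P \<in> planes S" and a: "a \<in> S" "a \<in> P"
  obtains e where "e \<in> P" "norm e = 1" "a \<bullet> e = 0"
    "\<forall>x\<in>P. x = (x \<bullet> a) *\<^sub>R a + (x \<bullet> e) *\<^sub>R e"
proof -
  from plane_partner[OF P a] obtain y where y: "y \<in> S" "y \<noteq> a" "y \<noteq> - a" "P = span {a, y}"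
    .
  show ?thesis using span_basis[OF a(1) y(1-3)] that unfolding y(4) by metis
qed

lemma plane_neg: "P \<in> planes S \<Longrightarrow> x \<in> P \<Longrightarrow> - x \<in> P"
  by (simp add: subspace_plane subspace_neg)

lemma planes_at_inter:
  assumes "P \<in> planes S" "Q \<in> planes S" "P \<noteq> Q" "x \<in> S" "x \<in> P" "x \<in> Q" "y \<in> S" "y \<in> P" "y \<in> Q"
  shows "y = x \<or> y = - x"
proof (rule ccontr)
  assume "\<not> ?thesis"
  then have "P = span {x, y}" "Q = span {x, y}"
    using plane_eq_span[of P x y] plane_eq_span[of Q x y] assms(1,2,4-) by simp_all
  then show False using assms by simp
qed

text \<open>Every element of \<open>S\<close> other than \<open>a\<close> and \<open>- a\<close>
  spans exactly one plane with \<open>a\<close>, so the planes through \<open>a\<close> partition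
  the rest of \<open>S\<close>.\<close>

lemma sum_planes_at:
  fixes f :: "real^3 \<Rightarrow> real"
  assumes a: "a \<in> S"
  shows "sum f S = f a + f (- a) + (\<Sum>P | P \<in> planes S \<and> a \<in> P. sum f (S \<inter> P - {a, - a}))"
proof -
  let ?A = "{P \<in> planes S. a \<in> P}"
  have "S - {a, - a} = (\<Union>P\<in>?A. S \<inter> P - {a, - a})"
  proof (intro equalityI subsetI)
    fix x assume "x \<in> S - {a, - a}"
    then show "x \<in> (\<Union>P\<in>?A. S \<inter> P - {a, - a})"
      using planesI[OF a, of x] span_superset[of "{a, x}"] by (intro UN_I[of "span {a, x}"]) auto
  qed auto
  moreover have "sum f (\<Union>P\<in>?A. S \<inter> P - {a, - a}) = (\<Sum>P\<in>?A. sum f (S \<inter> P - {a, - a}))"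
  proof (rule sum.UNION_disjoint)
    show "\<forall>P\<in>?A. \<forall>Q\<in>?A. P \<noteq> Q \<longrightarrow> (S \<inter> P - {a, - a}) \<inter> (S \<inter> Q - {a, - a}) = {}"
      using planes_at_inter a by blast
  qed (use finite_planes finite_S in auto)
  ultimately have "sum f (S - {a, - a}) = (\<Sum>P\<in>?A. sum f (S \<inter> P - {a, - a}))" by simp
  moreover have "sum f S = sum f (S - {a, - a}) + sum f {a, - a}"
    using a neg[OF a] finite_S by (subst sum.subset_diff[of "{a, - a}"]) auto
  moreover have "sum f {a, - a} = f a + f (- a)"
    using neq_neg[OF a] by simp
  ultimately show ?thesis by simp
qed

lemma sum_plane_split:
  fixes f :: "real^3 \<Rightarrow> real"
  assumes "a \<in> S" "P \<in> planes S" "a \<in> P"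
  shows "sum f (S \<inter> P) = sum f (S \<inter> P - {a, - a}) + (f a + f (- a))"
proof -
  have "sum f (S \<inter> P) = sum f (S \<inter> P - {a, - a}) + sum f {a, - a}"
    using assms neg plane_neg finite_S by (subst sum.subset_diff[of "{a, - a}"]) auto
  then show ?thesis using neq_neg[of a] assms by simp
qed

lemma sum_over_flags:
  fixes h :: "(real^3) set \<Rightarrow> real^3 \<Rightarrow> real"
  shows "(\<Sum>P\<in>planes S. \<Sum>x\<in>S \<inter> P. h P x) = (\<Sum>x\<in>S. \<Sum>P | P \<in> planes S \<and> x \<in> P. h P x)"
  using sum.swap_restrict[OF finite_planes finite_S, of h "\<lambda>P x. x \<in> P"]
  by (simp only: Int_def)

end

text \<open>The condition \<open>planes_at\<close> says that there are \<open>n + 1\<close> points on each line, and \<open>frame\<close> that the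
  unit normals are in isotropic position.\<close>

locale hirzebruch_system = unit_system +
  fixes n :: nat
  assumes card_S: "card S = 6 * n"
    and n_ge_2: "2 \<le> n"
    and planes_at: "a \<in> S \<Longrightarrow> card {P \<in> planes S. a \<in> P} = n + 1"
    and frame: "(\<Sum>x\<in>S. (x \<bullet> y)\<^sup>2) = 2 * real n * (y \<bullet> y)"
begin

text \<open>All \<open>n + 1\<close> planes through \<open>a\<close> contain the pair
  \<open>a\<close>, \<open>- a\<close>, which \<open>sum f S\<close> counts once; hence the excess
  of \<open>n\<close> copies.\<close>

lemma sum_flag_planes:
  fixes f :: "real^3 \<Rightarrow> real"
  assumes a: "a \<in> S"
  shows "(\<Sum>P | P \<in> planes S \<and> a \<in> P. sum f (S \<inter> P)) = sum f S + n * (f a + f (- a))"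
proof -
  let ?A = "{P \<in> planes S. a \<in> P}"
  have "(\<Sum>P\<in>?A. sum f (S \<inter> P)) = (\<Sum>P\<in>?A. sum f (S \<inter> P - {a, - a}) + (f a + f (- a)))"
    by (rule sum.cong[OF refl], rule sum_plane_split[OF a]) auto
  also have "\<dots> = (\<Sum>P\<in>?A. sum f (S \<inter> P - {a, - a})) + real (card ?A) * (f a + f (- a))"
    by (simp only: sum.distrib sum_constant distrib_left)
  also have "\<dots> = (\<Sum>P\<in>?A. sum f (S \<inter> P - {a, - a})) + (real n + 1) * (f a + f (- a))"
    by (simp only: planes_at[OF a] of_nat_add of_nat_1)
  also have "\<dots> = sum f S + n * (f a + f (- a))"
    unfolding sum_planes_at[OF a, of f] by (rule trans[OF _ refl]) (simp only: distrib_right mult_1_left add_ac)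
  finally show ?thesis .
qed

lemma sum_card_at:
  assumes a: "a \<in> S"
  shows "(\<Sum>P | P \<in> planes S \<and> a \<in> P. real (card (S \<inter> P))) = 8 * real n"
  using sum_flag_planes[OF a, of "\<lambda>_. 1"] card_S by simp

lemma sum_card: "(\<Sum>P\<in>planes S. real (card (S \<inter> P))) = 6 * real n * (real n + 1)"
proof -
  have "(\<Sum>P\<in>planes S. real (card (S \<inter> P))) = (\<Sum>x\<in>S. \<Sum>P | P \<in> planes S \<and> x \<in> P. 1)"
    using sum_over_flags[of "\<lambda>_ _. 1"] by simp
  also have "\<dots> = (\<Sum>x\<in>S. real n + 1)"
    using planes_at by (intro sum.cong) auto
  finally show ?thesis using card_S by (simp add: algebra_simps)
qed

lemma sum_card_squared: "(\<Sum>P\<in>planes S. (real (card (S \<inter> P)))\<^sup>2) = 48 * (real n)\<^sup>2"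
proof -
  have "(\<Sum>P\<in>planes S. (real (card (S \<inter> P)))\<^sup>2) = (\<Sum>x\<in>S. \<Sum>P | P \<in> planes S \<and> x \<in> P. real (card (S \<inter> P)))"
    using sum_over_flags[of "\<lambda>P _. real (card (S \<inter> P))"] by (simp add: power2_eq_square)
  then show ?thesis using sum_card_at card_S by (simp add: power2_eq_square)
qed

text \<open>By \<open>frame\<close>, each of the \<open>6 * n\<close> elements contributes
  \<open>2 * n + 2 * n\<close>. The total is exactly half of \<open>sum_card_squared\<close>, which
  leaves no slack in the lower bound for the individual planes.\<close>

lemma sum_gram_squared: "(\<Sum>P\<in>planes S. \<Sum>x\<in>S \<inter> P. \<Sum>y\<in>S \<inter> P. (x \<bullet> y)\<^sup>2) = 24 * (real n)\<^sup>2"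
proof -
  have "(\<Sum>P\<in>planes S. \<Sum>x\<in>S \<inter> P. \<Sum>y\<in>S \<inter> P. (x \<bullet> y)\<^sup>2)
      = (\<Sum>x\<in>S. \<Sum>P | P \<in> planes S \<and> x \<in> P. \<Sum>y\<in>S \<inter> P. (x \<bullet> y)\<^sup>2)"
    by (rule sum_over_flags)
  also have "\<dots> = (\<Sum>x\<in>S. 4 * real n)"
  proof (rule sum.cong[OF refl])
    fix x assume x: "x \<in> S"
    have "(\<Sum>y\<in>S. (x \<bullet> y)\<^sup>2) = 2 * n" using frame[of x] dot_self[OF x] by (simp add: inner_commute)
    then show "(\<Sum>P | P \<in> planes S \<and> x \<in> P. \<Sum>y\<in>S \<inter> P. (x \<bullet> y)\<^sup>2) = 4 * real n"
      using sum_flag_planes[OF x, of "\<lambda>y. (x \<bullet> y)\<^sup>2"] dot_self[OF x] by simp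
  qed
  finally show ?thesis using card_S by (simp add: power2_eq_square)
qed

end

section \<open>Frame operators of the planes\<close>

context unit_system
begin

text \<open>In the basis \<open>a\<close>, \<open>e\<close>, the sum of the projections onto the
  elements of \<open>S \<inter> P\<close> is a symmetric matrix of size two. Its trace is the number
  of elements, and the sum of all squared inner products is its squared Frobenius norm, written here
  as half the squared trace plus the squares that measure the distance from a scalar matrix.\<close>

lemma gram_squared:
  assumes P: "P \<in> planes S" and a: "a \<in> S" "a \<in> P" and e: "norm e = 1" "a \<bullet> e = 0"
    and basis: "\<forall>x\<in>P. x = (x \<bullet> a) *\<^sub>R a + (x \<bullet> e) *\<^sub>R e"
  shows "(\<Sum>x\<in>S \<inter> P. (x \<bullet> a)\<^sup>2) + (\<Sum>x\<in>S \<inter> P. (x \<bullet> e)\<^sup>2) = card (S \<inter> P)"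
    and "(\<Sum>x\<in>S \<inter> P. \<Sum>y\<in>S \<inter> P. (x \<bullet> y)\<^sup>2) = (card (S \<inter> P))\<^sup>2 / 2
      + ((\<Sum>x\<in>S \<inter> P. (x \<bullet> a)\<^sup>2) - (\<Sum>x\<in>S \<inter> P. (x \<bullet> e)\<^sup>2))\<^sup>2 / 2
      + 2 * (\<Sum>x\<in>S \<inter> P. (x \<bullet> a) * (x \<bullet> e))\<^sup>2"
proof -
  let ?A = "(\<Sum>x\<in>S \<inter> P. (x \<bullet> a)\<^sup>2)" and ?B = "(\<Sum>x\<in>S \<inter> P. (x \<bullet> e)\<^sup>2)" and ?C = "\<Sum>x\<in>S \<inter> P. (x \<bullet> a) * (x \<bullet> e)"
    and ?G = "\<Sum>x\<in>S \<inter> P. \<Sum>y\<in>S \<inter> P. (x \<bullet> y)\<^sup>2"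
  have dot: "x \<bullet> y = (x \<bullet> a) * (y \<bullet> a) + (x \<bullet> e) * (y \<bullet> e)" if "x \<in> P" for x y
    by (subst basis[rule_format, OF that]) (simp add: inner_left_distrib, simp add: inner_commute)
  have "(x \<bullet> a)\<^sup>2 + (x \<bullet> e)\<^sup>2 = 1" if "x \<in> S \<inter> P" for x
    using dot[of x x] dot_self[of x] that by (simp add: power2_eq_square)
  then have "(\<Sum>x\<in>S \<inter> P. (x \<bullet> a)\<^sup>2 + (x \<bullet> e)\<^sup>2) = (\<Sum>x\<in>S \<inter> P. 1)"
    by (intro sum.cong) auto
  then show AB: "?A + ?B = card (S \<inter> P)" by (simp add: sum.distrib)
  have "?G = (\<Sum>x\<in>S \<inter> P. \<Sum>y\<in>S \<inter> P. (x \<bullet> a)\<^sup>2 * (y \<bullet> a)\<^sup>2 + (x \<bullet> e)\<^sup>2 * (y \<bullet> e)\<^sup>2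
      + 2 * (((x \<bullet> a) * (x \<bullet> e)) * ((y \<bullet> a) * (y \<bullet> e))))"
  proof (intro sum.cong refl)
    fix x y assume "x \<in> S \<inter> P" "y \<in> S \<inter> P"
    then have "x \<bullet> y = (x \<bullet> a) * (y \<bullet> a) + (x \<bullet> e) * (y \<bullet> e)" using dot by blast
    then show "(x \<bullet> y)\<^sup>2 = (x \<bullet> a)\<^sup>2 * (y \<bullet> a)\<^sup>2 + (x \<bullet> e)\<^sup>2 * (y \<bullet> e)\<^sup>2
      + 2 * (((x \<bullet> a) * (x \<bullet> e)) * ((y \<bullet> a) * (y \<bullet> e)))"
      by (simp add: power2_eq_square algebra_simps)
  qed
  also have "\<dots> = ?A * ?A + ?B * ?B + 2 * (?C * ?C)"
    unfolding sum_product by (simp only: sum.distrib sum_distrib_left)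
  finally have G: "?G = ?A * ?A + ?B * ?B + 2 * (?C * ?C)" .
  show "?G = (card (S \<inter> P))\<^sup>2 / 2 + (?A - ?B)\<^sup>2 / 2 + 2 * ?C\<^sup>2"
  proof -
    have k: "real ((card (S \<inter> P))\<^sup>2) = (?A + ?B) * (?A + ?B)"
      unfolding AB by (simp add: power2_eq_square)
    have "u * u + v * v + 2 * (w * w) = (u + v) * (u + v) / 2 + (u - v)\<^sup>2 / 2 + 2 * w\<^sup>2" for u v w :: real
      by (simp add: power2_eq_square field_simps)
    then show ?thesis unfolding G k .
  qed
qed

lemma gram_squared_ge:
  assumes P: "P \<in> planes S"
  shows "(card (S \<inter> P))\<^sup>2 / 2 \<le> (\<Sum>x\<in>S \<inter> P. \<Sum>y\<in>S \<inter> P. (x \<bullet> y)\<^sup>2)"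
proof -
  from P obtain a where a: "a \<in> S" "a \<in> P"
    unfolding planes_def using span_superset by blast
  obtain e where e: "e \<in> P" "norm e = 1" "a \<bullet> e = 0"
    "\<forall>x\<in>P. x = (x \<bullet> a) *\<^sub>R a + (x \<bullet> e) *\<^sub>R e"
    using plane_basis[OF P a] .
  show ?thesis unfolding gram_squared(2)[OF P a e(2-4)] by simp
qed

end

context hirzebruch_system
begin

text \<open>The deficits of the planes are nonnegative, and by the two double counts they add up to
  zero.\<close>

lemma gram_squared_eq:
  assumes P: "P \<in> planes S"
  shows "(\<Sum>x\<in>S \<inter> P. \<Sum>y\<in>S \<inter> P. (x \<bullet> y)\<^sup>2) = (card (S \<inter> P))\<^sup>2 / 2"
proof -
  let ?D = "\<lambda>P. (\<Sum>x\<in>S \<inter> P. \<Sum>y\<in>S \<inter> P. (x \<bullet> y)\<^sup>2) - (card (S \<inter> P))\<^sup>2 / 2"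
  have "(\<Sum>P\<in>planes S. (card (S \<inter> P))\<^sup>2 / 2) = 24 * (real n)\<^sup>2"
    using sum_card_squared by (simp add: sum_divide_distrib[symmetric])
  then have "(\<Sum>P\<in>planes S. ?D P) = 0"
    unfolding sum_subtractf sum_gram_squared by simp
  moreover have "0 \<le> ?D P" if "P \<in> planes S" for P using gram_squared_ge[OF that] by simp
  ultimately have "?D P = 0" using sum_nonneg_eq_0_iff[OF finite_planes, of ?D] P by blast
  then show ?thesis by simp
qed

text \<open>Equality in \<open>gram_squared\<close> makes the frame operator of
  \<open>S \<inter> P\<close> a multiple of the identity of \<open>P\<close>; the trace fixes the
  multiple.\<close>

lemma local_frame:
  assumes P: "P \<in> planes S" and y: "y \<in> P" and z: "z \<in> P"
  shows "(\<Sum>x\<in>S \<inter> P. (x \<bullet> y) * (x \<bullet> z)) = card (S \<inter> P) / 2 * (y \<bullet> z)"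
proof -
  from P obtain a where a: "a \<in> S" "a \<in> P"
    unfolding planes_def using span_superset by blast
  obtain e where e: "e \<in> P" "norm e = 1" "a \<bullet> e = 0"
    and basis: "\<forall>x\<in>P. x = (x \<bullet> a) *\<^sub>R a + (x \<bullet> e) *\<^sub>R e"
    using plane_basis[OF P a] .
  let ?A = "\<Sum>x\<in>S \<inter> P. (x \<bullet> a)\<^sup>2" and ?B = "\<Sum>x\<in>S \<inter> P. (x \<bullet> e)\<^sup>2"
    and ?C = "\<Sum>x\<in>S \<inter> P. (x \<bullet> a) * (x \<bullet> e)" and ?k = "real (card (S \<inter> P))"
  note g = gram_squared[OF P a e(2,3) basis]
  have "(?A - ?B)\<^sup>2 / 2 + 2 * ?C\<^sup>2 = 0" using g(2) gram_squared_eq[OF P] by linarith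
  then have "(?A - ?B)\<^sup>2 = 0" "?C\<^sup>2 = 0"
    using zero_le_power2[of "?A - ?B"] zero_le_power2[of ?C] by linarith+
  then have C: "?C = 0" and "?A = ?B" by simp_all
  then have A: "?A = ?k / 2" and B: "?B = ?k / 2" using g(1) by simp_all
  have dot: "x \<bullet> w = (x \<bullet> a) * (w \<bullet> a) + (x \<bullet> e) * (w \<bullet> e)" if "w \<in> P" for x w
    by (subst basis[rule_format, OF that]) (simp add: inner_right_distrib)
  have "(\<Sum>x\<in>S \<inter> P. (x \<bullet> y) * (x \<bullet> z)) = (\<Sum>x\<in>S \<inter> P. ((y \<bullet> a) * (z \<bullet> a)) * (x \<bullet> a)\<^sup>2
      + ((y \<bullet> e) * (z \<bullet> e)) * (x \<bullet> e)\<^sup>2 + ((y \<bullet> a) * (z \<bullet> e) + (y \<bullet> e) * (z \<bullet> a)) * ((x \<bullet> a) * (x \<bullet> e)))"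
    unfolding dot[OF y] dot[OF z] by (intro sum.cong refl) (simp add: power2_eq_square algebra_simps)
  also have "\<dots> = ((y \<bullet> a) * (z \<bullet> a)) * ?A + ((y \<bullet> e) * (z \<bullet> e)) * ?B
      + ((y \<bullet> a) * (z \<bullet> e) + (y \<bullet> e) * (z \<bullet> a)) * ?C"
    by (simp only: sum.distrib sum_distrib_left)
  also have "\<dots> = ?k / 2 * (y \<bullet> z)"
    unfolding A B C dot[OF z, of y] by (simp add: algebra_simps)
  finally show ?thesis .
qed

end

section \<open>Neighbouring great circles in a pencil\<close>

context unit_system
begin

text \<open>The two great circles orthogonal to \<open>a\<close> and \<open>b\<close> are neighbours in the pencil that they generate.\<close>

definition wedge :: "real^3 \<Rightarrow> real^3 \<Rightarrow> bool" where
  "wedge a b \<longleftrightarrow> a \<in> S \<and> b \<in> S \<and> b \<noteq> a \<and> b \<noteq> - a \<and>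
     (\<forall>x \<in> S \<inter> span {a, b}. \<exists>s t. 0 \<le> s \<and> 0 \<le> t \<and> (x = s *\<^sub>R a + t *\<^sub>R b \<or> x = - (s *\<^sub>R a + t *\<^sub>R b)))"

lemma wedge_sym: "wedge a b \<Longrightarrow> wedge b a" (is "_ \<Longrightarrow> ?thesis")
proof -
  assume w: "wedge a b"
  have "a \<noteq> - b" using w unfolding wedge_def by auto
  moreover have "\<exists>s t. 0 \<le> s \<and> 0 \<le> t \<and> (x = s *\<^sub>R b + t *\<^sub>R a \<or> x = - (s *\<^sub>R b + t *\<^sub>R a))"
    if "x \<in> S \<inter> span {b, a}" for x
  proof -
    have "x \<in> S \<inter> span {a, b}" using that by (simp add: insert_commute)
    then obtain s t where "0 \<le> s" "0 \<le> t" "x = s *\<^sub>R a + t *\<^sub>R b \<or> x = - (s *\<^sub>R a + t *\<^sub>R b)"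
      using w unfolding wedge_def by blast
    then show ?thesis by (intro exI[of _ t] exI[of _ s]) (simp add: add.commute)
  qed
  ultimately show ?thesis using w unfolding wedge_def by blast
qed

lemma four_elements:
  assumes "a \<in> S" "b \<in> S" "b \<noteq> a" "b \<noteq> - a"
  shows "card {a, - a, b, - b} = 4"
proof -
  have "a \<noteq> - a" "b \<noteq> - b" "a \<noteq> - b" "- a \<noteq> - b" "a \<noteq> b" using assms neq_neg by (auto simp: eq_neg_iff_add_eq_0 add.commute)
  then show ?thesis using assms(4) by (simp add: card_insert_if)
qed

lemma sum_four:
  fixes f :: "real^3 \<Rightarrow> real"
  assumes "a \<in> S" "b \<in> S" "b \<noteq> a" "b \<noteq> - a"
  shows "sum f {a, - a, b, - b} = f a + f (- a) + f b + f (- b)"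
proof -
  have "a \<noteq> - a" "b \<noteq> - b" "a \<noteq> - b" "- a \<noteq> - b" "a \<noteq> b" using assms neq_neg by (auto simp: eq_neg_iff_add_eq_0 add.commute)
  then show ?thesis using assms(4) by (simp add: add.assoc)
qed

lemma span_subset_plane:
  assumes "a \<in> S" "b \<in> S" "b \<noteq> a" "b \<noteq> - a" shows "{a, - a, b, - b} \<subseteq> S \<inter> span {a, b}"
  using assms neg by (auto intro: span_base span_neg)

end

context hirzebruch_system
begin

text \<open>Let \<open>e\<close> be orthogonal to \<open>a\<close> in the plane. If
  \<open>a \<bullet> b \<ge> 0\<close>, every element of the plane lies up to sign in the cone of
  \<open>a\<close> and \<open>b\<close>, so that \<open>(x \<bullet> a) * (x \<bullet> e)\<close> is
  never negative. By \<open>local_frame\<close> these products add up to zero; hence all vanish, and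
  only \<open>a\<close>, \<open>b\<close> and their opposites remain.\<close>

lemma wedge_obtuse:
  assumes w: "wedge a b"
  shows "a \<bullet> b \<le> 0" and "a \<bullet> b = 0 \<longleftrightarrow> card (S \<inter> span {a, b}) = 4"
proof -
  let ?P = "span {a, b}"
  have ab: "a \<in> S" "b \<in> S" "b \<noteq> a" "b \<noteq> - a" using w by (auto simp: wedge_def)
  have P: "?P \<in> planes S" using planesI ab by blast
  obtain e where e: "e \<in> ?P" "norm e = 1" "a \<bullet> e = 0" "b \<bullet> e > 0"
    using span_basis[OF ab] by metis
  have fr: "(\<Sum>x\<in>S \<inter> ?P. (x \<bullet> a) * (x \<bullet> e)) = 0"
    using local_frame[OF P _ e(1), of a] e(3) by (simp add: span_base)
  have orth4: "a \<bullet> b = 0 \<and> card (S \<inter> ?P) = 4" if nn: "a \<bullet> b \<ge> 0"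
  proof -
    have form: "\<exists>s t. 0 \<le> s \<and> 0 \<le> t \<and> (x \<bullet> a) * (x \<bullet> e) = (s + t * (a \<bullet> b)) * (t * (b \<bullet> e))
        \<and> (x = s *\<^sub>R a + t *\<^sub>R b \<or> x = - (s *\<^sub>R a + t *\<^sub>R b))" if "x \<in> S \<inter> ?P" for x
    proof -
      from w that obtain s t where st: "0 \<le> s" "0 \<le> t" "x = s *\<^sub>R a + t *\<^sub>R b \<or> x = - (s *\<^sub>R a + t *\<^sub>R b)"
        unfolding wedge_def by blast
      have ua: "(s *\<^sub>R a + t *\<^sub>R b) \<bullet> a = s + t * (a \<bullet> b)"
        using dot_self[OF ab(1)] by (simp add: inner_left_distrib inner_commute[of b a])
      have ue: "(s *\<^sub>R a + t *\<^sub>R b) \<bullet> e = t * (b \<bullet> e)" using e(3) by (simp add: inner_left_distrib)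
      have "(x \<bullet> a) * (x \<bullet> e) = (s + t * (a \<bullet> b)) * (t * (b \<bullet> e))"
      proof -
        have "(x \<bullet> a) * (x \<bullet> e) = (u \<bullet> a) * (u \<bullet> e)" if "x = u \<or> x = - u" for u
          using that by auto
        from this[OF st(3)] show ?thesis unfolding ua ue .
      qed
      with st show ?thesis by blast
    qed
    have ge: "0 \<le> (x \<bullet> a) * (x \<bullet> e)" if "x \<in> S \<inter> ?P" for x
      using form[OF that] nn e(4) by auto
    have zero: "(x \<bullet> a) * (x \<bullet> e) = 0" if "x \<in> S \<inter> ?P" for x
      using sum_nonneg_eq_0_iff[of "S \<inter> ?P" "\<lambda>x. (x \<bullet> a) * (x \<bullet> e)"] finite_S ge fr that by auto
    have ab0: "a \<bullet> b = 0" using zero[of b] ab e(4) by (auto simp: span_base inner_commute)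
    have "S \<inter> ?P \<subseteq> {a, - a, b, - b}"
    proof
      fix x assume x: "x \<in> S \<inter> ?P"
      from form[OF x] obtain s t where st: "(x \<bullet> a) * (x \<bullet> e) = (s + t * (a \<bullet> b)) * (t * (b \<bullet> e))"
        "x = s *\<^sub>R a + t *\<^sub>R b \<or> x = - (s *\<^sub>R a + t *\<^sub>R b)" by blast
      have "s * (t * (b \<bullet> e)) = 0" using zero[OF x] st(1) ab0 by simp
      then have "s = 0 \<or> t = 0" using e(4) by auto
      then have "(\<exists>c. x = c *\<^sub>R a) \<or> (\<exists>c. x = c *\<^sub>R b)"
      proof
        assume "s = 0"
        then have "x = t *\<^sub>R b \<or> x = (- t) *\<^sub>R b" using st(2) by simp
        then show ?thesis by blast
      next
        assume "t = 0"
        then have "x = s *\<^sub>R a \<or> x = (- s) *\<^sub>R a" using st(2) by simp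
        then show ?thesis by blast
      qed
      then show "x \<in> {a, - a, b, - b}"
        using x parallel_in_S ab by blast
    qed
    then have "S \<inter> ?P = {a, - a, b, - b}" using span_subset_plane[OF ab] by blast
    then show ?thesis using ab0 four_elements[OF ab] by simp
  qed
  show "a \<bullet> b \<le> 0" using orth4 by linarith
  have "a \<bullet> b = 0" if c4: "card (S \<inter> ?P) = 4"
  proof -
    have eq: "S \<inter> ?P = {a, - a, b, - b}"
      using card_subset_eq[of "S \<inter> ?P" "{a, - a, b, - b}"] span_subset_plane[OF ab] finite_S c4 four_elements[OF ab] by simp
    have "2 * ((b \<bullet> a) * (b \<bullet> e)) = 0"
      using fr e(3) unfolding eq sum_four[OF ab] by (simp add: inner_minus_left)
    then show ?thesis using e(4) by (simp add: inner_commute)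
  qed
  then show "a \<bullet> b = 0 \<longleftrightarrow> card (S \<inter> ?P) = 4" using orth4 by (metis order_refl)
qed

lemma card4_orthogonal:
  assumes P: "P \<in> planes S" "card (S \<inter> P) = 4" and xy: "x \<in> S" "x \<in> P" "y \<in> S" "y \<in> P" "y \<noteq> x" "y \<noteq> - x"
  shows "x \<bullet> y = 0"
proof -
  have Ps: "P = span {x, y}" using plane_eq_span[OF P(1) xy] .
  have eq: "S \<inter> P = {x, - x, y, - y}"
    using card_subset_eq[of "S \<inter> P" "{x, - x, y, - y}"] span_subset_plane[of x y] finite_S P four_elements[of x y] xy
    unfolding Ps by simp
  have "(\<Sum>z\<in>S \<inter> P. (z \<bullet> x) * (z \<bullet> x)) = 2" using local_frame[OF P(1) xy(2,2)] P(2) dot_self[OF xy(1)] by simp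
  then have "2 * (1 + (y \<bullet> x) * (y \<bullet> x)) = 2" unfolding eq sum_four[OF xy(1,3,5,6)] using dot_self[OF xy(1)]
    by (simp add: inner_minus_left)
  then show ?thesis by (simp add: inner_commute)
qed

lemma card6_third:
  assumes P: "P \<in> planes S" "card (S \<inter> P) = 6" and xy: "x \<in> S" "x \<in> P" "y \<in> S" "y \<in> P" "y \<noteq> x" "y \<noteq> - x"
  obtains z where "z \<in> S" "z \<in> P" "z \<noteq> x" "z \<noteq> - x" "z \<noteq> y" "z \<noteq> - y" "S \<inter> P = {x, - x, y, - y} \<union> {z, - z}"
proof -
  have Ps: "P = span {x, y}" using plane_eq_span[OF P(1) xy] .
  have sub: "{x, - x, y, - y} \<subseteq> S \<inter> P" using span_subset_plane[of x y] xy unfolding Ps by blast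
  have "card (S \<inter> P - {x, - x, y, - y}) = 2"
    using card_Diff_subset[OF _ sub] P four_elements[of x y] xy by simp
  then obtain z where z: "z \<in> S \<inter> P - {x, - x, y, - y}"
    by (metis all_not_in_conv card.empty zero_neq_numeral)
  then have zz: "- z \<in> S \<inter> P - {x, - x, y, - y}" using neg plane_neg[OF P(1)] by (auto simp: minus_equation_iff)
  have "S \<inter> P - {x, - x, y, - y} = {z, - z}"
    using \<open>card (S \<inter> P - {x, - x, y, - y}) = 2\<close> z zz neq_neg[of z] finite_S
    by (intro card_seteq[symmetric]) auto
  then show ?thesis using that[of z] z sub by blast
qed

text \<open>Testing \<open>local_frame\<close> at \<open>x\<close>, \<open>y\<close> and
  \<open>z\<close> gives three linear equations for the three squared cosines, with the single
  solution \<open>1 / 4\<close>: three lines at sixty degrees.\<close>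

lemma card6_dot:
  assumes P: "P \<in> planes S" "card (S \<inter> P) = 6" and xy: "x \<in> S" "x \<in> P" "y \<in> S" "y \<in> P" "y \<noteq> x" "y \<noteq> - x"
  shows "(x \<bullet> y)\<^sup>2 = 1 / 4"
proof -
  obtain z where z: "z \<in> S" "z \<in> P" "z \<noteq> x" "z \<noteq> - x" "z \<noteq> y" "z \<noteq> - y"
    and eq: "S \<inter> P = {x, - x, y, - y} \<union> {z, - z}" using card6_third[OF P xy] .
  have sum6: "sum f (S \<inter> P) = f x + f (- x) + f y + f (- y) + f z + f (- z)" for f :: "real^3 \<Rightarrow> real"
  proof -
    have "{x, - x, y, - y} \<inter> {z, - z} = {}" using z by auto
    then show ?thesis unfolding eq using sum_four[of x y f] xy neq_neg[OF z(1)]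
      by (subst sum.union_disjoint) auto
  qed
  have "2 * (1 + (y \<bullet> x)\<^sup>2 + (z \<bullet> x)\<^sup>2) = 3"
    using local_frame[OF P(1) xy(2,2)] P(2) dot_self[OF xy(1)] unfolding sum6 by (simp add: inner_minus_left power2_eq_square)
  moreover have "2 * ((x \<bullet> y)\<^sup>2 + 1 + (z \<bullet> y)\<^sup>2) = 3"
    using local_frame[OF P(1) xy(4,4)] P(2) dot_self[OF xy(3)] unfolding sum6 by (simp add: inner_minus_left power2_eq_square)
  moreover have "2 * ((x \<bullet> z)\<^sup>2 + (y \<bullet> z)\<^sup>2 + 1) = 3"
    using local_frame[OF P(1) z(2,2)] P(2) dot_self[OF z(1)] unfolding sum6 by (simp add: inner_minus_left power2_eq_square)
  ultimately show ?thesis by (simp add: inner_commute)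
qed

lemma span_S: "span S = UNIV"
proof (rule ccontr)
  assume "span S \<noteq> UNIV"
  then obtain y where y: "y \<noteq> 0" "\<And>x. x \<in> span S \<Longrightarrow> orthogonal y x"
    using orthogonal_to_subspace_exists[of S] dim_eq_full[of S] by (metis dim_subset_UNIV le_neq_implies_less dim_UNIV)
  then have "(\<Sum>x\<in>S. (x \<bullet> y)\<^sup>2) = 0"
    by (auto intro!: sum.neutral simp: span_base orthogonal_def inner_commute)
  then show False using frame[of y] y n_ge_2 by simp
qed

end

section \<open>Simple systems\<close>

context unit_system
begin

text \<open>The triples of inner normals of the chambers.\<close>

definition simple :: "real^3 \<Rightarrow> real^3 \<Rightarrow> real^3 \<Rightarrow> bool" where
  "simple a b c \<longleftrightarrow> a \<in> S \<and> b \<in> S \<and> c \<in> S \<and>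
     (\<forall>s t u. s *\<^sub>R a + t *\<^sub>R b + u *\<^sub>R c = 0 \<longrightarrow> s = 0 \<and> t = 0 \<and> u = 0) \<and>
     (\<forall>x \<in> S. \<exists>s t u. 0 \<le> s \<and> 0 \<le> t \<and> 0 \<le> u \<and>
        (x = s *\<^sub>R a + t *\<^sub>R b + u *\<^sub>R c \<or> x = - (s *\<^sub>R a + t *\<^sub>R b + u *\<^sub>R c)))"

lemma simple_rep:
  assumes "simple a b c" "x \<in> S"
  obtains s t u where "0 \<le> s" "0 \<le> t" "0 \<le> u"
    "x = s *\<^sub>R a + t *\<^sub>R b + u *\<^sub>R c \<or> x = - (s *\<^sub>R a + t *\<^sub>R b + u *\<^sub>R c)"
proof -
  have "\<exists>s t u. 0 \<le> s \<and> 0 \<le> t \<and> 0 \<le> u \<and>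
     (x = s *\<^sub>R a + t *\<^sub>R b + u *\<^sub>R c \<or> x = - (s *\<^sub>R a + t *\<^sub>R b + u *\<^sub>R c))"
    using assms unfolding simple_def by simp
  then show ?thesis using that by blast
qed

lemma simple_mem: "simple a b c \<Longrightarrow> a \<in> S" "simple a b c \<Longrightarrow> b \<in> S" "simple a b c \<Longrightarrow> c \<in> S"
  by (simp_all add: simple_def)

text \<open>Common part of rotation and swap: \<open>\<alpha>\<close>, \<open>\<beta>\<close>,
  \<open>\<gamma>\<close> give the coefficients over \<open>a\<close>, \<open>b\<close>,
  \<open>c\<close> in terms of those over \<open>a'\<close>, \<open>b'\<close>, \<open>c'\<close>,
  and \<open>inv\<close> says that they only permute them, which preserves nonnegativity.\<close>

lemma simple_permute:
  assumes s: "simple a b c"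
    and perm: "\<And>s t u. s *\<^sub>R a' + t *\<^sub>R b' + u *\<^sub>R c' = \<alpha> s t u *\<^sub>R a + \<beta> s t u *\<^sub>R b + \<gamma> s t u *\<^sub>R c"
    and inv: "\<And>s t u. \<exists>s' t' u'. s = \<alpha> s' t' u' \<and> t = \<beta> s' t' u' \<and> u = \<gamma> s' t' u'
       \<and> {s', t', u'} = {s, t, u}"
    and zero: "\<And>s t u. \<alpha> s t u = 0 \<Longrightarrow> \<beta> s t u = 0 \<Longrightarrow> \<gamma> s t u = 0 \<Longrightarrow> s = 0 \<and> t = 0 \<and> u = 0"
    and S: "a' \<in> S" "b' \<in> S" "c' \<in> S"
  shows "simple a' b' c'"
  unfolding simple_def
proof (intro conjI S allI impI ballI)
  fix s t u assume "s *\<^sub>R a' + t *\<^sub>R b' + u *\<^sub>R c' = 0"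
  then have "\<alpha> s t u = 0" "\<beta> s t u = 0" "\<gamma> s t u = 0" using s unfolding perm simple_def by blast+
  then show "s = 0" "t = 0" "u = 0" using zero by blast+
next
  fix x assume "x \<in> S"
  then obtain s t u where x: "0 \<le> s" "0 \<le> t" "0 \<le> u"
    "x = s *\<^sub>R a + t *\<^sub>R b + u *\<^sub>R c \<or> x = - (s *\<^sub>R a + t *\<^sub>R b + u *\<^sub>R c)"
    using s unfolding simple_def by blast
  obtain s' t' u' where i: "s = \<alpha> s' t' u'" "t = \<beta> s' t' u'" "u = \<gamma> s' t' u'" "{s', t', u'} = {s, t, u}"
    using inv by blast
  have "\<forall>v\<in>{s', t', u'}. 0 \<le> v" unfolding i(4) using x by auto
  then have "0 \<le> s' \<and> 0 \<le> t' \<and> 0 \<le> u'" by blast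
  then show "\<exists>s t u. 0 \<le> s \<and> 0 \<le> t \<and> 0 \<le> u \<and>
      (x = s *\<^sub>R a' + t *\<^sub>R b' + u *\<^sub>R c' \<or> x = - (s *\<^sub>R a' + t *\<^sub>R b' + u *\<^sub>R c'))"
    using x(4) unfolding perm i(1-3) by blast
qed

lemma simple_rotate: "simple a b c \<Longrightarrow> simple b c a"
  by (rule simple_permute[where \<alpha> = "\<lambda>s t u. u" and \<beta> = "\<lambda>s t u. s" and \<gamma> = "\<lambda>s t u. t"])
    (auto simp: simple_def algebra_simps)

lemma simple_swap: "simple a b c \<Longrightarrow> simple b a c"
  by (rule simple_permute[where \<alpha> = "\<lambda>s t u. t" and \<beta> = "\<lambda>s t u. s" and \<gamma> = "\<lambda>s t u. u"])
    (auto simp: simple_def algebra_simps)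

lemma simple_coeffs:
  assumes "simple a b c" "s *\<^sub>R a + t *\<^sub>R b + u *\<^sub>R c = s' *\<^sub>R a + t' *\<^sub>R b + u' *\<^sub>R c"
  shows "s = s' \<and> t = t' \<and> u = u'"
proof -
  have "(s - s') *\<^sub>R a + (t - t') *\<^sub>R b + (u - u') *\<^sub>R c = 0"
    using assms(2) by (simp add: algebra_simps)
  then show ?thesis using assms(1) unfolding simple_def by fastforce
qed

lemma simple_neq:
  assumes "simple a b c" shows "b \<noteq> a" "b \<noteq> - a" "c \<noteq> a" "c \<noteq> - a" "c \<noteq> b" "c \<noteq> - b"
  using simple_coeffs[OF assms, of 1 0 0 0 1 0] simple_coeffs[OF assms, of "-1" 0 0 0 1 0]
    simple_coeffs[OF assms, of 1 0 0 0 0 1] simple_coeffs[OF assms, of "-1" 0 0 0 0 1]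
    simple_coeffs[OF assms, of 0 1 0 0 0 1] simple_coeffs[OF assms, of 0 "-1" 0 0 0 1]
  by auto

text \<open>An element of \<open>S\<close> in the plane of two walls has third coefficient zero,
  because coordinates over a simple triple are unique.\<close>

lemma simple_wedge:
  assumes s: "simple a b c" shows "wedge a b"
proof -
  have "\<exists>s t. 0 \<le> s \<and> 0 \<le> t \<and> (x = s *\<^sub>R a + t *\<^sub>R b \<or> x = - (s *\<^sub>R a + t *\<^sub>R b))"
    if x: "x \<in> S \<inter> span {a, b}" for x
  proof -
    obtain p q where pq: "x = p *\<^sub>R a + q *\<^sub>R b"
      using x by (auto simp: span_insert algebra_simps)
    obtain s t u where stu: "0 \<le> s" "0 \<le> t" "0 \<le> u"
      "x = s *\<^sub>R a + t *\<^sub>R b + u *\<^sub>R c \<or> x = - (s *\<^sub>R a + t *\<^sub>R b + u *\<^sub>R c)"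
      using s x unfolding simple_def by blast
    from stu(4) show ?thesis
    proof
      assume "x = s *\<^sub>R a + t *\<^sub>R b + u *\<^sub>R c"
      then have "u = 0" using simple_coeffs[OF s, of p q 0 s t u] pq by simp
      then show ?thesis using stu \<open>x = s *\<^sub>R a + t *\<^sub>R b + u *\<^sub>R c\<close> by auto
    next
      assume *: "x = - (s *\<^sub>R a + t *\<^sub>R b + u *\<^sub>R c)"
      then have "p *\<^sub>R a + q *\<^sub>R b + 0 *\<^sub>R c = (- s) *\<^sub>R a + (- t) *\<^sub>R b + (- u) *\<^sub>R c" using pq by simp
      then have "u = 0" using simple_coeffs[OF s] by fastforce
      then have "x = - (s *\<^sub>R a + t *\<^sub>R b)" using * by simp
      then show ?thesis using stu by blast
    qed
  qed
  then show ?thesis unfolding wedge_def using s simple_neq[OF s] by (auto simp: simple_def)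
qed

text \<open>If \<open>a\<close> has a larger coefficient on the left than on the right, the equation
  can be solved for \<open>a\<close>, which is then a redundant generator of the cone.\<close>

lemma nonneg_combination_extreme:
  fixes D :: "(real^3) set"
  assumes fin: "finite D" and a: "a \<in> D" and v: "\<forall>d\<in>D. 0 \<le> v d" and gt: "\<alpha> > v a"
    and eq: "\<alpha> *\<^sub>R a = (\<Sum>d\<in>D. v d *\<^sub>R d)"
  obtains w where "\<forall>d\<in>D - {a}. 0 \<le> w d" "a = (\<Sum>d\<in>D - {a}. w d *\<^sub>R d)"
proof -
  have "\<alpha> *\<^sub>R a = v a *\<^sub>R a + (\<Sum>d\<in>D - {a}. v d *\<^sub>R d)" using eq sum.remove[OF fin a] by simp
  then have "(\<alpha> - v a) *\<^sub>R a = (\<Sum>d\<in>D - {a}. v d *\<^sub>R d)" by (simp add: algebra_simps)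
  then have "a = (1 / (\<alpha> - v a)) *\<^sub>R (\<Sum>d\<in>D - {a}. v d *\<^sub>R d)"
    using gt by (metis diff_gt_0_iff_gt divide_self_if less_irrefl scaleR_one scaleR_scaleR times_divide_eq_left mult_1)
  also have "\<dots> = (\<Sum>d\<in>D - {a}. (v d / (\<alpha> - v a)) *\<^sub>R d)" by (simp add: scaleR_sum_right)
  finally show ?thesis using that[of "\<lambda>d. v d / (\<alpha> - v a)"] v gt by auto
qed

text \<open>As for simple roots: take a set of fewest elements whose cone contains all of
  \<open>S\<close> on the positive side of \<open>\<rho>\<close>. A combination of two of its
  elements with coefficients of opposite signs cannot lie in \<open>S\<close>, as one of the two
  would become redundant; so the two are neighbours in their pencil.\<close>

lemma minimal_generators:
  assumes \<rho>: "\<forall>x\<in>S. \<rho> \<bullet> x \<noteq> 0"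
  obtains D where "D \<subseteq> {x \<in> S. \<rho> \<bullet> x > 0}"
    "\<forall>x\<in>{x \<in> S. \<rho> \<bullet> x > 0}. \<exists>w. (\<forall>d\<in>D. 0 \<le> w d) \<and> x = (\<Sum>d\<in>D. w d *\<^sub>R d)"
    "\<forall>a\<in>D. \<forall>b\<in>D. a \<noteq> b \<longrightarrow> wedge a b"
proof -
  let ?N = "{x \<in> S. \<rho> \<bullet> x > 0}"
  define gen where "gen D \<longleftrightarrow> D \<subseteq> ?N \<and> (\<forall>x\<in>?N. \<exists>w. (\<forall>d\<in>D. 0 \<le> w d) \<and> x = (\<Sum>d\<in>D. w d *\<^sub>R d))" for D :: "(real^3) set"
  have "gen ?N"
    unfolding gen_def
  proof (intro conjI ballI subset_refl)
    fix x assume x: "x \<in> ?N"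
    have "x = (\<Sum>d\<in>?N. (if d = x then 1 else 0) *\<^sub>R d)"
      using x finite_S by (simp add: if_distrib[of "\<lambda>c. c *\<^sub>R _"] cong: if_cong)
    then show "\<exists>w. (\<forall>d\<in>?N. 0 \<le> w d) \<and> x = (\<Sum>d\<in>?N. w d *\<^sub>R d)"
      by (intro exI[of _ "\<lambda>d. if d = x then 1 else 0"]) auto
  qed
  then obtain D where D: "gen D" and min: "\<And>D'. gen D' \<Longrightarrow> card D \<le> card D'"
    using ex_has_least_nat[of gen ?N card] by blast
  have DN: "D \<subseteq> ?N" and Dgen: "\<And>x. x \<in> ?N \<Longrightarrow> \<exists>w. (\<forall>d\<in>D. 0 \<le> w d) \<and> x = (\<Sum>d\<in>D. w d *\<^sub>R d)"
    using D unfolding gen_def by auto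
  have fin: "finite D" using DN finite_S finite_subset by fastforce
  \<comment> \<open>Substituting the combination for \<open>a\<close> would leave a smaller
    generating set.\<close>
  have irr: False if a: "a \<in> D" and w: "\<forall>d\<in>D - {a}. 0 \<le> w d" "a = (\<Sum>d\<in>D - {a}. w d *\<^sub>R d)" for a w
  proof -
    have "gen (D - {a})" unfolding gen_def
    proof (intro conjI ballI)
      fix x assume "x \<in> ?N"
      then obtain v where v: "\<forall>d\<in>D. 0 \<le> v d" "x = (\<Sum>d\<in>D. v d *\<^sub>R d)" using Dgen by blast
      have "x = v a *\<^sub>R a + (\<Sum>d\<in>D - {a}. v d *\<^sub>R d)" using v(2) sum.remove[OF fin a] by simp
      also have "v a *\<^sub>R a = (\<Sum>d\<in>D - {a}. (v a * w d) *\<^sub>R d)"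
        by (subst w(2)) (simp add: scaleR_sum_right)
      finally have "x = (\<Sum>d\<in>D - {a}. (v a * w d + v d) *\<^sub>R d)" by (simp add: scaleR_add_left sum.distrib)
      then show "\<exists>w. (\<forall>d\<in>D - {a}. 0 \<le> w d) \<and> x = (\<Sum>d\<in>D - {a}. w d *\<^sub>R d)"
        using v(1) w(1) a by (intro exI[of _ "\<lambda>d. v a * w d + v d"]) auto
    qed (use DN in auto)
    then show False using min[of "D - {a}"] a fin card_Diff1_less[of D a] by simp
  qed
  \<comment> \<open>Moving a negative \<open>\<beta>\<close> to the other side turns a multiple of
    \<open>a\<close> into a nonnegative combination of \<open>D\<close> in which \<open>b\<close>
    really occurs. Either \<open>a\<close> can be solved for, against \<open>irr\<close>, or pairing
    the rest with \<open>\<rho>\<close> gives a contradiction of signs.\<close>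
  have pos: "0 \<le> \<beta>" if ab: "a \<in> D" "b \<in> D" "a \<noteq> b" and z: "z \<in> ?N" "z = \<alpha> *\<^sub>R a + \<beta> *\<^sub>R b" for a b z \<alpha> \<beta>
  proof (rule ccontr)
    assume "\<not> 0 \<le> \<beta>"
    then have \<beta>: "\<beta> < 0" by simp
    obtain v where v: "\<forall>d\<in>D. 0 \<le> v d" "z = (\<Sum>d\<in>D. v d *\<^sub>R d)" using Dgen z(1) by blast
    define v' where "v' d = v d - (if d = b then \<beta> else 0)" for d
    have eq: "\<alpha> *\<^sub>R a = (\<Sum>d\<in>D. v' d *\<^sub>R d)"
    proof -
      have "(\<Sum>d\<in>D. v' d *\<^sub>R d) = (\<Sum>d\<in>D. v d *\<^sub>R d) - (\<Sum>d\<in>D. (if d = b then \<beta> else 0) *\<^sub>R d)"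
        unfolding v'_def by (simp add: scaleR_diff_left sum_subtractf)
      also have "(\<Sum>d\<in>D. (if d = b then \<beta> else 0) *\<^sub>R d) = \<beta> *\<^sub>R b"
        using ab(2) fin by (simp add: if_distrib[of "\<lambda>c. c *\<^sub>R _"] cong: if_cong)
      finally show ?thesis using v(2) z(2) by (metis add_diff_cancel_right')
    qed
    have v': "\<forall>d\<in>D. 0 \<le> v' d" using v(1) \<beta> by (auto simp: v'_def)
    show False
    proof (cases "\<alpha> > v' a")
      case True
      obtain w where "\<forall>d\<in>D - {a}. 0 \<le> w d" "a = (\<Sum>d\<in>D - {a}. w d *\<^sub>R d)"
        using nonneg_combination_extreme[OF fin ab(1) v' True eq] .
      then show False by (rule irr[OF ab(1)])
    next
      case False
      have "\<alpha> * (\<rho> \<bullet> a) = (\<Sum>d\<in>D. v' d * (\<rho> \<bullet> d))"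
        using arg_cong[OF eq, of "\<lambda>x. \<rho> \<bullet> x"] by (simp add: inner_sum_right)
      also have "\<dots> = v' a * (\<rho> \<bullet> a) + (\<Sum>d\<in>D - {a}. v' d * (\<rho> \<bullet> d))" using sum.remove[OF fin ab(1)] by simp
      finally have *: "(\<alpha> - v' a) * (\<rho> \<bullet> a) = (\<Sum>d\<in>D - {a}. v' d * (\<rho> \<bullet> d))" by (simp add: algebra_simps)
      have "v' b * (\<rho> \<bullet> b) \<le> (\<Sum>d\<in>D - {a}. v' d * (\<rho> \<bullet> d))"
        using ab fin v' DN by (intro member_le_sum) auto
      moreover have "v' b > 0" using v(1) ab(2) \<beta> by (auto simp: v'_def add_nonneg_pos diff_conv_add_uminus simp del: add_uminus_conv_diff)
      moreover have "\<rho> \<bullet> b > 0" "\<rho> \<bullet> a > 0" using DN ab by auto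
      ultimately have "(\<alpha> - v' a) * (\<rho> \<bullet> a) > 0" unfolding * by (meson less_le_trans mult_pos_pos)
      then show False using False \<open>\<rho> \<bullet> a > 0\<close> by (simp add: zero_less_mult_iff)
    qed
  qed
  have "wedge a b" if ab: "a \<in> D" "b \<in> D" "a \<noteq> b" for a b
  proof -
    have p: "\<rho> \<bullet> a > 0" "\<rho> \<bullet> b > 0" "a \<in> S" "b \<in> S" using DN ab by auto
    have "\<exists>s t. 0 \<le> s \<and> 0 \<le> t \<and> (x = s *\<^sub>R a + t *\<^sub>R b \<or> x = - (s *\<^sub>R a + t *\<^sub>R b))"
      if x: "x \<in> S" "x \<in> span {a, b}" for x
    proof -
      obtain s t where st: "x = s *\<^sub>R a + t *\<^sub>R b"
        using x(2) by (auto simp: span_insert algebra_simps)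
      show ?thesis
      proof (cases "\<rho> \<bullet> x > 0")
        case True
        then have "0 \<le> t" "0 \<le> s" using pos[OF ab, of x s t] pos[OF ab(2,1), of x t s] ab x(1) st by (auto simp: add.commute)
        then show ?thesis using st by blast
      next
        case False
        then have "\<rho> \<bullet> (- x) > 0" using \<rho> x(1) by (simp add: less_le)
        then have "0 \<le> - t" "0 \<le> - s"
          using pos[OF ab, of "- x" "- s" "- t"] pos[OF ab(2,1), of "- x" "- t" "- s"] ab neg[OF x(1)] st
          by (auto simp: add.commute)
        moreover have "x = - ((- s) *\<^sub>R a + (- t) *\<^sub>R b)" using st by simp
        ultimately show ?thesis by blast
      qed
    qed
    moreover have "b \<noteq> - a" using p by auto
    ultimately show ?thesis unfolding wedge_def using p ab by auto
  qed
  then show ?thesis using that[of D] DN Dgen by blast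
qed

end

context hirzebruch_system
begin

text \<open>Vectors in an open half space with pairwise nonpositive inner products are independent.
  Splitting a relation by the signs of its coefficients gives \<open>p = q\<close>; then
  \<open>p \<bullet> p = p \<bullet> q \<le> 0\<close>, and pairing \<open>p = 0\<close> and
  \<open>q = 0\<close> with \<open>\<rho>\<close> kills every coefficient.\<close>

lemma minimal_generators_independent:
  assumes fin: "finite D" and pos: "\<forall>d\<in>D. \<rho> \<bullet> d > 0"
    and w: "\<forall>a\<in>D. \<forall>b\<in>D. a \<noteq> b \<longrightarrow> wedge a b"
  shows "independent D"
proof -
  have "\<forall>d\<in>D. u d = 0" if u: "(\<Sum>d\<in>D. u d *\<^sub>R d) = 0" for u
  proof -
    define p q where "p = (\<Sum>d\<in>D. max (u d) 0 *\<^sub>R d)" and "q = (\<Sum>d\<in>D. max (- u d) 0 *\<^sub>R d)"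
    have "p - q = (\<Sum>d\<in>D. u d *\<^sub>R d)"
      unfolding p_def q_def sum_subtractf[symmetric] scaleR_diff_left[symmetric]
      by (intro sum.cong refl arg_cong2[of _ _ _ _ scaleR]) auto
    then have pq: "p = q" using u by simp
    have "p \<bullet> q = (\<Sum>d\<in>D. \<Sum>d'\<in>D. max (u d) 0 * (max (- u d') 0 * (d \<bullet> d')))"
      unfolding p_def inner_sum_left by (simp add: q_def inner_sum_right sum_distrib_left mult.left_commute)
    also have "\<dots> \<le> 0"
    proof (intro sum_nonpos)
      fix d d' assume d: "d \<in> D" "d' \<in> D"
      show "max (u d) 0 * (max (- u d') 0 * (d \<bullet> d')) \<le> 0"
      proof (cases "d = d'")
        case True then show ?thesis by (auto simp: max_def)
      next
        case False
        then have "d \<bullet> d' \<le> 0" using wedge_obtuse(1) w d by blast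
        then show ?thesis by (simp add: mult_nonneg_nonpos)
      qed
    qed
    finally have "p \<bullet> p \<le> 0" using pq by simp
    then have "p = 0" using inner_ge_zero[of p] inner_eq_zero_iff[of p] by linarith
    have zero: "\<forall>d\<in>D. f d = 0" if f: "\<forall>d\<in>D. 0 \<le> f d" "(\<Sum>d\<in>D. f d *\<^sub>R d) = 0" for f
    proof -
      have "(\<Sum>d\<in>D. f d * (\<rho> \<bullet> d)) = 0"
        using arg_cong[OF f(2), of "\<lambda>x. \<rho> \<bullet> x"] by (simp add: inner_sum_right)
      then have "\<forall>d\<in>D. f d * (\<rho> \<bullet> d) = 0"
        using f(1) pos by (subst (asm) sum_nonneg_eq_0_iff[OF fin]) (auto simp: less_imp_le)
      then show ?thesis using pos by fastforce
    qed
    have "\<forall>d\<in>D. max (u d) 0 = 0" "\<forall>d\<in>D. max (- u d) 0 = 0"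
      using zero[of "\<lambda>d. max (u d) 0"] zero[of "\<lambda>d. max (- u d) 0"] \<open>p = 0\<close> pq p_def q_def by auto
    then show ?thesis by (metis max.absorb_iff2 max.commute neg_0_le_iff_le order_antisym max.cobounded1 neg_le_0_iff_le)
  qed
  then show ?thesis using dependent_finite[OF fin] by blast
qed

text \<open>The minimal generators span, because \<open>S\<close> does, and are independent, so
  there are three of them: the chamber with interior point \<open>\<rho>\<close> is a
  triangle.\<close>

lemma simple_exists:
  assumes \<rho>: "\<forall>x\<in>S. \<rho> \<bullet> x \<noteq> 0"
  obtains a b c where "simple a b c" "\<rho> \<bullet> a > 0" "\<rho> \<bullet> b > 0" "\<rho> \<bullet> c > 0"
proof -
  obtain D where D: "D \<subseteq> {x \<in> S. \<rho> \<bullet> x > 0}"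
    and gen: "\<forall>x\<in>{x \<in> S. \<rho> \<bullet> x > 0}. \<exists>w. (\<forall>d\<in>D. 0 \<le> w d) \<and> x = (\<Sum>d\<in>D. w d *\<^sub>R d)"
    and w: "\<forall>a\<in>D. \<forall>b\<in>D. a \<noteq> b \<longrightarrow> wedge a b"
    using minimal_generators[OF \<rho>] .
  have fin: "finite D" using D finite_S finite_subset by fastforce
  have ind: "independent D" using minimal_generators_independent[OF fin _ w] D by blast
  have "S \<subseteq> span D"
  proof
    fix x assume x: "x \<in> S"
    have N: "y \<in> span D" if y: "y \<in> {x \<in> S. \<rho> \<bullet> x > 0}" for y
    proof -
      obtain w where "y = (\<Sum>d\<in>D. w d *\<^sub>R d)" using bspec[OF gen y] by blast
      then show ?thesis by (simp add: span_sum span_mul span_base)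
    qed
    show "x \<in> span D"
    proof (cases "\<rho> \<bullet> x > 0")
      case True then show ?thesis using N x by simp
    next
      case False
      then have "- x \<in> {x \<in> S. \<rho> \<bullet> x > 0}" using \<rho> x neg by (auto simp: less_le)
      then show ?thesis using N span_neg[of "- x" D] by fastforce
    qed
  qed
  then have "span D = UNIV" using span_S span_mono[of S "span D"] by (metis span_span top.extremum_uniqueI)
  then have "card D = 3" using ind dim_span_eq_card_independent[OF ind] by (simp)
  then obtain a b c where abc: "D = {a, b, c}" "a \<noteq> b" "b \<noteq> c" "a \<noteq> c"
    by (metis card_3_iff)
  have s3: "(\<Sum>d\<in>D. f d *\<^sub>R d) = f a *\<^sub>R a + f b *\<^sub>R b + f c *\<^sub>R c" for f
    using abc by (simp add: add.assoc)
  have "simple a b c" unfolding simple_def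
  proof (intro conjI allI impI ballI)
    fix s t u assume *: "s *\<^sub>R a + t *\<^sub>R b + u *\<^sub>R c = 0"
    define f where "f d = (if d = a then s else if d = b then t else u)" for d
    have "(\<Sum>d\<in>D. f d *\<^sub>R d) = 0" unfolding s3 using abc * by (simp add: f_def)
    then have "\<forall>d\<in>D. f d = 0" using ind dependent_finite[OF fin] by blast
    then show "s = 0" "t = 0" "u = 0" using abc by (auto simp: f_def split: if_splits)
  next
    fix x assume x: "x \<in> S"
    show "\<exists>s t u. 0 \<le> s \<and> 0 \<le> t \<and> 0 \<le> u \<and> (x = s *\<^sub>R a + t *\<^sub>R b + u *\<^sub>R c \<or> x = - (s *\<^sub>R a + t *\<^sub>R b + u *\<^sub>R c))"
    proof (cases "\<rho> \<bullet> x > 0")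
      case True
      then have "x \<in> {x \<in> S. \<rho> \<bullet> x > 0}" using x by simp
      then obtain w where w: "\<forall>d\<in>D. 0 \<le> w d" "x = (\<Sum>d\<in>D. w d *\<^sub>R d)" using bspec[OF gen] by blast
      then show ?thesis unfolding s3 using abc(1) by blast
    next
      case False
      then have "- x \<in> {x \<in> S. \<rho> \<bullet> x > 0}" using \<rho> x neg by (auto simp: less_le)
      then obtain w where w: "\<forall>d\<in>D. 0 \<le> w d" "- x = (\<Sum>d\<in>D. w d *\<^sub>R d)" using bspec[OF gen] by blast
      then have "x = - (w a *\<^sub>R a + w b *\<^sub>R b + w c *\<^sub>R c)" unfolding s3 by (metis minus_minus)
      then show ?thesis using w(1) abc(1) by blast
    qed
  qed (use D abc in auto)
  then show ?thesis using that[of a b c] D abc(1) by auto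
qed

end

lemma positive_sign:
  fixes x u \<rho> :: "'a::real_inner"
  shows "x = u \<or> x = - u \<Longrightarrow> \<rho> \<bullet> u \<ge> 0 \<Longrightarrow> \<rho> \<bullet> x > 0 \<Longrightarrow> x = u"
  by auto

lemma sign_inner:
  fixes x u y :: "'a::real_inner"
  shows "x = u \<or> x = - u \<Longrightarrow> y \<bullet> x = y \<bullet> u \<or> y \<bullet> x = - (y \<bullet> u)"
  by auto

section \<open>Chambers at a given vertex\<close>

context unit_system
begin

lemma plane_eq_perp:
  assumes "a \<in> S" "b \<in> S" "b \<noteq> a" "b \<noteq> - a" "p \<noteq> 0" "p \<bullet> a = 0" "p \<bullet> b = 0"
  shows "span {a, b} = {x. p \<bullet> x = 0}"
proof (rule subspace_dim_equal)
  show "span {a, b} \<subseteq> {x. p \<bullet> x = 0}"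
    using assms by (intro span_minimal subspace_hyperplane) auto
  have ind: "independent {a, b}"
  proof -
    have "a \<notin> span {b}"
    proof
      assume "a \<in> span {b}"
      then obtain c where "a = c *\<^sub>R b" by (auto simp: span_singleton)
      then show False using parallel_in_S[of b c] assms by auto
    qed
    then show ?thesis using assms nonzero[of b] independent_insertI[of a "{b}"] by simp
  qed
  have "dim {x. p \<bullet> x = 0} = 2" using dim_hyperplane[OF \<open>p \<noteq> 0\<close>] by simp
  moreover have "dim (span {a, b}) = 2" using dim_span_eq_card_independent[OF ind] assms by simp
  ultimately show "dim {x. p \<bullet> x = 0} \<le> dim (span {a, b})" by simp
qed (auto simp: subspace_hyperplane)

lemma common_normal:
  obtains p :: "real^3" where "p \<noteq> 0" "p \<bullet> a = 0" "p \<bullet> b = 0"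
proof -
  have "dim {a, b} \<le> 2" using dim_le_card'[of "{a, b}"] card_insert_le_m1[of 2 "{b}" a] by simp
  then have "dim {a, b} < DIM(real^3)" by simp
  then obtain p where "p \<noteq> 0" "span {a, b} \<subseteq> {x. p \<bullet> x = 0}"
    using lowdim_subset_hyperplane by blast
  then show ?thesis using that[of p] by (auto simp: span_base subset_eq)
qed

text \<open>Meant for a chamber with vertex \<open>p\<close>. In the nonnegative expansion of
  \<open>a\<close> over the three walls, pairing with \<open>p\<close> leaves only the walls through
  \<open>p\<close>; pairing with \<open>e\<close>, which vanishes on \<open>a\<close> and is
  positive on \<open>b\<close>, leaves only walls equal to \<open>a\<close>.\<close>

lemma extreme_in_simple:
  assumes s: "simple a' b' c'" and w: "wedge a b"
    and \<rho>: "\<rho> \<bullet> a' > 0" "\<rho> \<bullet> b' > 0" "\<rho> \<bullet> c' > 0" "\<rho> \<bullet> a > 0" "\<rho> \<bullet> b > 0"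
    and p: "p \<noteq> 0" "p \<bullet> a = 0" "p \<bullet> b = 0" "p \<bullet> a' \<ge> 0" "p \<bullet> b' \<ge> 0" "p \<bullet> c' \<ge> 0"
  shows "a \<in> {a', b', c'}"
proof -
  have ab: "a \<in> S" "b \<in> S" "b \<noteq> a" "b \<noteq> - a" using w by (auto simp: wedge_def)
  obtain e where e: "e \<in> span {a, b}" "a \<bullet> e = 0" "b \<bullet> e > 0"
    using span_basis[OF ab] by metis
  have cone: "0 \<le> d \<bullet> e \<and> (d \<bullet> e = 0 \<longrightarrow> d = a)" if d: "d \<in> S" "p \<bullet> d = 0" "\<rho> \<bullet> d > 0" for d
  proof -
    have "d \<in> span {a, b}" unfolding plane_eq_perp[OF ab p(1-3)] using d by simp
    then obtain s t where st: "0 \<le> s" "0 \<le> t" "d = s *\<^sub>R a + t *\<^sub>R b \<or> d = - (s *\<^sub>R a + t *\<^sub>R b)"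
      using w d(1) unfolding wedge_def by blast
    have "\<rho> \<bullet> (s *\<^sub>R a + t *\<^sub>R b) \<ge> 0" using st(1,2) \<rho> by (simp add: inner_right_distrib)
    from positive_sign[OF st(3) this d(3)] have deq: "d = s *\<^sub>R a + t *\<^sub>R b" .
    then have de: "d \<bullet> e = t * (b \<bullet> e)" using e(2) by (simp add: inner_left_distrib)
    moreover have "d = a" if "t = 0"
    proof -
      have "d = a \<or> d = - a" using parallel_in_S[of a s] ab(1) d(1) deq that by simp
      then show ?thesis using positive_sign[of d a \<rho>] d(3) \<rho>(4) by simp
    qed
    ultimately show ?thesis using st(1,2) e(3) by simp
  qed
  obtain s t u where stu: "0 \<le> s" "0 \<le> t" "0 \<le> u"
    "a = s *\<^sub>R a' + t *\<^sub>R b' + u *\<^sub>R c' \<or> a = - (s *\<^sub>R a' + t *\<^sub>R b' + u *\<^sub>R c')"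
    using simple_rep[OF s ab(1)] .
  have "\<rho> \<bullet> (s *\<^sub>R a' + t *\<^sub>R b' + u *\<^sub>R c') \<ge> 0" using stu(1-3) \<rho> by (simp add: inner_right_distrib)
  from positive_sign[OF stu(4) this \<rho>(4)] have aeq: "a = s *\<^sub>R a' + t *\<^sub>R b' + u *\<^sub>R c'" .
  have "0 = s * (p \<bullet> a') + t * (p \<bullet> b') + u * (p \<bullet> c')"
    using p(2) by (subst (asm) aeq) (simp add: inner_right_distrib)
  moreover have "s * (p \<bullet> a') \<ge> 0" "t * (p \<bullet> b') \<ge> 0" "u * (p \<bullet> c') \<ge> 0" using stu(1-3) p(4-6) by simp_all
  ultimately have z: "s * (p \<bullet> a') = 0" "t * (p \<bullet> b') = 0" "u * (p \<bullet> c') = 0" by linarith+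
  have S: "a' \<in> S" "b' \<in> S" "c' \<in> S" using s by (auto simp: simple_def)
  have coef: "0 \<le> k * (d \<bullet> e) \<and> (k * (d \<bullet> e) = 0 \<longrightarrow> k \<noteq> 0 \<longrightarrow> d = a)"
    if "d \<in> S" "0 < \<rho> \<bullet> d" "0 \<le> k" "k * (p \<bullet> d) = 0" for k d
    using cone[OF that(1) _ that(2)] that(3,4) by (cases "k = 0") auto
  note cs = coef[OF S(1) \<rho>(1) stu(1) z(1)] coef[OF S(2) \<rho>(2) stu(2) z(2)] coef[OF S(3) \<rho>(3) stu(3) z(3)]
  have "0 = s * (a' \<bullet> e) + t * (b' \<bullet> e) + u * (c' \<bullet> e)"
    using e(2) by (subst (asm) aeq) (simp add: inner_left_distrib)
  then have ze: "s * (a' \<bullet> e) = 0" "t * (b' \<bullet> e) = 0" "u * (c' \<bullet> e) = 0" using cs[THEN conjunct1] by linarith+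
  have "s \<noteq> 0 \<or> t \<noteq> 0 \<or> u \<noteq> 0" using aeq nonzero[OF ab(1)] by auto
  then show ?thesis using ze cs[THEN conjunct2] by fast
qed

text \<open>Each of the two third walls is a nonnegative combination of \<open>a\<close>,
  \<open>b\<close> and the other one. Inserting one expansion into the other leaves no room for
  \<open>a\<close> and \<open>b\<close>, so the third walls are parallel, and \<open>p\<close> fixes
  the sign.\<close>

lemma simple_unique:
  assumes s: "simple a b c" "simple a b c'" and p: "p \<bullet> a = 0" "p \<bullet> b = 0" "p \<bullet> c > 0" "p \<bullet> c' > 0"
  shows "c' = c"
proof -
  have rep: "\<exists>s t u. 0 \<le> s \<and> 0 \<le> t \<and> 0 < u \<and> d' = s *\<^sub>R a + t *\<^sub>R b + u *\<^sub>R d"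
    if h: "simple a b d" "simple a b d'" "p \<bullet> d > 0" "p \<bullet> d' > 0" for d d'
  proof -
    obtain s t u where stu: "0 \<le> s" "0 \<le> t" "0 \<le> u"
      "d' = s *\<^sub>R a + t *\<^sub>R b + u *\<^sub>R d \<or> d' = - (s *\<^sub>R a + t *\<^sub>R b + u *\<^sub>R d)"
      using simple_rep[OF h(1) simple_mem(3)[OF h(2)]] .
    have pd: "p \<bullet> (s *\<^sub>R a + t *\<^sub>R b + u *\<^sub>R d) = u * (p \<bullet> d)" using p by (simp add: inner_right_distrib)
    then have "p \<bullet> (s *\<^sub>R a + t *\<^sub>R b + u *\<^sub>R d) \<ge> 0" using stu(1-3) h(3) by simp
    from positive_sign[OF stu(4) this h(4)] have deq: "d' = s *\<^sub>R a + t *\<^sub>R b + u *\<^sub>R d" .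
    then have "u \<noteq> 0" using pd h(4) by auto
    then have "u > 0" using stu(3) by simp
    then show ?thesis using stu(1,2) deq by blast
  qed
  obtain s1 t1 u1 where 1: "0 \<le> s1" "0 \<le> t1" "0 < u1" "c' = s1 *\<^sub>R a + t1 *\<^sub>R b + u1 *\<^sub>R c" using rep[OF s p(3,4)] by blast
  obtain s2 t2 u2 where 2: "0 \<le> s2" "0 \<le> t2" "0 < u2" "c = s2 *\<^sub>R a + t2 *\<^sub>R b + u2 *\<^sub>R c'" using rep[OF s(2,1) p(4,3)] by blast
  have "0 *\<^sub>R a + 0 *\<^sub>R b + 1 *\<^sub>R c = (s2 + u2 * s1) *\<^sub>R a + (t2 + u2 * t1) *\<^sub>R b + (u2 * u1) *\<^sub>R c"
    using 2(4) unfolding 1(4) by (simp add: algebra_simps)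
  then have "0 = s2 + u2 * s1" "0 = t2 + u2 * t1" using simple_coeffs[OF s(1)] by blast+
  moreover have "u2 * s1 \<ge> 0" "u2 * t1 \<ge> 0" using 1(1,2) 2(3) by simp_all
  ultimately have "u2 * s1 = 0" "u2 * t1 = 0" using 2(1,2) by linarith+
  then have "s1 = 0" "t1 = 0" using 2(3) by simp_all
  then have c': "c' = u1 *\<^sub>R c" using 1(4) by simp
  then have "c' = c \<or> c' = - c" using parallel_in_S[of c u1] s by (auto simp: simple_def)
  then show ?thesis using p(3,4) by auto
qed

lemma simple_third_normal:
  assumes s: "simple a b c" and p: "p \<noteq> 0" "p \<bullet> a = 0" "p \<bullet> b = 0"
  shows "p \<bullet> c \<noteq> 0"
proof
  assume "p \<bullet> c = 0"
  then have "c \<in> span {a, b}"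
    using plane_eq_perp[of a b p] simple_neq[OF s] s p by (auto simp: simple_def)
  then obtain x y where "c = x *\<^sub>R a + y *\<^sub>R b" by (auto simp: span_insert algebra_simps)
  then show False using simple_coeffs[OF s, of x y 0 0 0 1] by simp
qed

end

context hirzebruch_system
begin

text \<open>\<open>p\<close> is a common point of the great circles orthogonal to \<open>a\<close>
  and \<open>b\<close>. Moving it slightly along \<open>a + b\<close>, into their angle, reaches a
  chamber with vertex \<open>p\<close>, of which \<open>a\<close> and \<open>b\<close> must be
  walls.\<close>

lemma wedge_extends:
  assumes w: "wedge a b" and p: "p \<noteq> 0" "p \<bullet> a = 0" "p \<bullet> b = 0"
  obtains c where "simple a b c" "p \<bullet> c > 0"
proof -
  have ab: "a \<in> S" "b \<in> S" "b \<noteq> a" "b \<noteq> - a" using w by (auto simp: wedge_def)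
  define y where "y = a + b"
  have "\<bar>a \<bullet> b\<bar> < 1" using abs_dot_less_1[OF ab] .
  moreover have "y \<bullet> a = 1 + a \<bullet> b" "y \<bullet> b = a \<bullet> b + 1"
    unfolding y_def inner_left_distrib using dot_self[OF ab(1)] dot_self[OF ab(2)] by (simp_all add: inner_commute)
  ultimately have ya: "y \<bullet> a > 0" "y \<bullet> b > 0" by linarith+
  define X where "X = insert 1 ((\<lambda>x. \<bar>p \<bullet> x\<bar>) ` {x \<in> S. p \<bullet> x \<noteq> 0})"
  have X: "finite X" "X \<noteq> {}" "\<forall>x\<in>X. x > 0" using finite_S by (auto simp: X_def)
  define m where "m = Min X"
  have m: "m > 0" using X by (simp add: m_def)
  \<comment> \<open>So small that the perturbation changes the sign of no nonzero
    \<open>p \<bullet> x\<close>; it only decides the signs of the elements orthogonal to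
    \<open>p\<close>.\<close>
  define \<epsilon> where "\<epsilon> = m / (norm y + 1)"
  have \<epsilon>: "\<epsilon> > 0" using m by (simp add: \<epsilon>_def add_nonneg_pos)
  define \<rho> where "\<rho> = p + \<epsilon> *\<^sub>R y"
  have small: "\<bar>\<epsilon> * (y \<bullet> x)\<bar> < \<bar>p \<bullet> x\<bar>" if "x \<in> S" "p \<bullet> x \<noteq> 0" for x
  proof -
    have "\<bar>y \<bullet> x\<bar> \<le> norm y" using Cauchy_Schwarz_ineq2[of y x] unit[OF that(1)] by simp
    then have "\<bar>\<epsilon> * (y \<bullet> x)\<bar> \<le> \<epsilon> * norm y" using \<epsilon> by (simp add: abs_mult)
    also have "\<dots> < \<epsilon> * (norm y + 1)" using \<epsilon> by simp
    also have "\<dots> = m" by (simp add: \<epsilon>_def add_nonneg_eq_0_iff)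
    also have "\<dots> \<le> \<bar>p \<bullet> x\<bar>" unfolding m_def using X that by (intro Min_le) (auto simp: X_def)
    finally show ?thesis .
  qed
  have \<rho>x: "\<rho> \<bullet> x = p \<bullet> x + \<epsilon> * (y \<bullet> x)" for x by (simp add: \<rho>_def inner_left_distrib)
  have nz: "\<rho> \<bullet> x \<noteq> 0 \<and> (\<rho> \<bullet> x > 0 \<longrightarrow> p \<bullet> x \<ge> 0)" if x: "x \<in> S" for x
  proof (cases "p \<bullet> x = 0")
    case True
    then have "x \<in> span {a, b}" unfolding plane_eq_perp[OF ab p] by simp
    then obtain s t where st: "0 \<le> s" "0 \<le> t" "x = s *\<^sub>R a + t *\<^sub>R b \<or> x = - (s *\<^sub>R a + t *\<^sub>R b)"
      using w x unfolding wedge_def by blast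
    have "s \<noteq> 0 \<or> t \<noteq> 0" using st(3) nonzero[OF x] by auto
    then have "s * (y \<bullet> a) + t * (y \<bullet> b) > 0" using st(1,2) ya
      by (auto simp: less_le add_nonneg_eq_0_iff)
    then have "y \<bullet> (s *\<^sub>R a + t *\<^sub>R b) > 0" by (simp add: inner_right_distrib)
    then have "y \<bullet> x \<noteq> 0" using sign_inner[OF st(3), of y] by linarith
    then show ?thesis using True \<epsilon> \<rho>x by simp
  next
    case False
    then show ?thesis using small[OF x False] \<rho>x[of x] by linarith
  qed
  obtain a' b' c' where s: "simple a' b' c'" "\<rho> \<bullet> a' > 0" "\<rho> \<bullet> b' > 0" "\<rho> \<bullet> c' > 0"
    using simple_exists[of \<rho>] nz by metis
  have S: "a' \<in> S" "b' \<in> S" "c' \<in> S" using s by (auto simp: simple_def)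
  have \<rho>ab: "\<rho> \<bullet> a > 0" "\<rho> \<bullet> b > 0" using ya \<epsilon> p by (simp_all add: \<rho>x)
  have pp: "p \<bullet> a' \<ge> 0" "p \<bullet> b' \<ge> 0" "p \<bullet> c' \<ge> 0" using nz S s by blast+
  have "a \<in> {a', b', c'}" "b \<in> {a', b', c'}"
    using extreme_in_simple[OF s(1) w s(2-4) \<rho>ab p pp]
      extreme_in_simple[OF s(1) wedge_sym[OF w] s(2-4) \<rho>ab(2,1) p(1,3,2) pp] by auto
  then have "simple a b a' \<or> simple a b b' \<or> simple a b c'"
    using s(1) simple_rotate simple_swap ab(3) by blast
  then obtain c where c: "simple a b c" "c \<in> {a', b', c'}" by blast
  then have "p \<bullet> c \<ge> 0" using pp by auto
  then have "p \<bullet> c > 0" using simple_third_normal[OF c(1) p] by simp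
  then show ?thesis using that c by blast
qed

text \<open>One chamber lies in the angle at \<open>p\<close> and one in the angle at the antipodal
  point \<open>- p\<close>.\<close>

lemma wedge_two_simple:
  assumes w: "wedge a b"
  shows "card {c. simple a b c} = 2"
proof -
  obtain p where p: "p \<noteq> 0" "p \<bullet> a = 0" "p \<bullet> b = 0" using common_normal by blast
  obtain c where c: "simple a b c" "p \<bullet> c > 0" using wedge_extends[OF w p] .
  have p': "- p \<noteq> 0" "(- p) \<bullet> a = 0" "(- p) \<bullet> b = 0" using p by auto
  obtain d where d: "simple a b d" "(- p) \<bullet> d > 0" using wedge_extends[OF w p'] .
  have "{c. simple a b c} = {c, d}"
  proof (intro equalityI subsetI)
    fix x assume x: "x \<in> {c. simple a b c}"
    then have "p \<bullet> x \<noteq> 0" using simple_third_normal p by blast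
    then consider "p \<bullet> x > 0" | "(- p) \<bullet> x > 0" by (simp add: inner_minus_left) linarith
    then show "x \<in> {c, d}"
    proof cases
      case 1 then show ?thesis using simple_unique[OF c(1) _ p(2,3) c(2), of x] x by auto
    next
      case 2 then show ?thesis using simple_unique[OF d(1) _ p'(2,3) d(2), of x] x by auto
    qed
  qed (use c d in auto)
  moreover have "c \<noteq> d" using c d by auto
  ultimately show ?thesis by simp
qed

text \<open>Let \<open>x\<close> be another element of \<open>S\<close>, and \<open>y\<close> the
  part of \<open>x\<close> in the cone of \<open>b\<close> and \<open>c\<close>, up to sign. If
  \<open>a\<close> is orthogonal to that cone, every element of the plane of \<open>a\<close> and
  \<open>x\<close> is up to sign a nonnegative combination of \<open>a\<close> and \<open>y\<close>,
  and as in \<open>wedge_obtuse\<close> the local frame forces \<open>x \<bullet> a = 0\<close>.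
  Then \<open>frame\<close> at \<open>a\<close> has the value 2 instead of
  \<open>2 * n\<close>.\<close>

lemma not_two_right_angles:
  assumes s: "simple a b c"
  shows "\<not> (a \<bullet> b = 0 \<and> a \<bullet> c = 0)"
proof
  assume o: "a \<bullet> b = 0 \<and> a \<bullet> c = 0"
  have S: "a \<in> S" "b \<in> S" "c \<in> S" using s by (auto simp: simple_def)
  have da: "(s *\<^sub>R a + t *\<^sub>R b + u *\<^sub>R c) \<bullet> a = s" for s t u
  proof -
    have "b \<bullet> a = 0" "c \<bullet> a = 0" using o by (simp_all add: inner_commute)
    then show ?thesis using dot_self[OF S(1)] by (simp add: inner_left_distrib)
  qed
  have orth: "x \<bullet> a = 0" if x: "x \<in> S" "x \<noteq> a" "x \<noteq> - a" for x
  proof -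
    let ?P = "span {a, x}"
    have P: "?P \<in> planes S" using planesI[OF S(1) x] .
    obtain s0 t0 u0 where st0: "0 \<le> s0" "0 \<le> t0" "0 \<le> u0"
      "x = s0 *\<^sub>R a + t0 *\<^sub>R b + u0 *\<^sub>R c \<or> x = - (s0 *\<^sub>R a + t0 *\<^sub>R b + u0 *\<^sub>R c)"
      using simple_rep[OF s x(1)] .
    define y where "y = t0 *\<^sub>R b + u0 *\<^sub>R c"
    have ya: "a \<bullet> y = 0" using o by (simp add: y_def inner_right_distrib)
    have xy: "x = s0 *\<^sub>R a + y \<or> x = - (s0 *\<^sub>R a + y)" using st0(4) by (simp add: y_def add.assoc)
    have y0: "y \<noteq> 0"
    proof
      assume "y = 0"
      then have "x = s0 *\<^sub>R a \<or> x = (- s0) *\<^sub>R a" using xy by auto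
      then show False using parallel_in_S[OF S(1)] x by metis
    qed
    have y_eq: "y = x - s0 *\<^sub>R a \<or> y = - x - s0 *\<^sub>R a" using xy
    proof
      assume "x = - (s0 *\<^sub>R a + y)"
      then show ?thesis by simp
    qed simp
    have yP: "y \<in> ?P"
    proof -
      have "x \<in> ?P" "s0 *\<^sub>R a \<in> ?P" by (auto intro: span_base span_mul)
      then show ?thesis using y_eq span_diff[of _ "{a, x}"] span_neg[of x "{a, x}"] by metis
    qed
    have nn: "(z \<bullet> a) * (z \<bullet> y) \<ge> 0" if z: "z \<in> S \<inter> ?P" for z
    proof -
      obtain s1 t1 u1 where st1: "0 \<le> s1" "0 \<le> t1" "0 \<le> u1"
        "z = s1 *\<^sub>R a + t1 *\<^sub>R b + u1 *\<^sub>R c \<or> z = - (s1 *\<^sub>R a + t1 *\<^sub>R b + u1 *\<^sub>R c)"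
        using simple_rep[OF s IntD1[OF z]] .
      define v where "v = s1 *\<^sub>R a + t1 *\<^sub>R b + u1 *\<^sub>R c"
      have zv: "z = v \<or> z = - v" using st1(4) by (simp add: v_def)
      have "v \<in> ?P" using zv z span_neg[of z "{a, x}"] by auto
      then obtain p q where "v = p *\<^sub>R a + q *\<^sub>R x" by (auto simp: span_insert algebra_simps)
      moreover obtain s2 where "x = s2 *\<^sub>R a + y \<or> x = s2 *\<^sub>R a - y" using xy
      proof
        assume "x = - (s0 *\<^sub>R a + y)"
        then have "x = (- s0) *\<^sub>R a - y" by simp
        then show ?thesis using that by blast
      qed blast
      ultimately obtain k l where kl: "v = k *\<^sub>R a + l *\<^sub>R y"
      proof (elim disjE)
        assume "v = p *\<^sub>R a + q *\<^sub>R x" "x = s2 *\<^sub>R a + y"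
        then have "v = (p + q * s2) *\<^sub>R a + q *\<^sub>R y" by (simp add: algebra_simps)
        then show ?thesis using that by blast
      next
        assume "v = p *\<^sub>R a + q *\<^sub>R x" "x = s2 *\<^sub>R a - y"
        then have "v = (p + q * s2) *\<^sub>R a + (- q) *\<^sub>R y" by (simp add: algebra_simps)
        then show ?thesis using that by blast
      qed
      have "s1 *\<^sub>R a + t1 *\<^sub>R b + u1 *\<^sub>R c = k *\<^sub>R a + (l * t0) *\<^sub>R b + (l * u0) *\<^sub>R c"
        using kl unfolding v_def y_def by (simp add: algebra_simps)
      then have c: "s1 = k" "t1 = l * t0" "u1 = l * u0" using simple_coeffs[OF s] by blast+
      have "t0 > 0 \<or> u0 > 0" using y0 st0 by (auto simp: y_def)
      then have "l \<ge> 0" using c st1 by (metis zero_le_mult_iff not_less)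
      have "v \<bullet> a = s1" unfolding v_def by (rule da)
      moreover have "v \<bullet> y = l * (y \<bullet> y)" using kl ya by (simp add: inner_left_distrib)
      ultimately have "(v \<bullet> a) * (v \<bullet> y) \<ge> 0" using \<open>l \<ge> 0\<close> st1(1) by simp
      then show ?thesis using zv by auto
    qed
    have "(\<Sum>z\<in>S \<inter> ?P. (z \<bullet> a) * (z \<bullet> y)) = 0"
      using local_frame[OF P _ yP, of a] ya by (simp add: span_base)
    then have "(x \<bullet> a) * (x \<bullet> y) = 0"
      using sum_nonneg_eq_0_iff[of "S \<inter> ?P" "\<lambda>z. (z \<bullet> a) * (z \<bullet> y)"] finite_S nn x by (auto simp: span_base)
    moreover have "x \<bullet> y \<noteq> 0"
    proof -
      have "y \<bullet> (s0 *\<^sub>R a + y) = y \<bullet> y" using ya by (simp add: inner_right_distrib inner_commute[of y a])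
      then have "y \<bullet> x \<noteq> 0" using sign_inner[OF xy, of y] y0 by auto
      then show ?thesis by (simp add: inner_commute)
    qed
    ultimately show ?thesis by simp
  qed
  have "(\<Sum>x\<in>S. (x \<bullet> a)\<^sup>2) = (\<Sum>x\<in>{a, - a}. (x \<bullet> a)\<^sup>2)"
    using orth finite_S S neg by (intro sum.mono_neutral_right) auto
  also have "\<dots> = 2" using neq_neg[OF S(1)] dot_self[OF S(1)] by simp
  finally show False using frame[of a] dot_self[OF S(1)] n_ge_2 by simp
qed

end

section \<open>Angles in a plane\<close>

definition circ :: "real^3 \<Rightarrow> real^3 \<Rightarrow> real \<Rightarrow> real^3" where
  "circ a e t = cos t *\<^sub>R a + sin t *\<^sub>R e"

text \<open>The dihedral angle between two walls of a chamber with inner normals \<open>a\<close> and \<open>b\<close>.\<close>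

definition ang :: "real^3 \<Rightarrow> real^3 \<Rightarrow> real" where
  "ang a b = arccos (- (a \<bullet> b))"

lemma ang_commute: "ang a b = ang b a"
  by (simp add: ang_def inner_commute)

lemma circ_add_pi: "circ a e (t + pi) = - circ a e t"
  by (simp add: circ_def)

lemma circ_dot:
  assumes "norm a = 1" "norm e = 1" "a \<bullet> e = 0"
  shows "circ a e s \<bullet> circ a e t = cos (s - t)"
proof -
  have "a \<bullet> a = 1" "e \<bullet> e = 1" "e \<bullet> a = 0" using assms by (simp_all add: norm_eq_1 inner_commute)
  then show ?thesis using assms(3) by (simp add: circ_def inner_left_distrib inner_right_distrib cos_diff)
qed

text \<open>A unit vector of the plane in terms of two others, with coefficients whose signs can be
  read off from the order of the angles.\<close>

lemma circ_combination:
  "sin (t - s) *\<^sub>R circ a e u = sin (u - s) *\<^sub>R circ a e t + sin (t - u) *\<^sub>R circ a e s"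
proof -
  have c: "sin (t - s) * cos u = sin (u - s) * cos t + sin (t - u) * cos s"
    by (simp add: sin_diff algebra_simps)
  have d: "sin (t - s) * sin u = sin (u - s) * sin t + sin (t - u) * sin s"
    by (simp add: sin_diff algebra_simps)
  have "sin (t - s) *\<^sub>R circ a e u = (sin (t - s) * cos u) *\<^sub>R a + (sin (t - s) * sin u) *\<^sub>R e"
    by (simp add: circ_def scaleR_add_right)
  also have "\<dots> = sin (u - s) *\<^sub>R circ a e t + sin (t - u) *\<^sub>R circ a e s"
    unfolding c d by (simp add: circ_def algebra_simps)
  finally show ?thesis .
qed

lemma finite_set_enumeration:
  fixes T :: "real set"
  assumes "finite T" "\<forall>t\<in>T. t < m"
  obtains \<theta> :: "nat \<Rightarrow> real" where "\<theta> ` {..<card T} = T" "\<theta> (card T) = m"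
    "\<forall>j\<le>card T. \<forall>i<j. \<theta> i < \<theta> j"
proof -
  define xs where "xs = sorted_list_of_set T"
  have xs: "set xs = T" "length xs = card T" "sorted_wrt (<) xs"
    using assms by (auto simp: xs_def)
  have s: "sorted_wrt (<) (xs @ [m])" using xs assms by (simp add: sorted_wrt_append)
  show ?thesis
  proof (rule that[of "\<lambda>i. (xs @ [m]) ! i"])
    have "(\<lambda>i. (xs @ [m]) ! i) ` {..<card T} = (\<lambda>i. xs ! i) ` {..<card T}"
      using xs(2) by (intro image_cong) (auto simp: nth_append)
    also have "\<dots> = T" using xs nth_image[of "length xs" xs] by (simp add: lessThan_atLeast0)
    finally show "(\<lambda>i. (xs @ [m]) ! i) ` {..<card T} = T" .
    show "(xs @ [m]) ! card T = m" using xs(2) by (metis nth_append_length)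
    show "\<forall>j\<le>card T. \<forall>i<j. (xs @ [m]) ! i < (xs @ [m]) ! j"
      using sorted_wrt_nth_less[OF s] xs(2) by simp
  qed
qed

context unit_system
begin

text \<open>One angle in \<open>[0, pi)\<close> from each pair of opposite elements, in increasing
  order. The additional value \<open>\<theta> r = pi\<close> is the first ray turned round, which
  makes the last gap a gap like all others.\<close>

lemma plane_enumeration:
  assumes P: "P \<in> planes S" and a: "a \<in> S" "a \<in> P" and e: "norm e = 1" "a \<bullet> e = 0" "e \<in> P"
    and basis: "\<forall>x\<in>P. x = (x \<bullet> a) *\<^sub>R a + (x \<bullet> e) *\<^sub>R e"
  obtains \<theta> :: "nat \<Rightarrow> real" and r where "card (S \<inter> P) = 2 * r" "r \<ge> 2" "\<theta> 0 = 0" "\<theta> r = pi"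
    "\<forall>j\<le>r. \<forall>i<j. \<theta> i < \<theta> j"
    "S \<inter> P = (\<lambda>i. circ a e (\<theta> i)) ` {..<r} \<union> (\<lambda>i. - circ a e (\<theta> i)) ` {..<r}"
proof -
  define T where "T = {t. 0 \<le> t \<and> t < pi \<and> circ a e t \<in> S}"
  have na: "norm a = 1" using unit a by blast
  have inP: "circ a e t \<in> P" for t
    unfolding circ_def using subspace_plane[OF P] a e by (intro subspace_add subspace_mul) auto
  have inj: "inj_on (circ a e) {0..<pi}"
  proof (rule inj_onI)
    fix s t assume st: "s \<in> {0..<pi}" "t \<in> {0..<pi}" "circ a e s = circ a e t"
    then have "circ a e s \<bullet> circ a e 0 = circ a e t \<bullet> circ a e 0" by simp
    then have "cos s = cos t" unfolding circ_dot[OF na e(1,2)] by simp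
    then show "s = t" using cos_inj_pi[of s t] st by simp
  qed
  have nneg: "circ a e s \<noteq> - circ a e t" if "s \<in> {0..<pi}" "t \<in> {0..<pi}" for s t
  proof
    assume *: "circ a e s = - circ a e t"
    then have "circ a e s \<bullet> e = - (circ a e t \<bullet> e)" by simp
    then have "sin s = - sin t" using e by (simp add: circ_def inner_left_distrib norm_eq_1)
    moreover have "sin s \<ge> 0" "sin t \<ge> 0" using that by (auto intro!: sin_ge_zero)
    ultimately have "sin s = 0" "sin t = 0" by simp_all
    then have "s = 0" "t = 0" using that sin_gt_zero[of s] sin_gt_zero[of t] by force+
    then have "a = - a" using * by (simp add: circ_def)
    then show False using neq_neg[OF a(1)] by simp
  qed
  have Tsub: "T \<subseteq> {0..<pi}" by (auto simp: T_def)
  have "finite (circ a e ` T)" using finite_S by (rule finite_subset[rotated]) (auto simp: T_def)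
  then have finT: "finite T" using inj_on_subset[OF inj Tsub] by (simp add: finite_image_iff)
  have eq: "S \<inter> P = circ a e ` T \<union> (\<lambda>t. - circ a e t) ` T"
  proof (intro equalityI subsetI)
    fix x assume x: "x \<in> S \<inter> P"
    have x': "x = (x \<bullet> a) *\<^sub>R a + (x \<bullet> e) *\<^sub>R e" using basis x by blast
    have "x \<bullet> x = (x \<bullet> a) * (x \<bullet> a) + (x \<bullet> e) * (x \<bullet> e)"
      by (subst (2) x') (simp add: inner_right_distrib)
    then have "(x \<bullet> a)\<^sup>2 + (x \<bullet> e)\<^sup>2 = 1" using dot_self[of x] x by (simp add: power2_eq_square)
    then obtain t where t: "0 \<le> t" "t < 2 * pi" "x \<bullet> a = cos t" "x \<bullet> e = sin t"
      using sincos_total_2pi by metis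
    then have xc: "x = circ a e t" using x' by (simp add: circ_def)
    show "x \<in> circ a e ` T \<union> (\<lambda>t. - circ a e t) ` T"
    proof (cases "t < pi")
      case True
      then show ?thesis using t xc x by (auto simp: T_def)
    next
      case False
      have "x = - circ a e (t - pi)" using xc circ_add_pi[of a e "t - pi"] by simp
      moreover have "t - pi \<in> T" using False t x calculation neg[of x] by (simp add: T_def)
      ultimately show ?thesis by blast
    qed
  next
    fix x assume "x \<in> circ a e ` T \<union> (\<lambda>t. - circ a e t) ` T"
    then show "x \<in> S \<inter> P" using inP neg plane_neg[OF P] by (auto simp: T_def)
  qed
  have "card (S \<inter> P) = card (circ a e ` T) + card ((\<lambda>t. - circ a e t) ` T)"
    unfolding eq
  proof (rule card_Un_disjoint)
    show "circ a e ` T \<inter> (\<lambda>t. - circ a e t) ` T = {}"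
    proof (intro equals0I)
      fix x assume "x \<in> circ a e ` T \<inter> (\<lambda>t. - circ a e t) ` T"
      then obtain s t where st: "s \<in> T" "t \<in> T" "x = circ a e s" "x = - circ a e t" by auto
      then have "circ a e s = - circ a e t" by simp
      then show False using nneg subsetD[OF Tsub st(1)] subsetD[OF Tsub st(2)] by blast
    qed
  qed (use finT in simp_all)
  moreover have "card (circ a e ` T) = card T" using inj_on_subset[OF inj Tsub] by (rule card_image)
  moreover have "inj_on (\<lambda>t. - circ a e t) T" using inj_on_subset[OF inj Tsub] by (simp add: inj_on_def)
  then have "card ((\<lambda>t. - circ a e t) ` T) = card T" by (rule card_image)
  ultimately have cr: "card (S \<inter> P) = 2 * card T" by simp
  have Tlt: "\<forall>t\<in>T. t < pi" by (simp add: T_def)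
  obtain \<theta> where \<theta>: "\<theta> ` {..<card T} = T" "\<theta> (card T) = pi"
    "\<forall>j\<le>card T. \<forall>i<j. \<theta> i < \<theta> j"
    using finite_set_enumeration[OF finT Tlt] .
  have "0 \<in> T" using a by (simp add: T_def circ_def)
  then obtain i where i: "i < card T" "\<theta> i = 0" using \<theta>(1) by force
  have "\<theta> 0 = 0"
  proof (rule ccontr)
    assume "\<theta> 0 \<noteq> 0"
    then have "\<theta> 0 < 0" using \<theta>(3)[rule_format, of i 0] i by (cases "i = 0") auto
    moreover have "\<theta> 0 \<in> T" using i(1) \<theta>(1) by auto
    ultimately show False using Tsub by auto
  qed
  moreover have "card T \<ge> 2"
  proof -
    obtain y where y: "y \<in> S" "y \<in> P" "y \<noteq> a" "y \<noteq> - a" using plane_partner[OF P a] by metis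
    have "card {a, - a, y, - y} \<le> card (S \<inter> P)"
      using finite_S y a neg plane_neg[OF P] by (intro card_mono) auto
    then show ?thesis using four_elements[OF a(1) y(1,3,4)] cr by simp
  qed
  moreover have "S \<inter> P = (\<lambda>i. circ a e (\<theta> i)) ` {..<card T} \<union> (\<lambda>i. - circ a e (\<theta> i)) ` {..<card T}"
  proof -
    have "(\<lambda>i. circ a e (\<theta> i)) ` {..<card T} = circ a e ` (\<theta> ` {..<card T})"
      "(\<lambda>i. - circ a e (\<theta> i)) ` {..<card T} = (\<lambda>t. - circ a e t) ` (\<theta> ` {..<card T})"
      by (simp_all only: image_image)
    then show ?thesis unfolding \<theta>(1) eq by simp
  qed
  ultimately show ?thesis using that[OF cr] \<theta>(2,3) by simp
qed

lemma wedge_neg: "wedge a b \<Longrightarrow> wedge (- a) (- b)"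
proof -
  assume w: "wedge a b"
  have sp: "span {- a, - b} = span {a, b}"
  proof
    show "span {- a, - b} \<subseteq> span {a, b}" by (rule span_minimal) (auto simp: span_neg span_base)
    have "a \<in> span {- a, - b}" "b \<in> span {- a, - b}"
      using span_neg[of "- a" "{- a, - b}"] span_neg[of "- b" "{- a, - b}"] by (auto simp: span_base)
    then show "span {a, b} \<subseteq> span {- a, - b}" by (intro span_minimal) auto
  qed
  have "\<exists>s t. 0 \<le> s \<and> 0 \<le> t \<and> (x = s *\<^sub>R (- a) + t *\<^sub>R (- b) \<or> x = - (s *\<^sub>R (- a) + t *\<^sub>R (- b)))"
    if x: "x \<in> S \<inter> span {a, b}" for x
  proof -
    obtain s t where "0 \<le> s" "0 \<le> t" "x = s *\<^sub>R a + t *\<^sub>R b \<or> x = - (s *\<^sub>R a + t *\<^sub>R b)"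
      using w x unfolding wedge_def by blast
    then show ?thesis by (intro exI[of _ s] exI[of _ t]) auto
  qed
  then show ?thesis using w neg unfolding wedge_def sp by auto
qed

lemma wedge_coeffs:
  assumes w: "wedge a b" and x: "x \<in> S" "x = A *\<^sub>R a + B *\<^sub>R b"
  shows "A * B \<ge> 0"
proof -
  have ab: "a \<in> S" "b \<in> S" "b \<noteq> a" "b \<noteq> - a" using w by (auto simp: wedge_def)
  have "x \<in> span {a, b}" unfolding x(2) by (intro span_add span_mul) (auto intro: span_base)
  then obtain s t where st: "0 \<le> s" "0 \<le> t" "x = s *\<^sub>R a + t *\<^sub>R b \<or> x = - (s *\<^sub>R a + t *\<^sub>R b)"
    using w x(1) unfolding wedge_def by blast
  obtain e where e: "a \<bullet> e = 0" "b \<bullet> e > 0" using span_basis[OF ab] by metis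
  have uniq: "A' = s' \<and> B' = t'" if "A' *\<^sub>R a + B' *\<^sub>R b = s' *\<^sub>R a + t' *\<^sub>R b" for A' B' s' t'
  proof -
    have "B' * (b \<bullet> e) = t' * (b \<bullet> e)"
      using arg_cong[OF that, of "\<lambda>x. x \<bullet> e"] e(1) by (simp add: inner_left_distrib)
    then have "B' = t'" using e(2) by simp
    then show ?thesis using that nonzero[OF ab(1)] by simp
  qed
  from st(3) show ?thesis
  proof
    assume "x = s *\<^sub>R a + t *\<^sub>R b"
    then show ?thesis using uniq[of A B s t] x(2) st(1,2) by simp
  next
    assume "x = - (s *\<^sub>R a + t *\<^sub>R b)"
    then have "A *\<^sub>R a + B *\<^sub>R b = (- s) *\<^sub>R a + (- t) *\<^sub>R b" using x(2) by simp
    then have "A = - s \<and> B = - t" by (rule uniq)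
    then show ?thesis using st(1,2) by simp
  qed
qed

definition enumerates :: "(real^3) set \<Rightarrow> real^3 \<Rightarrow> real^3 \<Rightarrow> (nat \<Rightarrow> real) \<Rightarrow> nat \<Rightarrow> bool" where
  "enumerates P a e \<theta> r \<longleftrightarrow> P \<in> planes S \<and> norm a = 1 \<and> norm e = 1 \<and> a \<bullet> e = 0 \<and> a \<in> P \<and> e \<in> P \<and>
     card (S \<inter> P) = 2 * r \<and> r \<ge> 2 \<and> \<theta> 0 = 0 \<and> \<theta> r = pi \<and> (\<forall>j\<le>r. \<forall>i<j. \<theta> i < \<theta> j) \<and>
     S \<inter> P = (\<lambda>i. circ a e (\<theta> i)) ` {..<r} \<union> (\<lambda>i. - circ a e (\<theta> i)) ` {..<r}"

lemma enumeration_exists: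
  assumes P: "P \<in> planes S"
  obtains a e \<theta> r where "enumerates P a e \<theta> r"
proof -
  from P obtain a where a: "a \<in> S" "a \<in> P"
    unfolding planes_def using span_superset by blast
  obtain e where e: "e \<in> P" "norm e = 1" "a \<bullet> e = 0"
    and basis: "\<forall>x\<in>P. x = (x \<bullet> a) *\<^sub>R a + (x \<bullet> e) *\<^sub>R e"
    using plane_basis[OF P a] .
  obtain \<theta> :: "nat \<Rightarrow> real" and r where "card (S \<inter> P) = 2 * r" "r \<ge> 2" "\<theta> 0 = 0" "\<theta> r = pi"
    "\<forall>j\<le>r. \<forall>i<j. \<theta> i < \<theta> j"
    "S \<inter> P = (\<lambda>i. circ a e (\<theta> i)) ` {..<r} \<union> (\<lambda>i. - circ a e (\<theta> i)) ` {..<r}"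
    using plane_enumeration[OF P a e(2,3,1) basis] .
  note \<theta> = this
  have "enumerates P a e \<theta> r"
    unfolding enumerates_def by (intro conjI P unit[OF a(1)] a(2) e(1-3) \<theta>)
  then show ?thesis using that by blast
qed

context
  fixes P a e \<theta> r
  assumes en: "enumerates P a e \<theta> r"
begin

abbreviation ray :: "nat \<Rightarrow> real^3" where "ray i \<equiv> circ a e (\<theta> i)"

lemma enum_basic: "P \<in> planes S" "norm a = 1" "norm e = 1" "a \<bullet> e = 0" "card (S \<inter> P) = 2 * r"
    "r \<ge> 2" "\<theta> 0 = 0" "\<theta> r = pi"
    "S \<inter> P = ray ` {..<r} \<union> (\<lambda>i. - ray i) ` {..<r}"
  using en unfolding enumerates_def by blast+

lemma \<theta>_less: "i < j \<Longrightarrow> j \<le> r \<Longrightarrow> \<theta> i < \<theta> j"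
  using en unfolding enumerates_def by simp

lemma \<theta>_range: "i \<le> r \<Longrightarrow> 0 \<le> \<theta> i \<and> \<theta> i \<le> pi"
  using \<theta>_less[of 0 i] \<theta>_less[of i r] enum_basic by (cases "i = 0"; cases "i = r") auto

lemma \<theta>_gap: "i < j \<Longrightarrow> j \<le> r \<Longrightarrow> 0 < \<theta> j - \<theta> i \<and> \<theta> j - \<theta> i \<le> pi \<and> (i \<noteq> 0 \<or> j \<noteq> r \<longrightarrow> \<theta> j - \<theta> i < pi)"
  using \<theta>_range[of i] \<theta>_range[of j] \<theta>_less[of i j] \<theta>_less[of 0 i] \<theta>_less[of j r] enum_basic by (cases "i = 0"; cases "j = r") auto

lemma sin_\<theta>_gap: "i < j \<Longrightarrow> j \<le> r \<Longrightarrow> i \<noteq> 0 \<or> j \<noteq> r \<Longrightarrow> sin (\<theta> j - \<theta> i) > 0"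
  using \<theta>_gap[of i j] by (intro sin_gt_zero) auto

lemma sin_\<theta>_nonneg: "i \<le> j \<Longrightarrow> j \<le> r \<Longrightarrow> sin (\<theta> j - \<theta> i) \<ge> 0"
  using \<theta>_gap[of i j] by (cases "i = j") (auto intro: sin_ge_zero)

lemma z_dot: "ray i \<bullet> ray j = cos (\<theta> i - \<theta> j)"
  using circ_dot enum_basic by blast

lemma z_last: "ray r = - ray 0"
  using circ_add_pi[of a e 0] enum_basic by simp

lemma z_mem: "i \<le> r \<Longrightarrow> ray i \<in> S \<and> ray i \<in> P \<and> - ray i \<in> S \<and> - ray i \<in> P"
proof -
  assume "i \<le> r"
  then have "ray i \<in> S \<inter> P"
    using z_last enum_basic(6) unfolding enum_basic(9) by (cases "i = r") auto
  then show ?thesis using neg plane_neg[OF enum_basic(1)] by blast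
qed

lemma z_neq: assumes "i < j" "j \<le> r" "i \<noteq> 0 \<or> j \<noteq> r" shows "ray i \<noteq> ray j" "ray i \<noteq> - ray j"
proof -
  have s: "sin (\<theta> j - \<theta> i) \<noteq> 0" using sin_\<theta>_gap[OF assms] by simp
  have "(ray i \<bullet> ray j)\<^sup>2 \<noteq> 1"
  proof
    assume "(ray i \<bullet> ray j)\<^sup>2 = 1"
    then have "(cos (\<theta> j - \<theta> i))\<^sup>2 = 1" using z_dot[of j i] by (simp add: inner_commute)
    then show False using s sin_squared_eq[of "\<theta> j - \<theta> i"] by simp
  qed
  then show "ray i \<noteq> ray j" "ray i \<noteq> - ray j" using z_dot[of j j] by (auto simp: inner_minus_left)
qed

lemma z_combination:
  "sin (\<theta> j - \<theta> i) *\<^sub>R ray k = sin (\<theta> k - \<theta> i) *\<^sub>R ray j + sin (\<theta> j - \<theta> k) *\<^sub>R ray i"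
  by (rule circ_combination)

text \<open>No ray lies strictly between two consecutive ones, so every element is up to sign in the
  complementary cone, which is spanned by one ray and the opposite of the other. With these signs,
  \<open>ang\<close> is the gap itself.\<close>

lemma gap_wedge:
  assumes i: "i < r"
  shows "wedge (ray (Suc i)) (- ray i)"
proof -
  let ?g = "\<theta> (Suc i) - \<theta> i"
  have ne: "i \<noteq> 0 \<or> Suc i \<noteq> r" using enum_basic(6) by linarith
  have sg: "sin ?g > 0" using sin_\<theta>_gap[of i "Suc i", OF _ _ ne] i by simp
  have nz: "- ray i \<noteq> ray (Suc i)" "- ray i \<noteq> - ray (Suc i)"
    using z_neq[of i "Suc i", OF _ _ ne] i by (auto simp: minus_equation_iff[of "ray i"])
  have sp: "span {ray (Suc i), - ray i} = P"
  proof -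
    show ?thesis
      using nz plane_eq_span[OF enum_basic(1), of "ray (Suc i)" "- ray i"] z_mem[of i] z_mem[of "Suc i"] i by simp
  qed
  have main: "\<exists>s t. 0 \<le> s \<and> 0 \<le> t \<and> (ray k = s *\<^sub>R ray (Suc i) + t *\<^sub>R (- ray i) \<or> ray k = - (s *\<^sub>R ray (Suc i) + t *\<^sub>R (- ray i)))"
    if k: "k < r" for k
  proof -
    have eq: "ray k = (sin (\<theta> k - \<theta> i) / sin ?g) *\<^sub>R ray (Suc i) + (sin (\<theta> (Suc i) - \<theta> k) / sin ?g) *\<^sub>R ray i"
    proof -
      have "ray k = (1 / sin ?g) *\<^sub>R (sin ?g *\<^sub>R ray k)" using sg by simp
      also have "\<dots> = (sin (\<theta> k - \<theta> i) / sin ?g) *\<^sub>R ray (Suc i) + (sin (\<theta> (Suc i) - \<theta> k) / sin ?g) *\<^sub>R ray i"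
        unfolding z_combination[of "Suc i" i k] by (simp add: scaleR_add_right)
      finally show ?thesis .
    qed
    show ?thesis
    proof (cases "k \<le> i")
      case True
      have "sin (\<theta> i - \<theta> k) \<ge> 0" "sin (\<theta> (Suc i) - \<theta> k) \<ge> 0"
        using True sin_\<theta>_nonneg[of k i] sin_\<theta>_nonneg[of k "Suc i"] i by simp_all
      moreover have "ray k = - ((sin (\<theta> i - \<theta> k) / sin ?g) *\<^sub>R ray (Suc i) + (sin (\<theta> (Suc i) - \<theta> k) / sin ?g) *\<^sub>R (- ray i))"
        by (subst eq) (simp add: sin_diff algebra_simps diff_divide_distrib)
      moreover have "0 \<le> sin (\<theta> i - \<theta> k) / sin ?g" "0 \<le> sin (\<theta> (Suc i) - \<theta> k) / sin ?g" using calculation sg by simp_all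
      ultimately show ?thesis by blast
    next
      case False
      have "sin (\<theta> k - \<theta> i) \<ge> 0" "sin (\<theta> k - \<theta> (Suc i)) \<ge> 0"
        using False sin_\<theta>_nonneg[of i k] sin_\<theta>_nonneg[of "Suc i" k] k by simp_all
      moreover have "ray k = (sin (\<theta> k - \<theta> i) / sin ?g) *\<^sub>R ray (Suc i) + (sin (\<theta> k - \<theta> (Suc i)) / sin ?g) *\<^sub>R (- ray i)"
        by (subst eq) (simp add: sin_diff algebra_simps diff_divide_distrib)
      moreover have "0 \<le> sin (\<theta> k - \<theta> i) / sin ?g" "0 \<le> sin (\<theta> k - \<theta> (Suc i)) / sin ?g" using calculation sg by simp_all
      ultimately show ?thesis by blast
    qed
  qed
  have all: "\<exists>s t. 0 \<le> s \<and> 0 \<le> t \<and> (x = s *\<^sub>R ray (Suc i) + t *\<^sub>R (- ray i) \<or> x = - (s *\<^sub>R ray (Suc i) + t *\<^sub>R (- ray i)))"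
    if x: "x \<in> S \<inter> P" for x
  proof -
    from x obtain k where k: "k < r" "x = ray k \<or> x = - ray k" unfolding enum_basic(9) by blast
    obtain s t where st: "0 \<le> s" "0 \<le> t" "ray k = s *\<^sub>R ray (Suc i) + t *\<^sub>R (- ray i) \<or> ray k = - (s *\<^sub>R ray (Suc i) + t *\<^sub>R (- ray i))"
      using main[OF k(1)] by blast
    define y where "y = s *\<^sub>R ray (Suc i) + t *\<^sub>R (- ray i)"
    have "ray k = y \<or> ray k = - y" using st(3) by (simp only: y_def)
    then have "x = y \<or> x = - y" using k(2) by auto
    then show ?thesis using st(1,2) unfolding y_def by blast
  qed
  have "ray (Suc i) \<in> S" "- ray i \<in> S" using z_mem[of i] z_mem[of "Suc i"] i by simp_all
  then show ?thesis unfolding wedge_def sp using all nz by blast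
qed

text \<open>By \<open>wedge_coeffs\<close> all rays have coefficients of equal sign. If the signs of
  the two vectors differ, a ray between them would violate this; if they agree, a ray before the
  first or after the second would. The case \<open>i = 0\<close>, \<open>Suc j = r\<close> is the
  gap that ends at \<open>pi\<close>.\<close>

lemma wedge_cases_less:
  assumes ij: "i < j" "j < r" and sg: "\<epsilon> = 1 \<or> \<epsilon> = -1" "\<delta> = 1 \<or> \<delta> = -1"
    and w: "wedge (\<epsilon> *\<^sub>R ray i) (\<delta> *\<^sub>R ray j)"
  shows "\<epsilon> = - \<delta> \<and> j = Suc i \<or> \<epsilon> = \<delta> \<and> i = 0 \<and> Suc j = r"
proof -
  let ?g = "sin (\<theta> j - \<theta> i)"
  have g: "?g > 0" using sin_\<theta>_gap[of i j] ij by simp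
  have prod: "(sin (\<theta> k - \<theta> i) * sin (\<theta> j - \<theta> k)) * (\<epsilon> * \<delta>) \<ge> 0" if k: "k < r" for k
  proof -
    have e2: "\<epsilon> * \<epsilon> = 1" "\<delta> * \<delta> = 1" using sg by auto
    have "ray k = (1 / ?g) *\<^sub>R (?g *\<^sub>R ray k)" using g by simp
    also have "\<dots> = (sin (\<theta> j - \<theta> k) / ?g) *\<^sub>R ray i + (sin (\<theta> k - \<theta> i) / ?g) *\<^sub>R ray j"
      unfolding z_combination[of j i k] by (simp add: scaleR_add_right)
    also have "\<dots> = (\<epsilon> * sin (\<theta> j - \<theta> k) / ?g) *\<^sub>R (\<epsilon> *\<^sub>R ray i) + (\<delta> * sin (\<theta> k - \<theta> i) / ?g) *\<^sub>R (\<delta> *\<^sub>R ray j)"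
      using sg by auto
    finally have zk: "ray k = (\<epsilon> * sin (\<theta> j - \<theta> k) / ?g) *\<^sub>R (\<epsilon> *\<^sub>R ray i)
      + (\<delta> * sin (\<theta> k - \<theta> i) / ?g) *\<^sub>R (\<delta> *\<^sub>R ray j)" .
    have "ray k \<in> S" using z_mem[of k] k by simp
    then have "(\<epsilon> * sin (\<theta> j - \<theta> k) / ?g) * (\<delta> * sin (\<theta> k - \<theta> i) / ?g) \<ge> 0"
      by (rule wedge_coeffs[OF w _ zk])
    moreover have "(\<epsilon> * sin (\<theta> j - \<theta> k) / ?g) * (\<delta> * sin (\<theta> k - \<theta> i) / ?g)
       = ((sin (\<theta> k - \<theta> i) * sin (\<theta> j - \<theta> k)) * (\<epsilon> * \<delta>)) / (?g * ?g)" by simp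
    moreover have "0 < ?g * ?g" using g by simp
    ultimately show ?thesis using pos_le_divide_eq[of "?g * ?g" 0] by (simp add: mult_ac)
  qed
  show ?thesis
  proof (cases "\<epsilon> = \<delta>")
    case False
    then have ed: "\<epsilon> = - \<delta>" "\<epsilon> * \<delta> = -1" using sg by auto
    have "j = Suc i"
    proof (rule ccontr)
      assume "j \<noteq> Suc i"
      then have "Suc i < j" using ij by simp
      then have "sin (\<theta> (Suc i) - \<theta> i) > 0" "sin (\<theta> j - \<theta> (Suc i)) > 0"
        using sin_\<theta>_gap[of i "Suc i"] sin_\<theta>_gap[of "Suc i" j] ij by simp_all
      then have "sin (\<theta> (Suc i) - \<theta> i) * sin (\<theta> j - \<theta> (Suc i)) > 0" by simp
      then show False using prod[of "Suc i"] ij \<open>Suc i < j\<close> ed(2) by simp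
    qed
    then show ?thesis using ed by simp
  next
    case True
    then have ed: "\<epsilon> * \<delta> = 1" using sg by auto
    have "i = 0"
    proof (rule ccontr)
      assume "i \<noteq> 0"
      then have "sin (\<theta> i - \<theta> 0) > 0" "sin (\<theta> j - \<theta> 0) > 0"
        using sin_\<theta>_gap[of 0 i] sin_\<theta>_gap[of 0 j] ij by simp_all
      then have "sin (\<theta> 0 - \<theta> i) * sin (\<theta> j - \<theta> 0) < 0"
        by (metis minus_diff_eq mult_neg_pos neg_less_0_iff_less sin_minus)
      then show False using prod[of 0] ij ed by simp
    qed
    moreover have "Suc j = r"
    proof (rule ccontr)
      assume "Suc j \<noteq> r"
      then have j: "Suc j < r" using ij by simp
      then have "sin (\<theta> (Suc j) - \<theta> i) > 0" "sin (\<theta> (Suc j) - \<theta> j) > 0"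
        using sin_\<theta>_gap[of i "Suc j"] sin_\<theta>_gap[of j "Suc j"] ij by simp_all
      then have "sin (\<theta> (Suc j) - \<theta> i) * sin (\<theta> j - \<theta> (Suc j)) < 0"
        by (metis minus_diff_eq mult_pos_neg neg_less_0_iff_less sin_minus)
      then show False using prod[of "Suc j"] j ed by simp
    qed
    ultimately show ?thesis using True by simp
  qed
qed

text \<open>A gap is the angle of four ordered wedges: two orders of the vectors, and a common
  change of sign.\<close>

definition gap_pairs :: "nat \<Rightarrow> ((real^3) \<times> (real^3)) set" where
  "gap_pairs i = {(ray (Suc i), - ray i), (- ray i, ray (Suc i)), (- ray (Suc i), ray i), (ray i, - ray (Suc i))}"

lemma gap_pairs_wedge: "i < r \<Longrightarrow> (x, y) \<in> gap_pairs i \<Longrightarrow> wedge x y \<and> x \<in> P \<and> y \<in> P"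
proof -
  assume i: "i < r" and xy: "(x, y) \<in> gap_pairs i"
  have "wedge (ray (Suc i)) (- ray i)" "wedge (- ray i) (ray (Suc i))" "wedge (- ray (Suc i)) (ray i)" "wedge (ray i) (- ray (Suc i))"
    using gap_wedge[OF i] wedge_sym[OF gap_wedge[OF i]] wedge_neg[OF gap_wedge[OF i]]
      wedge_sym[OF wedge_neg[OF gap_wedge[OF i]]] by simp_all
  moreover have "ray i \<in> P" "- ray i \<in> P" "ray (Suc i) \<in> P" "- ray (Suc i) \<in> P"
    using z_mem[of i] z_mem[of "Suc i"] i by simp_all
  ultimately show ?thesis using xy unfolding gap_pairs_def by auto
qed

lemma wedge_pairs: "{(x, y). wedge x y \<and> x \<in> P \<and> y \<in> P} = (\<Union>i<r. gap_pairs i)"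
proof (intro equalityI subsetI)
  fix q assume "q \<in> {(x, y). wedge x y \<and> x \<in> P \<and> y \<in> P}"
  then obtain x y where q: "q = (x, y)" and w: "wedge x y" and xP: "x \<in> P" and yP: "y \<in> P" by blast
  have sgn: "\<exists>i \<epsilon>. i < r \<and> (\<epsilon> = 1 \<or> \<epsilon> = -1) \<and> x = \<epsilon> *\<^sub>R ray i" if "x \<in> S \<inter> P" for x
  proof -
    from that obtain i where i: "i < r" "x = ray i \<or> x = - ray i" unfolding enum_basic(9) by blast
    then have "x = 1 *\<^sub>R ray i \<or> x = (- 1) *\<^sub>R ray i" by simp
    then show ?thesis using i(1) by blast
  qed
  have xS: "x \<in> S" and yS: "y \<in> S" using w by (auto simp: wedge_def)
  obtain i \<epsilon> where i: "i < r" "\<epsilon> = 1 \<or> \<epsilon> = -1" "x = \<epsilon> *\<^sub>R ray i" using sgn[of x] xS xP by blast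
  obtain j \<delta> where j: "j < r" "\<delta> = 1 \<or> \<delta> = -1" "y = \<delta> *\<^sub>R ray j" using sgn[of y] yS yP by blast
  have "i \<noteq> j"
  proof
    assume "i = j"
    then have "y = x \<or> y = - x" using i j by auto
    then show False using w by (auto simp: wedge_def)
  qed
  have key: "\<exists>k<r. (x, y) \<in> gap_pairs k \<and> (y, x) \<in> gap_pairs k"
    if ij: "i < j" "j < r" and s: "\<epsilon> = 1 \<or> \<epsilon> = -1" "\<delta> = 1 \<or> \<delta> = -1" and xy: "x = \<epsilon> *\<^sub>R ray i" "y = \<delta> *\<^sub>R ray j" and w: "wedge x y"
    for i j \<epsilon> \<delta> x y
  proof -
    have "\<epsilon> = - \<delta> \<and> j = Suc i \<or> \<epsilon> = \<delta> \<and> i = 0 \<and> Suc j = r"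
      using w unfolding xy by (rule wedge_cases_less[OF ij s])
    then show ?thesis unfolding xy
    proof
    assume "\<epsilon> = - \<delta> \<and> j = Suc i"
    then show "\<exists>k<r. (\<epsilon> *\<^sub>R ray i, \<delta> *\<^sub>R ray j) \<in> gap_pairs k \<and> (\<delta> *\<^sub>R ray j, \<epsilon> *\<^sub>R ray i) \<in> gap_pairs k"
      using s ij unfolding gap_pairs_def by (intro exI[of _ i]) auto
  next
    assume c: "\<epsilon> = \<delta> \<and> i = 0 \<and> Suc j = r"
    then have "ray (Suc j) = - ray 0" using z_last by simp
    then show "\<exists>k<r. (\<epsilon> *\<^sub>R ray i, \<delta> *\<^sub>R ray j) \<in> gap_pairs k \<and> (\<delta> *\<^sub>R ray j, \<epsilon> *\<^sub>R ray i) \<in> gap_pairs k"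
      using s ij c unfolding gap_pairs_def by (intro exI[of _ j]) auto
    qed
  qed
  have "\<exists>k<r. (x, y) \<in> gap_pairs k"
  proof (cases "i < j")
    case True
    then show ?thesis using key[OF True j(1) i(2) j(2) i(3) j(3) w] by blast
  next
    case False
    then have "j < i" using \<open>i \<noteq> j\<close> by simp
    then show ?thesis using key[OF _ i(1) j(2) i(2) j(3) i(3) wedge_sym[OF w]] by blast
  qed
  then show "q \<in> (\<Union>i<r. gap_pairs i)" unfolding q by blast
next
  fix q assume "q \<in> (\<Union>i<r. gap_pairs i)"
  then obtain x y i where "q = (x, y)" "i < r" "(x, y) \<in> gap_pairs i" by (metis UN_E lessThan_iff surj_pair)
  then show "q \<in> {(x, y). wedge x y \<and> x \<in> P \<and> y \<in> P}" using gap_pairs_wedge by simp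
qed

end

context
  fixes P a e \<theta> r
  assumes en: "enumerates P a e \<theta> r"
begin

lemma orient:
  "(circ a e s \<bullet> a) * (circ a e t \<bullet> e) - (circ a e s \<bullet> e) * (circ a e t \<bullet> a) = sin (t - s)"
proof -
  have "a \<bullet> a = 1" "e \<bullet> e = 1" "e \<bullet> a = 0" "a \<bullet> e = 0" using enum_basic[OF en] by (simp_all add: norm_eq_1 inner_commute)
  then show ?thesis by (simp add: circ_def inner_left_distrib sin_diff)
qed

lemma z_inj:
  assumes "i < r" "j < r"
  shows "circ a e (\<theta> i) = circ a e (\<theta> j) \<Longrightarrow> i = j" "circ a e (\<theta> i) \<noteq> - circ a e (\<theta> j)"
proof -
  let ?z = "\<lambda>i. circ a e (\<theta> i)"
  have *: "?z i \<noteq> ?z j" "?z i \<noteq> - ?z j" if "i < j" "j < r" for i j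
    using z_neq[OF en, of i j] that by simp_all
  show "?z i = ?z j \<Longrightarrow> i = j" using *[of i j] *[of j i] assms by (metis nat_neq_iff)
  show "?z i \<noteq> - ?z j"
  proof (cases "i = j")
    case True then show ?thesis using neq_neg[of "?z j"] z_mem[OF en, of j] assms by simp
  next
    case False
    then show ?thesis using *(2)[of i j] *(2)[of j i] assms by (metis minus_minus nat_neq_iff)
  qed
qed

lemma sum_enumeration:
  fixes F :: "real^3 \<Rightarrow> real"
  shows "sum F (S \<inter> P) = (\<Sum>i<r. F (circ a e (\<theta> i)) + F (- circ a e (\<theta> i)))"
proof -
  let ?z = "\<lambda>i. circ a e (\<theta> i)"
  have "inj_on ?z {..<r}" "inj_on (\<lambda>i. - ?z i) {..<r}" using z_inj(1) by (auto simp: inj_on_def)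
  moreover have "?z ` {..<r} \<inter> (\<lambda>i. - ?z i) ` {..<r} = {}"
  proof (intro equals0I)
    fix x assume "x \<in> ?z ` {..<r} \<inter> (\<lambda>i. - ?z i) ` {..<r}"
    then obtain i j where ij: "i < r" "j < r" "x = ?z i" "x = - ?z j" by auto
    then show False using z_inj(2)[OF ij(1,2)] by simp
  qed
  ultimately show ?thesis unfolding enum_basic(9)[OF en]
    by (simp add: sum.union_disjoint sum.reindex sum.distrib)
qed

text \<open>No wedge is counted twice: the sign of the area \<open>o'\<close> separates the two
  orders, and since no two rays are opposite to each other, the two choices of sign differ as
  well.\<close>

lemma sum_wedges:
  fixes f :: "real \<Rightarrow> real"
  shows "(\<Sum>(x, y) \<in> {(x, y). wedge x y \<and> x \<in> P \<and> y \<in> P}. f (ang x y)) = 4 * (\<Sum>i<r. f (\<theta> (Suc i) - \<theta> i))"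
proof -
  let ?z = "\<lambda>i. circ a e (\<theta> i)"
  let ?h = "\<lambda>(x, y). f (ang x y)"
  define o' where "o' q = (fst q \<bullet> a) * (snd q \<bullet> e) - (fst q \<bullet> e) * (snd q \<bullet> a)" for q :: "(real^3) \<times> (real^3)"
  define F1 where "F1 i = (?z (Suc i), - ?z i)" for i
  define F2 where "F2 i = (- ?z i, ?z (Suc i))" for i
  define F3 where "F3 i = (- ?z (Suc i), ?z i)" for i
  define F4 where "F4 i = (?z i, - ?z (Suc i))" for i
  note neq = z_inj
  have pos: "o' (F1 i) > 0" "o' (F3 i) > 0" "o' (F2 i) < 0" "o' (F4 i) < 0" if "i < r" for i
  proof -
    have ne: "i \<noteq> 0 \<or> Suc i \<noteq> r" using enum_basic(6)[OF en] by linarith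
    have "sin (\<theta> (Suc i) - \<theta> i) > 0" using sin_\<theta>_gap[OF en, of i "Suc i"] that ne by simp
    moreover have "sin (\<theta> i - \<theta> (Suc i)) = - sin (\<theta> (Suc i) - \<theta> i)" by (metis minus_diff_eq sin_minus)
    ultimately show "o' (F1 i) > 0" "o' (F3 i) > 0" "o' (F2 i) < 0" "o' (F4 i) < 0"
      using orient[of "\<theta> (Suc i)" "\<theta> i"] orient[of "\<theta> i" "\<theta> (Suc i)"]
      by (simp_all add: o'_def F1_def F2_def F3_def F4_def inner_minus_left)
  qed
  have inj: "inj_on F1 {..<r}" "inj_on F2 {..<r}" "inj_on F3 {..<r}" "inj_on F4 {..<r}"
    using neq(1) by (auto simp: inj_on_def F1_def F2_def F3_def F4_def)
  have d13: "F1 ` {..<r} \<inter> F3 ` {..<r} = {}" "F2 ` {..<r} \<inter> F4 ` {..<r} = {}"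
  proof -
    have "F1 i \<noteq> F3 j" "F2 i \<noteq> F4 j" if "i < r" "j < r" for i j
      using neq(2)[OF that] neq(2)[OF that(2,1)] by (auto simp: F1_def F2_def F3_def F4_def)
    then show "F1 ` {..<r} \<inter> F3 ` {..<r} = {}" "F2 ` {..<r} \<inter> F4 ` {..<r} = {}" by blast+
  qed
  have d: "(F1 ` {..<r} \<union> F3 ` {..<r}) \<inter> (F2 ` {..<r} \<union> F4 ` {..<r}) = {}"
  proof (intro equals0I)
    fix q assume q: "q \<in> (F1 ` {..<r} \<union> F3 ` {..<r}) \<inter> (F2 ` {..<r} \<union> F4 ` {..<r})"
    then obtain i j where "i < r" "j < r" "q = F1 i \<or> q = F3 i" "q = F2 j \<or> q = F4 j" by auto
    then show False using pos(1,2)[of i] pos(3,4)[of j] by auto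
  qed
  have W: "{(x, y). wedge x y \<and> x \<in> P \<and> y \<in> P} = (F1 ` {..<r} \<union> F3 ` {..<r}) \<union> (F2 ` {..<r} \<union> F4 ` {..<r})"
    unfolding wedge_pairs[OF en] gap_pairs_def[OF en] F1_def F2_def F3_def F4_def by auto
  have an: "ang (?z (Suc i)) (- ?z i) = \<theta> (Suc i) - \<theta> i" if "i < r" for i
    using z_dot[OF en, of "Suc i" i] \<theta>_gap[OF en, of i "Suc i"] that by (simp add: ang_def arccos_cos)
  have h: "?h (F1 i) = f (\<theta> (Suc i) - \<theta> i)" "?h (F2 i) = f (\<theta> (Suc i) - \<theta> i)"
    "?h (F3 i) = f (\<theta> (Suc i) - \<theta> i)" "?h (F4 i) = f (\<theta> (Suc i) - \<theta> i)" if "i < r" for i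
    using an[OF that] ang_commute[of "?z (Suc i)" "- ?z i"]
    by (simp_all add: F1_def F2_def F3_def F4_def) (simp_all add: ang_def inner_commute)
  have s: "sum ?h (F ` {..<r}) = (\<Sum>i<r. f (\<theta> (Suc i) - \<theta> i))"
    if "inj_on F {..<r}" "\<And>i. i < r \<Longrightarrow> ?h (F i) = f (\<theta> (Suc i) - \<theta> i)" for F
    using that(2) unfolding sum.reindex[OF that(1)] by (intro sum.cong) auto
  show ?thesis
    unfolding W
    by (simp only: sum.union_disjoint[OF _ _ d] sum.union_disjoint[OF _ _ d13(1)] sum.union_disjoint[OF _ _ d13(2)]
        finite_UnI finite_imageI finite_lessThan s[OF inj(1) h(1)] s[OF inj(2) h(2)] s[OF inj(3) h(3)] s[OF inj(4) h(4)])
qed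

lemma sum_gaps: "(\<Sum>i<r. \<theta> (Suc i) - \<theta> i) = pi"
  using sum_lessThan_telescope[of \<theta> r] enum_basic[OF en] by simp

end

text \<open>All that the angle counts need to know about a plane: the coordinates disappear, and
  only the gaps remain.\<close>

lemma plane_gaps:
  assumes "P \<in> planes S"
  obtains g :: "nat \<Rightarrow> real" and r where "card (S \<inter> P) = 2 * r" "r \<ge> 2" "\<forall>i<r. 0 < g i" "(\<Sum>i<r. g i) = pi"
    "\<forall>i<r. \<exists>x y. wedge x y \<and> x \<in> P \<and> y \<in> P \<and> ang x y = g i"
    "\<forall>f::real \<Rightarrow> real. (\<Sum>(x, y) \<in> {(x, y). wedge x y \<and> x \<in> P \<and> y \<in> P}. f (ang x y)) = 4 * (\<Sum>i<r. f (g i))"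
proof -
  obtain a e \<theta> r where en: "enumerates P a e \<theta> r" using enumeration_exists[OF assms] .
  show ?thesis
  proof (rule that[of r "\<lambda>i. \<theta> (Suc i) - \<theta> i"])
    show "card (S \<inter> P) = 2 * r" "r \<ge> 2" using enum_basic[OF en] by blast+
    show "\<forall>i<r. 0 < \<theta> (Suc i) - \<theta> i" using \<theta>_less[OF en] by simp
    show "(\<Sum>i<r. \<theta> (Suc i) - \<theta> i) = pi" by (rule sum_gaps[OF en])
    show "\<forall>f::real \<Rightarrow> real. (\<Sum>(x, y) \<in> {(x, y). wedge x y \<and> x \<in> P \<and> y \<in> P}. f (ang x y)) = 4 * (\<Sum>i<r. f (\<theta> (Suc i) - \<theta> i))"
      using sum_wedges[OF en] by blast
    show "\<forall>i<r. \<exists>x y. wedge x y \<and> x \<in> P \<and> y \<in> P \<and> ang x y = \<theta> (Suc i) - \<theta> i"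
    proof (intro allI impI)
      fix i assume i: "i < r"
      have "ang (circ a e (\<theta> (Suc i))) (- circ a e (\<theta> i)) = \<theta> (Suc i) - \<theta> i"
        using z_dot[OF en, of "Suc i" i] \<theta>_gap[OF en, of i "Suc i"] i by (simp add: ang_def arccos_cos)
      moreover have "wedge (circ a e (\<theta> (Suc i))) (- circ a e (\<theta> i))" using gap_wedge[OF en i] .
      moreover have "circ a e (\<theta> (Suc i)) \<in> P" "- circ a e (\<theta> i) \<in> P"
        using z_mem[OF en, of i] z_mem[OF en, of "Suc i"] i by simp_all
      ultimately show "\<exists>x y. wedge x y \<and> x \<in> P \<and> y \<in> P \<and> ang x y = \<theta> (Suc i) - \<theta> i" by blast
    qed
  qed
qed

end

section \<open>Counting planes\<close>

text \<open>The sum of the weights is nonnegative for the angles of every chamber, and nonpositive for the gaps of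
  every plane; since each gap occurs in the same number of chambers, all these sums vanish.\<close>

definition weight :: "real \<Rightarrow> int" where
  "weight s = (if pi / 3 < s \<and> s < pi / 2 then 1 else if s \<le> pi / 6 then -1 else 0)"

text \<open>Summed over the \<open>r\<close> gaps of a half turn, the right side is 6; so the total
  weight of a plane is less than \<open>6 - r\<close>.\<close>

lemma weight_bound: "0 < s \<Longrightarrow> weight s + 1 < 6 * s / pi"
  by (auto simp: weight_def field_simps)

lemma weight_complement: "0 < s \<Longrightarrow> s < pi / 2 \<Longrightarrow> weight s + weight (pi / 2 - s) \<le> 0"
  by (auto simp: weight_def)

text \<open>An angle of at most \<open>pi / 6\<close> leaves more than \<open>5 * pi / 6\<close> for
  the other two, which then both exceed \<open>pi / 3\<close>; they are not both right, so one has
  weight 1. If the total is zero, either this other angle is right, or no weight occurs at all and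
  three angles of at most \<open>pi / 3\<close> would be too small.\<close>

lemma weight_triangle:
  assumes "0 < A" "A \<le> pi / 2" "0 < B" "B \<le> pi / 2" "0 < C" "C \<le> pi / 2" "A + B + C > pi"
    and "\<not> (A = pi / 2 \<and> B = pi / 2)" "\<not> (B = pi / 2 \<and> C = pi / 2)" "\<not> (C = pi / 2 \<and> A = pi / 2)"
  shows "0 \<le> weight A + weight B + weight C"
    and "weight A + weight B + weight C = 0 \<Longrightarrow> A = pi / 2 \<or> B = pi / 2 \<or> C = pi / 2"
proof -
  have cases: "weight s = -1 \<and> s \<le> pi / 6 \<or> weight s = 1 \<and> pi / 3 < s \<and> s < pi / 2 \<or>
      weight s = 0 \<and> pi / 6 < s \<and> (s \<le> pi / 3 \<or> s = pi / 2)" if "s \<le> pi / 2" for s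
    using that by (auto simp: weight_def)
  have pi: "pi / 3 = 2 * (pi / 6)" "pi / 2 = 3 * (pi / 6)" "pi = 6 * (pi / 6)" by simp_all
  show "0 \<le> weight A + weight B + weight C"
    using cases[OF assms(2)] cases[OF assms(4)] cases[OF assms(6)] assms pi by (elim disjE conjE) linarith+
  show "A = pi / 2 \<or> B = pi / 2 \<or> C = pi / 2" if "weight A + weight B + weight C = 0"
    using cases[OF assms(2)] cases[OF assms(4)] cases[OF assms(6)] assms pi that by (elim disjE conjE) linarith+
qed

context unit_system
begin

text \<open>The hypotheses say that the unit vectors at the doubled angles 0,
  \<open>2 * \<theta> 1\<close>, \<open>2 * \<theta> 2\<close>, \<open>2 * \<theta> 3\<close> add up
  to zero. Four such vectors form two opposite pairs, and the order of the angles pairs the first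
  with the third.\<close>

lemma fourth_gaps:
  assumes en: "enumerates P a e \<theta> 4"
    and c: "1 + cos (2 * \<theta> 1) + cos (2 * \<theta> 2) + cos (2 * \<theta> 3) = 0"
    and s: "sin (2 * \<theta> 1) + sin (2 * \<theta> 2) + sin (2 * \<theta> 3) = 0"
  shows "\<theta> 2 = pi / 2" "\<theta> 3 = \<theta> 1 + pi / 2"
proof -
  let ?S = "\<theta> 1 + \<theta> 3" and ?c = "cos (\<theta> 3 - \<theta> 1)"
  have l: "0 < \<theta> 1" "\<theta> 1 < \<theta> 2" "\<theta> 2 < \<theta> 3" "\<theta> 3 < pi"
    using \<theta>_less[OF en, of 0 1] \<theta>_less[OF en, of 1 2] \<theta>_less[OF en, of 2 3] \<theta>_less[OF en, of 3 4]
      enum_basic(7,8)[OF en] by simp_all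
  have 1: "cos (2 * \<theta> 1) + cos (2 * \<theta> 3) = 2 * (?c * cos ?S)"
  proof -
    have "2 * \<theta> 1 = ?S - (\<theta> 3 - \<theta> 1)" "2 * \<theta> 3 = ?S + (\<theta> 3 - \<theta> 1)" by simp_all
    then show ?thesis by (simp only: cos_add cos_diff) simp
  qed
  have 2: "sin (2 * \<theta> 1) + sin (2 * \<theta> 3) = 2 * (?c * sin ?S)"
  proof -
    have "2 * \<theta> 1 = ?S - (\<theta> 3 - \<theta> 1)" "2 * \<theta> 3 = ?S + (\<theta> 3 - \<theta> 1)" by simp_all
    then show ?thesis by (simp only: sin_add sin_diff) simp
  qed
  have a: "?c * cos ?S = - (cos (\<theta> 2))\<^sup>2" using c 1 cos_double_cos[of "\<theta> 2"] by simp
  have b: "?c * sin ?S = - (sin (\<theta> 2) * cos (\<theta> 2))" using s 2 sin_double[of "\<theta> 2"] by simp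
  have "?c * sin (?S - \<theta> 2) = (?c * sin ?S) * cos (\<theta> 2) - (?c * cos ?S) * sin (\<theta> 2)"
    by (simp add: sin_diff algebra_simps)
  also have "\<dots> = 0" unfolding a b by (simp add: power2_eq_square)
  finally have "?c * sin (?S - \<theta> 2) = 0" .
  moreover have "sin (?S - \<theta> 2) > 0" using l by (intro sin_gt_zero) auto
  ultimately have c0: "?c = 0" by simp
  then have "cos (\<theta> 2) = 0" using a by simp
  then show "\<theta> 2 = pi / 2" using cos_inj_pi[of "\<theta> 2" "pi / 2"] l by simp
  have "\<theta> 3 - \<theta> 1 = pi / 2" using cos_inj_pi[of "\<theta> 3 - \<theta> 1" "pi / 2"] l c0 by simp
  then show "\<theta> 3 = \<theta> 1 + pi / 2" by simp
qed

lemma wedge_span: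
  assumes "wedge x y" "P \<in> planes S" "x \<in> P" "y \<in> P"
  shows "span {x, y} = P"
  using plane_eq_span[OF assms(2), of x y] assms by (auto simp: wedge_def)

lemma finite_wedges: "finite {(x, y). wedge x y}"
  by (rule finite_subset[of _ "S \<times> S"]) (auto simp: wedge_def finite_S)

lemma sum_wedges_planes:
  fixes F :: "(real^3) \<times> (real^3) \<Rightarrow> real"
  shows "sum F {(x, y). wedge x y} = (\<Sum>P\<in>planes S. sum F {(x, y). wedge x y \<and> x \<in> P \<and> y \<in> P})"
proof -
  have eq: "{(x, y). wedge x y} = (\<Union>P\<in>planes S. {(x, y). wedge x y \<and> x \<in> P \<and> y \<in> P})"
  proof (intro equalityI subsetI)
    fix q assume "q \<in> {(x, y). wedge x y}"
    then obtain x y where q: "q = (x, y)" "wedge x y" by blast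
    then have "span {x, y} \<in> planes S" using planesI by (auto simp: wedge_def)
    moreover have "x \<in> span {x, y}" "y \<in> span {x, y}" by (auto intro: span_base)
    ultimately show "q \<in> (\<Union>P\<in>planes S. {(x, y). wedge x y \<and> x \<in> P \<and> y \<in> P})" using q by blast
  qed auto
  show ?thesis
    unfolding eq
  proof (rule sum.UNION_disjoint[OF finite_planes])
    show "\<forall>P\<in>planes S. finite {(x, y). wedge x y \<and> x \<in> P \<and> y \<in> P}"
      using finite_wedges by (auto intro: finite_subset[rotated])
    show "\<forall>P\<in>planes S. \<forall>Q\<in>planes S. P \<noteq> Q \<longrightarrow>
       {(x, y). wedge x y \<and> x \<in> P \<and> y \<in> P} \<inter> {(x, y). wedge x y \<and> x \<in> Q \<and> y \<in> Q} = {}"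
    proof (intro ballI impI equals0I)
      fix P Q q assume PQ: "P \<in> planes S" "Q \<in> planes S" "P \<noteq> Q"
        and "q \<in> {(x, y). wedge x y \<and> x \<in> P \<and> y \<in> P} \<inter> {(x, y). wedge x y \<and> x \<in> Q \<and> y \<in> Q}"
      then obtain x y where "wedge x y" "x \<in> P" "y \<in> P" "x \<in> Q" "y \<in> Q" by auto
      then have "span {x, y} = P" "span {x, y} = Q"
        using wedge_span[of x y P] wedge_span[of x y Q] PQ by blast+
      then show False using PQ(3) by simp
    qed
  qed
qed

end

section \<open>Angles of chambers against angles at points\<close>

context hirzebruch_system
begin

lemma ang_range:
  assumes w: "wedge a b"
  shows "0 < ang a b" "ang a b \<le> pi / 2" "ang a b = pi / 2 \<longleftrightarrow> a \<bullet> b = 0" "cos (ang a b) = - (a \<bullet> b)"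
proof -
  have ab: "a \<in> S" "b \<in> S" "b \<noteq> a" "b \<noteq> - a" using w by (auto simp: wedge_def)
  have d: "0 \<le> - (a \<bullet> b)" "- (a \<bullet> b) < 1" using wedge_obtuse(1)[OF w] abs_dot_less_1[OF ab] by simp_all
  have 1: "ang a b = pi / 2 \<longleftrightarrow> a \<bullet> b = 0"
    unfolding ang_def using arccos_eq_iff[of "- (a \<bullet> b)" 0] d by simp
  show "cos (ang a b) = - (a \<bullet> b)" unfolding ang_def using d by (intro cos_arccos) auto
  show "ang a b = pi / 2 \<longleftrightarrow> a \<bullet> b = 0" by (rule 1)
  show "0 < ang a b" unfolding ang_def using d arccos_less_mono[of 1 "- (a \<bullet> b)"] by simp
  show "ang a b \<le> pi / 2" unfolding ang_def using d arccos_le_pi2 by auto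
qed

text \<open>In a plane triangle with angles \<open>A\<close>, \<open>B\<close> and
  \<open>pi - (A + B)\<close>, the unit normals weighted by the side lengths \<open>sin A\<close>,
  \<open>sin B\<close>, \<open>sin (A + B)\<close> add up to zero. If the angle sum here were at
  most \<open>pi\<close>, the same combination of the walls would have nonpositive square and hence
  vanish, against independence.\<close>

lemma angle_sum:
  assumes s: "simple a b c"
  shows "ang a b + ang b c + ang c a > pi"
proof (rule ccontr)
  assume *: "\<not> ?thesis"
  have w: "wedge a b" "wedge b c" "wedge c a"
    using simple_wedge s simple_rotate by blast+
  define A B C where "A = ang b c" and "B = ang c a" and "C = ang a b"
  note r = ang_range[OF w(1), folded C_def] ang_range[OF w(2), folded A_def] ang_range[OF w(3), folded B_def]
  have dots: "a \<bullet> b = - cos C" "b \<bullet> c = - cos A" "c \<bullet> a = - cos B" using r by simp_all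
  have "cos (pi - (A + B)) \<le> cos C"
    using * r by (intro cos_monotone_0_pi_le) (auto simp: A_def B_def C_def)
  then have C: "a \<bullet> b \<le> cos (A + B)" using dots(1) by simp
  have sA: "sin A > 0" "sin B > 0" using r pi_gt_zero by (auto intro!: sin_gt_zero)
  let ?x = "sin A *\<^sub>R a + sin B *\<^sub>R b + sin (A + B) *\<^sub>R c"
  have self: "a \<bullet> a = 1" "b \<bullet> b = 1" "c \<bullet> c = 1" using dot_self simple_mem[OF s] by blast+
  have "?x \<bullet> ?x = (sin A)\<^sup>2 + (sin B)\<^sup>2 + (sin (A + B))\<^sup>2 + 2 * (sin A * sin B) * (a \<bullet> b)
      + 2 * (sin B * sin (A + B)) * (b \<bullet> c) + 2 * (sin A * sin (A + B)) * (c \<bullet> a)"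
    unfolding inner_left_distrib inner_right_distrib inner_scaleR_left inner_scaleR_right self
      inner_commute[of b a] inner_commute[of a c] inner_commute[of c b]
    by (simp add: power2_eq_square algebra_simps)
  also have "\<dots> \<le> (sin A)\<^sup>2 + (sin B)\<^sup>2 + (sin (A + B))\<^sup>2 + 2 * (sin A * sin B) * cos (A + B)
      + 2 * (sin B * sin (A + B)) * (b \<bullet> c) + 2 * (sin A * sin (A + B)) * (c \<bullet> a)"
    using mult_left_mono[OF C, of "2 * (sin A * sin B)"] sA by simp
  also have "\<dots> = 0"
  proof -
    define p q u v where "p = sin A" and "q = sin B" and "u = cos A" and "v = cos B"
    have u: "u * u = 1 - p * p" "v * v = 1 - q * q"
      unfolding p_def q_def u_def v_def using sin_cos_squared_add[of A] sin_cos_squared_add[of B] by (simp_all add: power2_eq_square)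
    have "p\<^sup>2 + q\<^sup>2 + (p * v + u * q)\<^sup>2 + 2 * (p * q) * (u * v - p * q) + 2 * (q * (p * v + u * q)) * (- u)
       + 2 * (p * (p * v + u * q)) * (- v) = p * p * (1 - v * v) + q * q * (1 - u * u) - 2 * (p * p) * (q * q)"
      by (simp add: power2_eq_square algebra_simps)
    also have "\<dots> = 0" unfolding u by (simp add: algebra_simps)
    finally show ?thesis unfolding dots sin_add cos_add p_def q_def u_def v_def .
  qed
  finally have "?x = 0" using inner_ge_zero[of ?x] inner_eq_zero_iff[of ?x] by linarith
  then have "sin A = 0" using s unfolding simple_def by blast
  then show False using sA by simp
qed

lemma simple_weight:
  assumes s: "simple a b c"
  shows "0 \<le> weight (ang a b) + weight (ang b c) + weight (ang c a)"
    and "weight (ang a b) + weight (ang b c) + weight (ang c a) = 0 \<Longrightarrow> a \<bullet> b = 0 \<or> b \<bullet> c = 0 \<or> c \<bullet> a = 0"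
proof -
  have s': "simple b c a" "simple c a b" using s simple_rotate by blast+
  have w: "wedge a b" "wedge b c" "wedge c a" using simple_wedge s s' by blast+
  note r = ang_range[OF w(1)] ang_range[OF w(2)] ang_range[OF w(3)]
  have n: "\<not> (ang a b = pi / 2 \<and> ang b c = pi / 2)" "\<not> (ang b c = pi / 2 \<and> ang c a = pi / 2)" "\<not> (ang c a = pi / 2 \<and> ang a b = pi / 2)"
    using not_two_right_angles[OF s] not_two_right_angles[OF s'(1)] not_two_right_angles[OF s'(2)] r
    by (auto simp: inner_commute)
  note t = weight_triangle[OF r(1,2) r(5,6) r(9,10) angle_sum[OF s] n]
  show "0 \<le> weight (ang a b) + weight (ang b c) + weight (ang c a)" by (rule t(1))
  show "a \<bullet> b = 0 \<or> b \<bullet> c = 0 \<or> c \<bullet> a = 0" if "weight (ang a b) + weight (ang b c) + weight (ang c a) = 0"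
    using t(2)[OF that] r by blast
qed

lemma finite_simple: "finite {((a, b), c). simple a b c}"
  by (rule finite_subset[of _ "(S \<times> S) \<times> S"]) (auto simp: simple_def finite_S)

lemma sum_simple_wedges:
  fixes F :: "(real^3) \<times> (real^3) \<Rightarrow> real"
  shows "(\<Sum>((a, b), c) \<in> {((a, b), c). simple a b c}. F (a, b)) = 2 * sum F {(a, b). wedge a b}"
proof -
  have eq: "{((a, b), c). simple a b c} = (SIGMA q:{(a, b). wedge a b}. {c. simple (fst q) (snd q) c})"
    using simple_wedge by auto
  have fin: "\<forall>q\<in>{(a, b). wedge a b}. finite {c. simple (fst q) (snd q) c}"
    by (auto intro!: finite_subset[OF _ finite_S] simp: simple_def)
  have "(\<Sum>((a, b), c) \<in> {((a, b), c). simple a b c}. F (a, b)) = (\<Sum>(q, c) \<in> {((a, b), c). simple a b c}. F q)"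
    by (intro sum.cong) auto
  also have "\<dots> = (\<Sum>q\<in>{(a, b). wedge a b}. \<Sum>c\<in>{c. simple (fst q) (snd q) c}. F q)"
    unfolding eq by (rule sum.Sigma[OF finite_wedges fin, symmetric])
  also have "\<dots> = (\<Sum>q\<in>{(a, b). wedge a b}. 2 * F q)"
    using wedge_two_simple by (intro sum.cong) auto
  finally show ?thesis by (simp add: sum_distrib_left)
qed

lemma sum_simple_rotate:
  fixes F :: "(real^3) \<Rightarrow> (real^3) \<Rightarrow> real"
  shows "(\<Sum>((a, b), c) \<in> {((a, b), c). simple a b c}. F b c) = (\<Sum>((a, b), c) \<in> {((a, b), c). simple a b c}. F a b)"
  by (rule sum.reindex_bij_witness[of _ "\<lambda>((a, b), c). ((c, a), b)" "\<lambda>((a, b), c). ((b, c), a)"])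
    (auto intro: simple_rotate)

text \<open>An ordered triple shows three corners, and each wedge is a corner of two chambers, at
  opposite vertices: hence the factor 6.\<close>

lemma sum_simple_angles:
  fixes f :: "real \<Rightarrow> real"
  shows "(\<Sum>((a, b), c) \<in> {((a, b), c). simple a b c}. f (ang a b) + f (ang b c) + f (ang c a))
    = 6 * (\<Sum>P\<in>planes S. \<Sum>(x, y)\<in>{(x, y). wedge x y \<and> x \<in> P \<and> y \<in> P}. f (ang x y))"
proof -
  let ?T = "{((a, b), c). simple a b c}"
  have 1: "(\<Sum>((a, b), c)\<in>?T. f (ang a b)) = 2 * (\<Sum>P\<in>planes S. \<Sum>(x, y)\<in>{(x, y). wedge x y \<and> x \<in> P \<and> y \<in> P}. f (ang x y))"
    using sum_simple_wedges[of "\<lambda>(a, b). f (ang a b)"] sum_wedges_planes[of "\<lambda>(a, b). f (ang a b)"] by simp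
  have 2: "(\<Sum>((a, b), c)\<in>?T. f (ang b c)) = (\<Sum>((a, b), c)\<in>?T. f (ang a b))"
    by (rule sum_simple_rotate)
  have 3: "(\<Sum>((a, b), c)\<in>?T. f (ang c a)) = (\<Sum>((a, b), c)\<in>?T. f (ang b c))"
    by (rule sum.reindex_bij_witness[of _ "\<lambda>((a, b), c). ((c, a), b)" "\<lambda>((a, b), c). ((b, c), a)"])
      (auto intro: simple_rotate)
  have "(\<Sum>((a, b), c) \<in> ?T. f (ang a b) + f (ang b c) + f (ang c a))
    = (\<Sum>((a, b), c)\<in>?T. f (ang a b)) + (\<Sum>((a, b), c)\<in>?T. f (ang b c)) + (\<Sum>((a, b), c)\<in>?T. f (ang c a))"
    by (simp add: sum.distrib[symmetric] case_prod_unfold)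
  then show ?thesis using 1 2 3 by simp
qed

lemma wedge_in_plane:
  assumes P: "P \<in> planes S" and w: "wedge x y" "x \<in> P" "y \<in> P"
  shows "card (S \<inter> P) = 4 \<longleftrightarrow> ang x y = pi / 2" "card (S \<inter> P) = 6 \<Longrightarrow> ang x y = pi / 3"
proof -
  have sp: "span {x, y} = P" using wedge_span[OF w(1) P w(2,3)] .
  show "card (S \<inter> P) = 4 \<longleftrightarrow> ang x y = pi / 2"
    using wedge_obtuse(2)[OF w(1)] ang_range(3)[OF w(1)] sp by simp
  assume c: "card (S \<inter> P) = 6"
  have "(x \<bullet> y)\<^sup>2 = 1 / 4" using card6_dot[OF P c, of x y] w by (auto simp: wedge_def)
  then have "(- (x \<bullet> y))\<^sup>2 = (1 / 2)\<^sup>2" by (simp add: power2_eq_square)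
  then have "- (x \<bullet> y) = 1 / 2" using wedge_obtuse(1)[OF w(1)] by (subst (asm) power2_eq_iff_nonneg) auto
  moreover have "arccos (1 / 2) = pi / 3" using arccos_cos[of "pi / 3"] by (simp add: cos_60)
  ultimately show "ang x y = pi / 3" unfolding ang_def by (simp only:)
qed

text \<open>Four lines in a tight frame need not be at equal angles, but their gaps are
  \<open>t\<close>, \<open>pi / 2 - t\<close>, \<open>t\<close>, \<open>pi / 2 - t\<close>, and each
  complementary pair has nonpositive weight.\<close>

lemma sum_weight_8:
  assumes P: "P \<in> planes S" "card (S \<inter> P) = 8"
  shows "(\<Sum>(x, y)\<in>{(x, y). wedge x y \<and> x \<in> P \<and> y \<in> P}. real_of_int (weight (ang x y))) \<le> 0"
proof -
  obtain a e \<theta> r where en': "enumerates P a e \<theta> r" using enumeration_exists[OF P(1)] .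
  have r: "r = 4" using enum_basic(5)[OF en'] P(2) by simp
  have en: "enumerates P a e \<theta> 4" using en' r by simp
  note b = enum_basic[OF en]
  have aP: "a \<in> P" "e \<in> P" using en unfolding enumerates_def by blast+
  have self: "a \<bullet> a = 1" "e \<bullet> e = 1" "e \<bullet> a = 0" using b by (simp_all add: norm_eq_1 inner_commute)
  have za: "circ a e t \<bullet> a = cos t" "circ a e t \<bullet> e = sin t" for t
    using self b(4) by (simp_all add: circ_def inner_left_distrib)
  have lt: "{..<4} = {0, 1, 2, 3::nat}" by auto
  have "(\<Sum>x\<in>S \<inter> P. (x \<bullet> a) * (x \<bullet> a)) = 4" using local_frame[OF P(1) aP(1,1)] P(2) self by simp
  then have c: "(cos (\<theta> 0))\<^sup>2 + (cos (\<theta> 1))\<^sup>2 + (cos (\<theta> 2))\<^sup>2 + (cos (\<theta> 3))\<^sup>2 = 2"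
    unfolding sum_enumeration[OF en] by (simp add: lt za inner_minus_left power2_eq_square)
  have "(\<Sum>x\<in>S \<inter> P. (x \<bullet> a) * (x \<bullet> e)) = 0" using local_frame[OF P(1) aP] b(4) by simp
  then have s: "cos (\<theta> 0) * sin (\<theta> 0) + cos (\<theta> 1) * sin (\<theta> 1) + cos (\<theta> 2) * sin (\<theta> 2) + cos (\<theta> 3) * sin (\<theta> 3) = 0"
    unfolding sum_enumeration[OF en] by (simp add: lt za inner_minus_left)
  have "1 + cos (2 * \<theta> 1) + cos (2 * \<theta> 2) + cos (2 * \<theta> 3) = 0"
    using c b(7) by (simp add: cos_double_cos)
  moreover have "sin (2 * \<theta> 1) + sin (2 * \<theta> 2) + sin (2 * \<theta> 3) = 0"
  proof -
    have "sin (2 * \<theta> 1) + sin (2 * \<theta> 2) + sin (2 * \<theta> 3) = 2 * (cos (\<theta> 0) * sin (\<theta> 0) + cos (\<theta> 1) * sin (\<theta> 1)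
      + cos (\<theta> 2) * sin (\<theta> 2) + cos (\<theta> 3) * sin (\<theta> 3))"
      using b(7) by (simp add: sin_double)
    then show ?thesis using s by simp
  qed
  ultimately have t: "\<theta> 2 = pi / 2" "\<theta> 3 = \<theta> 1 + pi / 2" by (rule fourth_gaps[OF en])+
  have l: "0 < \<theta> 1" "\<theta> 1 < \<theta> 2" using \<theta>_less[OF en, of 0 1] \<theta>_less[OF en, of 1 2] b(7) by simp_all
  have "weight (\<theta> 1) + weight (pi / 2 - \<theta> 1) \<le> 0" using weight_complement l t by simp
  then have "real_of_int (weight (\<theta> 1)) + real_of_int (weight (pi / 2 - \<theta> 1)) \<le> 0" by linarith
  moreover have "(\<Sum>i<4. real_of_int (weight (\<theta> (Suc i) - \<theta> i))) = 2 * (real_of_int (weight (\<theta> 1)) + real_of_int (weight (pi / 2 - \<theta> 1)))"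
  proof -
    have "\<theta> 4 = pi" "\<theta> 0 = 0" using b by simp_all
    moreover have "\<theta> (Suc 0) = \<theta> 1" "\<theta> (Suc 1) = \<theta> 2" "\<theta> (Suc 2) = \<theta> 3" "\<theta> (Suc 3) = \<theta> 4"
      by (simp_all add: numeral_2_eq_2 numeral_3_eq_3 eval_nat_numeral)
    ultimately have gaps: "\<theta> (Suc 0) - \<theta> 0 = \<theta> 1" "\<theta> (Suc 1) - \<theta> 1 = pi / 2 - \<theta> 1"
      "\<theta> (Suc 2) - \<theta> 2 = \<theta> 1" "\<theta> (Suc 3) - \<theta> 3 = pi / 2 - \<theta> 1"
      using t by linarith+
    have sum4: "(\<Sum>i<4. f i) = f 0 + f 1 + f 2 + f 3" for f :: "nat \<Rightarrow> real" unfolding lt by simp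
    show ?thesis unfolding sum4 gaps by simp
  qed
  ultimately show ?thesis
    using sum_wedges[OF en, of "\<lambda>s. real_of_int (weight s)"] by simp
qed

text \<open>Two or three lines have gaps of weight zero, and four are treated by
  \<open>sum_weight_8\<close>. From five on, the integer total is less than \<open>6 - r\<close>,
  hence at most zero, and it can only be zero if \<open>r\<close> is 5.\<close>

lemma sum_weight:
  assumes P: "P \<in> planes S"
  shows "(\<Sum>(x, y)\<in>{(x, y). wedge x y \<and> x \<in> P \<and> y \<in> P}. real_of_int (weight (ang x y))) \<le> 0" (is "?D \<le> 0")
    and "(\<Sum>(x, y)\<in>{(x, y). wedge x y \<and> x \<in> P \<and> y \<in> P}. real_of_int (weight (ang x y))) = 0 \<Longrightarrow> card (S \<inter> P) \<le> 10"
proof -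
  obtain g :: "nat \<Rightarrow> real" and r where g: "card (S \<inter> P) = 2 * r" "r \<ge> 2" "\<forall>i<r. 0 < g i" "(\<Sum>i<r. g i) = pi"
    "\<forall>i<r. \<exists>x y. wedge x y \<and> x \<in> P \<and> y \<in> P \<and> ang x y = g i"
    "\<forall>f::real \<Rightarrow> real. (\<Sum>(x, y) \<in> {(x, y). wedge x y \<and> x \<in> P \<and> y \<in> P}. f (ang x y)) = 4 * (\<Sum>i<r. f (g i))"
    using plane_gaps[OF P] .
  have D: "?D = 4 * (\<Sum>i<r. real_of_int (weight (g i)))" using g(6)[rule_format, of "\<lambda>s. real_of_int (weight s)"] .
  have "(\<Sum>i<r. real_of_int (weight (g i)) + 1) < (\<Sum>i<r. 6 * g i / pi)"
  proof (rule sum_strict_mono)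
    show "{..<r} \<noteq> {}" using g(2) by (simp add: lessThan_empty_iff)
    show "real_of_int (weight (g i)) + 1 < 6 * g i / pi" if "i \<in> {..<r}" for i
      using weight_bound[of "g i"] g(3) that by auto
  qed simp
  also have "\<dots> = 6" using g(4) by (simp add: sum_divide_distrib[symmetric] sum_distrib_left[symmetric])
  finally have "real_of_int (\<Sum>i<r. weight (g i)) + real r < 6" by (simp add: sum.distrib)
  then have ub: "(\<Sum>i<r. weight (g i)) + int r < 6" by linarith
  have D': "?D = 4 * real_of_int (\<Sum>i<r. weight (g i))" using D by simp
  have z: "?D = 0" if "r = 2 \<or> r = 3"
  proof -
    have "weight (g i) = 0" if i: "i < r" for i
    proof -
      obtain x y where xy: "wedge x y" "x \<in> P" "y \<in> P" "ang x y = g i" using g(5) i by blast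
      have "g i = pi / 2 \<or> g i = pi / 3"
        using wedge_in_plane[OF P xy(1-3)] xy(4) g(1) \<open>r = 2 \<or> r = 3\<close> by auto
      moreover have "weight (pi / 2) = 0" "weight (pi / 3) = 0" by (simp_all add: weight_def)
      ultimately show ?thesis by metis
    qed
    then show ?thesis unfolding D' by simp
  qed
  show "?D \<le> 0"
  proof -
    consider "r = 2 \<or> r = 3" | "r = 4" | "r \<ge> 5" using g(2) by linarith
    then show ?thesis
    proof cases
      case 1 then show ?thesis using z by simp
    next
      case 2 then show ?thesis using sum_weight_8[OF P] g(1) by simp
    next
      case 3
      then have "(\<Sum>i<r. weight (g i)) \<le> 0" using ub by linarith
      then have "real_of_int (\<Sum>i<r. weight (g i)) \<le> 0" by (simp only: of_int_le_0_iff)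
      then show ?thesis unfolding D' by linarith
    qed
  qed
  assume "?D = 0"
  then have "real_of_int (\<Sum>i<r. weight (g i)) = 0" unfolding D' by linarith
  then have "(\<Sum>i<r. weight (g i)) = 0" by (simp only: of_int_eq_0_iff)
  then show "card (S \<inter> P) \<le> 10" using ub g(1) by linarith
qed

text \<open>The same total is nonnegative as a sum over chambers and nonpositive as a sum over
  planes; so every summand is zero, and the equality cases of both estimates apply.\<close>

lemma weight_equality:
  shows "P \<in> planes S \<Longrightarrow> card (S \<inter> P) \<le> 10"
    and "simple a b c \<Longrightarrow> a \<bullet> b = 0 \<or> b \<bullet> c = 0 \<or> c \<bullet> a = 0"
proof -
  let ?T = "{((a, b), c). simple a b c}"
  let ?W = "\<lambda>((a, b), c). real_of_int (weight (ang a b)) + real_of_int (weight (ang b c)) + real_of_int (weight (ang c a))"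
  let ?D = "\<lambda>P. \<Sum>(x, y)\<in>{(x, y). wedge x y \<and> x \<in> P \<and> y \<in> P}. real_of_int (weight (ang x y))"
  have eq: "sum ?W ?T = 6 * (\<Sum>P\<in>planes S. ?D P)"
    using sum_simple_angles[of "\<lambda>s. real_of_int (weight s)"] .
  have nn: "?W q \<ge> 0" if "q \<in> ?T" for q
  proof -
    obtain a b c where q: "q = ((a, b), c)" "simple a b c" using \<open>q \<in> ?T\<close> by blast
    have "0 \<le> real_of_int (weight (ang a b) + weight (ang b c) + weight (ang c a))"
      using simple_weight(1)[OF q(2)] by (simp only: of_int_0_le_iff)
    then show ?thesis using q(1) by simp
  qed
  have "(\<Sum>P\<in>planes S. ?D P) \<le> 0" by (rule sum_nonpos, rule sum_weight(1))
  moreover have "sum ?W ?T \<ge> 0" using nn by (intro sum_nonneg)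
  ultimately have z: "sum ?W ?T = 0" "(\<Sum>P\<in>planes S. - ?D P) = 0" using eq by (simp_all add: sum_negf)
  have "?W q = 0" if "q \<in> ?T" for q
    using z(1) sum_nonneg_eq_0_iff[OF finite_simple, of ?W] nn that by blast
  note W0 = this
  have "- ?D P = 0" if "P \<in> planes S" for P
    using sum_nonneg_eq_0_iff[OF finite_planes, of "\<lambda>P. - ?D P"] z(2) that sum_weight(1) by (simp add: sum_negf)
  then show "P \<in> planes S \<Longrightarrow> card (S \<inter> P) \<le> 10" using sum_weight(2) by simp
  assume s: "simple a b c"
  have "real_of_int (weight (ang a b) + weight (ang b c) + weight (ang c a)) = 0" using W0[of "((a, b), c)"] s by simp
  then show "a \<bullet> b = 0 \<or> b \<bullet> c = 0 \<or> c \<bullet> a = 0" using simple_weight(2)[OF s] by (simp only: of_int_eq_0_iff)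
qed

lemma plane_card_cases:
  assumes "P \<in> planes S" shows "card (S \<inter> P) \<in> {4, 6, 8, 10}"
proof -
  obtain a e \<theta> r where en: "enumerates P a e \<theta> r" using enumeration_exists[OF assms] .
  have "card (S \<inter> P) = 2 * r" "r \<ge> 2" using enum_basic[OF en] by blast+
  moreover have "card (S \<inter> P) \<le> 10" using weight_equality(1)[OF assms] .
  ultimately have "r = 2 \<or> r = 3 \<or> r = 4 \<or> r = 5" by linarith
  then show ?thesis using \<open>card (S \<inter> P) = 2 * r\<close> by auto
qed

section \<open>Numbers of points of each multiplicity\<close>

definition count :: "nat \<Rightarrow> nat" where
  "count k = card {P \<in> planes S. card (S \<inter> P) = 2 * k}"

lemma sum_by_card:
  fixes h :: "nat \<Rightarrow> real"
  shows "(\<Sum>P\<in>planes S. h (card (S \<inter> P))) = count 2 * h 4 + count 3 * h 6 + count 4 * h 8 + count 5 * h 10"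
proof -
  have "(\<Sum>P\<in>planes S. h (card (S \<inter> P))) = (\<Sum>k\<in>{4, 6, 8, 10}. \<Sum>P\<in>{P \<in> planes S. card (S \<inter> P) = k}. h (card (S \<inter> P)))"
    using plane_card_cases by (intro sum.group[symmetric] finite_planes) auto
  also have "\<dots> = (\<Sum>k\<in>{4, 6, 8, 10}. real (card {P \<in> planes S. card (S \<inter> P) = k}) * h k)"
    by (intro sum.cong refl) simp
  finally show ?thesis by (simp add: count_def)
qed

lemma sum_wedges_at:
  assumes "P \<in> planes S"
  shows "(\<Sum>(x, y)\<in>{(x, y). wedge x y \<and> x \<in> P \<and> y \<in> P}. 1) = 2 * real (card (S \<inter> P))"
    and "(\<Sum>(x, y)\<in>{(x, y). wedge x y \<and> x \<in> P \<and> y \<in> P}. ang x y) = 4 * pi"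
    and "(\<Sum>(x, y)\<in>{(x, y). wedge x y \<and> x \<in> P \<and> y \<in> P}. if ang x y = pi / 2 then 1 else 0)
      = (if card (S \<inter> P) = 4 then 8 else 0 :: real)"
proof -
  obtain g :: "nat \<Rightarrow> real" and r where g: "card (S \<inter> P) = 2 * r" "r \<ge> 2" "\<forall>i<r. 0 < g i" "(\<Sum>i<r. g i) = pi"
    "\<forall>i<r. \<exists>x y. wedge x y \<and> x \<in> P \<and> y \<in> P \<and> ang x y = g i"
    "\<forall>f::real \<Rightarrow> real. (\<Sum>(x, y) \<in> {(x, y). wedge x y \<and> x \<in> P \<and> y \<in> P}. f (ang x y)) = 4 * (\<Sum>i<r. f (g i))"
    using plane_gaps[OF assms] .
  show 1: "(\<Sum>(x, y)\<in>{(x, y). wedge x y \<and> x \<in> P \<and> y \<in> P}. 1) = 2 * real (card (S \<inter> P))"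
    using g(6)[rule_format, of "\<lambda>_. 1"] g(1) by simp
  show "(\<Sum>(x, y)\<in>{(x, y). wedge x y \<and> x \<in> P \<and> y \<in> P}. ang x y) = 4 * pi"
    using g(6)[rule_format, of "\<lambda>s. s"] g(4) by simp
  have "(\<Sum>(x, y)\<in>{(x, y). wedge x y \<and> x \<in> P \<and> y \<in> P}. if ang x y = pi / 2 then 1 else (0 :: real))
    = (\<Sum>(x, y)\<in>{(x, y). wedge x y \<and> x \<in> P \<and> y \<in> P}. if card (S \<inter> P) = 4 then 1 else (0 :: real))"
  proof (rule sum.cong[OF refl])
    fix q assume "q \<in> {(x, y). wedge x y \<and> x \<in> P \<and> y \<in> P}"
    then obtain x y where q: "q = (x, y)" "wedge x y" "x \<in> P" "y \<in> P" by blast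
    then show "(case q of (x, y) \<Rightarrow> if ang x y = pi / 2 then 1 else (0 :: real))
      = (case q of (x, y) \<Rightarrow> if card (S \<inter> P) = 4 then 1 else (0 :: real))"
      using wedge_in_plane(1)[OF assms q(2-4)] by simp
  qed
  then show "(\<Sum>(x, y)\<in>{(x, y). wedge x y \<and> x \<in> P \<and> y \<in> P}. if ang x y = pi / 2 then 1 else 0)
      = (if card (S \<inter> P) = 4 then 8 else 0 :: real)"
    using 1 by (cases "card (S \<inter> P) = 4") (simp_all add: case_prod_unfold)
qed

lemma card_simple: "real (card {((a, b), c). simple a b c}) = 24 * real n * (real n + 1)"
proof -
  have "3 * real (card {((a, b), c). simple a b c}) = (\<Sum>((a, b), c) \<in> {((a, b), c). simple a b c}. 1 + 1 + 1)"
    by (simp add: case_prod_unfold)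
  also have "\<dots> = 6 * (\<Sum>P\<in>planes S. 2 * real (card (S \<inter> P)))"
    using sum_simple_angles[of "\<lambda>_. 1"] sum_wedges_at(1) by simp
  also have "\<dots> = 72 * real n * (real n + 1)" using sum_card by (simp add: sum_distrib_left[symmetric])
  finally show ?thesis by simp
qed

lemma one_right_angle:
  assumes s: "simple a b c"
  shows "(if ang a b = pi / 2 then 1 else 0) + (if ang b c = pi / 2 then 1 else 0) + (if ang c a = pi / 2 then 1 else 0) = (1::real)"
proof -
  have s': "simple b c a" "simple c a b" using s simple_rotate by blast+
  have w: "wedge a b" "wedge b c" "wedge c a" using simple_wedge s s' by blast+
  have "a \<bullet> b = 0 \<or> b \<bullet> c = 0 \<or> c \<bullet> a = 0" using weight_equality(2)[OF s] .
  then show ?thesis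
    using not_two_right_angles[OF s] not_two_right_angles[OF s'(1)] not_two_right_angles[OF s'(2)]
    unfolding ang_range(3)[OF w(1)] ang_range(3)[OF w(2)] ang_range(3)[OF w(3)]
    by (auto simp: inner_commute)
qed

text \<open>The first and the last relation come from \<open>sum_simple_angles\<close>: the
  indicator of a right angle counts the double points, since every chamber has exactly one right
  angle, and the angle itself turns the excess of the chambers into a strict bound. The other two
  are the double counts of \<open>S\<close>.\<close>

lemma counts:
  shows "2 * count 2 = n * (n + 1)"
    and "2 * count 2 + 3 * count 3 + 4 * count 4 + 5 * count 5 = 3 * n * (n + 1)"
    and "4 * count 2 + 9 * count 3 + 16 * count 4 + 25 * count 5 = 12 * n * n"
    and "n * (n + 1) < count 2 + count 3 + count 4 + count 5"
proof -
  let ?T = "{((a, b), c). simple a b c}"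
  have "real (card ?T) = (\<Sum>((a, b), c) \<in> ?T. (if ang a b = pi / 2 then 1 else 0) + (if ang b c = pi / 2 then 1 else 0) + (if ang c a = pi / 2 then 1 else 0))"
    using one_right_angle by (subst card_eq_sum, subst of_nat_sum) (intro sum.cong; auto)
  also have "\<dots> = 6 * (\<Sum>P\<in>planes S. if card (S \<inter> P) = 4 then 8 else 0)"
    using sum_simple_angles[of "\<lambda>s. if s = pi / 2 then 1 else 0"] sum_wedges_at(3) by simp
  also have "\<dots> = 48 * real (count 2)" using sum_by_card[of "\<lambda>k. if k = 4 then 8 else 0"] by simp
  finally have "real (2 * count 2) = real (n * (n + 1))" unfolding card_simple by (simp add: algebra_simps)
  then show "2 * count 2 = n * (n + 1)" by (simp only: of_nat_eq_iff)
  have "real (2 * count 2 + 3 * count 3 + 4 * count 4 + 5 * count 5) = real (3 * n * (n + 1))"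
    using sum_card sum_by_card[of real] by (simp add: algebra_simps)
  then show "2 * count 2 + 3 * count 3 + 4 * count 4 + 5 * count 5 = 3 * n * (n + 1)" by (simp only: of_nat_eq_iff)
  have "real (4 * count 2 + 9 * count 3 + 16 * count 4 + 25 * count 5) = real (12 * n * n)"
    using sum_card_squared sum_by_card[of "\<lambda>k. (real k)\<^sup>2"] by (simp add: power2_eq_square)
  then show "4 * count 2 + 9 * count 3 + 16 * count 4 + 25 * count 5 = 12 * n * n" by (simp only: of_nat_eq_iff)
  have ne: "?T \<noteq> {}"
  proof
    assume "?T = {}"
    then have "card ?T = 0" by (simp only: card.empty)
    then have "24 * real n * (real n + 1) = 0" using card_simple by (simp only: of_nat_0)
    then show False using n_ge_2 by (simp add: add_nonneg_eq_0_iff)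
  qed
  have "(\<Sum>((a, b), c) \<in> ?T. pi) < (\<Sum>((a, b), c) \<in> ?T. ang a b + ang b c + ang c a)"
    using ne finite_simple angle_sum by (intro sum_strict_mono) auto
  then have "real (card ?T) * pi < (\<Sum>((a, b), c) \<in> ?T. ang a b + ang b c + ang c a)" by (simp add: case_prod_unfold)
  also have "\<dots> = 6 * (\<Sum>P\<in>planes S. 4 * pi)"
    using sum_simple_angles[of "\<lambda>s. s"] sum_wedges_at(2) by simp
  finally have "real (card ?T) < 24 * real (card (planes S))" by (simp add: mult.commute)
  then have "real (n * (n + 1)) < real (card (planes S))" unfolding card_simple by (simp add: algebra_simps)
  also have "\<dots> = real (count 2 + count 3 + count 4 + count 5)" using sum_by_card[of "\<lambda>_. 1"] by simp
  finally show "n * (n + 1) < count 2 + count 3 + count 4 + count 5" by (simp only: of_nat_less_iff)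
qed

theorem count_cases:
  "n = 2 \<and> count 2 = 3 \<and> count 3 = 4 \<and> count 4 = 0 \<and> count 5 = 0 \<or>
   n = 3 \<and> count 2 = 6 \<and> count 3 = 4 \<and> count 4 = 3 \<and> count 5 = 0 \<or>
   n = 4 \<and> count 2 = 10 \<and> count 3 = 6 \<and> count 4 = 3 \<and> count 5 = 2 \<or>
   n = 5 \<and> count 2 = 15 \<and> count 3 = 10 \<and> count 4 = 0 \<and> count 5 = 6"
proof -
  define p q u v where "p = int (count 2)" and "q = int (count 3)" and "u = int (count 4)" and "v = int (count 5)"
  define m where "m = int n"
  have nn: "p \<ge> 0" "q \<ge> 0" "u \<ge> 0" "v \<ge> 0" by (simp_all add: p_def q_def u_def v_def)
  have e: "2 * p = m * m + m" "2 * p + 3 * q + 4 * u + 5 * v = 3 * (m * m) + 3 * m"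
    "4 * p + 9 * q + 16 * u + 25 * v = 12 * (m * m)" "m * m + m < p + q + u + v"
    using counts(1-3)[THEN arg_cong[of _ _ int]] counts(4)[folded of_nat_less_iff[where 'a = int]]
    unfolding p_def q_def u_def v_def m_def by (simp_all add: algebra_simps)
  have m2: "m \<ge> 2" using n_ge_2 by (simp add: m_def)
  \<comment> \<open>Add up \<open>(k - 3) * (k - 5)\<close> over all points of multiplicity
    \<open>k\<close>. This vanishes for 3 and 5 and is negative for 4, while the number of double
    points is known.\<close>
  have "3 * (m * m) - 21 * m + 30 \<le> 0" using e nn by linarith
  then have "(m - 2) * (m - 5) \<le> 0" by (simp add: algebra_simps)
  then have "m \<le> 5" using m2 by (cases "m > 5") (auto simp: mult_le_0_iff)
  then consider "m = 2" | "m = 3" | "m = 4" | "m = 5" using m2 by linarith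
  then show ?thesis
  proof cases
    case 1
    have "2 * p = 6" "2 * p + 3 * q + 4 * u + 5 * v = 18" "4 * p + 9 * q + 16 * u + 25 * v = 48" "6 < p + q + u + v"
      using e unfolding 1 by simp_all
    then have "p = 3 \<and> q = 4 \<and> u = 0 \<and> v = 0" using nn by (intro conjI; linarith)
    then show ?thesis using 1 by (simp add: p_def q_def u_def v_def m_def)
  next
    case 2
    have "2 * p = 12" "2 * p + 3 * q + 4 * u + 5 * v = 36" "4 * p + 9 * q + 16 * u + 25 * v = 108" "12 < p + q + u + v"
      using e unfolding 2 by simp_all
    moreover from this have "2 * u + 5 * v = 6" "0 \<le> v" "v \<le> 1" using nn by linarith+
    then have "v = 0" by presburger
    ultimately have "p = 6 \<and> q = 4 \<and> u = 3 \<and> v = 0" by (intro conjI; linarith)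
    then show ?thesis using 2 by (simp add: p_def q_def u_def v_def m_def)
  next
    case 3
    have "2 * p = 20" "2 * p + 3 * q + 4 * u + 5 * v = 60" "4 * p + 9 * q + 16 * u + 25 * v = 192" "20 < p + q + u + v"
      using e unfolding 3 by simp_all
    moreover from this have "2 * u + 5 * v = 16" "2 \<le> v" "v \<le> 3" using nn by linarith+
    then have "v = 2" by presburger
    ultimately have "p = 10 \<and> q = 6 \<and> u = 3 \<and> v = 2" by (intro conjI; linarith)
    then show ?thesis using 3 by (simp add: p_def q_def u_def v_def m_def)
  next
    case 4
    have "2 * p = 30" "2 * p + 3 * q + 4 * u + 5 * v = 90" "4 * p + 9 * q + 16 * u + 25 * v = 300" "30 < p + q + u + v"
      using e unfolding 4 by simp_all
    then have "p = 15 \<and> q = 10 \<and> u = 0 \<and> v = 6" using nn by (intro conjI; linarith)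
    then show ?thesis using 4 by (simp add: p_def q_def u_def v_def m_def)
  qed
qed

end

section \<open>Root systems of rank three\<close>

definition golden :: real where "golden = (1 + sqrt 5) / 2"

lemma golden_square: "golden * golden = golden + 1"
  by (simp add: golden_def field_simps)

lemma golden_gt_1: "golden > 1"
  by (simp add: golden_def real_less_rsqrt)

definition comb :: "real^3 \<Rightarrow> real^3 \<Rightarrow> real^3 \<Rightarrow> real \<times> real \<times> real \<Rightarrow> real^3" where
  "comb e1 e2 e3 = (\<lambda>(p, q, r). p *\<^sub>R e1 + q *\<^sub>R e2 + r *\<^sub>R e3)"

definition orthonormal :: "real^3 \<Rightarrow> real^3 \<Rightarrow> real^3 \<Rightarrow> bool" where
  "orthonormal e1 e2 e3 \<longleftrightarrow> e1 \<bullet> e1 = 1 \<and> e2 \<bullet> e2 = 1 \<and> e3 \<bullet> e3 = 1 \<and>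
     e1 \<bullet> e2 = 0 \<and> e1 \<bullet> e3 = 0 \<and> e2 \<bullet> e3 = 0"

text \<open>Coordinates in an orthonormal frame of the mirror normals, one for each mirror, of the groups of type
  \<open>A\<^sub>3\<close>, \<open>B\<^sub>3\<close>, \<open>H\<^sub>3\<close> for \<open>n = 2, 3, 5\<close>, and of type \<open>A\<^sub>1\<^sup>3\<close> for \<open>n = 1\<close>.\<close>

definition roots :: "nat \<Rightarrow> (real \<times> real \<times> real) set" where
  "roots n =
    (if n = 2 then {} else {(1, 0, 0), (0, 1, 0), (0, 0, 1)}) \<union>
    (if n = 2 \<or> n = 3 then {(1, 1, 0), (1, -1, 0), (1, 0, 1), (1, 0, -1), (0, 1, 1), (0, 1, -1)} else {}) \<union>
    (if n = 5 then
      (\<lambda>(s, t). (1, s * golden, t * (golden - 1))) ` ({1, -1} \<times> {1, -1}) \<union>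
      (\<lambda>(s, t). (t * (golden - 1), 1, s * golden)) ` ({1, -1} \<times> {1, -1}) \<union>
      (\<lambda>(s, t). (s * golden, t * (golden - 1), 1)) ` ({1, -1} \<times> {1, -1}) else {})"

text \<open>Scaling is included so that sets of normals of arbitrary length are covered; this serves
  both the normals of a given arrangement and the mirror normals of a Coxeter group.\<close>

definition reflection_closed :: "(real^3) set \<Rightarrow> bool" where
  "reflection_closed D \<longleftrightarrow> (\<forall>x\<in>D. \<forall>y\<in>D. reflection x y \<in> D) \<and> (\<forall>x\<in>D. \<forall>c. c \<noteq> 0 \<longrightarrow> c *\<^sub>R x \<in> D)"

section \<open>Generating the roots by reflections in simple ones\<close>

lemma comb_dot:
  assumes "orthonormal e1 e2 e3"
  shows "comb e1 e2 e3 (p, q, r) \<bullet> comb e1 e2 e3 (p', q', r') = p * p' + q * q' + r * r'"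
proof -
  have "e1 \<bullet> e1 = 1" "e2 \<bullet> e2 = 1" "e3 \<bullet> e3 = 1" "e1 \<bullet> e2 = 0" "e1 \<bullet> e3 = 0" "e2 \<bullet> e3 = 0"
    "e2 \<bullet> e1 = 0" "e3 \<bullet> e1 = 0" "e3 \<bullet> e2 = 0"
    using assms by (simp_all add: orthonormal_def inner_commute)
  then show ?thesis by (simp add: comb_def inner_left_distrib inner_right_distrib)
qed

lemma comb_scale: "c *\<^sub>R comb e1 e2 e3 (p, q, r) = comb e1 e2 e3 (c * p, c * q, c * r)"
  by (simp add: comb_def scaleR_add_right)

text \<open>The coefficient enters as a parameter \<open>k\<close> that satisfies an equation, which
  keeps quotients out of the coordinates.\<close>

lemma comb_reflection:
  assumes "orthonormal e1 e2 e3" and k: "k * (p * p + q * q + r * r) = 2 * (p * p' + q * q' + r * r')"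
    and nz: "p * p + q * q + r * r \<noteq> 0"
  shows "reflection (comb e1 e2 e3 (p, q, r)) (comb e1 e2 e3 (p', q', r'))
     = comb e1 e2 e3 (p' - k * p, q' - k * q, r' - k * r)"
proof -
  have k': "2 * (p * p' + q * q' + r * r') / (p * p + q * q + r * r) = k"
    using k nz by (simp add: field_simps)
  show ?thesis unfolding reflection_def comb_dot[OF assms(1)] k'
    by (simp add: comb_def algebra_simps)
qed

lemma reflection_closed_comb:
  assumes D: "reflection_closed D" and on: "orthonormal e1 e2 e3"
    and "comb e1 e2 e3 (p, q, r) \<in> D" "comb e1 e2 e3 (p', q', r') \<in> D"
    and "k * (p * p + q * q + r * r) = 2 * (p * p' + q * q' + r * r')" "p * p + q * q + r * r \<noteq> 0"
    and "c \<noteq> 0" "x = c * (p' - k * p)" "y = c * (q' - k * q)" "z = c * (r' - k * r)"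
  shows "comb e1 e2 e3 (x, y, z) \<in> D"
proof -
  have "c *\<^sub>R reflection (comb e1 e2 e3 (p, q, r)) (comb e1 e2 e3 (p', q', r')) \<in> D"
    using D assms(3,4,7) unfolding reflection_closed_def by blast
  then show ?thesis unfolding comb_reflection[OF on assms(5,6)] comb_scale assms(8-10) .
qed

lemma closure_A3:
  assumes D: "reflection_closed D" and on: "orthonormal e1 e2 e3"
    and m: "comb e1 e2 e3 (1, -1, 0) \<in> D" "comb e1 e2 e3 (0, 1, -1) \<in> D" "comb e1 e2 e3 (0, 1, 1) \<in> D"
  shows "comb e1 e2 e3 ` roots 2 \<subseteq> D"
proof -
  note r = reflection_closed_comb[OF D on]
  have 1: "comb e1 e2 e3 (1, 0, -1) \<in> D"
    by (rule r[OF m(1) m(2), where k = "-1" and c = 1]) simp_all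
  have 2: "comb e1 e2 e3 (1, 0, 1) \<in> D"
    by (rule r[OF m(1) m(3), where k = "-1" and c = 1]) simp_all
  have 3: "comb e1 e2 e3 (1, 1, 0) \<in> D"
    by (rule r[OF m(2) 2, where k = "-1" and c = 1]) simp_all
  show ?thesis using m 1 2 3 by (auto simp: roots_def)
qed

lemma closure_B3:
  assumes D: "reflection_closed D" and on: "orthonormal e1 e2 e3"
    and m: "comb e1 e2 e3 (1, -1, 0) \<in> D" "comb e1 e2 e3 (0, 1, -1) \<in> D" "comb e1 e2 e3 (0, 0, 1) \<in> D"
  shows "comb e1 e2 e3 ` roots 3 \<subseteq> D"
proof -
  note r = reflection_closed_comb[OF D on]
  have 0: "comb e1 e2 e3 (0, 1, 1) \<in> D"
    by (rule r[OF m(3) m(2), where k = "-2" and c = 1]) simp_all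
  have 1: "comb e1 e2 e3 (0, 1, 0) \<in> D"
    by (rule r[OF m(2) m(3), where k = "-1" and c = 1]) simp_all
  have 2: "comb e1 e2 e3 (1, 0, 0) \<in> D"
    by (rule r[OF m(1) 1, where k = "-1" and c = 1]) simp_all
  show ?thesis using closure_A3[OF D on m(1,2) 0] m(3) 1 2 by (auto simp: roots_def)
qed

text \<open>The reflections in the first two axes, together with the factor -1, change any sign of a
  coordinate. One further reflection each then yields the two remaining cyclic families and the
  third axis.\<close>

lemma closure_H3:
  assumes D: "reflection_closed D" and on: "orthonormal e1 e2 e3"
    and m: "comb e1 e2 e3 (1, 0, 0) \<in> D" "comb e1 e2 e3 (0, 1, 0) \<in> D" "comb e1 e2 e3 (1, golden, golden - 1) \<in> D"
  shows "comb e1 e2 e3 ` roots 5 \<subseteq> D"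
proof -
  note r = reflection_closed_comb[OF D on]
  let ?f = golden and ?g = "golden - 1"
  have sq: "?f * ?f = ?f + 1" by (rule golden_square)
  then have fg: "?f * ?f = ?f + 1" "x * (?f * ?f) = x * ?f + x" for x :: real by (simp_all add: algebra_simps)
  have norm: "1 * 1 + ?f * ?f + ?g * ?g = 4" "?g * ?g + 1 * 1 + ?f * ?f = 4"
    "1 * 1 + ?f * ?f + (- ?g) * (- ?g) = 4" by (simp_all add: algebra_simps fg)
  have flip1: "comb e1 e2 e3 (- p, q, s) \<in> D" if "comb e1 e2 e3 (p, q, s) \<in> D" for p q s
    by (rule r[OF m(1) that, where k = "2 * p" and c = 1]) simp_all
  have flip2: "comb e1 e2 e3 (p, - q, s) \<in> D" if "comb e1 e2 e3 (p, q, s) \<in> D" for p q s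
    by (rule r[OF m(2) that, where k = "2 * q" and c = 1]) simp_all
  have minus: "comb e1 e2 e3 (- p, - q, - s) \<in> D" if "comb e1 e2 e3 (p, q, s) \<in> D" for p q s
  proof -
    have "(-1) *\<^sub>R comb e1 e2 e3 (p, q, s) \<in> D"
      using D that unfolding reflection_closed_def by (metis neg_equal_0_iff_equal zero_neq_one)
    then show ?thesis unfolding comb_scale by simp
  qed
  have flip3: "comb e1 e2 e3 (p, q, - s) \<in> D" if "comb e1 e2 e3 (p, q, s) \<in> D" for p q s
    using minus[OF flip1[OF flip2[OF that]]] by simp
  have signs: "comb e1 e2 e3 (a * p, b * q, c * s) \<in> D"
    if "comb e1 e2 e3 (p, q, s) \<in> D" "a \<in> {1, -1}" "b \<in> {1, -1}" "c \<in> {1, -1}" for p q s a b c :: real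
    using that flip1 flip2 flip3 by auto
  have v2: "comb e1 e2 e3 (-1, - ?f, ?g) \<in> D" using flip1[OF flip2[OF m(3)]] .
  have t2: "comb e1 e2 e3 (?g, 1, ?f) \<in> D"
    by (rule r[OF m(3) v2, where k = "- ?f" and c = 1]; simp add: norm; simp add: algebra_simps fg)
  have t3': "comb e1 e2 e3 (- ?f, ?g, 1) \<in> D"
    by (rule r[OF t2 m(1), where k = "?g / 2" and c = "-2"]; simp add: norm; simp add: algebra_simps fg; simp add: field_simps)
  then have t3: "comb e1 e2 e3 (?f, ?g, 1) \<in> D" using flip1[OF t3'] by simp
  have u: "comb e1 e2 e3 (- ?g, -1, ?f) \<in> D" using flip1[OF flip2[OF t2]] .
  have e3: "comb e1 e2 e3 (0, 0, 1) \<in> D"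
    by (rule r[OF m(3) u, where k = "- ?g" and c = "1 / 2"]; simp add: norm; simp add: algebra_simps fg)
  have 1: "comb e1 e2 e3 (1, s * ?f, t * ?g) \<in> D" if "s \<in> {1, -1}" "t \<in> {1, -1}" for s t
    using signs[OF m(3), of 1 s t] that by simp
  have 2: "comb e1 e2 e3 (t * ?g, 1, s * ?f) \<in> D" if "s \<in> {1, -1}" "t \<in> {1, -1}" for s t
    using signs[OF t2, of t 1 s] that by simp
  have 3: "comb e1 e2 e3 (s * ?f, t * ?g, 1) \<in> D" if "s \<in> {1, -1}" "t \<in> {1, -1}" for s t
    using signs[OF t3, of s t 1] that by simp
  show ?thesis
  proof
    fix x assume "x \<in> comb e1 e2 e3 ` roots 5"
    then obtain q where q: "q \<in> roots 5" "x = comb e1 e2 e3 q" by blast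
    have "(q = (1, 0, 0) \<or> q = (0, 1, 0) \<or> q = (0, 0, 1)) \<or>
      (\<exists>s\<in>{1, -1}. \<exists>t\<in>{1, -1}. q = (1, s * ?f, t * ?g) \<or> q = (t * ?g, 1, s * ?f) \<or> q = (s * ?f, t * ?g, 1))"
      using q(1) unfolding roots_def by auto
    then show "x \<in> D" unfolding q(2)
    proof
      assume "q = (1, 0, 0) \<or> q = (0, 1, 0) \<or> q = (0, 0, 1)"
      then show "comb e1 e2 e3 q \<in> D" using m(1,2) e3 by auto
    next
      assume "\<exists>s\<in>{1, -1}. \<exists>t\<in>{1, -1}. q = (1, s * ?f, t * ?g) \<or> q = (t * ?g, 1, s * ?f) \<or> q = (s * ?f, t * ?g, 1)"
      then obtain s t where st: "s \<in> {1, -1}" "t \<in> {1, -1}"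
        and "q = (1, s * ?f, t * ?g) \<or> q = (t * ?g, 1, s * ?f) \<or> q = (s * ?f, t * ?g, 1)" by blast
      then show "comb e1 e2 e3 q \<in> D" using 1[OF st] 2[OF st] 3[OF st] by (elim disjE) (simp_all only:)
    qed
  qed
qed

text \<open>In the coordinates of \<open>roots 2\<close>, the vectors \<open>x + z\<close> and
  \<open>z - x\<close> point along the second and third axis, which dictates the frame.\<close>

lemma frame_A3:
  assumes "x \<bullet> x = 1" "y \<bullet> y = 1" "z \<bullet> z = 1" "x \<bullet> y = - 1 / 2" "y \<bullet> z = - 1 / 2" "x \<bullet> z = 0"
  obtains e1 e2 e3 where "orthonormal e1 e2 e3" "comb e1 e2 e3 (1, -1, 0) = sqrt 2 *\<^sub>R y"
    "comb e1 e2 e3 (0, 1, -1) = sqrt 2 *\<^sub>R x" "comb e1 e2 e3 (0, 1, 1) = sqrt 2 *\<^sub>R z"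
proof -
  define s where "s = sqrt 2"
  have s: "s * s = 2" by (simp add: s_def)
  have g: "y \<bullet> x = - 1 / 2" "z \<bullet> y = - 1 / 2" "z \<bullet> x = 0" using assms by (simp_all add: inner_commute)
  define e2 where "e2 = (s / 2) *\<^sub>R (x + z)"
  define e3 where "e3 = (s / 2) *\<^sub>R (z - x)"
  define e1 where "e1 = s *\<^sub>R y + e2"
  have "e1 = (s / 2) *\<^sub>R (x + 2 *\<^sub>R y + z)" unfolding e1_def e2_def by (simp add: algebra_simps)
  then have on: "orthonormal e1 e2 e3"
    unfolding orthonormal_def e2_def e3_def using assms g s
    by (simp add: inner_left_distrib inner_right_distrib inner_diff_left inner_diff_right)
  have "comb e1 e2 e3 (1, -1, 0) = sqrt 2 *\<^sub>R y" by (simp add: comb_def e1_def s_def)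
  moreover have "comb e1 e2 e3 (0, 1, -1) = sqrt 2 *\<^sub>R x" "comb e1 e2 e3 (0, 1, 1) = sqrt 2 *\<^sub>R z"
    unfolding comb_def e2_def e3_def s_def[symmetric] by (simp_all add: algebra_simps flip: scaleR_add_left)
  ultimately show ?thesis using that[OF on] by blast
qed

lemma frame_B3:
  assumes "x \<bullet> x = 1" "y \<bullet> y = 1" "z \<bullet> z = 1" "x \<bullet> y = - 1 / 2" "y \<bullet> z = - sqrt 2 / 2" "x \<bullet> z = 0"
  obtains e1 e2 e3 where "orthonormal e1 e2 e3" "comb e1 e2 e3 (1, -1, 0) = sqrt 2 *\<^sub>R x"
    "comb e1 e2 e3 (0, 1, -1) = sqrt 2 *\<^sub>R y" "comb e1 e2 e3 (0, 0, 1) = z"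
proof -
  define s where "s = sqrt 2"
  have s: "s * s = 2" by (simp add: s_def)
  have yz: "y \<bullet> z = - s / 2" using assms(5) by (simp add: s_def)
  have g: "y \<bullet> x = - 1 / 2" "z \<bullet> y = - s / 2" "z \<bullet> x = 0" using assms yz by (simp_all add: inner_commute)
  define e2 where "e2 = s *\<^sub>R y + z"
  define e1 where "e1 = s *\<^sub>R x + s *\<^sub>R y + z"
  have on: "orthonormal e1 e2 z"
    unfolding orthonormal_def e2_def e1_def using assms(1-4,6) g yz s
    by (simp add: inner_left_distrib inner_right_distrib inner_diff_left inner_diff_right algebra_simps)
  have "comb e1 e2 z (1, -1, 0) = sqrt 2 *\<^sub>R x" "comb e1 e2 z (0, 1, -1) = sqrt 2 *\<^sub>R y" "comb e1 e2 z (0, 0, 1) = z"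
    by (simp_all add: comb_def e1_def e2_def s_def)
  then show ?thesis using that[OF on] by blast
qed

lemma frame_H3:
  assumes "x \<bullet> x = 1" "y \<bullet> y = 1" "z \<bullet> z = 1" "x \<bullet> y = - 1 / 2" "y \<bullet> z = - golden / 2" "x \<bullet> z = 0"
  obtains e1 e2 e3 where "orthonormal e1 e2 e3" "comb e1 e2 e3 (1, 0, 0) = x"
    "comb e1 e2 e3 (0, 1, 0) = z" "comb e1 e2 e3 (1, golden, golden - 1) = (-2) *\<^sub>R y"
proof -
  let ?f = golden
  have sq: "?f * ?f = ?f + 1" by (rule golden_square)
  have f3: "c * (?f * ?f) = c * ?f + c" "?f * (?f * c) = ?f * c + c" for c
    using sq by (simp_all add: algebra_simps flip: mult.assoc)
  have g: "y \<bullet> x = - 1 / 2" "z \<bullet> y = - ?f / 2" "z \<bullet> x = 0" using assms by (simp_all add: inner_commute)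
  \<comment> \<open>Since \<open>golden * (golden - 1) = 1\<close>, this solves the last required
    equation for the third axis.\<close>
  define e3 where "e3 = ?f *\<^sub>R ((-2) *\<^sub>R y - x - ?f *\<^sub>R z)"
  have on: "orthonormal x z e3"
    unfolding orthonormal_def e3_def using assms g sq
    by (simp add: inner_left_distrib inner_right_distrib inner_diff_left inner_diff_right algebra_simps f3; simp add: field_simps)
  have "(?f - 1) * ?f = 1" using sq by (simp add: algebra_simps)
  then have "(?f - 1) *\<^sub>R e3 = (-2) *\<^sub>R y - x - ?f *\<^sub>R z" unfolding e3_def by (simp only: scaleR_scaleR scaleR_one)
  then have "comb x z e3 (1, ?f, ?f - 1) = (-2) *\<^sub>R y" by (simp add: comb_def)
  then show ?thesis using that[OF on] by (simp add: comb_def)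
qed

section \<open>Algebra of reflections\<close>

lemma reflection_unit: "x \<bullet> x = 1 \<Longrightarrow> reflection x y = y - (2 * (x \<bullet> y)) *\<^sub>R x"
  by (simp add: reflection_def)

lemma reflection_scale_left: "c \<noteq> 0 \<Longrightarrow> reflection (c *\<^sub>R x) y = reflection x y"
  by (simp add: reflection_def)

lemma reflection_scale_right: "reflection x (c *\<^sub>R y) = c *\<^sub>R reflection x y"
  by (simp add: reflection_def algebra_simps)

lemma reflection_minus: "reflection x (- y) = - reflection x y"
  using reflection_scale_right[of x "-1" y] by simp

lemma reflection_add: "reflection x (y + z) = reflection x y + reflection x z"
  by (simp add: reflection_def inner_right_distrib add_divide_distrib algebra_simps)

lemma reflection_reflection: "reflection x (reflection x y) = y"
  by (simp add: reflection_def inner_diff_right algebra_simps)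

lemma reflection_dot: "reflection x y \<bullet> reflection x z = y \<bullet> z"
  by (simp add: reflection_def inner_diff_right inner_diff_left inner_commute)

lemma reflection_conjugate: "reflection (reflection h a) (reflection h b) = reflection h (reflection a b)"
proof -
  have "reflection h (reflection a b) = reflection h b + reflection h ((- (2 * (a \<bullet> b) / (a \<bullet> a))) *\<^sub>R a)"
    unfolding reflection_add[symmetric] by (simp add: reflection_def[of a])
  then show ?thesis
    unfolding reflection_scale_right by (simp add: reflection_def[of "reflection h a"] reflection_dot)
qed

lemma linear_reflection: "linear (reflection x)"
  by (rule linearI) (simp_all add: reflection_add reflection_scale_right)

context unit_system
begin

text \<open>The nonzero normals of every length, so that roots need not be normalised.\<close>

definition lines :: "(real^3) set" where
  "lines = {d. \<exists>c. c \<noteq> 0 \<and> c *\<^sub>R d \<in> S}"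

lemma lines_scale: "c \<noteq> 0 \<Longrightarrow> c *\<^sub>R d \<in> lines \<longleftrightarrow> d \<in> lines"
proof -
  assume c: "c \<noteq> 0"
  have *: "c *\<^sub>R d \<in> lines" if d: "d \<in> lines" and "c \<noteq> 0" for c d
  proof -
    obtain b where "b \<noteq> 0" "b *\<^sub>R d \<in> S" using d unfolding lines_def by blast
    then have "b / c \<noteq> 0 \<and> (b / c) *\<^sub>R (c *\<^sub>R d) \<in> S" using \<open>c \<noteq> 0\<close> by simp
    then show ?thesis unfolding lines_def by blast
  qed
  show ?thesis using *[of d c] *[of "c *\<^sub>R d" "1 / c"] c by auto
qed

lemma S_lines: "x \<in> S \<Longrightarrow> x \<in> lines"
  unfolding lines_def by (auto intro: exI[of _ 1])

lemma lines_reflection_closed: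
  assumes "\<And>x y. x \<in> S \<Longrightarrow> y \<in> S \<Longrightarrow> reflection x y \<in> S"
  shows "reflection_closed lines"
  unfolding reflection_closed_def
proof (intro conjI ballI allI impI)
  fix x y assume "x \<in> lines" "y \<in> lines"
  then obtain b c where bc: "b \<noteq> 0" "b *\<^sub>R x \<in> S" "c \<noteq> 0" "c *\<^sub>R y \<in> S" unfolding lines_def by blast
  then have "c *\<^sub>R reflection x y \<in> S"
    using assms[OF bc(2,4)] by (simp add: reflection_scale_left reflection_scale_right)
  then show "reflection x y \<in> lines" using bc(3) unfolding lines_def by blast
next
  fix x c assume "x \<in> lines" "c \<noteq> (0::real)"
  then show "c *\<^sub>R x \<in> lines" using lines_scale by blast
qed

lemma two_elements:
  assumes "x \<in> S" "y \<in> S" "y \<noteq> x" "y \<noteq> - x" "P \<in> planes S" "Q \<in> planes S" "x \<in> P" "y \<in> P" "x \<in> Q" "y \<in> Q"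
  shows "P = Q"
  using planes_at_inter[of P Q x y] assms by blast

lemma outside_element:
  assumes P: "P \<in> planes S" and A: "finite A" "card A < card (S \<inter> P)"
  obtains y where "y \<in> S" "y \<in> P" "y \<notin> A"
proof -
  have "\<not> S \<inter> P \<subseteq> A" using A card_mono by (metis linorder_not_le)
  then show ?thesis using that by blast
qed

lemma orthogonal_plane:
  assumes "x \<in> S" "y \<in> S" "y \<noteq> x" "y \<noteq> - x" "w \<in> span {x, y}" "z \<bullet> x = 0" "z \<bullet> y = 0"
  shows "z \<bullet> w = 0"
proof -
  obtain s t where "w = s *\<^sub>R x + t *\<^sub>R y" using assms(5) by (auto simp: span_insert algebra_simps)
  then show ?thesis using assms by (simp add: inner_right_distrib)
qed

end

section \<open>Points on at most three lines, and the case \<open>n = 2\<close>\<close>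

context hirzebruch_system
begin

lemma count_zero: "count k = 0 \<Longrightarrow> P \<in> planes S \<Longrightarrow> card (S \<inter> P) \<noteq> 2 * k"
  using finite_planes by (auto simp: count_def)

lemma wedge_dot_card6:
  assumes w: "wedge x y" and c: "card (S \<inter> span {x, y}) = 6"
  shows "x \<bullet> y = - 1 / 2"
proof -
  have xy: "x \<in> S" "y \<in> S" "y \<noteq> x" "y \<noteq> - x" using w by (auto simp: wedge_def)
  have "(x \<bullet> y)\<^sup>2 = 1 / 4"
    by (rule card6_dot[OF planesI[OF xy] c xy(1) _ xy(2) _ xy(3,4)]) (auto simp: span_base)
  then have "(- (x \<bullet> y))\<^sup>2 = (1 / 2)\<^sup>2" by (simp add: power2_eq_square)
  then have "- (x \<bullet> y) = 1 / 2" using wedge_obtuse(1)[OF w] by (subst (asm) power2_eq_iff_nonneg) auto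
  then show ?thesis by simp
qed

text \<open>Two orthogonal lines, or three lines at sixty degrees, are preserved by their
  reflections. In the second case the third vector \<open>z\<close> has the same coordinates over
  \<open>x\<close> and \<open>e\<close> as \<open>y\<close> up to signs, so it is the reflection of
  \<open>y\<close> up to sign.\<close>

lemma reflection_small:
  assumes P: "P \<in> planes S" "card (S \<inter> P) \<le> 6" and x: "x \<in> S" "x \<in> P" and y: "y \<in> S" "y \<in> P"
  shows "reflection x y \<in> S"
proof -
  have r: "reflection x y = y - (2 * (x \<bullet> y)) *\<^sub>R x" using reflection_unit dot_self x by blast
  show ?thesis
  proof (cases "y = x \<or> y = - x")
    case True
    then have "reflection x y = - y" unfolding r using dot_self[OF x(1)] by (auto simp: scaleR_2)
    then show ?thesis using neg y by simp
  next
    case False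
    consider "card (S \<inter> P) = 4" | "card (S \<inter> P) = 6" using plane_card_cases[OF P(1)] P(2) by auto
    then show ?thesis
    proof cases
      case 1
      then have "x \<bullet> y = 0" using card4_orthogonal[OF P(1)] x y False by blast
      then show ?thesis unfolding r using y by simp
    next
      case 2
      obtain z where z: "z \<in> S" "z \<in> P" "z \<noteq> x" "z \<noteq> - x" "z \<noteq> y" "z \<noteq> - y"
        using card6_third[OF P(1) 2 x y] False by metis
      obtain e where e: "norm e = 1" "x \<bullet> e = 0"
        and basis: "\<forall>u\<in>P. u = (u \<bullet> x) *\<^sub>R x + (u \<bullet> e) *\<^sub>R e"
        using plane_basis[OF P(1) x] by metis
      have self: "x \<bullet> x = 1" "e \<bullet> e = 1" using dot_self x e by (simp_all add: norm_eq_1)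
      have sq: "(u \<bullet> x)\<^sup>2 = 1 / 4 \<and> (u \<bullet> e)\<^sup>2 = 3 / 4" if u: "u \<in> S" "u \<in> P" "u \<noteq> x" "u \<noteq> - x" for u
      proof -
        have 1: "(u \<bullet> x)\<^sup>2 = 1 / 4" using card6_dot[OF P(1) 2 x u] by (simp add: inner_commute)
        have "u \<bullet> u = (u \<bullet> x) * (u \<bullet> x) + (u \<bullet> e) * (u \<bullet> e)"
          by (subst (2) basis[rule_format, OF u(2)]) (simp add: inner_right_distrib)
        then show ?thesis using 1 dot_self[OF u(1)] by (simp add: power2_eq_square)
      qed
      have yz: "y = (y \<bullet> x) *\<^sub>R x + (y \<bullet> e) *\<^sub>R e" "z = (z \<bullet> x) *\<^sub>R x + (z \<bullet> e) *\<^sub>R e"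
        using basis y z by blast+
      have "(z \<bullet> x)\<^sup>2 = (y \<bullet> x)\<^sup>2" "(z \<bullet> e)\<^sup>2 = (y \<bullet> e)\<^sup>2"
        using sq[of y] sq[of z] y z False by simp_all
      then have ze: "z \<bullet> x = y \<bullet> x \<or> z \<bullet> x = - (y \<bullet> x)" "z \<bullet> e = y \<bullet> e \<or> z \<bullet> e = - (y \<bullet> e)"
        by (simp_all add: power2_eq_iff)
      define p q where "p = y \<bullet> x" and "q = y \<bullet> e"
      have y': "y = p *\<^sub>R x + q *\<^sub>R e" using yz(1) by (simp add: p_def q_def)
      have ry: "reflection x y = - p *\<^sub>R x + q *\<^sub>R e"
      proof -
        have "reflection x y = y - (2 * p) *\<^sub>R x" unfolding r p_def by (simp add: inner_commute)
        moreover have "(2 * p) *\<^sub>R x = p *\<^sub>R x + p *\<^sub>R x" by (simp only: mult_2 scaleR_add_left)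
        ultimately have "reflection x y = y - (p *\<^sub>R x + p *\<^sub>R x)" by simp
        also have "\<dots> = (p *\<^sub>R x + q *\<^sub>R e) - (p *\<^sub>R x + p *\<^sub>R x)" by (simp only: y'[symmetric])
        also have "\<dots> = - p *\<^sub>R x + q *\<^sub>R e" by simp
        finally show ?thesis .
      qed
      have "z = p *\<^sub>R x + q *\<^sub>R e \<or> z = p *\<^sub>R x + (- q) *\<^sub>R e \<or> z = (- p) *\<^sub>R x + q *\<^sub>R e \<or> z = (- p) *\<^sub>R x + (- q) *\<^sub>R e"
        using yz(2) ze unfolding p_def[symmetric] q_def[symmetric] by auto
      moreover define X E where "X = p *\<^sub>R x" and "E = q *\<^sub>R e"
      ultimately have "z = X + E \<or> z = X - E \<or> z = E - X \<or> z = - (X + E)" by simp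
      moreover have "y = X + E" using y' by (simp add: X_def E_def)
      moreover have "reflection x y = E - X" using ry by (simp add: X_def E_def)
      ultimately have "z = y \<or> z = - reflection x y \<or> z = reflection x y \<or> z = - y"
        by (metis minus_diff_eq)
      then show ?thesis using z by (auto simp: neg_iff)
    qed
  qed
qed

lemma simple_ex: obtains a b c where "simple a b c"
proof -
  have "card {((a, b), c). simple a b c} \<noteq> 0"
  proof
    assume "card {((a, b), c). simple a b c} = 0"
    then have "24 * real n * (real n + 1) = 0" using card_simple by (simp only: of_nat_0)
    moreover have "24 * real n * (real n + 1) > 0" using n_ge_2 by simp
    ultimately show False by simp
  qed
  then have "{((a, b), c). simple a b c} \<noteq> {}" by (metis card.empty)
  then show ?thesis using that by auto
qed

text \<open>Orders the walls as a path in the Coxeter diagram: \<open>y\<close> is the middle node,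
  orthogonal to neither end.\<close>

lemma simple_right_angle:
  assumes s: "simple a b c"
  obtains x y z where "simple x y z" "x \<bullet> z = 0" "x \<bullet> y \<noteq> 0" "y \<bullet> z \<noteq> 0" "{x, y, z} = {a, b, c}"
proof -
  have ex: "\<exists>x y z. simple x y z \<and> x \<bullet> z = 0 \<and> {x, y, z} = {a, b, c}"
  proof -
    have s': "simple b c a" "simple c a b" using s simple_rotate by blast+
    consider "a \<bullet> b = 0" | "b \<bullet> c = 0" | "c \<bullet> a = 0" using weight_equality(2)[OF s] by blast
    then show ?thesis
    proof cases
      case 1 then show ?thesis using s'(1) by (intro exI[of _ b] exI[of _ c] exI[of _ a]) (auto simp: inner_commute)
    next
      case 2 then show ?thesis using s'(2) by (intro exI[of _ c] exI[of _ a] exI[of _ b]) (auto simp: inner_commute)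
    next
      case 3 then show ?thesis using s by (intro exI[of _ a] exI[of _ b] exI[of _ c]) (auto simp: inner_commute)
    qed
  qed
  then obtain x y z where xyz: "simple x y z" "x \<bullet> z = 0" "{x, y, z} = {a, b, c}" by blast
  have "simple z x y" using xyz(1) simple_rotate by blast
  then have "x \<bullet> y \<noteq> 0" "y \<bullet> z \<noteq> 0"
    using not_two_right_angles[OF xyz(1)] not_two_right_angles[of z x y] xyz(2) by (auto simp: inner_commute)
  then show ?thesis using that xyz by blast
qed

text \<open>No point lies on more than three lines, so \<open>reflection_small\<close> already
  closes \<open>S\<close> under all its reflections, and the walls of any chamber have the inner
  products of simple roots of type \<open>A\<^sub>3\<close>.\<close>

lemma roots_A3:
  assumes n: "n = 2"
  obtains e1 e2 e3 where "orthonormal e1 e2 e3" "comb e1 e2 e3 ` roots 2 \<subseteq> lines"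
proof -
  have small: "card (S \<inter> P) \<le> 6" if "P \<in> planes S" for P
    using plane_card_cases[OF that] count_zero[OF _ that, of 4] count_zero[OF _ that, of 5] count_cases n by auto
  have "reflection x y \<in> S" if "x \<in> S" "y \<in> S" for x y
  proof (cases "y = x \<or> y = - x")
    case True
    then have "reflection x y = - y" using that dot_self[OF that(1)]
      by (auto simp: reflection_unit reflection_minus scaleR_2)
    then show ?thesis using neg that by simp
  next
    case False
    then have "span {x, y} \<in> planes S" using planesI that by blast
    then show ?thesis using reflection_small[of "span {x, y}"] small that by (simp add: span_base)
  qed
  then have cl: "reflection_closed lines" by (rule lines_reflection_closed)
  obtain a b c where "simple a b c" using simple_ex .
  then obtain x y z where s: "simple x y z" "x \<bullet> z = 0" "x \<bullet> y \<noteq> 0" "y \<bullet> z \<noteq> 0"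
    using simple_right_angle by metis
  have xyz: "x \<in> S" "y \<in> S" "z \<in> S" using simple_mem[OF s(1)] by blast+
  have "x' \<bullet> y' = - 1 / 2" if w: "wedge x' y'" "x' \<bullet> y' \<noteq> 0" for x' y'
  proof -
    have "span {x', y'} \<in> planes S" using w planesI by (auto simp: wedge_def)
    then have "card (S \<inter> span {x', y'}) = 6"
      using plane_card_cases small wedge_obtuse(2)[OF w(1)] w(2) by fastforce
    then show ?thesis using wedge_dot_card6 w by blast
  qed
  then have d: "x \<bullet> y = - 1 / 2" "y \<bullet> z = - 1 / 2"
    using s simple_wedge simple_rotate by blast+
  obtain e1 e2 e3 where e: "orthonormal e1 e2 e3" "comb e1 e2 e3 (1, -1, 0) = sqrt 2 *\<^sub>R y"
    "comb e1 e2 e3 (0, 1, -1) = sqrt 2 *\<^sub>R x" "comb e1 e2 e3 (0, 1, 1) = sqrt 2 *\<^sub>R z"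
    using frame_A3[of x y z] dot_self xyz d s(2) by metis
  have "comb e1 e2 e3 ` roots 2 \<subseteq> lines"
    by (rule closure_A3[OF cl e(1)]) (simp_all add: e lines_scale S_lines xyz)
  then show ?thesis using that e(1) by blast
qed

section \<open>Multiplicities of the points on a single line\<close>

definition mult_at :: "real^3 \<Rightarrow> nat \<Rightarrow> nat" where
  "mult_at a k = card {P \<in> planes S. a \<in> P \<and> card (S \<inter> P) = 2 * k}"

lemma at_sums:
  assumes "a \<in> S"
  shows "mult_at a 2 + mult_at a 3 + mult_at a 4 + mult_at a 5 = n + 1"
    and "2 * mult_at a 2 + 3 * mult_at a 3 + 4 * mult_at a 4 + 5 * mult_at a 5 = 4 * n"
proof -
  have g: "(\<Sum>P | P \<in> planes S \<and> a \<in> P. h (card (S \<inter> P))) = mult_at a 2 * h 4 + mult_at a 3 * h 6 + mult_at a 4 * h 8 + mult_at a 5 * h 10"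
    for h :: "nat \<Rightarrow> real"
  proof -
    have "(\<Sum>P | P \<in> planes S \<and> a \<in> P. h (card (S \<inter> P)))
      = (\<Sum>k\<in>{4, 6, 8, 10}. \<Sum>P\<in>{P \<in> {P \<in> planes S. a \<in> P}. card (S \<inter> P) = k}. h (card (S \<inter> P)))"
      using plane_card_cases finite_planes by (intro sum.group[symmetric]) auto
    also have "\<dots> = (\<Sum>k\<in>{4, 6, 8, 10}. real (card {P \<in> {P \<in> planes S. a \<in> P}. card (S \<inter> P) = k}) * h k)"
      by (intro sum.cong refl) simp
    finally show ?thesis by (simp add: mult_at_def)
  qed
  have "real (mult_at a 2 + mult_at a 3 + mult_at a 4 + mult_at a 5) = real (n + 1)"
    using g[of "\<lambda>_. 1"] planes_at[OF assms] by simp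
  then show "mult_at a 2 + mult_at a 3 + mult_at a 4 + mult_at a 5 = n + 1" by (simp only: of_nat_eq_iff)
  have "real (2 * mult_at a 2 + 3 * mult_at a 3 + 4 * mult_at a 4 + 5 * mult_at a 5) = real (4 * n)"
    using g[of real] sum_card_at[OF assms] by simp
  then show "2 * mult_at a 2 + 3 * mult_at a 3 + 4 * mult_at a 4 + 5 * mult_at a 5 = 4 * n" by (simp only: of_nat_eq_iff)
qed

lemma at_pos: "P \<in> planes S \<Longrightarrow> a \<in> P \<Longrightarrow> card (S \<inter> P) = 2 * k \<Longrightarrow> mult_at a k \<noteq> 0"
  using finite_planes by (auto simp: mult_at_def)

lemma sum_at: "(\<Sum>a\<in>S. mult_at a k) = 2 * k * count k"
proof -
  have "(\<Sum>a\<in>S. mult_at a k) = (\<Sum>a\<in>S. \<Sum>P\<in>{P \<in> {P \<in> planes S. card (S \<inter> P) = 2 * k}. a \<in> P}. 1)"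
    by (intro sum.cong refl) (simp add: mult_at_def conj_ac)
  also have "\<dots> = (\<Sum>P\<in>{P \<in> planes S. card (S \<inter> P) = 2 * k}. \<Sum>a\<in>{a \<in> S. a \<in> P}. 1)"
    by (rule sum.swap_restrict[symmetric]) (use finite_planes finite_S in auto)
  also have "\<dots> = (\<Sum>P\<in>{P \<in> planes S. card (S \<inter> P) = 2 * k}. 2 * k)"
    by (intro sum.cong refl) (simp add: Int_def)
  finally show ?thesis by (simp add: count_def)
qed

text \<open>If \<open>m\<close> planes of the same size \<open>2k\<close> did not all meet pairwise in \<open>S\<close>, there would be too few
  incidences, by \<open>t\<^sup>2 - t \<ge> 2t - 2\<close> for the number \<open>t\<close> of these planes through a point.\<close>

lemma planes_meet:
  assumes k: "4 * real k * count k - 12 * real n \<ge> 2 * real (count k) * (real (count k) - 1)"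
    and Q: "Q \<in> planes S" "card (S \<inter> Q) = 2 * k" "Q' \<in> planes S" "card (S \<inter> Q') = 2 * k" "Q \<noteq> Q'"
  obtains x where "x \<in> S" "x \<in> Q" "x \<in> Q'"
proof -
  let ?Q = "{P \<in> planes S. card (S \<inter> P) = 2 * k}"
  have fin: "finite ?Q" using finite_planes by simp
  have at': "real (mult_at a k) = (\<Sum>P\<in>?Q. if a \<in> P then 1 else 0)" for a
    using fin by (simp add: mult_at_def sum.If_cases Int_def conj_ac)
  have cardS: "real (card (S \<inter> A)) = (\<Sum>a\<in>S. if a \<in> A then 1 else 0)" for A
    using finite_S by (simp add: sum.If_cases Int_def)
  have le2: "card (S \<inter> (P \<inter> P')) \<le> 2" if PP: "P \<in> ?Q" "P' \<in> ?Q" "P \<noteq> P'" for P P'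
  proof (cases "S \<inter> (P \<inter> P') = {}")
    case False
    then obtain x where x: "x \<in> S \<inter> (P \<inter> P')" by blast
    have "S \<inter> (P \<inter> P') \<subseteq> {x, - x}" using planes_at_inter[of P P' x] PP x by auto
    then have "card (S \<inter> (P \<inter> P')) \<le> card {x, - x}" by (intro card_mono) auto
    also have "\<dots> \<le> 2" using card_insert_le_m1[of 2 "{- x}" x] by simp
    finally show ?thesis .
  qed simp
  have "S \<inter> (Q \<inter> Q') \<noteq> {}"
  proof
    assume empty: "S \<inter> (Q \<inter> Q') = {}"
    let ?f = "\<lambda>(P, P'). real (card (S \<inter> (P \<inter> P')))"
    let ?O = "?Q \<times> ?Q - Id"
    have finO: "finite ?O" using fin by simp
    have Id: "?Q \<times> ?Q \<inter> Id = (\<lambda>P. (P, P)) ` ?Q" by auto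
    have cId: "card (?Q \<times> ?Q \<inter> Id) = count k" unfolding Id count_def by (intro card_image) (simp add: inj_on_def)
    have cO: "real (card ?O) = real (count k) * real (count k) - real (count k)"
    proof -
      have "card ?O = card (?Q \<times> ?Q) - card (?Q \<times> ?Q \<inter> Id)" using fin by (intro card_Diff_subset_Int) simp
      also have "\<dots> = count k * count k - count k" unfolding cId by (simp add: card_cartesian_product count_def)
      finally show ?thesis by (simp add: of_nat_diff)
    qed
    have "sum ?f (?Q \<times> ?Q) = sum ?f ?O + sum ?f (?Q \<times> ?Q \<inter> Id)"
      using fin by (subst sum.Int_Diff[of _ _ Id]) auto
    moreover have "sum ?f (?Q \<times> ?Q \<inter> Id) = 2 * real k * real (count k)"
      unfolding Id by (subst sum.reindex) (simp_all add: inj_on_def count_def)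
    moreover have "sum ?f (?Q \<times> ?Q) = (\<Sum>a\<in>S. (real (mult_at a k))\<^sup>2)"
    proof -
      have "sum ?f (?Q \<times> ?Q) = (\<Sum>P\<in>?Q. \<Sum>P'\<in>?Q. \<Sum>a\<in>S. (if a \<in> P then 1 else 0) * (if a \<in> P' then 1 else 0))"
        unfolding sum.cartesian_product[symmetric] cardS by (intro sum.cong refl) auto
      also have "\<dots> = (\<Sum>P\<in>?Q. \<Sum>a\<in>S. \<Sum>P'\<in>?Q. (if a \<in> P then 1 else 0) * (if a \<in> P' then 1 else 0))"
        by (intro sum.cong refl sum.swap)
      also have "\<dots> = (\<Sum>a\<in>S. \<Sum>P\<in>?Q. \<Sum>P'\<in>?Q. (if a \<in> P then 1 else 0) * (if a \<in> P' then 1 else 0))"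
        by (rule sum.swap)
      also have "\<dots> = (\<Sum>a\<in>S. (real (mult_at a k))\<^sup>2)"
        unfolding at' power2_eq_square sum_product ..
      finally show ?thesis .
    qed
    moreover have "(\<Sum>a\<in>S. (real (mult_at a k))\<^sup>2) \<ge> (\<Sum>a\<in>S. 3 * real (mult_at a k) - 2)"
    proof (rule sum_mono)
      fix a
      have "mult_at a k = 0 \<or> mult_at a k = 1 \<or> mult_at a k \<ge> 2" by linarith
      then have "(real (mult_at a k) - 1) * (real (mult_at a k) - 2) \<ge> 0"
      proof (elim disjE)
        assume "mult_at a k \<ge> 2"
        then show ?thesis by (intro mult_nonneg_nonneg) simp_all
      qed simp_all
      then show "3 * real (mult_at a k) - 2 \<le> (real (mult_at a k))\<^sup>2" by (simp add: algebra_simps power2_eq_square)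
    qed
    moreover have "(\<Sum>a\<in>S. 3 * real (mult_at a k) - 2) = 6 * real k * real (count k) - 12 * real n"
    proof -
      have "(\<Sum>a\<in>S. real (mult_at a k)) = 2 * real k * real (count k)"
        using arg_cong[OF sum_at[of k], of real] by simp
      then show ?thesis using card_S by (simp add: sum_subtractf sum_distrib_left[symmetric])
    qed
    ultimately have "sum ?f ?O \<ge> 2 * real (count k) * (real (count k) - 1)" using k by linarith
    moreover have "sum ?f ?O < (\<Sum>q\<in>?O. 2)"
    proof (rule sum_strict_mono_ex1[OF finO])
      show "\<forall>q\<in>?O. ?f q \<le> 2" using le2 by fastforce
      show "\<exists>q\<in>?O. ?f q < 2" using Q empty by (intro bexI[of _ "(Q, Q')"]) auto
    qed
    ultimately show False using cO by (simp add: algebra_simps)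
  qed
  then show ?thesis using that by blast
qed

section \<open>The cases \<open>n = 3\<close> and \<open>n = 4\<close>\<close>

lemma at_count_zero: "count k = 0 \<Longrightarrow> mult_at a k = 0"
  unfolding count_def mult_at_def using finite_planes by (auto simp: card_eq_0_iff)

lemma plane_unique_at:
  assumes "mult_at a k \<le> 1" "P \<in> planes S" "a \<in> P" "card (S \<inter> P) = 2 * k" "Q \<in> planes S" "a \<in> Q" "card (S \<inter> Q) = 2 * k"
  shows "P = Q"
proof (rule ccontr)
  assume "P \<noteq> Q"
  then have "card {P, Q} = 2" by simp
  moreover have "card {P, Q} \<le> mult_at a k" unfolding mult_at_def by (rule card_mono) (use assms finite_planes in auto)
  ultimately show False using assms(1) by linarith
qed

lemma mult_at_ge:
  assumes "\<And>P. P \<in> A \<Longrightarrow> P \<in> planes S \<and> a \<in> P \<and> card (S \<inter> P) = 2 * k"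
  shows "card A \<le> mult_at a k"
  unfolding mult_at_def by (rule card_mono) (use assms finite_planes in auto)

text \<open>For \<open>n = 3\<close>, the three planes with eight elements are the coordinate planes.\<close>

lemma pole:
  assumes n: "n = 3"
    and Q: "Q \<in> planes S" "card (S \<inter> Q) = 8" "Q' \<in> planes S" "card (S \<inter> Q') = 8" "Q'' \<in> planes S" "card (S \<inter> Q'') = 8"
      "Q \<noteq> Q'" "Q \<noteq> Q''" "Q' \<noteq> Q''"
    and x: "x \<in> S" "x \<in> Q'" "x \<in> Q''" and x': "x' \<in> S" "x' \<in> Q" "x' \<in> Q''" and x'': "x'' \<in> S" "x'' \<in> Q" "x'' \<in> Q'"
  shows "x \<notin> Q" "x' \<noteq> x''" "x' \<noteq> - x''" "w \<in> Q \<Longrightarrow> x \<bullet> w = 0"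
    "\<And>y. y \<in> S \<Longrightarrow> y \<in> Q \<Longrightarrow> y \<notin> {x', - x', x'', - x''} \<Longrightarrow> card (S \<inter> span {x, y}) = 4"
    "\<exists>y y'. y \<in> S \<and> y' \<in> S \<and> y' \<noteq> y \<and> y' \<noteq> - y \<and> S \<inter> Q = {x', - x', x'', - x''} \<union> {y, - y, y', - y'}
       \<and> y \<notin> {x', - x', x'', - x''} \<and> y' \<notin> {x', - x', x'', - x''}"
proof -
  have c5: "count 5 = 0" using count_cases n by auto
  \<comment> \<open>For \<open>n = 3\<close> each line has four points, of multiplicities at most 4,
    that add up to 12.\<close>
  have le2: "mult_at a 4 \<le> 2 \<and> mult_at a 4 = mult_at a 2 \<and> mult_at a 3 + 2 * mult_at a 4 = 4" if "a \<in> S" for a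
    using at_sums[OF that] at_count_zero[OF c5, of a] n by simp
  have three: False if "a \<in> S" "a \<in> Q" "a \<in> Q'" "a \<in> Q''" for a
  proof -
    have "card {Q, Q', Q''} \<le> mult_at a 4" by (rule mult_at_ge) (use Q that in auto)
    moreover have "card {Q, Q', Q''} = 3" using Q by simp
    ultimately show False using le2[OF that(1)] by simp
  qed
  show xQ: "x \<notin> Q" using three x by blast
  show d1: "x' \<noteq> x''" using three[of x'] x' x'' by blast
  show d2: "x' \<noteq> - x''"
  proof
    assume "x' = - x''"
    then have "x' \<in> Q'" using plane_neg[OF Q(3) x''(3)] by simp
    then show False using three[of x'] x' by blast
  qed
  \<comment> \<open>The other two big planes use up 8 of the 12, so the remaining two planes through
    \<open>x\<close> have four elements each.\<close>
  have "card {Q', Q''} \<le> mult_at x 4" by (rule mult_at_ge) (use Q x in auto)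
  then have "mult_at x 4 = 2" using le2[OF x(1)] Q(9) by simp
  then have x3: "mult_at x 3 = 0" using le2[OF x(1)] by simp
  show c4: "card (S \<inter> span {x, y}) = 4" if y: "y \<in> S" "y \<in> Q" "y \<notin> {x', - x', x'', - x''}" for y
  proof -
    have ne: "y \<noteq> x" "y \<noteq> - x" using xQ y(2) plane_neg[OF Q(1), of y] by auto
    have P: "span {x, y} \<in> planes S" using planesI[OF x(1) y(1) ne] .
    have in_P: "x \<in> span {x, y}" "y \<in> span {x, y}" by (auto intro: span_base)
    have not8: "card (S \<inter> span {x, y}) \<noteq> 8"
    proof
      assume c: "card (S \<inter> span {x, y}) = 8"
      have "span {x, y} \<noteq> Q'" using planes_at_inter[OF Q(1,3,7) x''(1-3), of y] y in_P by auto
      moreover have "span {x, y} \<noteq> Q''" using planes_at_inter[OF Q(1,5,8) x'(1-3), of y] y in_P by auto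
      ultimately have "card {span {x, y}, Q', Q''} = 3" using Q(9) by simp
      moreover have "card {span {x, y}, Q', Q''} \<le> mult_at x 4" by (rule mult_at_ge) (use Q x P c in_P in auto)
      ultimately show False using le2[OF x(1)] by simp
    qed
    have "card (S \<inter> span {x, y}) \<noteq> 6" using at_pos[OF P in_P(1), of 3] x3 by auto
    moreover have "card (S \<inter> span {x, y}) \<noteq> 10" using count_zero[OF c5 P] by simp
    ultimately show ?thesis using plane_card_cases[OF P] not8 by simp
  qed
  let ?A = "{x', - x', x'', - x''}"
  have subA: "?A \<subseteq> S \<inter> Q" using x' x'' neg plane_neg[OF Q(1)] by auto
  have cA: "card ?A = 4" using four_elements[OF x'(1) x''(1)] d1 d2 by (metis minus_minus)
  obtain y where y: "y \<in> S" "y \<in> Q" "y \<notin> ?A" using outside_element[OF Q(1), of ?A] cA Q(2) by auto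
  have ny: "- y \<in> S" "- y \<in> Q" "- y \<notin> ?A" using y neg plane_neg[OF Q(1)] by (auto simp: minus_equation_iff)
  have cB: "card (?A \<union> {y, - y}) = 6" using cA y ny neq_neg[OF y(1)] by (subst card_Un_disjoint) auto
  obtain y' where y': "y' \<in> S" "y' \<in> Q" "y' \<notin> ?A \<union> {y, - y}" using outside_element[OF Q(1), of "?A \<union> {y, - y}"] cB Q(2) by auto
  have ny': "- y' \<in> S" "- y' \<in> Q" "- y' \<notin> ?A \<union> {y, - y}" using y' neg plane_neg[OF Q(1)] by (auto simp: minus_equation_iff)
  have cC: "card (?A \<union> {y, - y, y', - y'}) = 8"
  proof -
    have "?A \<union> {y, - y, y', - y'} = (?A \<union> {y, - y}) \<union> {y', - y'}" by auto
    also have "card \<dots> = 8" using cB y' ny' neq_neg[OF y'(1)] by (subst card_Un_disjoint) auto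
    finally show ?thesis .
  qed
  have eq: "S \<inter> Q = ?A \<union> {y, - y, y', - y'}"
    using card_subset_eq[of "S \<inter> Q" "?A \<union> {y, - y, y', - y'}"] subA y ny y' ny' finite_S cC Q(2) by auto
  show "\<exists>y y'. y \<in> S \<and> y' \<in> S \<and> y' \<noteq> y \<and> y' \<noteq> - y \<and> S \<inter> Q = ?A \<union> {y, - y, y', - y'} \<and> y \<notin> ?A \<and> y' \<notin> ?A"
    using y y' eq by (intro exI[of _ y] exI[of _ y']) auto
  have o: "x \<bullet> v = 0" if v: "v \<in> S" "v \<in> Q" "v \<notin> ?A" for v
  proof -
    have "v \<noteq> x" "v \<noteq> - x" using xQ v(2) plane_neg[OF Q(1), of v] by auto
    then show ?thesis using card4_orthogonal[OF planesI[OF x(1) v(1)] c4[OF v] x(1) _ v(1)] by (auto intro: span_base)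
  qed
  assume w: "w \<in> Q"
  have "Q = span {y, y'}" using plane_eq_span[OF Q(1) y(1,2) y'(1,2)] y'(3) by auto
  then show "x \<bullet> w = 0" using orthogonal_plane[OF y(1) y'(1), of w x] o[OF y] o[of y'] y' w by auto
qed

text \<open>Besides the axes \<open>x'\<close> and \<open>x''\<close>, the plane \<open>Q\<close>
  contains two lines, given by \<open>y\<close> and \<open>y'\<close>. Together with an off-axis
  vector \<open>w\<close> of \<open>Q'\<close>, each of them spans a plane of six elements, so its
  inner product with \<open>w\<close> has square \<open>1 / 4\<close>. As \<open>w\<close> is
  orthogonal to \<open>x'\<close>, only the coordinate along \<open>x''\<close> enters; hence
  \<open>y\<close> and \<open>y'\<close> agree in its square, and the local frame gives
  \<open>1 / 2\<close>: they are the two diagonals.\<close>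

lemma diagonal_roots:
  assumes n: "n = 3"
    and Q: "Q \<in> planes S" "card (S \<inter> Q) = 8" "Q' \<in> planes S" "card (S \<inter> Q') = 8" "Q'' \<in> planes S" "card (S \<inter> Q'') = 8"
      "Q \<noteq> Q'" "Q \<noteq> Q''" "Q' \<noteq> Q''"
    and x: "x \<in> S" "x \<in> Q'" "x \<in> Q''" and x': "x' \<in> S" "x' \<in> Q" "x' \<in> Q''" and x'': "x'' \<in> S" "x'' \<in> Q" "x'' \<in> Q'"
  shows "x' + x'' \<in> lines" "x' - x'' \<in> lines"
proof -
  note p = pole[OF assms]
  note p' = pole[OF n Q(3,4) Q(1,2) Q(5,6) Q(7)[symmetric] Q(9) Q(8) x' x x''(1) x''(3) x''(2)]
  have c5: "count 5 = 0" using count_cases n by auto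
  obtain y y' where y: "y \<in> S" "y' \<in> S" "y' \<noteq> y" "y' \<noteq> - y" and SQ: "S \<inter> Q = {x', - x', x'', - x''} \<union> {y, - y, y', - y'}"
    and yn: "y \<notin> {x', - x', x'', - x''}" "y' \<notin> {x', - x', x'', - x''}" using p(6) by blast
  obtain w where w: "w \<in> S" "w \<in> Q'" "w \<notin> {x, - x, x'', - x''}" using p'(6) by blast
  have yQ: "y \<in> Q" "y' \<in> Q" using SQ by auto
  have o: "x' \<bullet> x'' = 0" using p'(4)[of x''] x''(3) by simp
  have self: "x \<bullet> x = 1" "x' \<bullet> x' = 1" "x'' \<bullet> x'' = 1" using dot_self x x' x'' by blast+
  have triple: "(u \<bullet> w)\<^sup>2 = 1 / 4" if u: "u \<in> S" "u \<in> Q" "u \<notin> {x', - x', x'', - x''}" for u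
  proof -
    have uQ': "u \<notin> Q'" using planes_at_inter[OF Q(1,3,7) x''(1-3), of u] u by auto
    have uQ'': "u \<notin> Q''" using planes_at_inter[OF Q(1,5,8) x'(1-3), of u] u by auto
    have wQ: "w \<notin> Q" using planes_at_inter[OF Q(1,3,7) x''(1-3), of w] w by auto
    have ne: "w \<noteq> u" "w \<noteq> - u" using wQ u(2) plane_neg[OF Q(1), of u] by auto
    have P: "span {u, w} \<in> planes S" using planesI[OF u(1) w(1) ne] .
    have inP: "u \<in> span {u, w}" "w \<in> span {u, w}" by (auto intro: span_base)
    have mu: "mult_at u 4 = mult_at u 2" "mult_at u 4 \<ge> 1" "mult_at u 3 + 2 * mult_at u 4 = 4"
      using at_sums[OF u(1)] at_count_zero[OF c5, of u] n at_pos[OF Q(1) u(2), of 4] Q(2) by simp_all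
    have nx: "u \<noteq> x" "u \<noteq> - x" using p(1) u(2) plane_neg[OF Q(1), of u] by auto
    have xu: "span {x, u} \<in> planes S" using planesI[OF x(1) u(1) nx] .
    have card_xu: "card (S \<inter> span {x, u}) = 4" using p(5)[OF u] .
    \<comment> \<open>A second big plane through \<open>u\<close> would be a fourth plane with eight
      elements.\<close>
    have m4: "mult_at u 4 = 1"
    proof (rule ccontr)
      assume "mult_at u 4 \<noteq> 1"
      then have "mult_at u 4 \<noteq> card {Q}" by simp
      moreover have "{Q} \<subseteq> {P \<in> planes S. u \<in> P \<and> card (S \<inter> P) = 2 * 4}" using Q u by auto
      ultimately have "{P \<in> planes S. u \<in> P \<and> card (S \<inter> P) = 2 * 4} \<noteq> {Q}" unfolding mult_at_def by metis
      then obtain R where R: "R \<in> planes S" "u \<in> R" "card (S \<inter> R) = 8" "R \<noteq> Q" using Q u by auto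
      have "R \<noteq> Q'" "R \<noteq> Q''" using uQ' uQ'' R by auto
      then have "card {R, Q, Q', Q''} = 4" using R Q by simp
      moreover have "card {R, Q, Q', Q''} \<le> count 4" unfolding count_def
        by (rule card_mono) (use R Q finite_planes in auto)
      moreover have "count 4 = 3" using count_cases n by auto
      ultimately show False by simp
    qed
    have "card (S \<inter> span {u, w}) \<noteq> 8"
    proof
      assume "card (S \<inter> span {u, w}) = 8"
      then have "span {u, w} = Q" using plane_unique_at[of u 4 "span {u, w}" Q] m4 P inP Q u by simp
      then show False using wQ inP by simp
    qed
    moreover have "card (S \<inter> span {u, w}) \<noteq> 4"
    proof
      assume "card (S \<inter> span {u, w}) = 4"
      then have eq: "span {u, w} = span {x, u}"
        using plane_unique_at[of u 2 "span {u, w}" "span {x, u}"] m4 mu P inP xu card_xu by (simp add: span_base)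
      then have "x \<in> span {u, w}" by (simp add: span_base)
      then have "span {u, w} = Q'" using two_elements[OF x(1) w(1) _ _ P Q(3) _ inP(2) x(2) w(2)] w(3) by simp
      then show False using uQ' inP by simp
    qed
    moreover have "card (S \<inter> span {u, w}) \<noteq> 10" using count_zero[OF c5 P] by simp
    ultimately have "card (S \<inter> span {u, w}) = 6" using plane_card_cases[OF P] by simp
    then show ?thesis using card6_dot[OF P _ u(1) inP(1) w(1) inP(2) ne] by simp
  qed
  have ex: "u = (u \<bullet> x') *\<^sub>R x' + (u \<bullet> x'') *\<^sub>R x''" if uQ: "u \<in> Q" for u
  proof -
    have "Q = span {x', x''}" using plane_eq_span[OF Q(1) x'(1,2) x''(1,2)] p(2,3) by (metis minus_minus)
    then obtain s t where u: "u = s *\<^sub>R x' + t *\<^sub>R x''" using uQ by (auto simp: span_insert algebra_simps)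
    then have "u \<bullet> x' = s" "u \<bullet> x'' = t" using o self by (simp_all add: inner_left_distrib inner_commute[of x'' x'])
    then show ?thesis using u by simp
  qed
  have uw: "(u \<bullet> x'')\<^sup>2 * (w \<bullet> x'')\<^sup>2 = 1 / 4" if u: "u \<in> S" "u \<in> Q" "u \<notin> {x', - x', x'', - x''}" for u
  proof -
    have "x' \<bullet> w = 0" using p'(4)[OF w(2)] .
    then have "u \<bullet> w = (u \<bullet> x'') * (x'' \<bullet> w)" by (subst ex[OF u(2)]) (simp add: inner_left_distrib)
    then show ?thesis using triple[OF u] by (simp add: power_mult_distrib inner_commute)
  qed
  have "(w \<bullet> x'')\<^sup>2 \<noteq> 0" using uw[OF y(1) yQ(1) yn(1)] by auto
  then have eq: "(y \<bullet> x'')\<^sup>2 = (y' \<bullet> x'')\<^sup>2"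
    using uw[OF y(1) yQ(1) yn(1)] uw[OF y(2) yQ(2) yn(2)] by (metis mult_right_cancel)
  have s8: "sum f (S \<inter> Q) = f x' + f (- x') + f x'' + f (- x'') + f y + f (- y) + f y' + f (- y')" for f :: "real^3 \<Rightarrow> real"
  proof -
    have "{x', - x', x'', - x''} \<inter> {y, - y, y', - y'} = {}" using yn by (auto simp: minus_equation_iff)
    then have "sum f (S \<inter> Q) = sum f {x', - x', x'', - x''} + sum f {y, - y, y', - y'}"
      unfolding SQ by (intro sum.union_disjoint) auto
    moreover have "x'' \<noteq> x'" "x'' \<noteq> - x'" using p(2,3) by auto
    ultimately show ?thesis using sum_four[OF x'(1) x''(1), of f] sum_four[OF y(1,2,3,4), of f] by simp
  qed
  have "(\<Sum>v\<in>S \<inter> Q. (v \<bullet> x'') * (v \<bullet> x'')) = 4" using local_frame[OF Q(1) x''(2,2)] Q(2) self by simp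
  then have "2 + 2 * (y \<bullet> x'')\<^sup>2 + 2 * (y' \<bullet> x'')\<^sup>2 = 4"
    unfolding s8 using o self by (simp add: power2_eq_square)
  then have half: "(y \<bullet> x'')\<^sup>2 = 1 / 2" "(y' \<bullet> x'')\<^sup>2 = 1 / 2" using eq by simp_all
  have diag: "\<exists>c. c \<noteq> 0 \<and> (u = c *\<^sub>R (x' + x'') \<or> u = c *\<^sub>R (x' - x''))" if u: "u \<in> S" "u \<in> Q" "(u \<bullet> x'')\<^sup>2 = 1 / 2" for u
  proof -
    have "u \<bullet> u = (u \<bullet> x') * (u \<bullet> x') + (u \<bullet> x'') * (u \<bullet> x'')"
      by (subst (2) ex[OF u(2)]) (simp add: inner_right_distrib)
    then have "(u \<bullet> x')\<^sup>2 = (u \<bullet> x'')\<^sup>2" using u dot_self[OF u(1)] by (simp add: power2_eq_square)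
    then have "u \<bullet> x'' = u \<bullet> x' \<or> u \<bullet> x'' = - (u \<bullet> x')" by (metis power2_eq_iff)
    moreover have "u \<bullet> x' \<noteq> 0" using u \<open>(u \<bullet> x')\<^sup>2 = (u \<bullet> x'')\<^sup>2\<close> by auto
    moreover have "u = (u \<bullet> x') *\<^sub>R (x' + x'')" if "u \<bullet> x'' = u \<bullet> x'"
      using ex[OF u(2)] unfolding that by (simp add: scaleR_add_right)
    moreover have "u = (u \<bullet> x') *\<^sub>R (x' - x'')" if "u \<bullet> x'' = - (u \<bullet> x')"
      using ex[OF u(2)] unfolding that by (simp add: scaleR_diff_right)
    ultimately show ?thesis by blast
  qed
  have par: False if u: "u \<in> S" "v \<in> S" "v \<noteq> u" "v \<noteq> - u" "u = c *\<^sub>R d" "v = c' *\<^sub>R d" "c \<noteq> 0" for u v d :: "real^3" and c c'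
  proof -
    have "v = (c' / c) *\<^sub>R u" using u by simp
    then show False using parallel_in_S[of u "c' / c"] u by auto
  qed
  obtain c d where c: "c \<noteq> 0" "y = c *\<^sub>R (x' + x'') \<or> y = c *\<^sub>R (x' - x'')"
    and d: "d \<noteq> 0" "y' = d *\<^sub>R (x' + x'') \<or> y' = d *\<^sub>R (x' - x'')"
    using diag[OF y(1) yQ(1) half(1)] diag[OF y(2) yQ(2) half(2)] by blast
  have "y = c *\<^sub>R (x' + x'') \<and> y' = d *\<^sub>R (x' - x'') \<or> y = c *\<^sub>R (x' - x'') \<and> y' = d *\<^sub>R (x' + x'')"
    using c d par[OF y(1,2,3,4) _ _ c(1)] by blast
  then show "x' + x'' \<in> lines" "x' - x'' \<in> lines"
    using c(1) d(1) y(1,2) lines_scale S_lines by metis+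
qed

lemma roots_B3:
  assumes n: "n = 3"
  obtains e1 e2 e3 where "orthonormal e1 e2 e3" "comb e1 e2 e3 ` roots 3 \<subseteq> lines"
proof -
  have c4: "count 4 = 3" using count_cases n by auto
  then obtain Q Q' Q'' where QQ: "{P \<in> planes S. card (S \<inter> P) = 8} = {Q, Q', Q''}" "Q \<noteq> Q'" "Q' \<noteq> Q''" "Q \<noteq> Q''"
    unfolding count_def by (auto simp: card_3_iff)
  then have Q: "Q \<in> planes S" "card (S \<inter> Q) = 8" "Q' \<in> planes S" "card (S \<inter> Q') = 8" "Q'' \<in> planes S" "card (S \<inter> Q'') = 8"
    by blast+
  have k: "4 * real 4 * count 4 - 12 * real n \<ge> 2 * real (count 4) * (real (count 4) - 1)" using c4 n by simp
  obtain x where x: "x \<in> S" "x \<in> Q'" "x \<in> Q''" using planes_meet[OF k, of Q' Q''] Q QQ by auto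
  obtain x' where x': "x' \<in> S" "x' \<in> Q" "x' \<in> Q''" using planes_meet[OF k, of Q Q''] Q QQ by auto
  obtain x'' where x'': "x'' \<in> S" "x'' \<in> Q" "x'' \<in> Q'" using planes_meet[OF k, of Q Q'] Q QQ by auto
  note ne = QQ(2) QQ(4) QQ(3)
  have o1: "x \<bullet> x' = 0" "x \<bullet> x'' = 0"
    using pole(4)[OF n Q ne x x' x''] x' x'' by blast+
  have o2: "x' \<bullet> x'' = 0"
    using pole(4)[OF n Q(3,4) Q(1,2) Q(5,6) QQ(2)[symmetric] QQ(3) QQ(4) x' x x''(1) x''(3) x''(2), of x''] x'' by blast
  have on: "orthonormal x x' x''"
    unfolding orthonormal_def using o1 o2 dot_self x x' x'' by blast
  have 1: "x' + x'' \<in> lines" "x' - x'' \<in> lines"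
    using diagonal_roots[OF n Q ne x x' x''] by blast+
  have 2: "x + x'' \<in> lines" "x - x'' \<in> lines"
    using diagonal_roots[OF n Q(3,4) Q(1,2) Q(5,6) QQ(2)[symmetric] QQ(3) QQ(4) x' x x''(1) x''(3) x''(2)] by blast+
  have 3: "x + x' \<in> lines" "x - x' \<in> lines"
    using diagonal_roots[OF n Q(5,6) Q(1,2) Q(3,4) QQ(4)[symmetric] QQ(3)[symmetric] QQ(2) x''(1-3) x(1) x(3) x(2) x'(1) x'(3) x'(2)] by blast+
  have "comb x x' x'' ` roots 3 \<subseteq> lines"
    unfolding roots_def comb_def using 1 2 3 S_lines x x' x'' by auto
  then show ?thesis using that on by blast
qed

text \<open>For \<open>n = 4\<close>, every plane with eight elements contains most of the few vectors outside the two
  planes with ten elements.\<close>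

lemma n_neq_4: "n \<noteq> 4"
proof
  assume n: "n = 4"
  have c: "count 5 = 2" "count 4 = 3" using count_cases n by auto
  obtain P Q where PQ: "{P \<in> planes S. card (S \<inter> P) = 10} = {P, Q}" "P \<noteq> Q"
    using c(1) unfolding count_def by (auto simp: card_2_iff)
  then have P: "P \<in> planes S" "card (S \<inter> P) = 10" "Q \<in> planes S" "card (S \<inter> Q) = 10" by blast+
  obtain R1 R2 where R: "R1 \<in> planes S" "card (S \<inter> R1) = 8" "R2 \<in> planes S" "card (S \<inter> R2) = 8" "R1 \<noteq> R2"
    using c(2) unfolding count_def by (auto simp: card_3_iff)
  have le2: "card (S \<inter> A \<inter> B) \<le> 2" if "A \<in> planes S" "B \<in> planes S" "A \<noteq> B" for A B
  proof (cases "S \<inter> A \<inter> B = {}")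
    case False
    then obtain x where x: "x \<in> S \<inter> A \<inter> B" by blast
    have "S \<inter> A \<inter> B \<subseteq> {x, - x}" using planes_at_inter[of A B x] that x by auto
    then have "card (S \<inter> A \<inter> B) \<le> card {x, - x}" by (intro card_mono) auto
    also have "\<dots> \<le> 2" using card_insert_le_m1[of 2 "{- x}" x] by simp
    finally show ?thesis .
  qed simp
  let ?U = "S - (P \<union> Q)"
  \<comment> \<open>A plane with eight elements shares at most two with each of \<open>P\<close> and
    \<open>Q\<close>.\<close>
  have many: "card (?U \<inter> R) \<ge> 4" if "R \<in> planes S" "card (S \<inter> R) = 8" for R
  proof -
    have ne: "R \<noteq> P" "R \<noteq> Q" using that P by auto
    have "S \<inter> R = (?U \<inter> R) \<union> (S \<inter> R \<inter> P) \<union> (S \<inter> R \<inter> Q)" by auto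
    then have "8 \<le> card (?U \<inter> R) + card (S \<inter> R \<inter> P) + card (S \<inter> R \<inter> Q)"
      using card_Un_le[of "(?U \<inter> R) \<union> (S \<inter> R \<inter> P)" "S \<inter> R \<inter> Q"] card_Un_le[of "?U \<inter> R" "S \<inter> R \<inter> P"] that(2) by simp
    then show ?thesis using le2[OF that(1) P(1) ne(1)] le2[OF that(1) P(3) ne(2)] by simp
  qed
  have cU: "card ?U = 24 - (20 - card (S \<inter> P \<inter> Q))"
  proof -
    have "card (S \<inter> (P \<union> Q)) + card (S \<inter> P \<inter> Q) = card (S \<inter> P) + card (S \<inter> Q)"
      using card_Un_Int[of "S \<inter> P" "S \<inter> Q"] finite_S by (simp add: Int_Un_distrib Int_ac)
    moreover have "card ?U = card S - card (S \<inter> (P \<union> Q))" using finite_S by (simp add: card_Diff_subset_Int)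
    ultimately show ?thesis using P card_S n by simp
  qed
  have nU: "- u \<in> ?U" if "u \<in> ?U" for u using that neg plane_neg[OF P(1), of "- u"] plane_neg[OF P(3), of "- u"] by auto
  show False
  proof (cases "S \<inter> P \<inter> Q = {}")
    \<comment> \<open>Here only four elements lie outside \<open>P\<close> and \<open>Q\<close>, and
      both \<open>R1\<close> and \<open>R2\<close> contain all of them.\<close>
    case True
    then have "card ?U = 4" using cU by simp
    then have "card ?U \<le> card (?U \<inter> R1)" "card ?U \<le> card (?U \<inter> R2)" using many[OF R(1,2)] many[OF R(3,4)] by simp_all
    then have "?U \<inter> R1 = ?U" "?U \<inter> R2 = ?U"
      using finite_S card_seteq[of ?U "?U \<inter> R1"] card_seteq[of ?U "?U \<inter> R2"] by blast+
    then have "?U \<subseteq> S \<inter> R1 \<inter> R2" by blast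
    then have "card ?U \<le> card (S \<inter> R1 \<inter> R2)" using finite_S by (intro card_mono) auto
    then show False using le2[OF R(1,3,5)] \<open>card ?U = 4\<close> by simp
  next
    case False
    then obtain x where x: "x \<in> S" "x \<in> P" "x \<in> Q" by blast
    have "S \<inter> P \<inter> Q = {x, - x}"
      using planes_at_inter[OF P(1,3) PQ(2) x] x neg plane_neg[OF P(1)] plane_neg[OF P(3)] by auto
    then have cU6: "card ?U = 6" using cU neq_neg[OF x(1)] by simp
    have "card {P, Q} \<le> mult_at x 5" by (rule mult_at_ge) (use P x in auto)
    then have m: "mult_at x 3 = 0 \<and> mult_at x 4 = 0 \<and> mult_at x 5 = 2" using at_sums[OF x(1)] PQ(2) n by simp
    have o: "x \<bullet> u = 0" if u: "u \<in> ?U" for u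
    proof -
      have ne: "u \<noteq> x" "u \<noteq> - x" using u x plane_neg[OF P(1)] by auto
      have T: "span {x, u} \<in> planes S" "x \<in> span {x, u}" "u \<in> span {x, u}" using planesI[OF x(1) _ ne] u by (auto intro: span_base)
      have "card (S \<inter> span {x, u}) \<noteq> 10"
      proof
        assume "card (S \<inter> span {x, u}) = 10"
        then have "span {x, u} \<in> {P, Q}" using PQ(1) T(1) by blast
        then show False using u T(3) by auto
      qed
      moreover have "card (S \<inter> span {x, u}) \<noteq> 6" "card (S \<inter> span {x, u}) \<noteq> 8"
        using at_pos[OF T(1,2), of 3] at_pos[OF T(1,2), of 4] m by auto
      ultimately have "card (S \<inter> span {x, u}) = 4" using plane_card_cases[OF T(1)] by simp
      then show ?thesis using card4_orthogonal[OF T(1) _ x(1) T(2) _ T(3) ne] u by simp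
    qed
    obtain u where u: "u \<in> ?U" using cU6 by (metis all_not_in_conv card.empty zero_neq_numeral)
    obtain v where v: "v \<in> ?U" "v \<noteq> u" "v \<noteq> - u"
    proof -
      have "card {u, - u} \<le> 2" using card_insert_le_m1[of 2 "{- u}" u] by simp
      then have "\<not> ?U \<subseteq> {u, - u}" using card_mono[of "{u, - u}" ?U] cU6 by auto
      then show ?thesis using that by blast
    qed
    \<comment> \<open>All elements outside \<open>P\<close> and \<open>Q\<close> are orthogonal to
      \<open>x\<close>, so every plane with eight elements is the plane orthogonal to
      \<open>x\<close>; but \<open>R1\<close> and \<open>R2\<close> differ.\<close>
    have RK: "R = span {u, v}" if RR: "R \<in> planes S" "card (S \<inter> R) = 8" for R
    proof -
      have "\<not> ?U \<inter> R \<subseteq> {}" using many[OF RR] by auto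
      then obtain w where w: "w \<in> ?U" "w \<in> R" by blast
      have "card {w, - w} \<le> 2" using card_insert_le_m1[of 2 "{- w}" w] by simp
      then have "\<not> ?U \<inter> R \<subseteq> {w, - w}" using card_mono[of "{w, - w}" "?U \<inter> R"] many[OF RR] by auto
      then obtain w' where w': "w' \<in> ?U" "w' \<in> R" "w' \<noteq> w" "w' \<noteq> - w" by blast
      have R': "R = span {w, w'}" using plane_eq_span[OF RR(1), of w w'] w w' by blast
      have x0: "x \<noteq> 0" using nonzero x by blast
      have "span {w, w'} = {y. x \<bullet> y = 0}" using plane_eq_perp[of w w' x] w w' x0 o by blast
      moreover have "span {u, v} = {y. x \<bullet> y = 0}" using plane_eq_perp[of u v x] u v x0 o by blast
      ultimately show ?thesis using R' by simp
    qed
    show False using RK[OF R(1,2)] RK[OF R(3,4)] R(5) by simp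
  qed
qed

end

section \<open>Planes closed under reflections have equal gaps\<close>

lemma reflection_span:
  "reflection x ` span {a, b} = span {reflection x a, reflection x b}"
proof -
  have "reflection x ` span {a, b} = span (reflection x ` {a, b})"
    using linear_span_image[OF linear_reflection] by metis
  then show ?thesis by simp
qed

context unit_system
begin

lemma enumeration_member:
  assumes en: "enumerates P a e \<theta> r" and t: "0 \<le> t" "t < pi" "circ a e t \<in> S"
  shows "\<exists>k<r. t = \<theta> k"
proof -
  note b = enum_basic[OF en]
  have aP: "a \<in> P" "e \<in> P" using en unfolding enumerates_def by blast+
  have inP: "circ a e t \<in> P"
    unfolding circ_def using subspace_plane[OF b(1)] aP by (intro subspace_add subspace_mul)
  then have "circ a e t \<in> S \<inter> P" using t by blast
  then obtain k where k: "k < r" "circ a e t = circ a e (\<theta> k) \<or> circ a e t = - circ a e (\<theta> k)"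
    unfolding b(9) by blast
  have \<theta>k: "0 \<le> \<theta> k" "\<theta> k < pi" using \<theta>_range[OF en, of k] \<theta>_less[OF en, of k r] k(1) b(8) by auto
  have ca: "circ a e s \<bullet> a = cos s" "circ a e s \<bullet> e = sin s" for s
  proof -
    have "a \<bullet> a = 1" "e \<bullet> e = 1" "e \<bullet> a = 0" "a \<bullet> e = 0" using b by (simp_all add: norm_eq_1 inner_commute)
    then show "circ a e s \<bullet> a = cos s" "circ a e s \<bullet> e = sin s" by (simp_all add: circ_def inner_left_distrib)
  qed
  from k(2) have "t = \<theta> k"
  proof
    assume "circ a e t = circ a e (\<theta> k)"
    then have "cos t = cos (\<theta> k)" using ca(1)[of t] ca(1)[of "\<theta> k"] by simp
    then show ?thesis using cos_inj_pi[of t "\<theta> k"] t \<theta>k by simp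
  next
    assume *: "circ a e t = - circ a e (\<theta> k)"
    then have "sin t = - sin (\<theta> k)" using ca(2)[of t] ca(2)[of "\<theta> k"] by simp
    moreover have "sin t \<ge> 0" "sin (\<theta> k) \<ge> 0" using t \<theta>k by (auto intro: sin_ge_zero)
    ultimately have "sin t = 0" "sin (\<theta> k) = 0" by simp_all
    then have z: "t = 0" "\<theta> k = 0" using t \<theta>k sin_gt_zero[of t] sin_gt_zero[of "\<theta> k"] by force+
    then have "a = - a" using * by (simp add: circ_def)
    then have "a \<bullet> a = - (a \<bullet> a)" by (metis inner_minus_left)
    then show ?thesis using b(2) by (simp add: norm_eq_1)
  qed
  then show ?thesis using k(1) by blast
qed

text \<open>In terms of angles, the reflection takes \<open>s\<close> to \<open>2 * t - s\<close>
  and adds a half turn, because its mirror is orthogonal to \<open>circ a e t\<close>.\<close>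

lemma circ_reflection:
  assumes "norm a = 1" "norm e = 1" "a \<bullet> e = 0"
  shows "reflection (circ a e t) (circ a e s) = - circ a e (2 * t - s)"
proof -
  have "circ a e t \<bullet> circ a e t = 1" using circ_dot[OF assms, of t t] by simp
  then have r: "reflection (circ a e t) (circ a e s) = circ a e s - (2 * cos (t - s)) *\<^sub>R circ a e t"
    using reflection_unit circ_dot[OF assms, of t s] by simp
  have c: "cos s - 2 * cos (t - s) * cos t = - cos (2 * t - s)"
  proof -
    have "cos (2 * t - s) = cos (t + (t - s))" "cos s = cos (t - (t - s))" by simp_all
    then show ?thesis by (simp only: cos_add cos_diff[of t "t - s"]) (simp add: algebra_simps)
  qed
  have d: "sin s - 2 * cos (t - s) * sin t = - sin (2 * t - s)"
  proof -
    have "sin (2 * t - s) = sin (t + (t - s))" "sin s = sin (t - (t - s))" by simp_all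
    then show ?thesis by (simp only: sin_add sin_diff[of t "t - s"]) (simp add: algebra_simps)
  qed
  have "circ a e s - (2 * cos (t - s)) *\<^sub>R circ a e t = (cos s - 2 * cos (t - s) * cos t) *\<^sub>R a + (sin s - 2 * cos (t - s) * sin t) *\<^sub>R e"
    by (simp add: circ_def algebra_simps)
  then show ?thesis unfolding r c d by (simp add: circ_def)
qed

text \<open>Reflecting one neighbour of a ray to its other side would put an element strictly inside
  the larger of two unequal adjacent gaps.\<close>

lemma equal_gaps:
  assumes en: "enumerates P a e \<theta> r"
    and cl: "\<And>x y. x \<in> S \<Longrightarrow> y \<in> S \<Longrightarrow> reflection x y \<in> S" and i: "i < r"
  shows "\<theta> (Suc i) - \<theta> i = pi / r"
proof -
  note b = enum_basic[OF en]
  have mem: "circ a e (2 * \<theta> j - \<theta> k) \<in> S" if "j \<le> r" "k \<le> r" for j k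
    using cl[of "circ a e (\<theta> j)" "circ a e (\<theta> k)"] z_mem[OF en that(1)] z_mem[OF en that(2)]
    unfolding circ_reflection[OF b(2,3,4)] by (simp add: neg_iff)
  have no: False if k: "k < r" "\<theta> k < t" "t < \<theta> (Suc k)" and tS: "circ a e t \<in> S" for k t
  proof -
    have "0 \<le> t" "t < pi" using k \<theta>_range[OF en, of k] \<theta>_range[OF en, of "Suc k"] by auto
    then obtain l where l: "l < r" "t = \<theta> l" using enumeration_member[OF en _ _ tS] by blast
    then have "\<not> l \<le> k" "\<not> Suc k \<le> l"
      using k \<theta>_less[OF en, of l k] \<theta>_less[OF en, of "Suc k" l] by (auto simp: le_less)
    then show False by simp
  qed
  have step: "\<theta> (Suc (Suc j)) - \<theta> (Suc j) = \<theta> (Suc j) - \<theta> j" if j: "Suc j < r" for j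
  proof (rule ccontr)
    assume ne: "\<not> ?thesis"
    have l: "\<theta> j < \<theta> (Suc j)" "\<theta> (Suc j) < \<theta> (Suc (Suc j))" using \<theta>_less[OF en] j by simp_all
    show False
    proof (cases "\<theta> (Suc j) - \<theta> j < \<theta> (Suc (Suc j)) - \<theta> (Suc j)")
      case True
      then show False using no[of "Suc j" "2 * \<theta> (Suc j) - \<theta> j"] mem[of "Suc j" j] j l by simp
    next
      case False
      then show False using no[of j "2 * \<theta> (Suc j) - \<theta> (Suc (Suc j))"] mem[of "Suc j" "Suc (Suc j)"] j l ne by simp
    qed
  qed
  have all: "\<theta> (Suc j) - \<theta> j = \<theta> 1 - \<theta> 0" if "j < r" for j
    using that by (induction j) (use step in auto)
  have "pi = (\<Sum>j<r. \<theta> (Suc j) - \<theta> j)" using sum_gaps[OF en] by simp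
  also have "\<dots> = (\<Sum>j<r. \<theta> 1 - \<theta> 0)" by (rule sum.cong[OF refl], rule all) simp
  finally have "pi = r * (\<theta> 1 - \<theta> 0)" by simp
  then have "\<theta> 1 - \<theta> 0 = pi / r" using b(6) by (simp add: field_simps)
  then show ?thesis using all[OF i] by simp
qed

lemma closed_wedge_angle:
  assumes cl: "\<And>x y. x \<in> S \<Longrightarrow> y \<in> S \<Longrightarrow> reflection x y \<in> S"
    and w: "wedge x y" and c: "card (S \<inter> span {x, y}) = 2 * r"
  shows "ang x y = pi / r"
proof -
  have P: "span {x, y} \<in> planes S" using w planesI by (auto simp: wedge_def)
  obtain a e \<theta> r' where en': "enumerates (span {x, y}) a e \<theta> r'" using enumeration_exists[OF P] .
  have "r' = r" using enum_basic(5)[OF en'] c by simp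
  then have en: "enumerates (span {x, y}) a e \<theta> r" using en' by simp
  have "(x, y) \<in> {(u, v). wedge u v \<and> u \<in> span {x, y} \<and> v \<in> span {x, y}}" using w by (simp add: span_base)
  then obtain i where i: "i < r" "(x, y) \<in> gap_pairs a e \<theta> i" unfolding wedge_pairs[OF en] by blast
  have "ang (circ a e (\<theta> (Suc i))) (- circ a e (\<theta> i)) = \<theta> (Suc i) - \<theta> i"
    using z_dot[OF en, of "Suc i" i] \<theta>_gap[OF en, of i "Suc i"] i by (simp add: ang_def arccos_cos)
  then have "ang x y = \<theta> (Suc i) - \<theta> i"
    using i(2) unfolding gap_pairs_def[OF en] by (auto simp: ang_def inner_commute)
  then show ?thesis using equal_gaps[OF en cl i(1)] by simp
qed

end

text \<open>\<open>pi / 5\<close> satisfies \<open>cos (3 * x) = - cos (2 * x)\<close>, a cubic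
  equation for the cosine. Its factor \<open>c + 1\<close> is positive here, and the other factor is
  the quadratic equation of \<open>golden / 2\<close>.\<close>

lemma cos_pi_5: "cos (pi / 5) = golden / 2"
proof -
  define c where "c = cos (pi / 5)"
  have c0: "c > 0" unfolding c_def by (intro cos_gt_zero_pi) (use pi_gt_zero in linarith)+
  have d: "cos (2 * (pi / 5)) = 2 * c\<^sup>2 - 1" unfolding c_def by (rule cos_double_cos)
  have "cos (3 * (pi / 5)) = 4 * c ^ 3 - 3 * c" unfolding c_def by (rule cos_treble_cos)
  moreover have "cos (3 * (pi / 5)) = - cos (2 * (pi / 5))"
  proof -
    have "3 * (pi / 5) = pi - 2 * (pi / 5)" by simp
    then show ?thesis by (simp only: cos_pi_minus)
  qed
  ultimately have "4 * c ^ 3 - 3 * c + (2 * c\<^sup>2 - 1) = 0" using d by simp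
  moreover have "4 * c ^ 3 - 3 * c + (2 * c\<^sup>2 - 1) = (c + 1) * (4 * c\<^sup>2 - 2 * c - 1)"
    by (simp add: algebra_simps power2_eq_square power3_eq_cube)
  ultimately have "4 * c\<^sup>2 - 2 * c - 1 = 0" using c0 by simp
  then have "(2 * c - golden) * (2 * c + (golden - 1)) = 0"
    using golden_square by (simp add: algebra_simps power2_eq_square)
  moreover have "2 * c + (golden - 1) > 0" using c0 golden_gt_1 by simp
  ultimately show ?thesis by (simp add: c_def)
qed

section \<open>The case \<open>n = 5\<close>\<close>

context hirzebruch_system
begin

text \<open>The six points on a line have multiplicities 2, 3 or 5 that add up to 20, which allows
  at most two of multiplicity 5. The six planes with ten elements give 60 incidences with the 30
  elements, so two is attained everywhere.\<close>

lemma ten_planes: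
  assumes n: "n = 5"
  shows "x \<in> S \<Longrightarrow> mult_at x 5 = 2" "count 5 = 6" "count 4 = 0"
proof -
  show c: "count 5 = 6" "count 4 = 0" using count_cases n by auto
  have le: "mult_at a 5 \<le> 2" if "a \<in> S" for a
    using at_sums[OF that] at_count_zero[OF c(2), of a] n by simp
  have "(\<Sum>a\<in>S. 2 - mult_at a 5) = 0"
  proof -
    have "(\<Sum>a\<in>S. 2 - mult_at a 5) = (\<Sum>a\<in>S. 2) - (\<Sum>a\<in>S. mult_at a 5)"
      using le by (intro sum_subtractf_nat) auto
    then show ?thesis using sum_at[of 5] c(1) card_S n by simp
  qed
  then have "2 - mult_at a 5 = 0" if "a \<in> S" for a using finite_S that by simp
  then show "x \<in> S \<Longrightarrow> mult_at x 5 = 2" using le by (metis diff_is_0_eq le_antisym)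
qed

abbreviation ten :: "(real^3) set \<Rightarrow> bool" where
  "ten U \<equiv> U \<in> planes S \<and> card (S \<inter> U) = 10"

lemma ten_meet:
  assumes n: "n = 5" and "ten U" "ten V" "U \<noteq> V"
  obtains x where "x \<in> S" "x \<in> U" "x \<in> V"
proof -
  have k: "4 * real 5 * count 5 - 12 * real n \<ge> 2 * real (count 5) * (real (count 5) - 1)"
    using ten_planes(2)[OF n] n by simp
  show ?thesis using planes_meet[OF k, of U V] assms that by auto
qed

lemma ten_not_three:
  assumes n: "n = 5" and "ten U" "ten V" "ten W" "U \<noteq> V" "U \<noteq> W" "V \<noteq> W" "x \<in> S" "x \<in> U" "x \<in> V"
  shows "x \<notin> W"
proof
  assume "x \<in> W"
  then have "card {U, V, W} \<le> mult_at x 5" by (intro mult_at_ge) (use assms in auto)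
  then show False using ten_planes(1)[OF n] assms by simp
qed

lemma ten_through:
  assumes n: "n = 5" and h: "h \<in> S"
  obtains P Q where "ten P" "ten Q" "P \<noteq> Q" "h \<in> P" "h \<in> Q"
    "\<And>W. ten W \<Longrightarrow> h \<in> W \<Longrightarrow> W = P \<or> W = Q"
proof -
  have "card {P \<in> planes S. h \<in> P \<and> card (S \<inter> P) = 2 * 5} = 2"
    using ten_planes(1)[OF n h] by (simp add: mult_at_def)
  then obtain P Q where "{P \<in> planes S. h \<in> P \<and> card (S \<inter> P) = 2 * 5} = {P, Q}" "P \<noteq> Q"
    by (auto simp: card_2_iff)
  then show ?thesis using that[of P Q] by auto
qed

lemma reflection_self: "x \<in> S \<Longrightarrow> y = x \<or> y = - x \<Longrightarrow> reflection x y = - y"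
  using dot_self[of x] by (auto simp: reflection_unit reflection_minus scaleR_2)

text \<open>Outside the planes with ten elements, \<open>h\<close> and \<open>k\<close> meet at a
  double or triple point, where \<open>reflection_small\<close> applies.\<close>

lemma reflection_off_ten:
  assumes n: "n = 5" and h: "h \<in> S" and k: "k \<in> S" and off: "\<And>W. ten W \<Longrightarrow> h \<in> W \<Longrightarrow> k \<notin> W"
  shows "reflection h k \<in> S"
proof (cases "k = h \<or> k = - h")
  case True
  then show ?thesis using reflection_self[OF h True] k by (simp add: neg_iff)
next
  case False
  have P: "span {h, k} \<in> planes S" "h \<in> span {h, k}" "k \<in> span {h, k}"
    using planesI[OF h k] False by (auto intro: span_base)
  have "card (S \<inter> span {h, k}) \<noteq> 10" using off P by blast
  moreover have "card (S \<inter> span {h, k}) \<noteq> 8" using count_zero[OF ten_planes(3)[OF n] P(1)] by simp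
  ultimately have "card (S \<inter> span {h, k}) \<le> 6" using plane_card_cases[OF P(1)] by auto
  then show ?thesis using reflection_small[OF P(1) _ h P(2) k P(3)] by simp
qed

lemma reflection_in_plane: "U \<in> planes S \<Longrightarrow> a \<in> U \<Longrightarrow> b \<in> U \<Longrightarrow> reflection a b \<in> U"
  unfolding reflection_def by (intro subspace_diff subspace_mul subspace_plane)

lemma reflection_image_self: "U \<in> planes S \<Longrightarrow> a \<in> U \<Longrightarrow> reflection a ` U = U"
proof
  assume U: "U \<in> planes S" "a \<in> U"
  then show "reflection a ` U \<subseteq> U" using reflection_in_plane by blast
  show "U \<subseteq> reflection a ` U"
  proof
    fix x assume "x \<in> U"
    then have "reflection a x \<in> U" using reflection_in_plane U by blast
    moreover have "x = reflection a (reflection a x)" by (simp add: reflection_reflection)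
    ultimately show "x \<in> reflection a ` U" by (rule image_eqI[rotated])
  qed
qed

lemma inj_reflection: "inj_on (reflection h) A"
  by (rule inj_on_inverseI[where g = "reflection h"]) (rule reflection_reflection)

text \<open>Two distinct planes share a line, so a common element of \<open>S\<close> is up to sign
  the only unit vector in both. This is how knowledge about reflected planes is turned back into
  membership of reflected vectors in \<open>S\<close>.\<close>

lemma meet_unit:
  assumes U: "U \<in> planes S" "V \<in> planes S" "U \<noteq> V" and v: "v \<in> S" "v \<in> U" "v \<in> V" and w: "w \<in> U" "w \<in> V" "w \<bullet> w = 1"
  shows "w = v \<or> w = - v"
proof -
  obtain e where e: "e \<in> U" "v \<bullet> e = 0" and basis: "\<forall>x\<in>U. x = (x \<bullet> v) *\<^sub>R v + (x \<bullet> e) *\<^sub>R e"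
    using plane_basis[OF U(1) v(1,2)] by metis
  have we: "w = (w \<bullet> v) *\<^sub>R v + (w \<bullet> e) *\<^sub>R e" using basis w(1) by blast
  have "w \<bullet> e = 0"
  proof (rule ccontr)
    assume n0: "w \<bullet> e \<noteq> 0"
    have "e = (1 / (w \<bullet> e)) *\<^sub>R ((w \<bullet> e) *\<^sub>R e)" using n0 by simp
    also have "(w \<bullet> e) *\<^sub>R e = w - (w \<bullet> v) *\<^sub>R v" using we by (metis add_diff_cancel_left')
    finally have eV: "e \<in> V"
      using subspace_plane[OF U(2)] v(3) w(2) by (metis subspace_diff subspace_mul)
    have UV: "U \<subseteq> V"
    proof
      fix x assume "x \<in> U"
      then have "x = (x \<bullet> v) *\<^sub>R v + (x \<bullet> e) *\<^sub>R e" using basis by blast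
      then show "x \<in> V" using subspace_plane[OF U(2)] v(3) eV by (metis subspace_add subspace_mul)
    qed
    obtain y where y: "y \<in> S" "y \<in> U" "y \<noteq> v" "y \<noteq> - v" using plane_partner[OF U(1) v(1,2)] by metis
    then show False using two_elements[OF v(1) y(1,3,4) U(1,2) v(2) y(2) v(3)] UV U(3) by blast
  qed
  then have wv: "w = (w \<bullet> v) *\<^sub>R v" using we by simp
  have "w \<bullet> w = w \<bullet> ((w \<bullet> v) *\<^sub>R v)" by (rule arg_cong[OF wv, of "\<lambda>u. w \<bullet> u"])
  then have "w \<bullet> w = (w \<bullet> v) * (w \<bullet> v)" by (simp only: inner_scaleR_right)
  then have "(w \<bullet> v)\<^sup>2 = 1" using w(3) by (simp add: power2_eq_square)
  then have "w \<bullet> v = 1 \<or> w \<bullet> v = -1" by (simp add: power2_eq_1_iff)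
  then show ?thesis
  proof
    assume "w \<bullet> v = 1" then show ?thesis using wv by simp
  next
    assume "w \<bullet> v = -1" then show ?thesis using wv by simp
  qed
qed

lemma reflected_plane:
  assumes "U \<in> planes S" "k \<in> S" "k \<in> U" "k' \<in> S" "k' \<in> U" "k' \<noteq> k" "k' \<noteq> - k"
    and "reflection h k \<in> S" "reflection h k' \<in> S"
  shows "reflection h ` U \<in> planes S"
proof -
  have U: "U = span {k, k'}" using plane_eq_span assms by blast
  have "reflection h k' \<noteq> reflection h k" "reflection h k' \<noteq> - reflection h k"
    using assms(6,7) inj_reflection[of h UNIV] by (auto simp: inj_on_def simp flip: reflection_minus)
  then show ?thesis unfolding U reflection_span using planesI assms(8,9) by blast
qed

text \<open>The six elements of \<open>K\<close> avoid both planes \<open>P\<close> and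
  \<open>Q\<close> through \<open>h\<close>, so their reflections stay in \<open>S\<close>, and the
  image of \<open>U\<close> has six or ten elements. If it has six, these are the images of
  \<open>K\<close>, and \<open>K\<close> inherits the geometry of three lines at sixty degrees;
  comparing the local frames of the image and of \<open>U\<close> at \<open>x\<close> then leaves
  \<open>x \<bullet> y = 0\<close>.\<close>

lemma reflected_ten:
  assumes n: "n = 5" and h: "h \<in> S" and U: "ten U" "h \<notin> U"
    and PQ: "ten P" "ten Q" "P \<noteq> Q" "h \<in> P" "h \<in> Q"
    and x: "x \<in> S" "x \<in> U" "x \<in> P" and y: "y \<in> S" "y \<in> U" "y \<in> Q"
    and K: "K = S \<inter> U - {x, - x, y, - y}"
  shows "ten (reflection h ` U) \<or>
    x \<bullet> y = 0 \<and> (\<forall>k\<in>K. \<forall>k'\<in>K. reflection k k' \<in> K \<and> (k' \<noteq> k \<and> k' \<noteq> - k \<longrightarrow> (k \<bullet> k')\<^sup>2 = 1 / 4))"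
proof -
  have ne: "U \<noteq> P" "U \<noteq> Q" using U PQ by blast+
  have xQ: "x \<notin> Q" using ten_not_three[OF n U(1) PQ(1,2) ne PQ(3) x] .
  have xy: "y \<noteq> x" "y \<noteq> - x" using xQ y plane_neg[of Q y] PQ(2) by auto
  have sub: "{x, - x, y, - y} \<subseteq> S \<inter> U" using x y neg plane_neg U(1) by auto
  have cK: "card K = 6" unfolding K using card_Diff_subset[OF _ sub] four_elements[OF x(1) y(1) xy] U(1) by simp
  have KU: "K \<subseteq> S \<inter> U" "finite K" using K finite_S by auto
  \<comment> \<open>An element of \<open>K\<close> in \<open>P\<close> or \<open>Q\<close> would be
    \<open>x\<close> or \<open>y\<close> up to sign.\<close>
  have hK: "reflection h k \<in> S" if k: "k \<in> K" for k
  proof (rule reflection_off_ten[OF n h])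
    show "k \<in> S" using k KU by blast
    fix W assume W: "ten W" "h \<in> W"
    have "W = P \<or> W = Q" using ten_not_three[OF n PQ(1,2) W(1) PQ(3) _ _ h PQ(4,5)] W(2) by blast
    moreover have "k \<notin> P" using planes_at_inter[of U P x k] k K U PQ ne x by auto
    moreover have "k \<notin> Q" using planes_at_inter[of U Q y k] k K U PQ ne y by auto
    ultimately show "k \<notin> W" by blast
  qed
  obtain k where k: "k \<in> K" using cK by (metis all_not_in_conv card.empty zero_neq_numeral)
  obtain k' where k': "k' \<in> K" "k' \<noteq> k" "k' \<noteq> - k"
  proof -
    have "card {k, - k} \<le> 2" using card_insert_le_m1[of 2 "{- k}" k] by simp
    then have "\<not> K \<subseteq> {k, - k}" using card_mono[of "{k, - k}" K] cK by auto
    then show ?thesis using that by blast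
  qed
  let ?R = "reflection h ` U"
  have R: "?R \<in> planes S" using reflected_plane[of U k k' h] U(1) k k' KU hK by blast
  have sK: "reflection h ` K \<subseteq> S \<inter> ?R" using hK KU by auto
  have csK: "card (reflection h ` K) = 6" using cK card_image[OF inj_reflection] by metis
  have ge6: "6 \<le> card (S \<inter> ?R)" using card_mono[OF _ sK] finite_S csK by simp
  have "card (S \<inter> ?R) \<noteq> 8" using count_zero[OF ten_planes(3)[OF n] R] by simp
  then consider "card (S \<inter> ?R) = 10" | "card (S \<inter> ?R) = 6" using plane_card_cases[OF R] ge6 by auto
  then show ?thesis
  proof cases
    case 1 then show ?thesis using R by blast
  next
    case 2
    then have eq: "S \<inter> ?R = reflection h ` K" using card_subset_eq[OF _ sK] finite_S csK by simp
    have quarter: "(p \<bullet> q)\<^sup>2 = 1 / 4" if "p \<in> K" "q \<in> K" "q \<noteq> p" "q \<noteq> - p" for p q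
    proof -
      have "reflection h q \<noteq> reflection h p" "reflection h q \<noteq> - reflection h p"
        using that inj_reflection[of h UNIV] by (auto simp: inj_on_def simp flip: reflection_minus)
      then have "(reflection h p \<bullet> reflection h q)\<^sup>2 = 1 / 4"
        using card6_dot[OF R 2, of "reflection h p" "reflection h q"] sK that by blast
      then show ?thesis unfolding reflection_dot .
    qed
    have closed: "reflection p q \<in> K" if "p \<in> K" "q \<in> K" for p q
    proof -
      have "reflection (reflection h p) (reflection h q) \<in> S"
      proof (rule reflection_small[OF R])
        show "card (S \<inter> ?R) \<le> 6" using 2 by simp
      qed (use sK that in blast)+
      moreover have "reflection p q \<in> U" using reflection_in_plane U(1) that KU by blast
      ultimately have "reflection h (reflection p q) \<in> reflection h ` K"
        unfolding eq[symmetric] reflection_conjugate by blast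
      then show ?thesis using inj_reflection[of h UNIV] by (auto simp: inj_on_def)
    qed
    have "(\<Sum>v\<in>S \<inter> ?R. (v \<bullet> reflection h x) * (v \<bullet> reflection h x)) = 3"
      using local_frame[OF R, of "reflection h x" "reflection h x"] 2 x dot_self[OF x(1)] by (simp add: reflection_dot)
    then have sumK: "(\<Sum>v\<in>K. (v \<bullet> x) * (v \<bullet> x)) = 3"
      unfolding eq by (subst (asm) sum.reindex[OF inj_reflection]) (simp add: reflection_dot)
    have "(\<Sum>v\<in>S \<inter> U. (v \<bullet> x) * (v \<bullet> x)) = 5" using local_frame[of U x x] U(1) x dot_self[OF x(1)] by simp
    moreover have "(\<Sum>v\<in>S \<inter> U. (v \<bullet> x) * (v \<bullet> x)) = (\<Sum>v\<in>K. (v \<bullet> x) * (v \<bullet> x)) + (\<Sum>v\<in>{x, - x, y, - y}. (v \<bullet> x) * (v \<bullet> x))"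
      unfolding K using finite_S by (intro sum.subset_diff[OF sub]) simp
    moreover have "(\<Sum>v\<in>{x, - x, y, - y}. (v \<bullet> x) * (v \<bullet> x)) = 2 + 2 * ((y \<bullet> x) * (y \<bullet> x))"
      unfolding sum_four[OF x(1) y(1) xy] using dot_self[OF x(1)] by simp
    ultimately have "x \<bullet> y = 0" using sumK by (simp add: inner_commute)
    then show ?thesis using quarter closed by blast
  qed
qed

lemma perpendicular_in_plane:
  assumes U: "U \<in> planes S" and x: "x \<in> S" "x \<in> U" and y: "y \<in> S" "y \<in> U" "x \<bullet> y = 0" and z: "z \<in> S" "z \<in> U" "x \<bullet> z = 0"
  shows "z = y \<or> z = - y"
proof -
  obtain e where e: "x \<bullet> e = 0" and basis: "\<forall>u\<in>U. u = (u \<bullet> x) *\<^sub>R x + (u \<bullet> e) *\<^sub>R e"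
    using plane_basis[OF U x] by metis
  have ye: "y = (y \<bullet> e) *\<^sub>R e" using basis y by (metis add_0 inner_commute scale_zero_left)
  have ze: "z = (z \<bullet> e) *\<^sub>R e" using basis z by (metis add_0 inner_commute scale_zero_left)
  have "y \<bullet> e \<noteq> 0" using nonzero[OF y(1)] ye by auto
  then have "z = ((z \<bullet> e) / (y \<bullet> e)) *\<^sub>R y" using ye ze by (metis nonzero_eq_divide_eq scaleR_scaleR)
  then show ?thesis using parallel_in_S[OF y(1)] z(1) by metis
qed

text \<open>If the image of \<open>U\<close> had fewer elements, each of the three planes with ten elements other than \<open>U\<close> and
  the two through \<open>h\<close> would be of one of two kinds, with at most one plane of each kind.\<close>

lemma reflected_ten_always:
  assumes n: "n = 5" and h: "h \<in> S" and U: "ten U"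
  shows "ten (reflection h ` U)"
proof (cases "h \<in> U")
  case True
  then show ?thesis using U reflection_image_self[of U h] by simp
next
  case hU: False
  show ?thesis
  proof (rule ccontr)
    assume bad: "\<not> ten (reflection h ` U)"
    obtain P Q where PQ: "ten P" "ten Q" "P \<noteq> Q" "h \<in> P" "h \<in> Q" using ten_through[OF n h] by metis
    have ne: "U \<noteq> P" "U \<noteq> Q" using hU PQ by blast+
    obtain x where x: "x \<in> S" "x \<in> U" "x \<in> P" using ten_meet[OF n U PQ(1) ne(1)] .
    obtain y where y: "y \<in> S" "y \<in> U" "y \<in> Q" using ten_meet[OF n U PQ(2) ne(2)] .
    define K where "K = S \<inter> U - {x, - x, y, - y}"
    have b: "x \<bullet> y = 0" "\<And>k k'. k \<in> K \<Longrightarrow> k' \<in> K \<Longrightarrow> reflection k k' \<in> K"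
      "\<And>k k'. k \<in> K \<Longrightarrow> k' \<in> K \<Longrightarrow> k' \<noteq> k \<Longrightarrow> k' \<noteq> - k \<Longrightarrow> (k \<bullet> k')\<^sup>2 = 1 / 4"
      using reflected_ten[OF n h U hU PQ x y K_def] bad by blast+
    have KU: "k \<in> S \<and> k \<in> U \<and> k \<noteq> x \<and> k \<noteq> - x \<and> k \<noteq> y \<and> k \<noteq> - y" if "k \<in> K" for k using that by (auto simp: K_def)
    have Kx: "k \<bullet> x \<noteq> 0" if k: "k \<in> K" for k
      using perpendicular_in_plane[of U x y k] U x y b(1) KU[OF k] by (auto simp: inner_commute)
    have card3: "card ({W \<in> planes S. card (S \<inter> W) = 10} - {U, P, Q}) = 3"
    proof -
      have "card {W \<in> planes S. card (S \<inter> W) = 10} = 6" using ten_planes(2)[OF n] by (simp add: count_def)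
      then show ?thesis using U PQ ne finite_planes by (subst card_Diff_subset) auto
    qed
    then obtain A B C where ABC: "{W \<in> planes S. card (S \<inter> W) = 10} - {U, P, Q} = {A, B, C}" "A \<noteq> B" "B \<noteq> C" "A \<noteq> C"
      by (auto simp: card_3_iff)
    \<comment> \<open>The meeting point with \<open>U\<close> is neither \<open>x\<close> nor
      \<open>y\<close>, as no three planes with ten elements share an element of
      \<open>S\<close>.\<close>
    have meetK: "\<exists>k. k \<in> K \<and> k \<in> W" if W: "W \<in> {A, B, C}" for W
    proof -
      have W': "ten W" "W \<noteq> U" "W \<noteq> P" "W \<noteq> Q" using W ABC(1) by blast+
      obtain k where k: "k \<in> S" "k \<in> U" "k \<in> W" using ten_meet[OF n U W'(1)] W'(2) by metis
      have "x \<notin> W" using ten_not_three[OF n U PQ(1) W'(1) ne(1) W'(2)[symmetric] W'(3)[symmetric] x] .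
      moreover have "y \<notin> W" using ten_not_three[OF n U PQ(2) W'(1) ne(2) W'(2)[symmetric] W'(4)[symmetric] y] .
      moreover have "- k \<in> W" using plane_neg W'(1) k by blast
      ultimately have "k \<in> K" using k by (auto simp: K_def)
      then show ?thesis using k(3) by blast
    qed
    \<comment> \<open>Apply \<open>reflected_ten\<close> with \<open>k\<close> in place of
      \<open>h\<close> and \<open>P\<close> in place of \<open>U\<close>: the two planes through
      \<open>k\<close> are \<open>U\<close> and \<open>W\<close>, which meet \<open>P\<close> in
      \<open>x\<close> and in \<open>w\<close>. These are the two kinds of planes.\<close>
    have other: "ten (reflection k ` P) \<or> (\<exists>w\<in>S. w \<in> P \<and> w \<in> W \<and> x \<bullet> w = 0)"
      if W: "W \<in> {A, B, C}" and k: "k \<in> K" "k \<in> W" for W k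
    proof -
      have W': "ten W" "W \<noteq> U" "W \<noteq> P" "W \<noteq> Q" using W ABC(1) by blast+
      have kS: "k \<in> S" "k \<in> U" using KU[OF k(1)] by auto
      have kP: "k \<notin> P" using planes_at_inter[of U P x k] U PQ(1) ne(1) x KU[OF k(1)] by blast
      obtain w where w: "w \<in> S" "w \<in> P" "w \<in> W" using ten_meet[OF n PQ(1) W'(1)] W'(3) by metis
      show ?thesis
        using reflected_ten[OF n kS(1) PQ(1) kP U W'(1) W'(2)[symmetric] kS(2) k(2) x(1,3,2) w refl] w by blast
    qed
    \<comment> \<open>Both \<open>U\<close> and the image of \<open>P\<close> contain the image of
      \<open>x\<close>, which therefore belongs to \<open>S\<close>. It is not in \<open>K\<close>,
      since \<open>K\<close> is closed under the reflection at \<open>k\<close> and does not contain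
      \<open>x\<close>; and it is not parallel to \<open>x\<close>. Only \<open>y\<close> and
      \<open>- y\<close> remain.\<close>
    have good: "reflection k x = y \<or> reflection k x = - y" if k: "k \<in> K" and g: "ten (reflection k ` P)" for k
    proof -
      have kS: "k \<in> S" "k \<in> U" using KU[OF k] by auto
      have ku: "k \<bullet> k = 1" using dot_self kS by blast
      have VU: "U \<noteq> reflection k ` P"
      proof
        assume "U = reflection k ` P"
        then have "reflection k ` U = P" by (auto simp: image_image reflection_reflection)
        then show False using reflection_image_self[of U k] U kS ne(1) by blast
      qed
      obtain v where v: "v \<in> S" "v \<in> U" "v \<in> reflection k ` P" using ten_meet[OF n U g VU] .
      have rU: "reflection k x \<in> U" using reflection_in_plane U kS x by blast
      have "reflection k x = v \<or> reflection k x = - v"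
        using meet_unit[of U "reflection k ` P" v "reflection k x"] U g VU v rU x dot_self[OF x(1)] by (simp add: reflection_dot)
      then have rS: "reflection k x \<in> S" using v(1) neg by auto
      have r: "reflection k x = x - (2 * (k \<bullet> x)) *\<^sub>R k" using reflection_unit ku by blast
      have "reflection k x \<notin> K"
      proof
        assume "reflection k x \<in> K"
        then have "reflection k (reflection k x) \<in> K" using b(2) k by blast
        then show False using KU[of x] by (simp add: reflection_reflection)
      qed
      moreover have "reflection k x \<noteq> x" unfolding r using Kx[OF k] nonzero[OF kS(1)] by simp
      moreover have "reflection k x \<noteq> - x"
      proof
        assume "reflection k x = - x"
        then have "2 *\<^sub>R x = (2 * (k \<bullet> x)) *\<^sub>R k" unfolding r by (simp add: scaleR_2 algebra_simps)
        then have "x = (k \<bullet> x) *\<^sub>R k" by (metis scaleR_scaleR scaleR_cancel_left zero_neq_numeral)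
        then show False using parallel_in_S[OF kS(1), of "k \<bullet> x"] x(1) KU[OF k] by auto
      qed
      ultimately show ?thesis using rS rU by (auto simp: K_def)
    qed
    \<comment> \<open>Two reflections that send \<open>x\<close> to the same vector up to sign:
      equal images make \<open>k\<close> and \<open>k'\<close> parallel, and opposite images make
      them orthogonal, against the angle of sixty degrees.\<close>
    have not_two_good: False
      if W: "W \<in> {A, B, C}" "W' \<in> {A, B, C}" "W \<noteq> W'" and k: "k \<in> K" "k \<in> W" "k' \<in> K" "k' \<in> W'"
        and g: "ten (reflection k ` P)" "ten (reflection k' ` P)" for W W' k k'
    proof -
      have Wt: "ten W" "W \<noteq> U" "ten W'" "W' \<noteq> U" using W ABC(1) by blast+
      have kS: "k \<in> S" "k \<in> U" "k' \<in> S" "k' \<in> U" using KU k by auto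
      have "k \<notin> W'" using ten_not_three[OF n U Wt(1,3) Wt(2)[symmetric] Wt(4)[symmetric] W(3) kS(1,2) k(2)] .
      then have kk: "k' \<noteq> k" "k' \<noteq> - k" using k(4) plane_neg[of W' k'] Wt(3) by auto
      have dd: "(k \<bullet> k')\<^sup>2 = 1 / 4" using b(3)[OF k(1,3) kk] .
      have self: "k \<bullet> k = 1" "k' \<bullet> k' = 1" using dot_self kS by blast+
      let ?p = "k \<bullet> x" and ?q = "k' \<bullet> x"
      have q0: "?q \<noteq> 0" "?p \<noteq> 0" using Kx k by blast+
      have r: "reflection k x = x - (2 * ?p) *\<^sub>R k" "reflection k' x = x - (2 * ?q) *\<^sub>R k'"
        using reflection_unit self by blast+
      have "reflection k x = reflection k' x \<or> reflection k x = - reflection k' x"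
        using good[OF k(1) g(1)] good[OF k(3) g(2)] by auto
      then show False
      proof
        assume "reflection k x = reflection k' x"
        then have "(2 * ?q) *\<^sub>R k' = (2 * ?p) *\<^sub>R k" unfolding r by simp
        then have "k' = (?p / ?q) *\<^sub>R k" using q0
          by (metis (no_types, lifting) mult_cancel_left nonzero_eq_divide_eq scaleR_cancel_left scaleR_scaleR times_divide_eq_right mult.commute zero_neq_numeral)
        then show False using parallel_in_S[OF kS(1), of "?p / ?q"] kS(3) kk by auto
      next
        assume "reflection k x = - reflection k' x"
        then have "x + x = (2 * ?p) *\<^sub>R k + (2 * ?q) *\<^sub>R k'" unfolding r by (simp add: algebra_simps)
        then have "k \<bullet> (x + x) = k \<bullet> ((2 * ?p) *\<^sub>R k + (2 * ?q) *\<^sub>R k')" by simp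
        moreover have "k \<bullet> (x + x) = ?p + ?p" by (rule inner_right_distrib)
        moreover have "k \<bullet> ((2 * ?p) *\<^sub>R k + (2 * ?q) *\<^sub>R k') = 2 * ?p + 2 * (?q * (k \<bullet> k'))"
          by (simp add: inner_right_distrib self)
        ultimately have "?q * (k \<bullet> k') = 0" by linarith
        then show False using q0 dd by auto
      qed
    qed
    \<comment> \<open>Up to sign only one element of \<open>P\<close> is orthogonal to
      \<open>x\<close>; it would lie in three planes with ten elements.\<close>
    have not_two_bad: False
      if W: "W \<in> {A, B, C}" "W' \<in> {A, B, C}" "W \<noteq> W'"
        and w: "w \<in> S" "w \<in> P" "w \<in> W" "x \<bullet> w = 0" and w': "w' \<in> S" "w' \<in> P" "w' \<in> W'" "x \<bullet> w' = 0" for W W' w w'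
    proof -
      have Wt: "ten W" "W \<noteq> P" "ten W'" "W' \<noteq> P" using W ABC(1) by blast+
      have "w' = w \<or> w' = - w" using perpendicular_in_plane[of P x w w'] PQ(1) x w w' by blast
      then have "w \<in> W'" using w'(3) plane_neg[of W' w'] Wt(3) by auto
      then show False using ten_not_three[OF n PQ(1) Wt(1,3) Wt(2)[symmetric] Wt(4)[symmetric] W(3) w(1-3)] by blast
    qed
    obtain ka kb kc where k: "ka \<in> K" "ka \<in> A" "kb \<in> K" "kb \<in> B" "kc \<in> K" "kc \<in> C"
      using meetK[of A] meetK[of B] meetK[of C] by blast
    have "ten (reflection ka ` P) \<or> (\<exists>w\<in>S. w \<in> P \<and> w \<in> A \<and> x \<bullet> w = 0)"
      "ten (reflection kb ` P) \<or> (\<exists>w\<in>S. w \<in> P \<and> w \<in> B \<and> x \<bullet> w = 0)"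
      "ten (reflection kc ` P) \<or> (\<exists>w\<in>S. w \<in> P \<and> w \<in> C \<and> x \<bullet> w = 0)"
      using other[of A ka] other[of B kb] other[of C kc] k by blast+
    moreover have "\<not> (ten (reflection ka ` P) \<and> ten (reflection kb ` P))"
      using not_two_good[of A B ka kb] k ABC by blast
    moreover have "\<not> (ten (reflection ka ` P) \<and> ten (reflection kc ` P))"
      using not_two_good[of A C ka kc] k ABC by blast
    moreover have "\<not> (ten (reflection kb ` P) \<and> ten (reflection kc ` P))"
      using not_two_good[of B C kb kc] k ABC by blast
    moreover have "\<not> ((\<exists>w\<in>S. w \<in> P \<and> w \<in> A \<and> x \<bullet> w = 0) \<and> (\<exists>w\<in>S. w \<in> P \<and> w \<in> B \<and> x \<bullet> w = 0))"
      using not_two_bad[of A B] ABC by blast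
    moreover have "\<not> ((\<exists>w\<in>S. w \<in> P \<and> w \<in> A \<and> x \<bullet> w = 0) \<and> (\<exists>w\<in>S. w \<in> P \<and> w \<in> C \<and> x \<bullet> w = 0))"
      using not_two_bad[of A C] ABC by blast
    moreover have "\<not> ((\<exists>w\<in>S. w \<in> P \<and> w \<in> B \<and> x \<bullet> w = 0) \<and> (\<exists>w\<in>S. w \<in> P \<and> w \<in> C \<and> x \<bullet> w = 0))"
      using not_two_bad[of B C] ABC by blast
    ultimately show False by argo
  qed
qed

text \<open>\<open>x\<close> is determined up to sign by its two planes with ten elements, and the
  images of these planes again have ten elements and meet in \<open>S\<close>.\<close>

lemma closed_5:
  assumes n: "n = 5" and h: "h \<in> S" and x: "x \<in> S"
  shows "reflection h x \<in> S"
proof -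
  obtain U V where UV: "ten U" "ten V" "U \<noteq> V" "x \<in> U" "x \<in> V" using ten_through[OF n x] by metis
  have t: "ten (reflection h ` U)" "ten (reflection h ` V)" using reflected_ten_always[OF n h] UV by blast+
  have ne: "reflection h ` U \<noteq> reflection h ` V" using UV(3) inj_image_eq_iff[OF inj_reflection] by blast
  obtain v where v: "v \<in> S" "v \<in> reflection h ` U" "v \<in> reflection h ` V" using ten_meet[OF n t ne] .
  have "reflection h x = v \<or> reflection h x = - v"
    using meet_unit[of "reflection h ` U" "reflection h ` V" v "reflection h x"] t ne v UV x
    by (simp add: reflection_dot dot_self)
  then show ?thesis using v(1) neg by auto
qed

text \<open>Take a chamber with a corner at a fivefold point; its angle there is
  \<open>pi / 5\<close>. One of its other angles is right. The third is not right as well, no point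
  has multiplicity four, and a second angle \<open>pi / 5\<close> would make the angle sum less than
  \<open>pi\<close>; so it belongs to a triple point.\<close>

lemma roots_H3:
  assumes n: "n = 5"
  obtains e1 e2 e3 where "orthonormal e1 e2 e3" "comb e1 e2 e3 ` roots 5 \<subseteq> lines"
proof -
  have cl: "\<And>x y. x \<in> S \<Longrightarrow> y \<in> S \<Longrightarrow> reflection x y \<in> S" using closed_5[OF n] by blast
  have c: "count 5 = 6" "count 4 = 0" using ten_planes[OF n] by blast+
  have "{P \<in> planes S. card (S \<inter> P) = 10} \<noteq> {}"
  proof
    assume "{P \<in> planes S. card (S \<inter> P) = 10} = {}"
    then have "{P \<in> planes S. card (S \<inter> P) = 2 * 5} = {}" by simp
    then have "count 5 = 0" by (simp only: count_def card.empty)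
    then show False using c by simp
  qed
  then obtain U where U: "U \<in> planes S" "card (S \<inter> U) = 10" by blast
  obtain u e \<theta> r where en: "enumerates U u e \<theta> r" using enumeration_exists[OF U(1)] .
  have "0 < r" using enum_basic(6)[OF en] by simp
  then have w': "wedge (circ u e (\<theta> (Suc 0))) (- circ u e (\<theta> 0))" using gap_wedge[OF en] by blast
  define b d where "b = circ u e (\<theta> (Suc 0))" and "d = - circ u e (\<theta> 0)"
  have w: "wedge b d" "b \<in> U" "d \<in> U"
    using w' z_mem[OF en, of 0] z_mem[OF en, of "Suc 0"] \<open>0 < r\<close> by (simp_all add: b_def d_def)
  have sp: "span {b, d} = U" using wedge_span[OF w(1) U(1) w(2,3)] .
  obtain p where p: "p \<noteq> 0" "p \<bullet> b = 0" "p \<bullet> d = 0" using common_normal by blast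
  obtain a where s: "simple b d a" using wedge_extends[OF w(1) p] by blast
  have w2: "wedge d a" "wedge a b" using simple_wedge simple_rotate s by blast+
  have big: "b \<bullet> d \<noteq> 0" using wedge_obtuse(2)[OF w(1)] sp U by simp
  have fin: "\<exists>e1 e2 e3. orthonormal e1 e2 e3 \<and> comb e1 e2 e3 ` roots 5 \<subseteq> lines" if s: "simple x y z" and o: "x \<bullet> z = 0" and yz: "card (S \<inter> span {y, z}) = 10" for x y z
  proof -
    have xyz: "x \<in> S" "y \<in> S" "z \<in> S" using simple_mem[OF s] by blast+
    have w: "wedge x y" "wedge y z" "wedge z x" using simple_wedge simple_rotate s by blast+
    have ayz: "ang y z = pi / 5" using closed_wedge_angle[OF cl w(2), of 5] yz by simp
    have dyz: "y \<bullet> z = - golden / 2" using ang_range(4)[OF w(2)] ayz cos_pi_5 by simp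
    have azx: "ang z x = pi / 2" using ang_range(3)[OF w(3)] o by (simp add: inner_commute)
    have P: "span {x, y} \<in> planes S" using w(1) planesI by (auto simp: wedge_def)
    have "card (S \<inter> span {x, y}) \<noteq> 4"
      using not_two_right_angles[OF s] wedge_obtuse(2)[OF w(1)] o by blast
    moreover have "card (S \<inter> span {x, y}) \<noteq> 8" using count_zero[OF c(2) P] by simp
    moreover have "card (S \<inter> span {x, y}) \<noteq> 10"
    proof
      assume "card (S \<inter> span {x, y}) = 10"
      then have "ang x y = pi / 5" using closed_wedge_angle[OF cl w(1), of 5] by simp
      then show False using angle_sum[OF s] ayz azx pi_gt_zero by linarith
    qed
    ultimately have "card (S \<inter> span {x, y}) = 6" using plane_card_cases[OF P] by blast
    then have dxy: "x \<bullet> y = - 1 / 2" using wedge_dot_card6[OF w(1)] by blast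
    obtain e1 e2 e3 where e: "orthonormal e1 e2 e3" "comb e1 e2 e3 (1, 0, 0) = x"
      "comb e1 e2 e3 (0, 1, 0) = z" "comb e1 e2 e3 (1, golden, golden - 1) = (-2) *\<^sub>R y"
      using frame_H3[of x y z] dot_self xyz dxy dyz o by metis
    have "comb e1 e2 e3 ` roots 5 \<subseteq> lines"
    proof (rule closure_H3[OF lines_reflection_closed[OF cl] e(1)])
      show "comb e1 e2 e3 (1, 0, 0) \<in> lines" "comb e1 e2 e3 (0, 1, 0) \<in> lines" unfolding e using S_lines xyz by blast+
      have "(-2::real) \<noteq> 0" by simp
      then show "comb e1 e2 e3 (1, golden, golden - 1) \<in> lines" unfolding e using lines_scale S_lines xyz(2) by blast
    qed
    then show ?thesis using e(1) by blast
  qed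
  from weight_equality(2)[OF s] big have "d \<bullet> a = 0 \<or> a \<bullet> b = 0" by blast
  then have "\<exists>e1 e2 e3. orthonormal e1 e2 e3 \<and> comb e1 e2 e3 ` roots 5 \<subseteq> lines"
  proof
    assume "d \<bullet> a = 0"
    moreover have "simple a b d" using s simple_rotate by blast
    ultimately show ?thesis using fin[of a b d] sp U by (simp add: inner_commute)
  next
    assume "a \<bullet> b = 0"
    moreover have "simple a d b" using s simple_rotate simple_swap by blast
    ultimately show ?thesis using fin[of a d b] sp U by (simp add: insert_commute)
  qed
  then show thesis using that by blast
qed

theorem root_system_frame:
  "n \<in> {2, 3, 5} \<and> (\<exists>e1 e2 e3. orthonormal e1 e2 e3 \<and> comb e1 e2 e3 ` roots n \<subseteq> lines)"
proof -
  have "n = 2 \<or> n = 3 \<or> n = 5" using count_cases n_neq_4 by blast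
  then show ?thesis
  proof (elim disjE)
    assume n: "n = 2"
    obtain e1 e2 e3 where "orthonormal e1 e2 e3" "comb e1 e2 e3 ` roots 2 \<subseteq> lines" using roots_A3[OF n] .
    then show ?thesis unfolding n by blast
  next
    assume n: "n = 3"
    obtain e1 e2 e3 where "orthonormal e1 e2 e3" "comb e1 e2 e3 ` roots 3 \<subseteq> lines" using roots_B3[OF n] .
    then show ?thesis unfolding n by blast
  next
    assume n: "n = 5"
    obtain e1 e2 e3 where "orthonormal e1 e2 e3" "comb e1 e2 e3 ` roots 5 \<subseteq> lines" using roots_H3[OF n] .
    then show ?thesis unfolding n by blast
  qed
qed

end

section \<open>Isotropic position\<close>

lemma span_pair_eq_hyperplane:
  fixes a b p :: "real^3"
  assumes "a \<noteq> 0" "b \<notin> span {a}" "p \<noteq> 0" "p \<bullet> a = 0" "p \<bullet> b = 0"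
  shows "span {a, b} = {x. p \<bullet> x = 0}"
proof (rule subspace_dim_equal)
  show "span {a, b} \<subseteq> {x. p \<bullet> x = 0}"
    using assms by (intro span_minimal subspace_hyperplane) auto
  have ind: "independent {b, a}"
    using assms independent_insertI[of b "{a}"] by simp
  have "b \<noteq> a" using assms(2) span_base[of a "{a}"] by auto
  then have "dim (span {a, b}) = 2" using dim_span_eq_card_independent[OF ind] by (simp add: insert_commute)
  moreover have "dim {x. p \<bullet> x = 0} = 2" using dim_hyperplane[OF \<open>p \<noteq> 0\<close>] by simp
  ultimately show "dim {x. p \<bullet> x = 0} \<le> dim (span {a, b})" by simp
qed (auto simp: subspace_hyperplane)

lemma cross3_nonzero:
  assumes "a \<noteq> 0" "b \<notin> span {a}"
  shows "cross3 a b \<noteq> 0"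
proof
  assume "cross3 a b = 0"
  then have "collinear {0, a, b}" by (simp add: cross_eq_0)
  then obtain k where "b = k *\<^sub>R a" using assms by (auto simp: collinear_lemma span_0)
  then show False using assms(2) by (simp add: span_mul span_base)
qed

lemma triple_product_nonzero:
  fixes a b c :: "real^3"
  assumes "a \<noteq> 0" "b \<notin> span {a}" "c \<notin> span {a, b}"
  shows "c \<bullet> cross3 a b \<noteq> 0"
proof
  assume 0: "c \<bullet> cross3 a b = 0"
  have "cross3 a b \<noteq> 0" using cross3_nonzero[OF assms(1,2)] .
  then have "span {a, b} = {x. cross3 a b \<bullet> x = 0}"
    by (intro span_pair_eq_hyperplane assms(1,2)) (simp_all add: dot_cross_self)
  then show False using assms(3) 0 by (simp add: inner_commute)
qed

lemma triple_product_matrix: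
  "(T *v c) \<bullet> cross3 (T *v a) (T *v b) = det T * (c \<bullet> cross3 a b)"
proof -
  have "(T *v c) \<bullet> cross3 (T *v a) (T *v b) = c \<bullet> (transpose T *v cross3 (T *v a) (T *v b))"
    using dot_lmul_matrix[of "cross3 (T *v a) (T *v b)" T c] inner_commute[of "T *v c"] inner_commute[of c]
    by (simp add: transpose_matrix_vector)
  then show ?thesis by (simp only: cross_matrix_mult inner_scaleR_right)
qed

lemma triple_product_le: "\<bar>c \<bullet> cross3 a b\<bar> \<le> norm a * norm b * norm c"
proof -
  have "norm (cross3 a b) \<le> norm a * norm b"
    by (rule power2_le_imp_le) (simp_all add: norm_cross power_mult_distrib)
  then have "norm c * norm (cross3 a b) \<le> norm c * (norm a * norm b)" by (rule mult_left_mono) simp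
  then show ?thesis using Cauchy_Schwarz_ineq2[of c "cross3 a b"] by (simp add: mult_ac)
qed

lemma finite_positive_lower_bound:
  assumes "finite A" "\<And>x. x \<in> A \<Longrightarrow> f x > (0::real)"
  obtains c where "c > 0" "\<And>x. x \<in> A \<Longrightarrow> c \<le> f x"
proof (rule that)
  show "Min (insert 1 (f ` A)) > 0" using assms by simp
  show "Min (insert 1 (f ` A)) \<le> f x" if "x \<in> A" for x using assms(1) that by (intro Min_le) auto
qed

lemma ex_minimiser:
  assumes "finite A" "A \<noteq> {}"
  shows "\<exists>x\<in>A. \<forall>y\<in>A. f x \<le> (f y :: real)"
proof -
  have "Min (f ` A) \<in> f ` A" using assms by (intro Min_in) auto
  then obtain x where "x \<in> A" "f x = Min (f ` A)" by auto
  then show ?thesis using assms by (intro bexI[of _ x]) simp_all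
qed

text \<open>By compactness of the unit sphere of matrices, as only the zero matrix annihilates a
  basis.\<close>

lemma basis_lower_bound:
  fixes a b c :: "real^3"
  assumes "c \<bullet> cross3 a b \<noteq> 0"
  obtains \<kappa> where "\<kappa> > 0" "\<And>T::real^3^3. norm T = 1 \<Longrightarrow> \<kappa> \<le> norm (T *v a) + norm (T *v b) + norm (T *v c)"
proof -
  let ?f = "\<lambda>T::real^3^3. norm (T *v a) + norm (T *v b) + norm (T *v c)"
  have cont: "continuous_on (sphere 0 1) ?f"
    unfolding matrix_vector_mult_def by (intro continuous_intros)
  have "compact (sphere (0::real^3^3) 1)" "sphere (0::real^3^3) 1 \<noteq> {}" by simp_all
  then obtain T0 :: "real^3^3" where T0: "T0 \<in> sphere 0 1" "\<And>T. T \<in> sphere 0 1 \<Longrightarrow> ?f T0 \<le> ?f T"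
    using continuous_attains_inf[OF _ _ cont] by metis
  have "?f T0 > 0"
  proof (rule ccontr)
    assume "\<not> ?f T0 > 0"
    then have "?f T0 = 0" using norm_ge_zero[of "T0 *v a"] norm_ge_zero[of "T0 *v b"] norm_ge_zero[of "T0 *v c"] by linarith
    then have z: "T0 *v a = 0" "T0 *v b = 0" "T0 *v c = 0"
      using norm_ge_zero[of "T0 *v a"] norm_ge_zero[of "T0 *v b"] norm_ge_zero[of "T0 *v c"] by (simp_all add: add_nonneg_eq_0_iff)
    have "det T0 = 0" using triple_product_matrix[of T0 c a b] assms z by simp
    have "T0 *v x = 0" for x
    proof -
      \<comment> \<open>Cramer's rule for the coordinates of \<open>x\<close> in the basis
        \<open>a\<close>, \<open>b\<close>, \<open>c\<close>.\<close>
      have "(c \<bullet> cross3 a b) *\<^sub>R x = (x \<bullet> cross3 b c) *\<^sub>R a + (x \<bullet> cross3 c a) *\<^sub>R b + (x \<bullet> cross3 a b) *\<^sub>R c"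
        by (simp add: cross3_simps forall_3)
      then have "T0 *v ((c \<bullet> cross3 a b) *\<^sub>R x) = 0"
        using z by (simp add: matrix_vector_right_distrib matrix_vector_mult_scaleR)
      then show ?thesis using assms by (simp add: matrix_vector_mult_scaleR)
    qed
    then have "T0 = 0" by (simp add: matrix_eq)
    then show False using T0(1) by simp
  qed
  then show ?thesis using that[of "?f T0"] T0(2) by simp
qed

text \<open>\<open>plane_bound\<close> is the form in which the number of points per line enters the
  existence of a maximiser.\<close>

locale spread_vectors =
  fixes V :: "(real^3) set" and n :: nat
  assumes finite_V: "finite V" and card_V: "card V = 3 * n" and n_ge_2: "2 \<le> n"
    and nonzero_V: "v \<in> V \<Longrightarrow> v \<noteq> 0"
    and nonparallel: "a \<in> V \<Longrightarrow> b \<in> V \<Longrightarrow> a \<noteq> b \<Longrightarrow> b \<notin> span {a}"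
    and plane_bound: "a \<in> V \<Longrightarrow> b \<in> V \<Longrightarrow> a \<noteq> b \<Longrightarrow> card (V \<inter> span {a, b}) \<le> n + 1"
begin

text \<open>Homogeneous of degree zero, because there are \<open>3 * n\<close> vectors. The
  stationarity condition for its logarithm is the isotropy of the unit vectors along the images,
  also known as radial isotropic position.\<close>

definition spread :: "real^3^3 \<Rightarrow> real" where
  "spread T = \<bar>det T\<bar> ^ n / (\<Prod>v\<in>V. norm (T *v v))"

lemma norm_pos: "invertible (T::real^3^3) \<Longrightarrow> v \<in> V \<Longrightarrow> norm (T *v v) > 0"
  using nonzero_V[of v] matrix_left_invertible_ker[of T] unfolding invertible_left_inverse zero_less_norm_iff by blast

lemma prod_pos: "invertible (T::real^3^3) \<Longrightarrow> (\<Prod>v\<in>V. norm (T *v v)) > 0"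
  using norm_pos by (intro prod_pos) auto

lemma spread_pos: "invertible T \<Longrightarrow> spread T > 0"
  unfolding spread_def using prod_pos[of T] by (intro divide_pos_pos) (simp_all add: invertible_det_nz)

lemma spread_scale:
  assumes c: "c \<noteq> 0" shows "spread (c *\<^sub>R T) = spread T"
proof -
  have "det (c *\<^sub>R T) = c ^ 3 * det T" by (simp add: det_3 power3_eq_cube algebra_simps)
  then have "\<bar>det (c *\<^sub>R T)\<bar> ^ n = \<bar>c\<bar> ^ (3 * n) * \<bar>det T\<bar> ^ n"
    by (simp add: abs_mult power_mult_distrib power_abs power_mult)
  moreover have "(\<Prod>v\<in>V. norm ((c *\<^sub>R T) *v v)) = \<bar>c\<bar> ^ (3 * n) * (\<Prod>v\<in>V. norm (T *v v))"
    using card_V by (simp add: scaleR_matrix_vector_assoc[symmetric] prod.distrib)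
  ultimately show ?thesis unfolding spread_def using c by simp
qed

text \<open>Since a plane contains at most \<open>n + 1\<close> of the vectors, \<open>spread T\<close> is small when \<open>T a\<close> is much shorter than
  \<open>T c\<close>; so the supremum can be taken over a compact set.\<close>

lemma greedy_basis:
  assumes T: "invertible T"
  obtains a b c where "a \<in> V" "b \<in> V" "c \<in> V" "a \<noteq> b" "c \<notin> span {a, b}"
    "norm (T *v a) \<le> norm (T *v b)" "norm (T *v b) \<le> norm (T *v c)"
    "\<forall>v\<in>V. norm (T *v a) \<le> norm (T *v v)"
    "norm (T *v a) * norm (T *v b) ^ n * norm (T *v c) ^ (2 * n - 1) \<le> (\<Prod>v\<in>V. norm (T *v v))"
proof -
  let ?m = "\<lambda>v. norm (T *v v)"
  have V0: "V \<noteq> {}" using card_V n_ge_2 by auto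
  obtain a where a: "a \<in> V" "\<forall>v\<in>V. ?m a \<le> ?m v"
    using ex_minimiser[OF finite_V V0, of ?m] by blast
  have "card (V - {a}) > 0" using card_V n_ge_2 a finite_V by simp
  then have V1: "V - {a} \<noteq> {}" "finite (V - {a})" using finite_V by (metis card.empty less_irrefl, simp)
  obtain b where b: "b \<in> V - {a}" "\<forall>v\<in>V - {a}. ?m b \<le> ?m v"
    using ex_minimiser[OF V1(2,1), of ?m] by blast
  let ?G = "V \<inter> span {a, b}"
  have ab: "a \<in> ?G" "b \<in> ?G" "a \<noteq> b" using a b by (auto simp: span_base)
  have G: "card ?G \<le> n + 1" using plane_bound ab by blast
  then have "card ?G < card V" using card_V n_ge_2 by simp
  then have "\<not> V \<subseteq> span {a, b}" by (auto dest: inf_absorb1)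
  then have V2: "V - ?G \<noteq> {}" "finite (V - ?G)" using finite_V by auto
  obtain c where c: "c \<in> V - ?G" "\<forall>v\<in>V - ?G. ?m c \<le> ?m v"
    using ex_minimiser[OF V2(2,1), of ?m] by blast
  have bc: "?m b \<le> ?m c" using b c ab by auto
  have "V = {a} \<union> (?G - {a}) \<union> (V - ?G)" using ab by auto
  then have "prod ?m V = prod ?m ({a} \<union> (?G - {a}) \<union> (V - ?G))" by simp
  also have "\<dots> = prod ?m ({a} \<union> (?G - {a})) * prod ?m (V - ?G)"
    using finite_V ab by (intro prod.union_disjoint) auto
  also have "prod ?m ({a} \<union> (?G - {a})) = ?m a * prod ?m (?G - {a})"
    using finite_V by (subst prod.union_disjoint) auto
  finally have split: "prod ?m V = ?m a * prod ?m (?G - {a}) * prod ?m (V - ?G)" .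
  have "(\<Prod>v\<in>?G - {a}. ?m b) \<le> prod ?m (?G - {a})" using b by (intro prod_mono) auto
  then have 1: "?m b ^ (card ?G - 1) \<le> prod ?m (?G - {a})" using ab finite_V by simp
  have "(\<Prod>v\<in>V - ?G. ?m c) \<le> prod ?m (V - ?G)" using c by (intro prod_mono) auto
  moreover have "card (V - ?G) = 3 * n - card ?G" using card_V finite_V by (simp add: card_Diff_subset)
  ultimately have 2: "?m c ^ (3 * n - card ?G) \<le> prod ?m (V - ?G)" by simp
  \<comment> \<open>The plane contains at most \<open>n\<close> vectors besides \<open>a\<close>.
    The exponent of \<open>b\<close> may be raised to \<open>n\<close> at the expense of that of
    \<open>c\<close>, since the image of \<open>c\<close> is at least as long.\<close>
  have e1: "3 * n - card ?G = (2 * n - 1) + (n + 1 - card ?G)" using G n_ge_2 by simp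
  have "card {a, b} \<le> card ?G" using ab finite_V by (intro card_mono) auto
  then have g2: "card ?G \<ge> 2" using ab(3) by simp
  then have e2: "n = (card ?G - 1) + (n + 1 - card ?G)" using G by simp
  have "?m b ^ n * ?m c ^ (2 * n - 1) = ?m b ^ (card ?G - 1) * (?m b ^ (n + 1 - card ?G) * ?m c ^ (2 * n - 1))"
    by (subst (1) e2) (simp only: power_add mult.assoc)
  also have "\<dots> \<le> ?m b ^ (card ?G - 1) * (?m c ^ (n + 1 - card ?G) * ?m c ^ (2 * n - 1))"
    using bc by (intro mult_left_mono mult_right_mono power_mono) auto
  also have "\<dots> = ?m b ^ (card ?G - 1) * ?m c ^ (3 * n - card ?G)" unfolding e1 power_add by (simp add: mult_ac)
  also have "\<dots> \<le> prod ?m (?G - {a}) * prod ?m (V - ?G)"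
    using 1 2 by (intro mult_mono) (auto intro: prod_nonneg)
  finally have "?m a * (?m b ^ n * ?m c ^ (2 * n - 1)) \<le> ?m a * (prod ?m (?G - {a}) * prod ?m (V - ?G))"
    by (rule mult_left_mono) simp
  then have "?m a * ?m b ^ n * ?m c ^ (2 * n - 1) \<le> prod ?m V" unfolding split by (simp add: mult.assoc)
  then show ?thesis using that[of a b c] a b c bc by auto
qed

text \<open>The determinant is at most a constant times the product of the three lengths of the
  greedy basis. Compared with the lower bound of \<open>greedy_basis\<close>, this leaves a bound of
  the longest of the three by the shortest. So all images are bounded below, and a spread no smaller
  than that of the identity turns this into a bound for the determinant.\<close>

lemma spread_coercive:
  obtains \<delta> where "\<delta> > 0"
    "\<And>T. invertible T \<Longrightarrow> norm T = 1 \<Longrightarrow> spread T \<ge> spread (mat 1) \<Longrightarrow> \<bar>det T\<bar> ^ n \<ge> \<delta>"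
proof -
  let ?B = "{(a, b, c). a \<in> V \<and> b \<in> V \<and> c \<in> V \<and> c \<bullet> cross3 a b \<noteq> 0}"
  have finB: "finite ?B" by (rule finite_subset[of _ "V \<times> V \<times> V"]) (auto simp: finite_V)
  obtain d where d: "d > 0" "\<And>q. q \<in> ?B \<Longrightarrow> d \<le> (case q of (a, b, c) \<Rightarrow> \<bar>c \<bullet> cross3 a b\<bar>)"
    by (rule finite_positive_lower_bound[OF finB, of "\<lambda>(a, b, c). \<bar>c \<bullet> cross3 a b\<bar>"]) auto
  define bd where "bd q \<kappa> \<longleftrightarrow> \<kappa> > 0 \<and> (\<forall>T::real^3^3. norm T = 1 \<longrightarrow>
      (case q of (a, b, c) \<Rightarrow> \<kappa> \<le> norm (T *v a) + norm (T *v b) + norm (T *v c)))" for q \<kappa>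
  have "\<forall>q\<in>?B. \<exists>\<kappa>. bd q \<kappa>"
  proof
    fix q assume "q \<in> ?B"
    then obtain a b c where q: "q = (a, b, c)" "c \<bullet> cross3 a b \<noteq> 0" by auto
    from basis_lower_bound[OF q(2)] show "\<exists>\<kappa>. bd q \<kappa>" unfolding bd_def q(1) prod.case by blast
  qed
  from bchoice[OF this] obtain k where k: "\<forall>q\<in>?B. bd q (k q)" ..
  then have "k q > 0" if "q \<in> ?B" for q using that unfolding bd_def by blast
  from finite_positive_lower_bound[OF finB, of k, OF this]
  obtain \<kappa> where \<kappa>: "\<kappa> > 0" "\<And>q. q \<in> ?B \<Longrightarrow> \<kappa> \<le> k q" by blast
  define s where "s = spread (mat 1)"
  have s: "s > 0" unfolding s_def by (rule spread_pos) (simp add: invertible_det_nz)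
  define \<eta> where "\<eta> = s * d ^ n"
  have \<eta>: "\<eta> > 0" using s d by (simp add: \<eta>_def)
  show ?thesis
  proof (rule that[of "s * (\<eta> * (\<kappa> / 3)) ^ (3 * n)"])
    show "s * (\<eta> * (\<kappa> / 3)) ^ (3 * n) > 0" using s \<eta> \<kappa> by simp
    fix T :: "real^3^3" assume T: "invertible T" "norm T = 1" "spread T \<ge> spread (mat 1)"
    let ?m = "\<lambda>v. norm (T *v v)"
    obtain a b c where abc: "a \<in> V" "b \<in> V" "c \<in> V" "a \<noteq> b" "c \<notin> span {a, b}"
      and le: "?m a \<le> ?m b" "?m b \<le> ?m c" "\<forall>v\<in>V. ?m a \<le> ?m v"
      and pr: "?m a * ?m b ^ n * ?m c ^ (2 * n - 1) \<le> (\<Prod>v\<in>V. ?m v)"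
      using greedy_basis[OF T(1)] .
    have tp: "c \<bullet> cross3 a b \<noteq> 0"
      using triple_product_nonzero[OF nonzero_V[OF abc(1)] nonparallel[OF abc(1,2,4)] abc(5)] .
    then have q: "(a, b, c) \<in> ?B" using abc by simp
    have pos: "?m a > 0" "?m b > 0" "?m c > 0" using norm_pos[OF T(1)] abc by blast+
    have "\<bar>det T\<bar> * d \<le> \<bar>det T\<bar> * \<bar>c \<bullet> cross3 a b\<bar>" using d(2)[OF q] by (intro mult_left_mono) auto
    also have "\<dots> \<le> ?m a * ?m b * ?m c"
      using triple_product_le[of "T *v c" "T *v a" "T *v b"] unfolding triple_product_matrix by (simp add: abs_mult)
    finally have "(\<bar>det T\<bar> * d) ^ n \<le> (?m a * ?m b * ?m c) ^ n" using d by (intro power_mono) auto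
    then have D: "\<bar>det T\<bar> ^ n * d ^ n \<le> ?m a ^ n * ?m b ^ n * ?m c ^ n" by (simp add: power_mult_distrib)
    have sP: "s * (\<Prod>v\<in>V. ?m v) \<le> \<bar>det T\<bar> ^ n"
      using T(3) prod_pos[OF T(1)] unfolding s_def spread_def[of T] by (simp add: pos_le_divide_eq)
    have "\<eta> * (?m a * ?m b ^ n * ?m c ^ (2 * n - 1)) \<le> d ^ n * (s * (\<Prod>v\<in>V. ?m v))"
      unfolding \<eta>_def using mult_left_mono[OF pr, of "s * d ^ n"] s d by (simp add: mult_ac)
    also have "\<dots> \<le> d ^ n * \<bar>det T\<bar> ^ n" using sP d by (intro mult_left_mono) auto
    also have "\<dots> \<le> ?m a ^ n * ?m b ^ n * ?m c ^ n" using D by (simp add: mult.commute)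
    finally have main: "\<eta> * (?m a * ?m b ^ n * ?m c ^ (2 * n - 1)) \<le> ?m a ^ n * ?m b ^ n * ?m c ^ n" .
    \<comment> \<open>After cancellation the exponents of \<open>c\<close> and of \<open>a\<close>
      are both \<open>n - 1\<close>, which is positive.\<close>
    obtain k where n: "n = Suc (Suc k)" using n_ge_2 by (metis add_2_eq_Suc le_Suc_ex)
    have e: "2 * n - 1 = n + Suc k" using n by simp
    have "(?m a * ?m b ^ n * ?m c ^ n) * (\<eta> * ?m c ^ Suc k) \<le> (?m a * ?m b ^ n * ?m c ^ n) * ?m a ^ Suc k"
      using main unfolding e power_add unfolding n by (simp add: mult_ac)
    moreover have "?m a * ?m b ^ n * ?m c ^ n > 0" using pos by simp
    ultimately have "\<eta> * ?m c ^ Suc k \<le> ?m a ^ Suc k" by (metis mult_le_cancel_left_pos)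
    moreover have "?m a ^ Suc k \<le> ?m a * ?m c ^ k"
      using le pos by (simp add: power_mono)
    ultimately have "?m c ^ k * (\<eta> * ?m c) \<le> ?m c ^ k * ?m a" by (simp add: mult_ac)
    then have ac: "\<eta> * ?m c \<le> ?m a" using pos by (metis mult_le_cancel_left_pos zero_less_power)
    have "\<kappa> \<le> ?m a + ?m b + ?m c" using \<kappa>(2)[OF q] bspec[OF k q] T(2) unfolding bd_def by fastforce
    then have "\<kappa> / 3 \<le> ?m c" using le by simp
    then have "\<eta> * (\<kappa> / 3) \<le> \<eta> * ?m c" using \<eta> by (intro mult_left_mono) auto
    then have low: "\<eta> * (\<kappa> / 3) \<le> ?m v" if "v \<in> V" for v using ac le(3) that by fastforce
    have "(\<Prod>v\<in>V. \<eta> * (\<kappa> / 3)) \<le> (\<Prod>v\<in>V. ?m v)" using low \<eta> \<kappa> by (intro prod_mono) auto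
    then have "(\<eta> * (\<kappa> / 3)) ^ (3 * n) \<le> (\<Prod>v\<in>V. ?m v)" using card_V by simp
    then have "s * (\<eta> * (\<kappa> / 3)) ^ (3 * n) \<le> s * (\<Prod>v\<in>V. ?m v)" using s by (intro mult_left_mono) auto
    then show "s * (\<eta> * (\<kappa> / 3)) ^ (3 * n) \<le> \<bar>det T\<bar> ^ n" using sP by linarith
  qed
qed

lemma continuous_det: "continuous_on A (\<lambda>T::real^3^3. det T)"
  unfolding det_3 by (intro continuous_intros)

text \<open>By \<open>spread_scale\<close> only matrices of norm 1 matter, and those with a spread
  no smaller than that of the identity lie in a compact set of invertible matrices.\<close>

lemma spread_attains_max:
  obtains T :: "real^3^3" where "invertible T" "\<And>T'. invertible T' \<Longrightarrow> spread T' \<le> spread T"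
proof -
  obtain \<delta> where \<delta>: "\<delta> > 0"
    "\<And>T. invertible T \<Longrightarrow> norm T = 1 \<Longrightarrow> spread T \<ge> spread (mat 1) \<Longrightarrow> \<bar>det T\<bar> ^ n \<ge> \<delta>"
    using spread_coercive by metis
  define K where "K = sphere (0::real^3^3) 1 \<inter> {T. \<bar>det T\<bar> ^ n \<ge> \<delta>}"
  have "closed {T::real^3^3. \<bar>det T\<bar> ^ n \<ge> \<delta>}"
    by (intro closed_Collect_le continuous_intros continuous_det)
  then have "compact K" unfolding K_def by (intro compact_Int_closed) simp_all
  have inv: "invertible T" if "T \<in> K" for T
  proof -
    have "\<bar>det T\<bar> ^ n > 0" using that order.strict_trans2[OF \<delta>(1), of "\<bar>det T\<bar> ^ n"] by (simp add: K_def)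
    then have "det T \<noteq> 0" using n_ge_2 by (auto simp: power_0_left)
    then show ?thesis by (simp add: invertible_det_nz)
  qed
  have normalize: "(1 / norm T) *\<^sub>R T \<in> K \<and> spread ((1 / norm T) *\<^sub>R T) = spread T"
    if T: "invertible T" "spread T \<ge> spread (mat 1)" for T :: "real^3^3"
  proof -
    have "T \<noteq> 0" using T(1) by (auto simp: invertible_det_nz det_3)
    then have c: "1 / norm T \<noteq> 0" by simp
    have "invertible ((1 / norm T) *\<^sub>R T)" using T(1) c by (simp add: invertible_det_nz det_3 algebra_simps) (simp add: field_simps)
    moreover have "norm ((1 / norm T) *\<^sub>R T) = 1" using \<open>T \<noteq> 0\<close> by simp
    ultimately show ?thesis using \<delta>(2)[of "(1 / norm T) *\<^sub>R T"] spread_scale[OF c, of T] T(2) by (simp add: K_def)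
  qed
  have "invertible (mat 1 :: real^3^3)" by (simp add: invertible_det_nz)
  then have ne: "K \<noteq> {}" using normalize[of "mat 1"] by auto
  have cont: "continuous_on K spread"
    unfolding spread_def matrix_vector_mult_def
  proof (intro continuous_intros continuous_det finite_V ballI)
    fix T assume "T \<in> K"
    then have "(\<Prod>v\<in>V. norm (T *v v)) \<noteq> 0" using prod_pos[OF inv] by (metis less_irrefl)
    then show "(\<Prod>v\<in>V. norm (\<chi> i. \<Sum>j\<in>UNIV. T $ i $ j * v $ j)) \<noteq> 0" unfolding matrix_vector_mult_def .
  qed
  obtain T where T: "T \<in> K" "\<And>T'. T' \<in> K \<Longrightarrow> spread T' \<le> spread T"
    using continuous_attains_sup[OF \<open>compact K\<close> ne cont] by metis
  have "spread (mat 1) \<le> spread T" using T(2) normalize[OF \<open>invertible (mat 1)\<close>] by force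
  then have "spread T' \<le> spread T" if "invertible T'" for T'
    using T(2)[of "(1 / norm T') *\<^sub>R T'"] normalize[OF that] by (cases "spread T' \<ge> spread (mat 1)") auto
  then show ?thesis using that inv[OF T(1)] by blast
qed

text \<open>The stationarity condition of the maximum along \<open>1 + t y y^T\<close>, applied
  after \<open>T\<close>. These rank-one perturbations suffice, as the assertion is one equation for
  each \<open>y\<close>.\<close>

theorem isotropic_position:
  obtains T :: "real^3^3" where "invertible T" "\<forall>y. (\<Sum>v\<in>V. ((T *v v) \<bullet> y)\<^sup>2 / (norm (T *v v))\<^sup>2) = n * (y \<bullet> y)"
proof -
  obtain T where T: "invertible T" "\<And>T'. invertible T' \<Longrightarrow> spread T' \<le> spread T"
    using spread_attains_max by metis
  have "(\<Sum>v\<in>V. ((T *v v) \<bullet> y)\<^sup>2 / (norm (T *v v))\<^sup>2) = n * (y \<bullet> y)" for y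
  proof -
    define O' where "O' = ((\<chi> i j. y $ i * y $ j) :: real^3^3)"
    have O': "O' *v x = (y \<bullet> x) *\<^sub>R y" for x
      by (simp add: O'_def matrix_vector_mult_def inner_vec_def vec_eq_iff sum_distrib_left sum_distrib_right mult_ac)
    have det: "det (mat 1 + t *\<^sub>R O') = 1 + t * (y \<bullet> y)" for t
      by (simp add: det_3 O'_def mat_def inner_vec_def sum_3 algebra_simps)
    let ?u = "\<lambda>v. T *v v"
    let ?N = "\<lambda>v t. (norm (?u v))\<^sup>2 + 2 * t * (y \<bullet> ?u v)\<^sup>2 + t\<^sup>2 * (y \<bullet> ?u v)\<^sup>2 * (y \<bullet> y)"
    \<comment> \<open>The logarithm of the spread along the perturbation, up to a constant; squared
      norms make it a sum of logarithms of polynomials in \<open>t\<close>.\<close>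
    define h where "h t = real n * ln (1 + t * (y \<bullet> y)) - (\<Sum>v\<in>V. ln (?N v t) / 2)" for t
    have N: "?N v t = (norm (((mat 1 + t *\<^sub>R O') ** T) *v v))\<^sup>2" for v t
    proof -
      have "((mat 1 + t *\<^sub>R O') ** T) *v v = ?u v + (t * (y \<bullet> ?u v)) *\<^sub>R y"
        by (simp add: matrix_vector_mul_assoc[symmetric] matrix_vector_mult_add_rdistrib O' scaleR_matrix_vector_assoc[symmetric])
      then show ?thesis
        by (simp only: power2_norm_eq_inner inner_left_distrib inner_right_distrib inner_scaleR_left inner_scaleR_right)
          (simp add: power2_eq_square algebra_simps inner_commute)
    qed
    have h_spread: "h t = ln (spread ((mat 1 + t *\<^sub>R O') ** T)) - n * ln \<bar>det T\<bar>" if t: "1 + t * (y \<bullet> y) > 0" for t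
    proof -
      let ?T = "(mat 1 + t *\<^sub>R O') ** T"
      have dT: "det ?T = (1 + t * (y \<bullet> y)) * det T" by (simp add: det_mul det)
      have iT: "invertible ?T" using T(1) t by (simp add: invertible_det_nz dT)
      have "ln (spread ?T) = ln (\<bar>det ?T\<bar> ^ n) - ln (\<Prod>v\<in>V. norm (?T *v v))"
        unfolding spread_def using iT prod_pos[OF iT] by (intro ln_divide_pos) (simp_all add: invertible_det_nz)
      also have "ln (\<Prod>v\<in>V. norm (?T *v v)) = (\<Sum>v\<in>V. ln (norm (?T *v v)))"
        using norm_pos[OF iT] finite_V by (intro ln_prod) auto
      also have "\<dots> = (\<Sum>v\<in>V. ln (?N v t) / 2)"
        unfolding N using norm_pos[OF iT] by (intro sum.cong) (auto simp: ln_realpow)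
      also have "ln (\<bar>det ?T\<bar> ^ n) = n * ln (1 + t * (y \<bullet> y)) + n * ln \<bar>det T\<bar>"
        using t T(1) by (simp add: dT abs_mult ln_realpow ln_mult invertible_det_nz distrib_left)
      finally show ?thesis unfolding h_def by simp
    qed
    have q: "y \<bullet> y \<ge> 0" by simp
    define d where "d = 1 / (1 + y \<bullet> y)"
    have d: "d > 0" using q by (simp add: d_def add_pos_nonneg)
    have small: "1 + t * (y \<bullet> y) > 0" if "\<bar>0 - t\<bar> < d" for t
    proof -
      have "\<bar>t\<bar> * (y \<bullet> y) \<le> d * (y \<bullet> y)" using that q by (intro mult_right_mono) auto
      also have "\<dots> < 1" using q by (simp add: d_def divide_less_eq add_pos_nonneg)
      finally have "\<bar>t * (y \<bullet> y)\<bar> < 1" by (simp add: abs_mult)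
      then show ?thesis by linarith
    qed
    have max: "\<forall>t. \<bar>0 - t\<bar> < d \<longrightarrow> h t \<le> h 0"
    proof (intro allI impI)
      fix t assume t: "\<bar>0 - t\<bar> < d"
      have iT: "invertible ((mat 1 + t *\<^sub>R O') ** T)" using T(1) small[OF t] by (simp add: invertible_det_nz det_mul det)
      have "ln (spread ((mat 1 + t *\<^sub>R O') ** T)) \<le> ln (spread T)"
        using T(2)[OF iT] spread_pos[OF iT] by simp
      then show "h t \<le> h 0" using h_spread[OF small[OF t]] h_spread[of 0] by simp
    qed
    have up: "norm (?u v) > 0" if "v \<in> V" for v using norm_pos[OF T(1) that] .
    have "(h has_real_derivative (real n * (y \<bullet> y) - (\<Sum>v\<in>V. (2 * (y \<bullet> ?u v)\<^sup>2 / (norm (?u v))\<^sup>2) / 2))) (at 0)"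
      unfolding h_def
      by (auto intro!: derivative_eq_intros sum.cong simp: up) (use up in fastforce)+
    from DERIV_local_max[OF this d max] show ?thesis by (simp add: inner_commute)
  qed
  then show ?thesis using that T(1) by blast
qed

end

section \<open>Arrangements and their normals\<close>

abbreviation pline :: "real^3 \<Rightarrow> (real^3) set set" where
  "pline a \<equiv> projectivization (mirror a)"

lemma RP2_eq: "RP2 = {span {x} | x. x \<noteq> 0}"
proof (intro equalityI subsetI)
  fix p assume "p \<in> RP2"
  then have p: "subspace p" "dim p = 1" by (auto simp: RP2_def)
  obtain B where B: "B \<subseteq> p" "independent B" "p \<subseteq> span B" "card B = dim p" using basis_exists by blast
  then obtain x where x: "B = {x}" using p(2) by (auto simp: card_1_singleton_iff)
  have "p = span {x}" using B p(1) x span_minimal by blast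
  moreover have "x \<noteq> 0" using B(2) x by auto
  ultimately show "p \<in> {span {x} | x. x \<noteq> 0}" by blast
next
  fix p :: "(real^3) set" assume "p \<in> {span {x} | x. x \<noteq> 0}"
  then obtain x where "p = span {x}" "x \<noteq> 0" by blast
  then show "p \<in> RP2" by (simp add: RP2_def dim_eq_card_independent)
qed

lemma subspace_mirror: "subspace (mirror a)"
  by (simp add: mirror_def subspace_hyperplane)

lemma pline_eq: "pline a = {span {x} | x. x \<noteq> 0 \<and> a \<bullet> x = 0}"
proof -
  have "span {x} \<subseteq> mirror a \<longleftrightarrow> a \<bullet> x = 0" for x
    using span_minimal[OF _ subspace_mirror, of "{x}" a] span_base[of x "{x}"] by (auto simp: mirror_def)
  then show ?thesis unfolding projectivization_def RP2_eq by auto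
qed

lemma span_singleton_eq_iff: "y \<noteq> 0 \<Longrightarrow> span {x} = span {y :: real^3} \<longleftrightarrow> y \<in> span {x}"
proof
  assume y: "y \<noteq> 0" "y \<in> span {x}"
  then obtain c where "y = c *\<^sub>R x" by (auto simp: span_singleton)
  then have "x = (1 / c) *\<^sub>R y" using y(1) by auto
  then show "span {x} = span {y}" using y(2)
    by (intro span_eq[THEN iffD2] conjI) (auto simp: span_base intro: span_mul)
qed (auto intro: span_base)

lemma span_in_pline: "x \<noteq> 0 \<Longrightarrow> span {x} \<in> pline a \<longleftrightarrow> a \<bullet> x = 0"
proof -
  assume x: "x \<noteq> 0"
  have "a \<bullet> x = 0" if "span {x} = span {y}" "a \<bullet> y = 0" for y
  proof -
    have "x \<in> span {y}" using that(1) span_base[of x "{x}"] by simp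
    then show ?thesis using that(2) by (auto simp: span_singleton)
  qed
  then show ?thesis using x unfolding pline_eq by blast
qed

lemma pline_scale: "c \<noteq> 0 \<Longrightarrow> pline (c *\<^sub>R a) = pline a"
  by (simp add: mirror_def)

lemma pline_minus: "pline (- a) = pline a"
  by (simp add: mirror_def)

lemma pline_eq_iff:
  assumes "a \<noteq> 0" "b \<noteq> 0"
  shows "pline a = pline b \<longleftrightarrow> b \<in> span {a}"
proof
  assume eq: "pline a = pline b"
  define x where "x = b - ((a \<bullet> b) / (a \<bullet> a)) *\<^sub>R a"
  have ax: "a \<bullet> x = 0" using assms by (simp add: x_def inner_diff_right)
  have "x = 0"
  proof (rule ccontr)
    assume "x \<noteq> 0"
    then have "b \<bullet> x = 0" using eq ax span_in_pline by metis
    then have "x \<bullet> x = 0" using ax by (simp add: x_def inner_diff_left)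
    then show False using \<open>x \<noteq> 0\<close> by simp
  qed
  then show "b \<in> span {a}" unfolding span_singleton x_def by auto
next
  assume "b \<in> span {a}"
  then obtain c where "b = c *\<^sub>R a" by (auto simp: span_singleton)
  then show "pline a = pline b" using assms pline_scale by (metis scale_eq_0_iff)
qed

lemma projective_line_pline: "a \<noteq> 0 \<Longrightarrow> projective_line (pline a)"
  unfolding projective_line_def using subspace_mirror dim_hyperplane[of a] by (auto simp: mirror_def)

lemma projective_line_normal:
  assumes "projective_line L"
  shows "\<exists>a. norm a = 1 \<and> L = pline a"
proof -
  obtain P where P: "subspace P" "dim P = 2" "L = projectivization P"
    using assms unfolding projective_line_def by blast
  obtain a where a: "a \<noteq> 0" "span P \<subseteq> {x. a \<bullet> x = 0}"
    using lowdim_subset_hyperplane[of P] P(2) by auto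
  have "P = mirror a"
    using subspace_dim_equal[OF P(1) subspace_mirror, of a] a P span_superset[of P] dim_hyperplane[OF a(1)]
    by (auto simp: mirror_def)
  then have "L = pline ((1 / norm a) *\<^sub>R a)" using P(3) a(1) by (simp only: pline_scale) (simp add: mirror_def)
  then show ?thesis using a(1) by (intro exI[of _ "(1 / norm a) *\<^sub>R a"]) simp
qed

lemma line_arrangement_pline: "finite V \<Longrightarrow> 0 \<notin> V \<Longrightarrow> line_arrangement (pline ` V)"
  unfolding line_arrangement_def
proof (intro conjI ballI)
  fix L assume V: "0 \<notin> V" and "L \<in> pline ` V"
  then obtain v where "v \<in> V" "L = pline v" by blast
  then show "projective_line L" using V projective_line_pline[of v] by blast
qed simp

lemma line_arrangement_normals:
  assumes "line_arrangement A"
  obtains V where "finite V" "inj_on pline V" "A = pline ` V" "\<forall>v\<in>V. norm v = 1"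
proof -
  have "\<forall>L\<in>A. \<exists>a. norm a = 1 \<and> L = pline a" using assms projective_line_normal by (auto simp: line_arrangement_def)
  from bchoice[OF this] obtain f where f: "\<forall>L\<in>A. norm (f L) = 1 \<and> L = pline (f L)" ..
  show ?thesis
  proof (rule that)
    show "finite (f ` A)" using assms by (simp add: line_arrangement_def)
    show "inj_on pline (f ` A)" using f by (force intro!: inj_onI)
    show "A = pline ` f ` A" using f by force
  qed (use f in auto)
qed

section \<open>Intersection points as planes of normals\<close>

lemma cross3_cross3: "cross3 (cross3 a b) x = (a \<bullet> x) *\<^sub>R b - (b \<bullet> x) *\<^sub>R a"
  by (simp add: cross3_simps forall_3)

lemma pline_inter:
  assumes "a \<noteq> 0" "b \<notin> span {a}"
  shows "pline a \<inter> pline b = {span {cross3 a b}}"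
proof
  note c = cross3_nonzero[OF assms]
  show "{span {cross3 a b}} \<subseteq> pline a \<inter> pline b"
    using c by (simp add: span_in_pline dot_cross_self)
  show "pline a \<inter> pline b \<subseteq> {span {cross3 a b}}"
  proof
    fix p assume p: "p \<in> pline a \<inter> pline b"
    then obtain x where x: "p = span {x}" "x \<noteq> 0" "a \<bullet> x = 0" unfolding pline_eq[of a] by auto
    then have "b \<bullet> x = 0" using p span_in_pline by auto
    then have "cross3 (cross3 a b) x = 0" using x(3) by (simp add: cross3_cross3)
    then have "x \<in> span {cross3 a b}" using c cross3_nonzero by blast
    then show "p \<in> {span {cross3 a b}}" using x span_singleton_eq_iff by blast
  qed
qed

text \<open>Duality: the point in which the lines of \<open>a\<close> and \<open>b\<close> meet is
  the orthogonal complement of \<open>span {a, b}\<close>. The map \<open>Q\<close> takes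
  complements and is injective on these points.\<close>

lemma card_intersection_points:
  assumes V: "0 \<notin> V" and a: "a \<noteq> 0"
  shows "card (intersection_points (pline ` V) (pline a)) = card ((\<lambda>b. span {a, b}) ` {b \<in> V. b \<notin> span {a}})"
proof -
  let ?V = "{b \<in> V. b \<notin> span {a}}"
  have "pline b = pline a \<longleftrightarrow> b \<in> span {a}" if "b \<in> V" for b
    using pline_eq_iff[OF a, of b] V that by metis
  then have "pline ` V - {pline a} = pline ` ?V" by blast
  then have "intersection_points (pline ` V) (pline a) = (\<Union>b\<in>?V. pline a \<inter> pline b)"
    unfolding intersection_points_def by simp
  also have "\<dots> = (\<lambda>b. span {cross3 a b}) ` ?V" using pline_inter[OF a] by auto
  finally have pts: "intersection_points (pline ` V) (pline a) = (\<lambda>b. span {cross3 a b}) ` ?V" .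
  define Q where "Q p = {x. \<forall>y\<in>p. x \<bullet> y = 0}" for p :: "(real^3) set"
  have Q: "Q (span {c}) = mirror c" for c
    unfolding Q_def mirror_def by (auto simp: span_singleton inner_commute intro: exI[of _ 1])
  have "Q (span {cross3 a b}) = span {a, b}" if "b \<in> ?V" for b
    using span_pair_eq_hyperplane[OF a, of b "cross3 a b"] cross3_nonzero[OF a, of b] that
    unfolding Q by (simp add: mirror_def dot_cross_self)
  then have "(\<lambda>b. span {a, b}) ` ?V = Q ` (\<lambda>b. span {cross3 a b}) ` ?V"
    unfolding image_image by (intro image_cong) auto
  moreover have "inj_on Q ((\<lambda>b. span {cross3 a b}) ` ?V)"
  proof (rule inj_onI, elim imageE)
    fix p q b c assume h: "Q p = Q q" "p = span {cross3 a b}" "q = span {cross3 a c}" "b \<in> ?V" "c \<in> ?V"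
    have nz: "cross3 a b \<noteq> 0" "cross3 a c \<noteq> 0" using cross3_nonzero[OF a] h(4,5) by auto
    have "mirror (cross3 a b) = mirror (cross3 a c)" using h(1-3) by (simp only: Q)
    then have "cross3 a c \<in> span {cross3 a b}" using pline_eq_iff[OF nz] by simp
    then show "p = q" using span_singleton_eq_iff[OF nz(2)] h(2,3) by simp
  qed
  ultimately show ?thesis unfolding pts by (simp add: card_image)
qed

section \<open>Invariance under projective equivalence\<close>

definition special :: "nat \<Rightarrow> (real^3) set set set \<Rightarrow> bool" where
  "special n A \<longleftrightarrow> line_arrangement A \<and> n \<ge> 1 \<and> card A = 3 * n \<and> (\<forall>L\<in>A. card (intersection_points A L) = n + 1)"

lemma special_arrangements_eq: "special_arrangements = {A. \<exists>n. special n A}"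
  by (auto simp: special_arrangements_def special_def)

lemma projectively_equivalent_card:
  assumes "(A, B) \<in> projectively_equivalent"
  shows "card B = card A"
    and "\<And>n. \<forall>L\<in>A. card (intersection_points A L) = n \<Longrightarrow> \<forall>L\<in>B. card (intersection_points B L) = n"
proof -
  obtain f :: "real^3 \<Rightarrow> real^3" where f: "bij f" "B = (\<lambda>L. image f ` L) ` A"
    using assms unfolding projectively_equivalent_def projective_transformation_def by auto
  have i: "inj (image f)" using inj_image_eq_iff[OF bij_is_inj[OF f(1)]] by (intro injI) simp
  then have i2: "inj (image (image f))" using inj_image_eq_iff[OF i] by (intro injI) simp
  show "card B = card A" unfolding f(2) using i2 by (simp add: card_image inj_on_subset)
  fix n assume n: "\<forall>L\<in>A. card (intersection_points A L) = n"
  show "\<forall>L\<in>B. card (intersection_points B L) = n"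
  proof
    fix L' assume "L' \<in> B"
    then obtain L where L: "L \<in> A" "L' = image f ` L" unfolding f(2) by blast
    have "B - {L'} = (\<lambda>L. image f ` L) ` (A - {L})"
      unfolding f(2) L(2) using image_set_diff[OF i2, of A "{L}"] by simp
    then have "intersection_points B L' = (\<Union>M\<in>A - {L}. image f ` L \<inter> image f ` M)"
      unfolding intersection_points_def L(2) by simp
    also have "\<dots> = image f ` intersection_points A L"
      unfolding intersection_points_def image_UN by (intro SUP_cong refl) (simp add: image_Int[OF i])
    finally show "card (intersection_points B L') = n" using n L(1) i by (simp add: card_image inj_on_subset)
  qed
qed

lemma special_equivalent: "(A, B) \<in> projectively_equivalent \<Longrightarrow> special n A \<Longrightarrow> special n B"
  using projectively_equivalent_card[of A B] unfolding special_def
  by (auto simp: projectively_equivalent_def)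

text \<open>Normals transform contragrediently: moving them by \<open>g\<close> is the effect on
  lines of the inverse \<open>f\<close> of the adjoint, because
  \<open>g a \<bullet> f x = a \<bullet> x\<close>.\<close>

lemma linear_equivalent:
  assumes g: "linear g" "inj g" and V: "finite V" "0 \<notin> V"
  shows "(pline ` V, pline ` g ` V) \<in> projectively_equivalent"
proof -
  have gsurj: "surj g" using linear_inj_imp_surj[OF g] .
  have la: "linear (adjoint g)" using adjoint_linear[OF g(1)] .
  have "inj (adjoint g)"
  proof (subst linear_injective_0[OF la], intro allI impI)
    fix y assume "adjoint g y = 0"
    then have "g a \<bullet> y = 0" for a using adjoint_works[OF g(1), of a y] by simp
    then have "y \<bullet> y = 0" using gsurj by (metis surjD)
    then show "y = 0" by simp
  qed
  then obtain f where f: "linear f" "adjoint g \<circ> f = id" "f \<circ> adjoint g = id"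
    using linear_injective_isomorphism[OF la] by (auto simp: fun_eq_iff)
  have bf: "bij f" using f(2,3) o_bij by blast
  have dot: "g a \<bullet> f x = a \<bullet> x" for a x
    using adjoint_works[OF g(1), of a "f x"] f(2) by (simp add: fun_eq_iff)
  have f0: "f x = 0 \<longleftrightarrow> x = 0" for x using linear_injective_0[OF f(1)] bf linear_0[OF f(1)] by (auto simp: bij_def)
  have "image f ` pline a = pline (g a)" for a
  proof (intro equalityI subsetI)
    fix p assume "p \<in> image f ` pline a"
    then obtain x where x: "p = f ` span {x}" "x \<noteq> 0" "a \<bullet> x = 0" unfolding pline_eq by auto
    then have "p = span {f x}" using linear_span_image[OF f(1), of "{x}"] by simp
    then show "p \<in> pline (g a)" using x dot f0 span_in_pline by simp
  next
    fix p assume "p \<in> pline (g a)"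
    then obtain y where y: "p = span {y}" "y \<noteq> 0" "g a \<bullet> y = 0" unfolding pline_eq by auto
    obtain x where x: "y = f x" using bf by (metis bij_pointE)
    have "p = f ` span {x}" using y(1) x linear_span_image[OF f(1), of "{x}"] by simp
    moreover have "span {x} \<in> pline a" using x y dot f0 span_in_pline by auto
    ultimately show "p \<in> image f ` pline a" by blast
  qed
  then have "pline ` g ` V = (\<lambda>L. image f ` L) ` pline ` V" unfolding image_image by simp
  moreover have "0 \<notin> g ` V" using V(2) g linear_injective_0 by (metis imageE)
  ultimately show ?thesis
    unfolding projectively_equivalent_def projective_transformation_def
    using line_arrangement_pline[OF V] line_arrangement_pline[OF finite_imageI[OF V(1)], of g] f(1) bf by fastforce
qed

section \<open>From arrangements to systems of unit normals\<close>

definition unit_normals :: "(real^3) set set set \<Rightarrow> (real^3) set" where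
  "unit_normals A = {x. norm x = 1 \<and> pline x \<in> A}"

lemma pline_normalize: "v \<noteq> 0 \<Longrightarrow> pline ((1 / norm v) *\<^sub>R v) = pline v"
  by (rule pline_scale) simp

lemma unit_normals_eq:
  assumes "0 \<notin> V"
  shows "unit_normals (pline ` V) = (\<Union>v\<in>V. {(1 / norm v) *\<^sub>R v, - ((1 / norm v) *\<^sub>R v)})"
proof (intro equalityI subsetI)
  fix x assume "x \<in> unit_normals (pline ` V)"
  then obtain v where v: "norm x = 1" "v \<in> V" "pline v = pline x" unfolding unit_normals_def by auto
  have v0: "v \<noteq> 0" "x \<noteq> 0" using v assms by auto
  then obtain c where c: "x = c *\<^sub>R v" using v(3) pline_eq_iff[OF v0] by (auto simp: span_singleton)
  have "\<bar>c\<bar> * norm v = 1" using v(1) c by simp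
  then have "\<bar>c\<bar> = 1 / norm v" using v0 by (simp add: field_simps)
  then have "c = 1 / norm v \<or> c = - (1 / norm v)" by linarith
  then show "x \<in> (\<Union>v\<in>V. {(1 / norm v) *\<^sub>R v, - ((1 / norm v) *\<^sub>R v)})" using c v(2) by auto
next
  fix x assume "x \<in> (\<Union>v\<in>V. {(1 / norm v) *\<^sub>R v, - ((1 / norm v) *\<^sub>R v)})"
  then obtain v where v: "v \<in> V" "x = (1 / norm v) *\<^sub>R v \<or> x = - ((1 / norm v) *\<^sub>R v)" by blast
  then have "v \<noteq> 0" using assms by auto
  then have "norm x = 1" "pline x = pline v" using v(2) pline_normalize pline_minus by auto
  then show "x \<in> unit_normals (pline ` V)" using v(1) unfolding unit_normals_def by auto
qed

lemma sum_unit_normals: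
  fixes g :: "real^3 \<Rightarrow> real"
  assumes V: "finite V" "0 \<notin> V" "inj_on pline V"
  shows "(\<Sum>x\<in>unit_normals (pline ` V). g x)
    = (\<Sum>v\<in>V. g ((1 / norm v) *\<^sub>R v) + g (- ((1 / norm v) *\<^sub>R v)))"
proof -
  let ?u = "\<lambda>v. (1 / norm v) *\<^sub>R v"
  have u: "norm (?u v) = 1" "pline (?u v) = pline v" "pline (- ?u v) = pline v" if "v \<in> V" for v
    using that V(2) pline_normalize[of v] pline_minus[of "?u v"] by auto
  have "(\<Sum>x\<in>(\<Union>v\<in>V. {?u v, - ?u v}). g x) = (\<Sum>v\<in>V. \<Sum>x\<in>{?u v, - ?u v}. g x)"
  proof (rule sum.UNION_disjoint)
    show "\<forall>v\<in>V. \<forall>w\<in>V. v \<noteq> w \<longrightarrow> {?u v, - ?u v} \<inter> {?u w, - ?u w} = {}"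
    proof (intro ballI impI, rule ccontr)
      fix v w assume vw: "v \<in> V" "w \<in> V" "v \<noteq> w" "{?u v, - ?u v} \<inter> {?u w, - ?u w} \<noteq> {}"
      then obtain x where "x = ?u v \<or> x = - ?u v" "x = ?u w \<or> x = - ?u w" by blast
      then have "pline v = pline x" "pline w = pline x" using u(2,3)[OF vw(1)] u(2,3)[OF vw(2)] by auto
      then show False using inj_onD[OF V(3), of v w] vw(1-3) by simp
    qed
  qed (use V(1) in auto)
  also have "\<dots> = (\<Sum>v\<in>V. g (?u v) + g (- ?u v))"
  proof (rule sum.cong[OF refl])
    fix v assume "v \<in> V"
    then have "?u v \<bullet> ?u v = 1" using u(1) by (simp only: norm_eq_1)
    then have "?u v \<noteq> - ?u v" by (metis inner_minus_left one_neq_neg_one)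
    then show "(\<Sum>x\<in>{?u v, - ?u v}. g x) = g (?u v) + g (- ?u v)" by simp
  qed
  finally show ?thesis unfolding unit_normals_eq[OF V(2)] .
qed

lemma
  assumes A: "line_arrangement A"
  shows unit_system_unit_normals: "unit_system (unit_normals A)"
    and card_unit_normals: "card (unit_normals A) = 2 * card A"
    and pline_unit_normals: "pline ` unit_normals A = A"
proof -
  obtain V where V: "finite V" "inj_on pline V" "A = pline ` V" "\<forall>v\<in>V. norm v = 1"
    using line_arrangement_normals[OF A] .
  have V0: "0 \<notin> V" using V(4) by force
  show "unit_system (unit_normals A)"
  proof
    show "finite (unit_normals A)" unfolding V(3) unit_normals_eq[OF V0] using V(1) by simp
    show "norm x = 1" "- x \<in> unit_normals A" if "x \<in> unit_normals A" for x
      using that pline_minus[of x] by (simp_all add: unit_normals_def)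
  qed
  have "real (card (unit_normals A)) = 2 * real (card A)"
    using sum_unit_normals[OF V(1) V0 V(2), of "\<lambda>_. 1"] card_image[OF V(2)] unfolding V(3) by simp
  then show "card (unit_normals A) = 2 * card A" by linarith
  show "pline ` unit_normals A = A"
    unfolding unit_normals_def V(3) using V(4) by blast
qed

context unit_system
begin

lemma parallel_iff: "a \<in> S \<Longrightarrow> b \<in> S \<Longrightarrow> b \<in> span {a} \<longleftrightarrow> b = a \<or> b = - a"
  using parallel_in_S by (auto simp: span_singleton span_base intro: range_eqI[of _ _ 1] range_eqI[of _ _ "- 1"])

lemma card_planes_at:
  assumes a: "a \<in> S"
  shows "card {P \<in> planes S. a \<in> P} = card (intersection_points (pline ` S) (pline a))"
proof -
  have "{P \<in> planes S. a \<in> P} = (\<lambda>b. span {a, b}) ` {b \<in> S. b \<notin> span {a}}"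
  proof (intro equalityI subsetI)
    fix P assume P: "P \<in> {P \<in> planes S. a \<in> P}"
    obtain y where "y \<in> S" "y \<noteq> a" "y \<noteq> - a" "P = span {a, y}" using plane_partner[of P a] P a by blast
    then show "P \<in> (\<lambda>b. span {a, b}) ` {b \<in> S. b \<notin> span {a}}" using parallel_iff[OF a] by blast
  next
    fix P assume "P \<in> (\<lambda>b. span {a, b}) ` {b \<in> S. b \<notin> span {a}}"
    then obtain b where "b \<in> S" "b \<noteq> a" "b \<noteq> - a" "P = span {a, b}" using parallel_iff[OF a] by blast
    then show "P \<in> {P \<in> planes S. a \<in> P}" using planesI[OF a] by (simp add: span_base)
  qed
  moreover have "0 \<notin> S" using nonzero by blast
  ultimately show ?thesis using card_intersection_points[of S a] nonzero[OF a] by simp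
qed

end

text \<open>For \<open>plane_bound\<close>: if all normals lay in \<open>span {a, b}\<close>, all
  lines would be concurrent and have a single point each. Otherwise a line off the point of
  \<open>a\<close> and \<open>b\<close> meets the lines through it in distinct points, and it has
  only \<open>n + 1\<close> points.\<close>

lemma special_spread_vectors:
  assumes sp: "special n (pline ` V)" and n: "n \<ge> 2" and V: "finite V" "inj_on pline V" "\<forall>v\<in>V. norm v = 1"
  shows "spread_vectors V n"
proof
  have V0: "v \<noteq> 0" if "v \<in> V" for v using that V(3) by force
  then have V0': "0 \<notin> V" by blast
  have np: "b \<notin> span {a}" if "a \<in> V" "b \<in> V" "a \<noteq> b" for a b
    using pline_eq_iff[of a b] V0 that V(2) by (auto dest: inj_onD)
  have pts: "card ((\<lambda>b. span {a, b}) ` {b \<in> V. b \<notin> span {a}}) = n + 1" if "a \<in> V" for a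
    using sp card_intersection_points[OF V0' V0[OF that]] that unfolding special_def by simp
  have ind: "dim (span {a, b}) = 2" if "a \<in> V" "b \<in> V" "a \<noteq> b" for a b
  proof -
    have i: "independent {b, a}" using np[OF that] V0[OF that(1)] independent_insertI[of b "{a}"] by simp
    show ?thesis using that(3) dim_span_eq_card_independent[OF i] by (simp add: insert_commute)
  qed
  show "finite V" "2 \<le> n" by fact+
  show "card V = 3 * n" using sp card_image[OF V(2)] by (simp add: special_def)
  show "v \<noteq> 0" if "v \<in> V" for v using V0 that .
  show "b \<notin> span {a}" if "a \<in> V" "b \<in> V" "a \<noteq> b" for a b using np that .
  fix a b assume ab: "a \<in> V" "b \<in> V" "a \<noteq> b"
  show "card (V \<inter> span {a, b}) \<le> n + 1"
  proof (cases "V \<subseteq> span {a, b}")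
    case True
    have "(\<lambda>c. span {a, c}) ` {c \<in> V. c \<notin> span {a}} \<subseteq> {span {a, b}}"
    proof clarify
      fix c assume c: "c \<in> V" "c \<notin> span {a}"
      then have "c \<noteq> a" by (auto simp: span_base)
      then show "span {a, c} = span {a, b}"
        using subspace_dim_equal[of "span {a, c}" "span {a, b}"] ind[OF ab] ind[OF ab(1) c(1)] True c(1)
          span_minimal[of "{a, c}" "span {a, b}"] by (auto simp: span_base)
    qed
    then have "card ((\<lambda>c. span {a, c}) ` {c \<in> V. c \<notin> span {a}}) \<le> 1"
      using card_mono[of "{span {a, b}}"] by fastforce
    then show ?thesis using pts[OF ab(1)] n by simp
  next
    case False
    then obtain c where c: "c \<in> V" "c \<notin> span {a, b}" by blast
    let ?G = "V \<inter> span {a, b}"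
    have cx: "x \<notin> span {c} \<and> c \<noteq> x" if "x \<in> ?G" for x
    proof -
      have "c \<noteq> x" using that c(2) by blast
      then show ?thesis using np[OF c(1), of x] that by blast
    qed
    have "inj_on (\<lambda>x. span {c, x}) ?G"
    proof (rule inj_onI, rule ccontr)
      fix x y assume xy: "x \<in> ?G" "y \<in> ?G" "span {c, x} = span {c, y}" "x \<noteq> y"
      have "y \<in> span {c, x}" unfolding xy(3) by (simp add: span_base)
      then have sub: "span {x, y} \<subseteq> span {c, x}" by (intro span_minimal) (auto simp: span_base)
      have "span {x, y} = span {c, x}"
        using subspace_dim_equal[OF _ _ sub] ind[of x y] ind[of c x] xy c(1) cx[OF xy(1)] by auto
      then have "c \<in> span {x, y}" by (simp add: span_base)
      also have "span {x, y} \<subseteq> span {a, b}" using xy by (intro span_minimal) auto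
      finally show False using c(2) by simp
    qed
    then have "card ?G = card ((\<lambda>x. span {c, x}) ` ?G)" by (simp add: card_image)
    also have "\<dots> \<le> card ((\<lambda>x. span {c, x}) ` {x \<in> V. x \<notin> span {c}})"
      using cx V(1) by (intro card_mono) auto
    finally show ?thesis using pts[OF c(1)] by simp
  qed
qed

theorem special_hirzebruch_system:
  assumes "special n A" "n \<ge> 2"
  obtains B where "(A, B) \<in> projectively_equivalent" "hirzebruch_system (unit_normals B) n"
proof -
  have A: "line_arrangement A" using assms(1) by (simp add: special_def)
  obtain V where V: "finite V" "inj_on pline V" "A = pline ` V" "\<forall>v\<in>V. norm v = 1"
    using line_arrangement_normals[OF A] .
  have V0: "0 \<notin> V" using V(4) by force
  interpret spread_vectors V n using special_spread_vectors assms V by simp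
  obtain T :: "real^3^3" where T: "invertible T"
    "\<forall>y. (\<Sum>v\<in>V. ((T *v v) \<bullet> y)\<^sup>2 / (norm (T *v v))\<^sup>2) = n * (y \<bullet> y)" using isotropic_position .
  have inj: "inj ((*v) T)" using T(1) by (simp add: invertible_eq_bij bij_is_inj)
  let ?W = "(*v) T ` V"
  have W: "finite ?W" "0 \<notin> ?W"
    using V(1) norm_pos[OF T(1)] by auto
  define B where "B = pline ` ?W"
  have eq: "(A, B) \<in> projectively_equivalent"
    unfolding V(3) B_def using linear_equivalent[OF _ inj V(1) V0] by simp
  then have spB: "special n B" using special_equivalent assms(1) by blast
  then have laB: "line_arrangement B" by (simp add: special_def)
  have "card ?W = card B"
    using spB card_V card_image[OF inj_on_subset[OF inj], of V] by (simp add: special_def)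
  then have injW: "inj_on pline ?W" unfolding B_def using W(1) by (simp add: eq_card_imp_inj_on)
  interpret u: unit_system "unit_normals B" using unit_system_unit_normals[OF laB] .
  have "hirzebruch_system (unit_normals B) n"
  proof
    show "card (unit_normals B) = 6 * n" using card_unit_normals[OF laB] spB by (simp add: special_def)
    show "2 \<le> n" by fact
    fix a assume a: "a \<in> unit_normals B"
    show "card {P \<in> planes (unit_normals B). a \<in> P} = n + 1"
      unfolding u.card_planes_at[OF a] pline_unit_normals[OF laB]
      using spB a by (simp add: special_def unit_normals_def)
  next
    fix y
    have "(\<Sum>x\<in>unit_normals B. (x \<bullet> y)\<^sup>2) = (\<Sum>w\<in>?W. 2 * ((w \<bullet> y)\<^sup>2 / (norm w)\<^sup>2))"
      unfolding B_def sum_unit_normals[OF W injW] by (intro sum.cong) (simp_all add: power_divide)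
    also have "\<dots> = (\<Sum>v\<in>V. 2 * (((T *v v) \<bullet> y)\<^sup>2 / (norm (T *v v))\<^sup>2))"
      using inj_on_subset[OF inj, of V] by (subst sum.reindex) simp_all
    also have "\<dots> = 2 * real n * (y \<bullet> y)" unfolding sum_distrib_left[symmetric] using T(2) by simp
    finally show "(\<Sum>x\<in>unit_normals B. (x \<bullet> y)\<^sup>2) = 2 * real n * (y \<bullet> y)" .
  qed
  then show ?thesis using that eq by blast
qed

section \<open>The standard arrangements\<close>

abbreviation axes :: "real \<times> real \<times> real \<Rightarrow> real^3" where
  "axes \<equiv> comb (axis 1 1) (axis 2 1) (axis 3 1)"

definition standard :: "nat \<Rightarrow> (real^3) set set set" where
  "standard n = pline ` axes ` roots n"

definition frame_map :: "real^3 \<Rightarrow> real^3 \<Rightarrow> real^3 \<Rightarrow> real^3 \<Rightarrow> real^3" where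
  "frame_map a b c x = x $ 1 *\<^sub>R a + x $ 2 *\<^sub>R b + x $ 3 *\<^sub>R c"

lemma frame_map_comb: "frame_map a b c (axes t) = comb a b c t"
  by (cases t) (simp add: frame_map_def comb_def axis_def)

lemma linear_frame_map: "linear (frame_map a b c)"
  by (rule linearI) (simp_all add: frame_map_def algebra_simps)

lemma inj_frame_map:
  assumes "a \<noteq> 0" "b \<notin> span {a}" "c \<notin> span {a, b}"
  shows "inj (frame_map a b c)"
proof (subst linear_injective_0[OF linear_frame_map], intro allI impI)
  fix x assume x: "frame_map a b c x = 0"
  have 3: "x $ 3 = 0"
  proof (rule ccontr)
    assume nz: "x $ 3 \<noteq> 0"
    have "x $ 3 *\<^sub>R c = (- x $ 1) *\<^sub>R a + (- x $ 2) *\<^sub>R b"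
      using x unfolding frame_map_def by (simp add: add_eq_0_iff algebra_simps)
    then have "(1 / x $ 3) *\<^sub>R (x $ 3 *\<^sub>R c) \<in> span {a, b}"
      by (simp only:) (intro span_mul span_add span_base; simp)
    then show False using nz assms(3) by simp
  qed
  have 2: "x $ 2 = 0"
  proof (rule ccontr)
    assume nz: "x $ 2 \<noteq> 0"
    have "x $ 2 *\<^sub>R b = (- x $ 1) *\<^sub>R a"
      using x 3 unfolding frame_map_def by (simp add: add_eq_0_iff algebra_simps)
    then have "(1 / x $ 2) *\<^sub>R (x $ 2 *\<^sub>R b) \<in> span {a}"
      by (simp only:) (intro span_mul span_base; simp)
    then show False using nz assms(2) by simp
  qed
  have "x $ 1 = 0" using x 2 3 assms(1) by (simp add: frame_map_def)
  then show "x = 0" using 2 3 by (simp add: vec_eq_iff forall_3)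
qed

lemma inj_frame_map_orthonormal:
  assumes "orthonormal a b c"
  shows "inj (frame_map a b c)"
proof (subst linear_injective_0[OF linear_frame_map], intro allI impI)
  fix x assume x: "frame_map a b c x = 0"
  have "frame_map a b c x \<bullet> a = x $ 1" "frame_map a b c x \<bullet> b = x $ 2" "frame_map a b c x \<bullet> c = x $ 3"
    using assms by (simp_all add: frame_map_def orthonormal_def inner_left_distrib inner_commute[of b a]
        inner_commute[of c a] inner_commute[of c b])
  then show "x = 0" using x by (simp add: vec_eq_iff forall_3)
qed

lemma finite_roots: "finite (roots n)"
  by (simp add: roots_def)

lemma roots_nonzero: "(0, 0, 0) \<notin> roots n"
  by (auto simp: roots_def)

lemma axes_eq_iff: "axes (p, q, r) = axes (p', q', r') \<longleftrightarrow> p = p' \<and> q = q' \<and> r = r'"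
  by (auto simp: comb_def vec_eq_iff forall_3 axis_def)

lemma axes_eq_0: "axes (p, q, r) = 0 \<longleftrightarrow> p = 0 \<and> q = 0 \<and> r = 0"
  by (auto simp: comb_def vec_eq_iff forall_3 axis_def)

lemma zero_notin_axes_roots: "0 \<notin> axes ` roots n"
proof
  assume "0 \<in> axes ` roots n"
  then obtain t where t: "t \<in> roots n" "axes t = 0" by auto
  obtain p q r where "t = (p, q, r)" by (cases t)
  then show False using t roots_nonzero[of n] axes_eq_0[of p q r] by simp
qed

lemma comb_equivalent:
  assumes "inj (frame_map a b c)"
  shows "(standard n, pline ` comb a b c ` roots n) \<in> projectively_equivalent"
  using linear_equivalent[OF linear_frame_map assms, of "axes ` roots n"] finite_roots zero_notin_axes_roots
  unfolding standard_def image_image frame_map_comb by simp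

lemma golden_less_2: "golden < 2"
  using golden_square golden_gt_1 mult_strict_left_mono[of 2 golden golden] mult_left_mono[of 2 golden golden]
  by linarith

text \<open>For given \<open>n\<close> the squared length of a root depends only on which
  coordinates vanish. Scaling does not change this pattern, so parallel roots have equal
  length.\<close>

lemma root_square:
  assumes "n \<in> {1, 2, 3, 5}" "(p, q, r) \<in> roots n"
  shows "p * p + q * q + r * r = (if n = 5 then if p = 0 \<or> q = 0 \<or> r = 0 then 1 else 4
    else of_bool (p \<noteq> 0) + of_bool (q \<noteq> 0) + of_bool (r \<noteq> 0))"
proof -
  have "(golden - 1) * (golden - 1) = 2 - golden" "(1 - golden) * (1 - golden) = 2 - golden"
    using golden_square by (simp_all add: algebra_simps)
  with golden_square golden_gt_1 assms show ?thesis by (auto simp: roots_def)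
qed

lemma minus_root: "n \<in> {1, 2, 3, 5} \<Longrightarrow> (p, q, r) \<in> roots n \<Longrightarrow> (- p, - q, - r) \<notin> roots n"
  using golden_gt_1 golden_less_2 by (auto simp: roots_def)

lemma roots_parallel:
  assumes n: "n \<in> {1, 2, 3, 5}" and s: "(p, q, r) \<in> roots n" and k: "(k * p, k * q, k * r) \<in> roots n"
  shows "k = 1"
proof -
  have nz: "k \<noteq> 0" "p \<noteq> 0 \<or> q \<noteq> 0 \<or> r \<noteq> 0" using k s roots_nonzero[of n] by auto
  have e: "p * p + q * q + r * r = (k * p) * (k * p) + (k * q) * (k * q) + (k * r) * (k * r)"
    unfolding root_square[OF n s] root_square[OF n k] using nz(1) by simp
  have "(k * k - 1) * (p * p + q * q + r * r)
      = ((k * p) * (k * p) + (k * q) * (k * q) + (k * r) * (k * r)) - (p * p + q * q + r * r)"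
    by (simp add: algebra_simps)
  then have "(k * k - 1) * (p * p + q * q + r * r) = 0" unfolding e[symmetric] by simp
  moreover have "p * p + q * q + r * r \<noteq> 0" using nz(2) unfolding root_square[OF n s] by auto
  ultimately have "k * k - 1 = 0" by (simp only: mult_eq_0_iff simp_thms)
  then have "(k - 1) * (k + 1) = 0" by (simp add: algebra_simps)
  moreover have "k \<noteq> -1" using minus_root[OF n s] k by auto
  ultimately show ?thesis by auto
qed

lemma card_roots: "n \<in> {1, 2, 3, 5} \<Longrightarrow> card (roots n) = 3 * n"
  using golden_gt_1 golden_less_2 by (auto simp: roots_def insert_Times_insert card_insert_if)

lemma card_standard:
  assumes n: "n \<in> {1, 2, 3, 5}"
  shows "card (standard n) = 3 * n"
proof -
  have "inj_on (\<lambda>t. pline (axes t)) (roots n)"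
  proof (rule inj_onI)
    fix s t assume st: "s \<in> roots n" "t \<in> roots n" "pline (axes s) = pline (axes t)"
    obtain p q r p' q' r' where e: "s = (p, q, r)" "t = (p', q', r')" by (cases s, cases t)
    note h = st[unfolded e]
    have "axes (p, q, r) \<noteq> 0" "axes (p', q', r') \<noteq> 0" using zero_notin_axes_roots[of n] h(1,2) by (auto simp del: split_paired_All)
    then obtain k where "axes (p', q', r') = k *\<^sub>R axes (p, q, r)"
      using h(3) pline_eq_iff[of "axes (p, q, r)" "axes (p', q', r')"] unfolding span_singleton by blast
    then have k: "p' = k * p" "q' = k * q" "r' = k * r" unfolding comb_scale axes_eq_iff by blast+
    from k(1-3) show "s = t" using roots_parallel[OF n h(1)] h(2) unfolding e by simp
  qed
  then show ?thesis using card_roots[OF n] by (simp add: standard_def image_image card_image)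
qed

section \<open>Special arrangements are standard\<close>

lemma equivalent_sym: "(A, B) \<in> projectively_equivalent \<Longrightarrow> (B, A) \<in> projectively_equivalent"
  using equiv_projectively_equivalent by (auto simp: equiv_def dest: symD)

lemma equivalent_trans:
  "(A, B) \<in> projectively_equivalent \<Longrightarrow> (B, C) \<in> projectively_equivalent \<Longrightarrow> (A, C) \<in> projectively_equivalent"
  using equiv_projectively_equivalent by (auto simp: equiv_def dest: transD)

text \<open>Inclusion suffices, since both arrangements have \<open>3 * n\<close> lines.\<close>

lemma comb_subset_equivalent:
  assumes n: "n \<in> {1, 2, 3, 5}" and on: "orthonormal a b c" and A: "finite A" "card A = 3 * n"
    and sub: "pline ` comb a b c ` roots n \<subseteq> A"
  shows "(A, standard n) \<in> projectively_equivalent"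
proof -
  have eq: "(standard n, pline ` comb a b c ` roots n) \<in> projectively_equivalent"
    using comb_equivalent[OF inj_frame_map_orthonormal[OF on]] .
  then have "card (pline ` comb a b c ` roots n) = 3 * n"
    using projectively_equivalent_card(1) card_standard[OF n] by metis
  then have "pline ` comb a b c ` roots n = A" using card_subset_eq[OF A(1) sub] A(2) by simp
  then show ?thesis using eq equivalent_sym by simp
qed

text \<open>Two points on each line mean that the three lines are not concurrent; so the normals
  form a basis, and every basis is the linear image of the axes.\<close>

lemma special_1:
  assumes sp: "special 1 A"
  shows "(A, standard 1) \<in> projectively_equivalent"
proof -
  have A: "line_arrangement A" using assms(1) by (simp add: special_def)
  obtain V where V: "finite V" "inj_on pline V" "A = pline ` V" "\<forall>v\<in>V. norm v = 1"
    using line_arrangement_normals[OF A] .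
  have V0: "v \<noteq> 0" if "v \<in> V" for v using that V(4) by force
  have "card V = 3" using sp card_image[OF V(2)] V(3) by (simp add: special_def)
  then obtain a b c where abc: "V = {a, b, c}" "a \<noteq> b" "b \<noteq> c" "a \<noteq> c" by (auto simp: card_3_iff)
  have np: "b \<notin> span {a}" "c \<notin> span {a}"
    using pline_eq_iff[of a b] pline_eq_iff[of a c] V0 V(2) abc by (auto dest: inj_onD)
  have "{x \<in> V. x \<notin> span {a}} = {b, c}" using np abc(1) by (auto simp: span_base)
  then have "card {span {a, b}, span {a, c}} = 2"
    using card_intersection_points[of V a] V0 sp abc(1) unfolding V(3) special_def by auto
  then have ne: "span {a, b} \<noteq> span {a, c}" by auto
  have ind: "dim (span {a, x}) = 2" if "x \<notin> span {a}" for x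
  proof -
    have i: "independent {x, a}" using that V0[of a] abc(1) independent_insertI[of x "{a}"] by simp
    have "x \<noteq> a" using that by (auto simp: span_base)
    then show ?thesis using dim_span_eq_card_independent[OF i] by (simp add: insert_commute)
  qed
  have "c \<notin> span {a, b}"
  proof
    assume "c \<in> span {a, b}"
    then have "span {a, c} \<subseteq> span {a, b}" by (intro span_minimal) (auto simp: span_base)
    then show False using ne subspace_dim_equal[of "span {a, c}" "span {a, b}"] ind np by simp
  qed
  then have "inj (frame_map a b c)" using inj_frame_map V0 abc(1) np(1) by simp
  moreover have "comb a b c ` roots 1 = V" unfolding abc(1) roots_def comb_def by simp
  ultimately show ?thesis using comb_equivalent equivalent_sym V(3) by metis
qed

theorem special_standard:
  assumes "special n A"
  shows "n \<in> {1, 2, 3, 5} \<and> (A, standard n) \<in> projectively_equivalent"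
proof (cases "n = 1")
  case True
  then show ?thesis using special_1 assms by simp
next
  case False
  then have n: "n \<ge> 2" using assms by (simp add: special_def)
  obtain B where B: "(A, B) \<in> projectively_equivalent" "hirzebruch_system (unit_normals B) n"
    using special_hirzebruch_system[OF assms n] .
  interpret hirzebruch_system "unit_normals B" n by (fact B(2))
  obtain a b c where n': "n \<in> {2, 3, 5}" and abc: "orthonormal a b c" "comb a b c ` roots n \<subseteq> lines"
    using root_system_frame by blast
  have spB: "special n B" using special_equivalent[OF B(1) assms] .
  have "pline d \<in> B" if "d \<in> lines" for d
  proof -
    from that[unfolded lines_def mem_Collect_eq] obtain k where k: "k \<noteq> 0 \<and> k *\<^sub>R d \<in> unit_normals B" ..
    then have "pline (k *\<^sub>R d) \<in> B" unfolding unit_normals_def by (simp only: mem_Collect_eq)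
    then show ?thesis using pline_scale k by metis
  qed
  then have "pline ` comb a b c ` roots n \<subseteq> B" using abc(2) by blast
  then have "(B, standard n) \<in> projectively_equivalent"
    using comb_subset_equivalent[of n a b c B] n' abc(1) spB by (auto simp: special_def line_arrangement_def)
  then show ?thesis using B(1) equivalent_trans n' by blast
qed

section \<open>Reflection arrangements\<close>

lemma reflection_Bij: "reflection a \<in> Bij UNIV"
  using o_bij[of "reflection a" "reflection a"] by (simp add: Bij_def reflection_reflection fun_eq_iff)

lemma BijGroup_UNIV_mult: "f \<in> Bij UNIV \<Longrightarrow> g \<in> Bij UNIV \<Longrightarrow> f \<otimes>\<^bsub>BijGroup UNIV\<^esub> g = f \<circ> g"
  by (simp add: BijGroup_def compose_def fun_eq_iff)

lemma coxeter_group_Bij: "f \<in> coxeter_group u v w \<Longrightarrow> f \<in> Bij UNIV"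
  using group.generate_in_carrier[OF group_BijGroup, of "{reflection a | a. a \<noteq> 0 \<and> mirror a \<in> {span {u, v}, span {v, w}, span {w, u}}}" UNIV f]
    reflection_Bij unfolding coxeter_group_def by (auto simp: BijGroup_def)

lemma coxeter_group_comp:
  assumes "f \<in> coxeter_group u v w" "g \<in> coxeter_group u v w"
  shows "f \<circ> g \<in> coxeter_group u v w"
  using generate.eng[OF assms[unfolded coxeter_group_def]] assms[THEN coxeter_group_Bij]
  unfolding coxeter_group_def by (simp add: BijGroup_UNIV_mult)

lemma coxeter_group_reflection:
  "a \<noteq> 0 \<Longrightarrow> mirror a \<in> {span {u, v}, span {v, w}, span {w, u}} \<Longrightarrow> reflection a \<in> coxeter_group u v w"
  unfolding coxeter_group_def by (rule generate.incl) blast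

text \<open>Reflections are their own inverses, so invariance under the generators carries over to
  all words.\<close>

lemma coxeter_group_invariant:
  assumes f: "f \<in> coxeter_group u v w"
    and T: "\<And>a t. a \<noteq> 0 \<Longrightarrow> mirror a \<in> {span {u, v}, span {v, w}, span {w, u}} \<Longrightarrow> t \<in> T \<Longrightarrow> reflection a t \<in> T"
  shows "\<forall>t\<in>T. f t \<in> T"
  using f unfolding coxeter_group_def
proof (induction f rule: generate.induct)
  case one
  then show ?case by (simp add: BijGroup_def)
next
  case (incl h)
  then show ?case using T by auto
next
  case (inv h)
  then obtain a where a: "h = reflection a" "a \<noteq> 0" "mirror a \<in> {span {u, v}, span {v, w}, span {w, u}}" by auto
  have "inv\<^bsub>BijGroup UNIV\<^esub> reflection a = reflection a"
    using reflection_Bij by (intro group.inv_equality[OF group_BijGroup])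
      (auto simp: BijGroup_UNIV_mult reflection_reflection fun_eq_iff, auto simp: BijGroup_def)
  then show ?case using a T by simp
next
  case (eng f g)
  then have "f \<in> Bij UNIV" "g \<in> Bij UNIV"
    using coxeter_group_Bij[of _ u v w] unfolding coxeter_group_def by blast+
  then show ?case using eng by (simp add: BijGroup_UNIV_mult)
qed

definition mirror_normals :: "real^3 \<Rightarrow> real^3 \<Rightarrow> real^3 \<Rightarrow> (real^3) set" where
  "mirror_normals u v w = {d. d \<noteq> 0 \<and> reflection d \<in> coxeter_group u v w}"

lemma reflection_arrangement_eq: "reflection_arrangement u v w = pline ` mirror_normals u v w"
  by (auto simp: reflection_arrangement_def mirror_normals_def)

lemma reflection_eq_0: "reflection x y = 0 \<longleftrightarrow> y = 0"
proof
  assume "reflection x y = 0"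
  then have "reflection x (reflection x y) = 0" using reflection_scale_right[of x 0 0] by simp
  then show "y = 0" by (simp add: reflection_reflection)
qed (use reflection_scale_right[of x 0 0] in simp)

lemma reflection_closed_mirror_normals: "reflection_closed (mirror_normals u v w)"
  unfolding reflection_closed_def
proof (intro conjI ballI allI impI)
  fix x y assume xy: "x \<in> mirror_normals u v w" "y \<in> mirror_normals u v w"
  have "reflection (reflection x y) = reflection x \<circ> (reflection y \<circ> reflection x)"
    using reflection_conjugate[of x y "reflection x z" for z] by (simp add: fun_eq_iff reflection_reflection)
  also have "\<dots> \<in> coxeter_group u v w" using xy coxeter_group_comp unfolding mirror_normals_def by blast
  finally show "reflection x y \<in> mirror_normals u v w"
    using xy(2) by (simp add: mirror_normals_def reflection_eq_0)
next
  fix x :: "real^3" and c :: real assume x: "x \<in> mirror_normals u v w" "c \<noteq> 0"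
  have "reflection (c *\<^sub>R x) = reflection x" using reflection_scale_left[OF x(2)] by (simp add: fun_eq_iff)
  then show "c *\<^sub>R x \<in> mirror_normals u v w" using x by (simp add: mirror_normals_def)
qed

text \<open>Normals to the sides of the triangle; \<open>m\<close> plays the role of \<open>n\<close> in \<open>roots\<close>.\<close>

definition simple_roots :: "nat \<Rightarrow> (real \<times> real \<times> real) set" where
  "simple_roots m =
    (if m = 1 then {(1, 0, 0), (0, 1, 0), (0, 0, 1)} else if m = 2 then {(1, -1, 0), (0, 1, -1), (0, 1, 1)}
     else if m = 3 then {(1, -1, 0), (0, 1, -1), (0, 0, 1)} else {(1, 0, 0), (0, 1, 0), (1, golden, golden - 1)})"

text \<open>Reflections in coordinates, so that the invariance of explicit sets of vertices can be
  checked by computation.\<close>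

fun triple_reflection :: "real \<times> real \<times> real \<Rightarrow> real \<times> real \<times> real \<Rightarrow> real \<times> real \<times> real" where
  "triple_reflection (p, q, r) (x, y, z) =
    (let k = 2 * (p * x + q * y + r * z) / (p * p + q * q + r * r) in (x - k * p, y - k * q, z - k * r))"

lemma reflection_comb:
  assumes "orthonormal a b c"
  shows "reflection (comb a b c s) (comb a b c t) = comb a b c (triple_reflection s t)"
proof -
  obtain p q r x y z where st: "s = (p, q, r)" "t = (x, y, z)" by (cases s, cases t)
  show ?thesis unfolding st reflection_def comb_dot[OF assms] triple_reflection.simps Let_def
    by (simp add: comb_def algebra_simps)
qed

lemma simple_roots_roots: "m \<in> {1, 2, 3, 5} \<Longrightarrow> simple_roots m \<subseteq> roots m"
  by (auto simp: simple_roots_def roots_def)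

text \<open>The sides are compared as an unordered set of planes, because the group depends only on
  this set.\<close>

locale coxeter_triangle =
  fixes u v w a b c :: "real^3" and m :: nat
  assumes m: "m \<in> {1, 2, 3, 5}"
    and orthonormal: "orthonormal a b c"
    and sides: "{span {u, v}, span {v, w}, span {w, u}} = mirror ` comb a b c ` simple_roots m"
begin

lemma comb_nonzero: "s \<noteq> (0, 0, 0) \<Longrightarrow> comb a b c s \<noteq> 0"
proof
  assume s: "s \<noteq> (0, 0, 0)" "comb a b c s = 0"
  obtain p q r where e: "s = (p, q, r)" by (cases s)
  have "p * p + q * q + r * r = 0" using comb_dot[OF orthonormal, of p q r p q r] s(2) unfolding e by simp
  then show False using s(1) unfolding e by (simp add: sum_squares_eq_zero_iff add_nonneg_eq_0_iff)
qed

lemma comb_root_nonzero: "s \<in> roots m \<Longrightarrow> comb a b c s \<noteq> 0"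
  using roots_nonzero[of m] by (intro comb_nonzero) auto

lemma simple_mirror_normals: "comb a b c ` simple_roots m \<subseteq> mirror_normals u v w"
proof
  fix d assume d: "d \<in> comb a b c ` simple_roots m"
  obtain s where s: "d = comb a b c s" "s \<in> simple_roots m" using d by (rule imageE)
  have d0: "d \<noteq> 0" unfolding s(1) by (rule comb_root_nonzero[OF subsetD[OF simple_roots_roots[OF m] s(2)]])
  have "mirror d \<in> {span {u, v}, span {v, w}, span {w, u}}" unfolding sides using d by (rule imageI)
  from coxeter_group_reflection[OF d0 this] d0 show "d \<in> mirror_normals u v w"
    unfolding mirror_normals_def by blast
qed

lemma closure_1: "m = 1 \<Longrightarrow> comb a b c ` roots 1 \<subseteq> mirror_normals u v w"
  using simple_mirror_normals by (simp add: roots_def simple_roots_def)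

lemma roots_mirror_normals: "comb a b c ` roots m \<subseteq> mirror_normals u v w"
proof -
  note cl = closure_1 closure_A3[OF reflection_closed_mirror_normals orthonormal, of u v w]
    closure_B3[OF reflection_closed_mirror_normals orthonormal, of u v w]
    closure_H3[OF reflection_closed_mirror_normals orthonormal, of u v w]
  consider "m = 1" | "m = 2" | "m = 3" | "m = 5" using m by blast
  then show ?thesis
  proof cases
    case 1 then show ?thesis using cl(1) by simp
  next
    case 2
    show ?thesis using cl(2) simple_mirror_normals unfolding 2 by (simp add: simple_roots_def)
  next
    case 3
    show ?thesis using cl(3) simple_mirror_normals unfolding 3 by (simp add: simple_roots_def)
  next
    case 4
    show ?thesis using cl(4) simple_mirror_normals unfolding 4 by (simp add: simple_roots_def)
  qed
qed

lemma invariant: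
  assumes T: "\<And>s t. s \<in> simple_roots m \<Longrightarrow> t \<in> T \<Longrightarrow> triple_reflection s t \<in> T"
    and d: "comb a b c d \<in> mirror_normals u v w" and t: "t \<in> T"
  obtains t' where "t' \<in> T" "comb a b c (triple_reflection d t) = comb a b c t'"
proof -
  have "reflection e x \<in> comb a b c ` T"
    if e: "e \<noteq> 0" "mirror e \<in> {span {u, v}, span {v, w}, span {w, u}}" and x: "x \<in> comb a b c ` T" for e x
  proof -
    obtain s where s: "s \<in> simple_roots m" "mirror e = mirror (comb a b c s)" using e(2) unfolding sides by auto
    have "comb a b c s \<noteq> 0" by (rule comb_root_nonzero[OF subsetD[OF simple_roots_roots[OF m] s(1)]])
    then have "e \<in> span {comb a b c s}" using pline_eq_iff[of "comb a b c s" e] e(1) s(2) by simp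
    then obtain k where k: "e = k *\<^sub>R comb a b c s" by (auto simp: span_singleton)
    then have "reflection e x = reflection (comb a b c s) x" using e(1) reflection_scale_left[of k] by (cases "k = 0") simp_all
    then show ?thesis using x T[OF s(1)] by (auto simp: reflection_comb[OF orthonormal])
  qed
  then have "\<forall>x\<in>comb a b c ` T. reflection (comb a b c d) x \<in> comb a b c ` T"
    using coxeter_group_invariant[of "reflection (comb a b c d)" u v w "comb a b c ` T"] d
    by (simp add: mirror_normals_def)
  then have "comb a b c (triple_reflection d t) \<in> comb a b c ` T" using t by (simp add: reflection_comb[OF orthonormal])
  then show ?thesis using that by blast
qed

end

section \<open>Vertices of polyhedra and their differences\<close>

definition proportional_root :: "nat \<Rightarrow> real \<Rightarrow> real \<Rightarrow> real \<Rightarrow> bool" where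
  "proportional_root m x y z \<longleftrightarrow> (\<exists>j. j \<noteq> 0 \<and> (j * x, j * y, j * z) \<in> roots m)"

lemma proportional_root_minus: "proportional_root m (- x) (- y) (- z) \<longleftrightarrow> proportional_root m x y z"
proof -
  have "proportional_root m (- x) (- y) (- z)" if "proportional_root m x y z" for x y z
  proof -
    from that[unfolded proportional_root_def] obtain j where "j \<noteq> 0 \<and> (j * x, j * y, j * z) \<in> roots m" ..
    then show ?thesis unfolding proportional_root_def by (intro exI[of _ "- j"]) simp
  qed
  from this[of x y z] this[of "- x" "- y" "- z", unfolded minus_minus] show ?thesis by (rule iffI[rotated])
qed

definition tetrahedron :: "(real \<times> real \<times> real) set" where
  "tetrahedron = {(1, 1, 1), (1, -1, -1), (-1, 1, -1), (-1, -1, 1)}"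

definition octahedron :: "(real \<times> real \<times> real) set" where
  "octahedron = {(1, 0, 0), (-1, 0, 0), (0, 1, 0), (0, -1, 0), (0, 0, 1), (0, 0, -1)}"

definition icosahedron :: "(real \<times> real \<times> real) set" where
  "icosahedron = {(x, y, z). \<exists>s\<in>{1, -1}. \<exists>t\<in>{1, -1}.
     x = s \<and> y = 0 \<and> z = t * golden \<or> x = t * golden \<and> y = s \<and> z = 0 \<or> x = 0 \<and> y = t * golden \<and> z = s}"

lemma tetrahedron_difference:
  assumes "(x, y, z) \<in> tetrahedron" "(x', y', z') \<in> tetrahedron" "(x', y', z') \<noteq> (x, y, z)"
  shows "proportional_root 2 (x - x') (y - y') (z - z')"
proof -
  have "\<forall>(x, y, z)\<in>tetrahedron. \<forall>(x', y', z')\<in>tetrahedron. (x', y', z') = (x, y, z) \<or>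
    ((1/2) * (x - x'), (1/2) * (y - y'), (1/2) * (z - z')) \<in> roots 2 \<or>
    ((-1/2) * (x - x'), (-1/2) * (y - y'), (-1/2) * (z - z')) \<in> roots 2"
    unfolding tetrahedron_def roots_def by simp
  then have "((1/2) * (x - x'), (1/2) * (y - y'), (1/2) * (z - z')) \<in> roots 2 \<or>
    ((-1/2) * (x - x'), (-1/2) * (y - y'), (-1/2) * (z - z')) \<in> roots 2"
    using assms by fast
  then show ?thesis unfolding proportional_root_def
    by (elim disjE) (rule exI[of _ "1/2"], simp, rule exI[of _ "-1/2"], simp)
qed

lemma octahedron_difference:
  assumes "(x, y, z) \<in> octahedron" "(x', y', z') \<in> octahedron" "(x', y', z') \<noteq> (x, y, z)"
  shows "proportional_root 3 (x - x') (y - y') (z - z')"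
proof -
  \<comment> \<open>Opposite vertices differ by twice an axis, which explains the factor
    \<open>1/2\<close>; other pairs differ by a root up to sign.\<close>
  have "\<forall>(x, y, z)\<in>octahedron. \<forall>(x', y', z')\<in>octahedron. (x', y', z') = (x, y, z) \<or>
    (\<exists>j\<in>{1, -1, 1/2, -1/2}. (j * (x - x'), j * (y - y'), j * (z - z')) \<in> roots 3)"
    unfolding octahedron_def roots_def by simp
  from bspec[OF bspec[OF this assms(1), unfolded prod.case] assms(2), unfolded prod.case] assms(3)
  have "\<exists>j\<in>{1, -1, 1/2, -1/2}. (j * (x - x'), j * (y - y'), j * (z - z')) \<in> roots 3" by (simp only: simp_thms)
  then obtain j where j: "j \<in> {1, -1, 1/2, -1/2}" "(j * (x - x'), j * (y - y'), j * (z - z')) \<in> roots 3" ..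
  have "j \<noteq> 0" using j(1) by auto
  then show ?thesis unfolding proportional_root_def using j(2) by (intro exI[of _ j] conjI)
qed

lemma icosahedron_cases:
  assumes "(x, y, z) \<in> icosahedron"
  obtains s t where "s \<in> {1, -1}" "t \<in> {1, -1}"
    "x = s \<and> y = 0 \<and> z = t * golden \<or> x = t * golden \<and> y = s \<and> z = 0 \<or> x = 0 \<and> y = t * golden \<and> z = s"
proof -
  from assms[unfolded icosahedron_def mem_Collect_eq prod.case] obtain s where "s \<in> {1, -1}"
    "\<exists>t\<in>{1, -1}. x = s \<and> y = 0 \<and> z = t * golden \<or> x = t * golden \<and> y = s \<and> z = 0 \<or> x = 0 \<and> y = t * golden \<and> z = s" ..
  then show ?thesis using that by (elim bexE)
qed

lemma icosahedronI:
  assumes "s \<in> {1, -1}" "t \<in> {1, -1}"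
  shows "(s, 0, t * golden) \<in> icosahedron" "(t * golden, s, 0) \<in> icosahedron" "(0, t * golden, s) \<in> icosahedron"
  unfolding icosahedron_def mem_Collect_eq prod.case
  by (rule bexI[OF bexI[OF _ assms(2)] assms(1)], simp)+

lemma roots_5_axes: "(1, 0, 0) \<in> roots 5" "(0, 1, 0) \<in> roots 5" "(0, 0, 1) \<in> roots 5"
  by (simp_all add: roots_def)

lemma roots_5I:
  assumes "s \<in> {1, -1}" "t \<in> {1, -1}"
  shows "(1, s * golden, t * (golden - 1)) \<in> roots 5" "(t * (golden - 1), 1, s * golden) \<in> roots 5"
    "(s * golden, t * (golden - 1), 1) \<in> roots 5"
proof -
  have "(s, t) \<in> {1, -1} \<times> {1, -1}" using assms by (rule SigmaI)
  note st = imageI[OF this, of "\<lambda>(s, t). (1, s * golden, t * (golden - 1))", unfolded prod.case]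
    imageI[OF this, of "\<lambda>(s, t). (t * (golden - 1), 1, s * golden)", unfolded prod.case]
    imageI[OF this, of "\<lambda>(s, t). (s * golden, t * (golden - 1), 1)", unfolded prod.case]
  show "(1, s * golden, t * (golden - 1)) \<in> roots 5" "(t * (golden - 1), 1, s * golden) \<in> roots 5"
    "(s * golden, t * (golden - 1), 1) \<in> roots 5"
    unfolding roots_def by (simp_all only: Un_iff st if_True refl simp_thms)
qed

text \<open>The cyclic symmetry of the coordinates reduces the comparison of two vertices to two
  kinds: the same position of the zero coordinate, or different positions.\<close>

lemma roots_5_cyclic:
  assumes "(x, y, z) \<in> roots 5" shows "(z, x, y) \<in> roots 5"
proof -
  have "(x = 1 \<and> y = 0 \<and> z = 0 \<or> x = 0 \<and> y = 1 \<and> z = 0 \<or> x = 0 \<and> y = 0 \<and> z = 1) \<or>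
    (\<exists>s\<in>{1, -1}. \<exists>t\<in>{1, -1}. x = 1 \<and> y = s * golden \<and> z = t * (golden - 1) \<or>
      x = t * (golden - 1) \<and> y = 1 \<and> z = s * golden \<or> x = s * golden \<and> y = t * (golden - 1) \<and> z = 1)"
    using assms unfolding roots_def by auto
  then show ?thesis by (elim disjE bexE conjE) (simp_all only: roots_5_axes roots_5I)
qed

lemma proportional_root_cyclic: "proportional_root 5 x y z \<Longrightarrow> proportional_root 5 z x y"
  unfolding proportional_root_def by (elim exE conjE, rule exI, rule conjI, assumption, rule roots_5_cyclic)

lemma icosahedron_difference_same:
  assumes "s \<in> {1, -1}" "t \<in> {1, -1}" "s' \<in> {1, -1}" "t' \<in> {1, -1::real}"
    and "\<not> (s = s' \<and> t = t')" "\<not> (s = - s' \<and> t = - t')"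
  shows "proportional_root 5 (s - s') 0 (t * golden - t' * golden)"
proof (cases "t = t'")
  case True
  then have "s' = - s" "s * s = 1" "s \<noteq> 0" using assms by auto
  then show ?thesis unfolding True proportional_root_def
    by (intro exI[of _ "s / 2"]) (simp add: roots_5_axes)
next
  case False
  then have t: "t' = - t" "t * t = 1" "t \<noteq> 0" using assms by auto
  then have "s = s'" using assms by auto
  moreover have "t / (2 * golden) * (t * golden - t' * golden) = 1"
    unfolding t(1) using t(2) golden_gt_1 by (simp add: field_simps)
  ultimately show ?thesis unfolding proportional_root_def using t golden_gt_1
    by (intro exI[of _ "t / (2 * golden)"]) (simp add: roots_5_axes)
qed

lemma icosahedron_difference_other:
  assumes "s \<in> {1, -1}" "t \<in> {1, -1}" "s' \<in> {1, -1}" "t' \<in> {1, -1::real}"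
  shows "proportional_root 5 (s - t' * golden) (- s') (t * golden)"
proof (cases "s = t'")
  case True
  have "(- s' * (s - t' * golden), - s' * (- s'), - s' * (t * golden))
      = ((s * s') * (golden - 1), 1, (- (s' * t)) * golden)"
    using assms True by (auto simp: algebra_simps)
  also have "\<dots> \<in> roots 5"
  proof -
    have "- (s' * t) \<in> {1, -1}" "s * s' \<in> {1, -1}" using assms by auto
    then show ?thesis by (rule roots_5I)
  qed
  finally show ?thesis unfolding proportional_root_def using assms by (intro exI[of _ "- s'"]) auto
next
  case False
  then have t': "t' = - s" using assms by auto
  \<comment> \<open>The factor is chosen to make the last coordinate 1, by
    \<open>golden * (golden - 1) = 1\<close>.\<close>
  have "(t * (golden - 1) * (s - t' * golden), t * (golden - 1) * (- s'), t * (golden - 1) * (t * golden))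
      = ((s * t) * golden, (- (s' * t)) * (golden - 1), 1)"
    using assms golden_square unfolding t' by (auto simp: algebra_simps)
  also have "\<dots> \<in> roots 5"
  proof -
    have "s * t \<in> {1, -1}" "- (s' * t) \<in> {1, -1}" using assms by auto
    then show ?thesis by (rule roots_5I)
  qed
  finally show ?thesis unfolding proportional_root_def using assms golden_gt_1
    by (intro exI[of _ "t * (golden - 1)"]) auto
qed

text \<open>The exceptional differences of antipodal vertices are not parallel to roots.\<close>

lemma icosahedron_difference:
  assumes v: "(x, y, z) \<in> icosahedron" "(x', y', z') \<in> icosahedron"
    and ne: "(x', y', z') \<noteq> (x, y, z)" "(x', y', z') \<noteq> (- x, - y, - z)"
  shows "proportional_root 5 (x - x') (y - y') (z - z')"
proof -
  note cyc = proportional_root_cyclic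
  obtain s t where st: "s \<in> {1, -1}" "t \<in> {1, -1}" and
    c: "x = s \<and> y = 0 \<and> z = t * golden \<or> x = t * golden \<and> y = s \<and> z = 0 \<or> x = 0 \<and> y = t * golden \<and> z = s"
    using icosahedron_cases[OF v(1)] .
  obtain s' t' where st': "s' \<in> {1, -1}" "t' \<in> {1, -1}" and
    c': "x' = s' \<and> y' = 0 \<and> z' = t' * golden \<or> x' = t' * golden \<and> y' = s' \<and> z' = 0 \<or> x' = 0 \<and> y' = t' * golden \<and> z' = s'"
    using icosahedron_cases[OF v(2)] .
  have same: "proportional_root 5 (s - s') 0 (t * golden - t' * golden)"
    if "\<not> (s = s' \<and> t = t')" "\<not> (s = - s' \<and> t = - t')"
    using icosahedron_difference_same[OF st st'] that .
  have o: "proportional_root 5 (s - t' * golden) (- s') (t * golden)"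
    using icosahedron_difference_other[OF st st'] .
  have "proportional_root 5 (s' - t * golden) (- s) (t' * golden)"
    using icosahedron_difference_other[OF st' st] .
  then have o': "proportional_root 5 (t * golden - s') s (- (t' * golden))"
    using proportional_root_minus[of 5 "t * golden - s'" s "- (t' * golden)"] by simp
  from c c' show ?thesis
  proof (elim disjE conjE)
    assume e: "x = s" "y = 0" "z = t * golden" "x' = s'" "y' = 0" "z' = t' * golden"
    have "\<not> (s = s' \<and> t = t')" "\<not> (s = - s' \<and> t = - t')" using ne unfolding e by auto
    then show ?thesis using same unfolding e by simp
  next
    assume e: "x = t * golden" "y = s" "z = 0" "x' = t' * golden" "y' = s'" "z' = 0"
    have "\<not> (s = s' \<and> t = t')" "\<not> (s = - s' \<and> t = - t')" using ne unfolding e by auto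
    then show ?thesis using cyc[OF same] unfolding e by simp
  next
    assume e: "x = 0" "y = t * golden" "z = s" "x' = 0" "y' = t' * golden" "z' = s'"
    have "\<not> (s = s' \<and> t = t')" "\<not> (s = - s' \<and> t = - t')" using ne unfolding e by auto
    then show ?thesis using cyc[OF cyc[OF same]] unfolding e by simp
  next
    assume "x = s" "y = 0" "z = t * golden" "x' = t' * golden" "y' = s'" "z' = 0"
    then show ?thesis using o by simp
  next
    assume "x = t * golden" "y = s" "z = 0" "x' = 0" "y' = t' * golden" "z' = s'"
    then show ?thesis using cyc[OF o] by simp
  next
    assume "x = 0" "y = t * golden" "z = s" "x' = s'" "y' = 0" "z' = t' * golden"
    then show ?thesis using cyc[OF cyc[OF o]] by simp
  next
    assume "x = t * golden" "y = s" "z = 0" "x' = s'" "y' = 0" "z' = t' * golden"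
    then show ?thesis using o' by simp
  next
    assume "x = 0" "y = t * golden" "z = s" "x' = t' * golden" "y' = s'" "z' = 0"
    then show ?thesis using cyc[OF o'] by simp
  next
    assume "x = s" "y = 0" "z = t * golden" "x' = 0" "y' = t' * golden" "z' = s'"
    then show ?thesis using cyc[OF cyc[OF o']] by simp
  qed
qed

lemma tetrahedron_invariant: "s \<in> simple_roots 2 \<Longrightarrow> t \<in> tetrahedron \<Longrightarrow> triple_reflection s t \<in> tetrahedron"
  unfolding simple_roots_def tetrahedron_def by auto

lemma octahedron_invariant: "s \<in> simple_roots 3 \<Longrightarrow> t \<in> octahedron \<Longrightarrow> triple_reflection s t \<in> octahedron"
  unfolding simple_roots_def octahedron_def by auto

lemma icosahedron_invariant:
  assumes s: "s \<in> simple_roots 5" and t: "t \<in> icosahedron"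
  shows "triple_reflection s t \<in> icosahedron"
proof -
  have n: "1 * 1 + golden * golden + (golden - 1) * (golden - 1) = 4"
    using golden_square by (simp add: algebra_simps)
  have s': "s = (1, 0, 0) \<or> s = (0, 1, 0) \<or> s = (1, golden, golden - 1)" using s by (simp add: simple_roots_def)
  obtain x y z where e: "t = (x, y, z)" by (cases t)
  obtain p q where pq: "p \<in> {1, -1}" "q \<in> {1, -1}" and
    c: "x = p \<and> y = 0 \<and> z = q * golden \<or> x = q * golden \<and> y = p \<and> z = 0 \<or> x = 0 \<and> y = q * golden \<and> z = p"
    using icosahedron_cases[OF t[unfolded e]] .
  have pq': "- p \<in> {1, -1}" "- q \<in> {1, -1}" using pq by auto
  note I = icosahedronI[OF pq] icosahedronI[OF pq'(1) pq(2)] icosahedronI[OF pq(1) pq'(2)]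
  from s' show ?thesis
  proof (elim disjE)
    assume "s = (1, 0, 0)"
    then show ?thesis using c I unfolding e by auto
  next
    assume "s = (0, 1, 0)"
    then show ?thesis using c I unfolding e by auto
  next
    assume s: "s = (1, golden, golden - 1)"
    \<comment> \<open>This root has squared length 4, so the coefficient of the reflection is half
      the inner product.\<close>
    have r: "triple_reflection s t = (x - k, y - k * golden, z - k * (golden - 1))"
      if "2 * k = x + golden * y + (golden - 1) * z" for k
      using that unfolding s e triple_reflection.simps n Let_def by simp
    have gw: "golden * (golden * w) = golden * w + w" for w using golden_square by (simp add: algebra_simps flip: mult.assoc)
    have "p = q \<or> q = - p" using pq by auto
    with c show ?thesis
    proof (elim disjE conjE)
      assume h: "x = p" "y = 0" "z = q * golden" "p = q"
      have "triple_reflection s t = (0, (- p) * golden, p)"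
        using r[of p] h by (simp add: algebra_simps gw golden_square)
      then show ?thesis using icosahedronI(3)[OF pq(1) pq'(1)] by simp
    next
      assume h: "x = p" "y = 0" "z = q * golden" "q = - p"
      have "triple_reflection s t = (p, 0, q * golden)"
        using r[of 0] h by (simp add: algebra_simps gw golden_square)
      then show ?thesis using I(1) by simp
    next
      assume h: "x = q * golden" "y = p" "z = 0" "p = q"
      have "triple_reflection s t = (0, (- p) * golden, - p)"
        using r[of "p * golden"] h by (simp add: algebra_simps gw golden_square)
      then show ?thesis using icosahedronI(3)[OF pq'(1) pq'(1)] by simp
    next
      assume h: "x = q * golden" "y = p" "z = 0" "q = - p"
      have "triple_reflection s t = (q * golden, p, 0)"
        using r[of 0] h by (simp add: algebra_simps gw golden_square)
      then show ?thesis using I(2) by simp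
    next
      assume h: "x = 0" "y = q * golden" "z = p" "p = q"
      have "triple_reflection s t = ((- p) * golden, - p, 0)"
        using r[of "p * golden"] h by (simp add: algebra_simps gw golden_square)
      then show ?thesis using icosahedronI(2)[OF pq'(1) pq'(1)] by simp
    next
      assume h: "x = 0" "y = q * golden" "z = p" "q = - p"
      have "triple_reflection s t = (p, 0, p * golden)"
        using r[of "- p"] h by (simp add: algebra_simps gw golden_square)
      then show ?thesis using icosahedronI(1)[OF pq(1) pq(1)] by simp
    qed
  qed
qed

text \<open>The reflection permutes \<open>X\<close>, reverses the sign of
  \<open>x \<bullet> h\<close> and preserves \<open>x \<bullet> y\<close>; so the sum equals its own
  negative.\<close>

lemma sum_reflection_orthogonal:
  fixes X :: "(real^3) set"
  assumes X: "\<And>x. x \<in> X \<Longrightarrow> reflection h x \<in> X" and h: "h \<noteq> 0" "h \<bullet> y = 0"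
  shows "(\<Sum>x\<in>X. (x \<bullet> h) * (x \<bullet> y)) = 0"
proof -
  have sh: "reflection h h = - h" using h(1) by (simp add: reflection_def scaleR_2)
  have sy: "reflection h y = y" using h by (simp add: reflection_def)
  have "reflection h x \<bullet> h = - (x \<bullet> h)" "reflection h x \<bullet> y = x \<bullet> y" for x
    using reflection_dot[of h x "- h"] reflection_dot[of h x y] sh sy by (simp_all add: reflection_minus)
  then have "(\<Sum>x\<in>X. (reflection h x \<bullet> h) * (reflection h x \<bullet> y)) = (\<Sum>x\<in>X. - ((x \<bullet> h) * (x \<bullet> y)))"
    by simp
  moreover have "(\<Sum>x\<in>X. (reflection h x \<bullet> h) * (reflection h x \<bullet> y)) = (\<Sum>x\<in>X. (x \<bullet> h) * (x \<bullet> y))"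
    by (rule sum.reindex_bij_witness[where i = "reflection h" and j = "reflection h"])
      (simp_all add: X reflection_reflection)
  ultimately show ?thesis by (simp add: sum_negf)
qed

lemma reflection_in_plane: "subspace P \<Longrightarrow> h \<in> P \<Longrightarrow> x \<in> P \<Longrightarrow> reflection h x \<in> P"
  by (simp add: reflection_def subspace_diff subspace_scale)

section \<open>Systems closed under their reflections are tight frames\<close>

context unit_system
begin

text \<open>By \<open>sum_reflection_orthogonal\<close>, every element of
  \<open>S \<inter> P\<close> is an eigenvector of the frame operator of the plane. Two eigenvectors
  that are neither parallel nor orthogonal make a symmetric operator of rank two scalar; if no
  element \<open>b\<close> is of this kind relative to \<open>a\<close>, the plane contains just
  \<open>a\<close>, \<open>e\<close> and their opposites.\<close>

lemma reflection_closed_local_frame: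
  assumes closed: "\<And>x y. x \<in> S \<Longrightarrow> y \<in> S \<Longrightarrow> reflection x y \<in> S"
    and P: "P \<in> planes S" and a: "a \<in> S" "a \<in> P"
  shows "(\<Sum>x\<in>S \<inter> P. (x \<bullet> a)\<^sup>2) = card (S \<inter> P) / 2"
proof -
  obtain e where e: "e \<in> P" "norm e = 1" "a \<bullet> e = 0" and basis: "\<forall>x\<in>P. x = (x \<bullet> a) *\<^sub>R a + (x \<bullet> e) *\<^sub>R e"
    using plane_basis[OF P a] .
  have ee: "e \<bullet> e = 1" using e(2) by (simp add: norm_eq_1)
  have aa: "a \<bullet> a = 1" using dot_self[OF a(1)] .
  let ?A = "\<Sum>x\<in>S \<inter> P. (x \<bullet> a)\<^sup>2" and ?E = "\<Sum>x\<in>S \<inter> P. (x \<bullet> e)\<^sup>2"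
  have one: "(x \<bullet> a)\<^sup>2 + (x \<bullet> e)\<^sup>2 = 1" if "x \<in> S \<inter> P" for x
  proof -
    have "x \<bullet> x = x \<bullet> ((x \<bullet> a) *\<^sub>R a + (x \<bullet> e) *\<^sub>R e)" using basis that by (metis IntD2)
    then show ?thesis using dot_self[of x] that by (simp add: inner_right_distrib power2_eq_square)
  qed
  have "?A + ?E = (\<Sum>x\<in>S \<inter> P. (x \<bullet> a)\<^sup>2 + (x \<bullet> e)\<^sup>2)" by (simp only: sum.distrib)
  also have "\<dots> = (\<Sum>x\<in>S \<inter> P. 1)" by (rule sum.cong[OF refl]) (rule one)
  finally have tot: "?A + ?E = card (S \<inter> P)" by simp
  have orth: "(\<Sum>x\<in>S \<inter> P. (x \<bullet> h) * (x \<bullet> y)) = 0" if "h \<in> S \<inter> P" "h \<bullet> y = 0" for h y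
    using that closed reflection_in_plane[OF subspace_plane[OF P]] nonzero[of h]
    by (intro sum_reflection_orthogonal) auto
  have ae: "(\<Sum>x\<in>S \<inter> P. (x \<bullet> a) * (x \<bullet> e)) = 0" using orth[of a e] a e(3) by blast
  have "?A = ?E"
  proof (cases "\<exists>b\<in>S \<inter> P. b \<bullet> a \<noteq> 0 \<and> b \<bullet> e \<noteq> 0")
    case True
    then obtain b where b: "b \<in> S \<inter> P" "b \<bullet> a \<noteq> 0" "b \<bullet> e \<noteq> 0" by blast
    define s t where "s = b \<bullet> a" and "t = b \<bullet> e"
    have be: "b = s *\<^sub>R a + t *\<^sub>R e" unfolding s_def t_def using basis b(1) by (rule_tac bspec[OF basis]) simp
    have "b \<bullet> ((- t) *\<^sub>R a + s *\<^sub>R e) = 0" by (simp add: inner_add_right inner_diff_right s_def t_def)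
    from orth[OF b(1) this] have "(\<Sum>x\<in>S \<inter> P. (x \<bullet> b) * (x \<bullet> ((- t) *\<^sub>R a + s *\<^sub>R e))) = 0" .
    moreover have "(x \<bullet> b) * (x \<bullet> ((- t) *\<^sub>R a + s *\<^sub>R e))
        = (s * t) * (x \<bullet> e)\<^sup>2 - (s * t) * (x \<bullet> a)\<^sup>2 + (s * s - t * t) * ((x \<bullet> a) * (x \<bullet> e))" for x
      unfolding be by (simp add: inner_right_distrib power2_eq_square algebra_simps)
    ultimately have "(s * t) * ?E - (s * t) * ?A + (s * s - t * t) * (\<Sum>x\<in>S \<inter> P. (x \<bullet> a) * (x \<bullet> e)) = 0"
      by (simp only: sum.distrib sum_subtractf sum_distrib_left)
    then have "(s * t) * (?E - ?A) = 0" using ae by (simp add: algebra_simps)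
    then show ?thesis using b(2,3) by (simp add: s_def t_def)
  next
    case False
    have sub: "S \<inter> P \<subseteq> {a, - a, e, - e}"
    proof
      fix b assume b: "b \<in> S \<inter> P"
      then have be: "b = (b \<bullet> a) *\<^sub>R a + (b \<bullet> e) *\<^sub>R e" using basis by blast
      have "b \<bullet> a = 0 \<or> b \<bullet> e = 0" using False b by blast
      then show "b \<in> {a, - a, e, - e}"
      proof
        assume z: "b \<bullet> a = 0"
        then have "(b \<bullet> e)\<^sup>2 = 1" using one[OF b] by simp
        then have "b \<bullet> e = 1 \<or> b \<bullet> e = - 1" by (simp add: power2_eq_1_iff)
        then show ?thesis using be z by auto
      next
        assume z: "b \<bullet> e = 0"
        then have "(b \<bullet> a)\<^sup>2 = 1" using one[OF b] by simp
        then have "b \<bullet> a = 1 \<or> b \<bullet> a = - 1" by (simp add: power2_eq_1_iff)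
        then show ?thesis using be z by auto
      qed
    qed
    obtain y where y: "y \<in> S" "y \<in> P" "y \<noteq> a" "y \<noteq> - a" using plane_partner[OF P a] by metis
    then have "y = e \<or> y = - e" using sub by blast
    then have "e \<in> S" using y(1) neg_iff by auto
    then have eq: "S \<inter> P = {a, - a, e, - e}"
      using sub a e(1) neg[of a] neg[of e] plane_neg[OF P] by blast
    have "a \<noteq> e" "a \<noteq> - e" using e(3) aa by auto
    moreover have "- a \<noteq> e" "- a \<noteq> - e" using e(3) aa by auto
    moreover have "a \<noteq> - a" "e \<noteq> - e" using neq_neg a(1) \<open>e \<in> S\<close> by blast+
    ultimately show ?thesis unfolding eq using aa ee e(3) by (simp add: inner_commute[of e a])
  qed
  then show ?thesis using tot by simp
qed

text \<open>The double count read backwards: summing squared inner products with \<open>a\<close>,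
  and summing 1, gives two linear equations for the number of planes through \<open>a\<close> and
  the total number of their elements. They determine both.\<close>

lemma reflection_closed_planes_at:
  assumes closed: "\<And>x y. x \<in> S \<Longrightarrow> y \<in> S \<Longrightarrow> reflection x y \<in> S"
    and card: "card S = 6 * n" and frame: "\<And>y. (\<Sum>x\<in>S. (x \<bullet> y)\<^sup>2) = 2 * real n * (y \<bullet> y)" and a: "a \<in> S"
  shows "card {P \<in> planes S. a \<in> P} = n + 1"
proof -
  let ?A = "{P \<in> planes S. a \<in> P}"
  let ?s = "\<Sum>P\<in>?A. real (card (S \<inter> P))" and ?c = "real (card ?A)"
  have aa: "a \<bullet> a = 1" using dot_self[OF a] .
  have "(\<Sum>x\<in>S. (x \<bullet> a)\<^sup>2) = 2 + (\<Sum>P\<in>?A. \<Sum>x\<in>S \<inter> P - {a, - a}. (x \<bullet> a)\<^sup>2)"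
    using sum_planes_at[OF a, of "\<lambda>x. (x \<bullet> a)\<^sup>2"] aa by simp
  also have "(\<Sum>P\<in>?A. \<Sum>x\<in>S \<inter> P - {a, - a}. (x \<bullet> a)\<^sup>2) = (\<Sum>P\<in>?A. real (card (S \<inter> P)) / 2 - 2)"
  proof (rule sum.cong[OF refl])
    fix P assume "P \<in> ?A"
    then have P: "P \<in> planes S" "a \<in> P" by auto
    show "(\<Sum>x\<in>S \<inter> P - {a, - a}. (x \<bullet> a)\<^sup>2) = real (card (S \<inter> P)) / 2 - 2"
      using sum_plane_split[OF a P, of "\<lambda>x. (x \<bullet> a)\<^sup>2"] reflection_closed_local_frame[OF assms(1) P(1) a P(2)] aa
      by (simp only: inner_minus_left power2_minus) simp
  qed
  also have "\<dots> = ?s / 2 - 2 * ?c" by (simp add: sum_subtractf sum_divide_distrib)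
  finally have 1: "2 * real n = 2 + ?s / 2 - 2 * ?c" using frame[of a] aa by simp
  have "real (card S) = 2 + (\<Sum>P\<in>?A. \<Sum>x\<in>S \<inter> P - {a, - a}. 1)"
    using sum_planes_at[OF a, of "\<lambda>x. 1"] by simp
  also have "(\<Sum>P\<in>?A. \<Sum>x\<in>S \<inter> P - {a, - a}. 1) = (\<Sum>P\<in>?A. real (card (S \<inter> P)) - 2)"
  proof (rule sum.cong[OF refl])
    fix P assume "P \<in> ?A"
    then have P: "P \<in> planes S" "a \<in> P" by auto
    show "(\<Sum>x\<in>S \<inter> P - {a, - a}. 1) = real (card (S \<inter> P)) - 2"
      using sum_plane_split[OF a P, of "\<lambda>x. 1"] by simp
  qed
  also have "\<dots> = ?s - 2 * ?c" by (simp add: sum_subtractf)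
  finally have "6 * real n = 2 + ?s - 2 * ?c" using card by simp
  with 1 have "?c = real n + 1" by linarith
  then show ?thesis by linarith
qed

end

section \<open>Mirrors of the Coxeter groups\<close>

context coxeter_triangle
begin

lemma comb_inj: "comb a b c s = comb a b c t \<Longrightarrow> s = t"
proof -
  assume h: "comb a b c s = comb a b c t"
  obtain p q r x y z where st: "s = (p, q, r)" "t = (x, y, z)" by (cases s, cases t)
  have "frame_map a b c (axes s) = frame_map a b c (axes t)" unfolding frame_map_comb by (rule h)
  then have "axes s = axes t" by (rule injD[OF inj_frame_map_orthonormal[OF orthonormal]])
  then show ?thesis unfolding st axes_eq_iff by simp
qed

lemma comb_surj: obtains p q r where "d = comb a b c (p, q, r)"
proof -
  have "surj (frame_map a b c)"
    by (rule linear_inj_imp_surj[OF linear_frame_map inj_frame_map_orthonormal[OF orthonormal]])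
  then obtain x where "d = frame_map a b c x" by (rule surjE)
  then have "d = comb a b c (x $ 1, x $ 2, x $ 3)" by (simp add: frame_map_def comb_def)
  then show ?thesis using that by blast
qed

lemma orthonormal_square: "(a \<bullet> y)\<^sup>2 + (b \<bullet> y)\<^sup>2 + (c \<bullet> y)\<^sup>2 = y \<bullet> y"
proof -
  obtain p q r where y: "y = comb a b c (p, q, r)" by (rule comb_surj)
  have "a = comb a b c (1, 0, 0)" "b = comb a b c (0, 1, 0)" "c = comb a b c (0, 0, 1)" by (simp_all add: comb_def)
  then have "a \<bullet> y = p" "b \<bullet> y = q" "c \<bullet> y = r"
    using comb_dot[OF orthonormal, of 1 0 0 p q r] comb_dot[OF orthonormal, of 0 1 0 p q r]
      comb_dot[OF orthonormal, of 0 0 1 p q r] unfolding y by simp_all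
  moreover have "y \<bullet> y = p * p + q * q + r * r" unfolding y by (rule comb_dot[OF orthonormal])
  ultimately show ?thesis by (simp add: power2_eq_square)
qed

text \<open>A reflection moves a vertex by a multiple of its normal, which is nonzero if the vertex
  does not lie on the mirror.\<close>

lemma difference:
  assumes T: "\<And>s t. s \<in> simple_roots m \<Longrightarrow> t \<in> T \<Longrightarrow> triple_reflection s t \<in> T"
    and d: "comb a b c (p, q, r) \<in> mirror_normals u v w" and t: "(x, y, z) \<in> T"
    and nz: "p * x + q * y + r * z \<noteq> 0"
  obtains k where "k \<noteq> 0" "(x - k * p, y - k * q, z - k * r) \<in> T"
proof -
  obtain t' where t': "t' \<in> T" "comb a b c (triple_reflection (p, q, r) (x, y, z)) = comb a b c t'"
    using invariant[OF T d t] by blast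
  have "triple_reflection (p, q, r) (x, y, z) \<in> T" using comb_inj[OF t'(2)] t'(1) by simp
  moreover have "p * p + q * q + r * r \<noteq> 0"
  proof
    assume "p * p + q * q + r * r = 0"
    then have "p = 0" "q = 0" "r = 0" by (simp_all add: add_nonneg_eq_0_iff)
    then show False using nz by simp
  qed
  ultimately show ?thesis using that[of "2 * (p * x + q * y + r * z) / (p * p + q * q + r * r)"] nz
    by (simp add: Let_def)
qed

lemma proportional_root_scale: "k \<noteq> 0 \<Longrightarrow> proportional_root m (k * p) (k * q) (k * r) \<Longrightarrow> proportional_root m p q r"
proof -
  assume k: "k \<noteq> 0" and h: "proportional_root m (k * p) (k * q) (k * r)"
  from h[unfolded proportional_root_def] obtain j where "j \<noteq> 0 \<and> (j * (k * p), j * (k * q), j * (k * r)) \<in> roots m" ..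
  then show ?thesis unfolding proportional_root_def using k by (intro exI[of _ "j * k"]) (simp add: mult.assoc)
qed

lemma normal_nonzero:
  assumes "comb a b c (p, q, r) \<in> mirror_normals u v w"
  shows "p \<noteq> 0 \<or> q \<noteq> 0 \<or> r \<noteq> 0"
proof (rule ccontr)
  assume "\<not> ?thesis"
  then have "comb a b c (p, q, r) = 0" by (simp add: comb_def)
  then show False using assms by (simp add: mirror_normals_def)
qed

text \<open>Here the group preserves each pair of opposite axis vectors, which takes the place of
  the polyhedron.\<close>

lemma normals_proportional_1:
  assumes m1: "m = 1" and d: "comb a b c (p, q, r) \<in> mirror_normals u v w"
  shows "proportional_root m p q r"
proof -
  have key: "proportional_root m p q r"
    if T: "(x, y, z) \<in> {(1, 0, 0), (0, 1, 0), (0, 0, 1)}" and nz: "p * x + q * y + r * z \<noteq> 0" for x y z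
  proof -
    obtain k where k: "k \<noteq> 0" "(x - k * p, y - k * q, z - k * r) \<in> {(x, y, z), (- x, - y, - z)}"
    proof (rule difference[OF _ d _ nz, of "{(x, y, z), (- x, - y, - z)}"])
      show "triple_reflection s t \<in> {(x, y, z), (- x, - y, - z)}"
        if "s \<in> simple_roots m" "t \<in> {(x, y, z), (- x, - y, - z)}" for s t
        using that T unfolding simple_roots_def m1 by auto
    qed (auto intro: that)
    have "(x - k * p, y - k * q, z - k * r) \<noteq> (x, y, z)" using k(1) normal_nonzero[OF d] by auto
    then have "k * p = 2 * x" "k * q = 2 * y" "k * r = 2 * z" using k(2) by auto
    then have "(1/2) * (k * p) = x" "(1/2) * (k * q) = y" "(1/2) * (k * r) = z" by simp_all
    moreover have "(x, y, z) \<in> roots m" using T by (auto simp: m1 roots_def)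
    ultimately have "proportional_root m (k * p) (k * q) (k * r)"
      unfolding proportional_root_def by (intro exI[of _ "1/2"]) simp
    then show ?thesis using proportional_root_scale[OF k(1)] by blast
  qed
  consider "p \<noteq> 0" | "q \<noteq> 0" | "r \<noteq> 0" using normal_nonzero[OF d] by blast
  then show ?thesis using key[of 1 0 0] key[of 0 1 0] key[of 0 0 1] by cases simp_all
qed

lemma normals_proportional_difference:
  assumes T: "\<And>s t. s \<in> simple_roots m \<Longrightarrow> t \<in> T \<Longrightarrow> triple_reflection s t \<in> T"
    and diff: "\<And>x y z x' y' z'. (x, y, z) \<in> T \<Longrightarrow> (x', y', z') \<in> T \<Longrightarrow> (x', y', z') \<noteq> (x, y, z) \<Longrightarrow>
      proportional_root m (x - x') (y - y') (z - z')"
    and d: "comb a b c (p, q, r) \<in> mirror_normals u v w"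
    and t: "(x, y, z) \<in> T" "p * x + q * y + r * z \<noteq> 0"
  shows "proportional_root m p q r"
proof -
  obtain k where k: "k \<noteq> 0" "(x - k * p, y - k * q, z - k * r) \<in> T"
    using difference[OF T d t] by blast
  have "(x - k * p, y - k * q, z - k * r) \<noteq> (x, y, z)" using k(1) normal_nonzero[OF d] by auto
  then have "proportional_root m (x - (x - k * p)) (y - (y - k * q)) (z - (z - k * r))"
    using diff[OF t(1) k(2)] by blast
  then have "proportional_root m (k * p) (k * q) (k * r)" by simp
  then show ?thesis using proportional_root_scale[OF k(1)] by blast
qed

lemma normals_proportional_2:
  assumes m2: "m = 2" and d: "comb a b c (p, q, r) \<in> mirror_normals u v w"
  shows "proportional_root m p q r"
proof -
  have key: "proportional_root m p q r" if "(x, y, z) \<in> tetrahedron" "p * x + q * y + r * z \<noteq> 0" for x y z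
    by (rule normals_proportional_difference[OF _ _ d that])
      (use tetrahedron_invariant tetrahedron_difference m2 in blast)+
  show ?thesis
  proof (rule ccontr)
    assume n: "\<not> ?thesis"
    have "p + q + r = 0" "p - q - r = 0" "- p + q - r = 0"
      using key[of 1 1 1] key[of 1 "-1" "-1"] key[of "-1" 1 "-1"] n by (auto simp: tetrahedron_def)
    then have "p = 0" "q = 0" "r = 0" by linarith+
    then show False using normal_nonzero[OF d] by simp
  qed
qed

lemma normals_proportional_3:
  assumes m3: "m = 3" and d: "comb a b c (p, q, r) \<in> mirror_normals u v w"
  shows "proportional_root m p q r"
proof -
  have key: "proportional_root m p q r" if "(x, y, z) \<in> octahedron" "p * x + q * y + r * z \<noteq> 0" for x y z
    by (rule normals_proportional_difference[OF _ _ d that])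
      (use octahedron_invariant octahedron_difference m3 in blast)+
  show ?thesis
  proof (rule ccontr)
    assume n: "\<not> ?thesis"
    have "p = 0" "q = 0" "r = 0"
      using key[of 1 0 0] key[of 0 1 0] key[of 0 0 1] n by (auto simp: octahedron_def)
    then show False using normal_nonzero[OF d] by simp
  qed
qed

lemma icosahedron_spanning:
  assumes "p \<noteq> 0 \<or> q \<noteq> 0 \<or> r \<noteq> (0::real)"
  shows "\<exists>x y z. (x, y, z) \<in> icosahedron \<and> p * x + q * y + r * z \<noteq> 0"
proof (rule ccontr)
  assume n: "\<not> ?thesis"
  have z: "p * x + q * y + r * z = 0" if t: "(x, y, z) \<in> icosahedron" for x y z using n t by blast
  have "p + r * golden = 0" "- p + r * golden = 0" "q + p * golden = 0"
    using z[OF icosahedronI(1)[of 1 1]] z[OF icosahedronI(1)[of "-1" 1]] z[OF icosahedronI(2)[of 1 1]] by simp_all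
  then have "p = 0" "q = 0" "r * golden = 0" by (linarith, auto)
  then show False using assms golden_gt_1 by auto
qed

text \<open>If the reflection takes a vertex to its antipode, the normal is parallel to that vertex.
  Then a second vertex, neither orthogonal nor parallel to the first, is moved as well; it cannot
  also go to its antipode, so the difference that it gives is parallel to a root.\<close>

lemma normals_proportional_5:
  assumes m5: "m = 5" and d: "comb a b c (p, q, r) \<in> mirror_normals u v w"
  shows "proportional_root m p q r"
proof -
  have T: "triple_reflection s t \<in> icosahedron" if "s \<in> simple_roots m" "t \<in> icosahedron" for s t
    using icosahedron_invariant that m5 by blast
  have key: "proportional_root m p q r \<or> k * p = 2 * x \<and> k * q = 2 * y \<and> k * r = 2 * z"
    if k: "k \<noteq> 0" "(x - k * p, y - k * q, z - k * r) \<in> icosahedron" and t: "(x, y, z) \<in> icosahedron" for x y z k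
  proof (cases "(x - k * p, y - k * q, z - k * r) = (- x, - y, - z)")
    case True
    then show ?thesis by auto
  next
    case False
    have "(x - k * p, y - k * q, z - k * r) \<noteq> (x, y, z)" using k(1) normal_nonzero[OF d] by auto
    then have "proportional_root m (x - (x - k * p)) (y - (y - k * q)) (z - (z - k * r))"
      using icosahedron_difference[OF t k(2) _ False] m5 by blast
    then have "proportional_root m (k * p) (k * q) (k * r)" by simp
    then show ?thesis using proportional_root_scale[OF k(1)] by blast
  qed
  obtain x y z where t: "(x, y, z) \<in> icosahedron" "p * x + q * y + r * z \<noteq> 0"
    using icosahedron_spanning[OF normal_nonzero[OF d]] by blast
  obtain k where k: "k \<noteq> 0" "(x - k * p, y - k * q, z - k * r) \<in> icosahedron"
    using difference[OF T d t] by blast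
  show ?thesis
  proof (rule ccontr)
    assume n: "\<not> ?thesis"
    then have e: "k * p = 2 * x" "k * q = 2 * y" "k * r = 2 * z" using key[OF k t(1)] by blast+
    obtain s t' where st: "s \<in> {1, -1}" "t' \<in> {1, -1}" and
      cs: "x = s \<and> y = 0 \<and> z = t' * golden \<or> x = t' * golden \<and> y = s \<and> z = 0 \<or> x = 0 \<and> y = t' * golden \<and> z = s"
      using icosahedron_cases[OF t(1)] .
    have nz: "s \<noteq> 0" "t' \<noteq> 0" "golden \<noteq> 0" using st golden_gt_1 by auto
    obtain x1 y1 z1 where t1: "(x1, y1, z1) \<in> icosahedron" "x * x1 + y * y1 + z * z1 \<noteq> 0"
      and np: "\<And>l. \<not> (x1 = l * x \<and> y1 = l * y \<and> z1 = l * z)"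
    proof -
      have "\<exists>x1 y1 z1. (x1, y1, z1) \<in> icosahedron \<and> x * x1 + y * y1 + z * z1 \<noteq> 0 \<and>
          (\<forall>l. \<not> (x1 = l * x \<and> y1 = l * y \<and> z1 = l * z))"
        using cs
      proof (elim disjE conjE)
        assume "x = s" "y = 0" "z = t' * golden"
        then show ?thesis using icosahedronI(2)[of 1 1] nz by (intro exI[of _ golden] exI[of _ 1] exI[of _ 0]) simp
      next
        assume "x = t' * golden" "y = s" "z = 0"
        then show ?thesis using icosahedronI(3)[of 1 1] nz by (intro exI[of _ 0] exI[of _ golden] exI[of _ 1]) simp
      next
        assume "x = 0" "y = t' * golden" "z = s"
        then show ?thesis using icosahedronI(1)[of 1 1] nz by (intro exI[of _ 1] exI[of _ 0] exI[of _ golden]) simp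
      qed
      then show ?thesis using that by blast
    qed
    have "k * (p * x1 + q * y1 + r * z1) = 2 * (x * x1 + y * y1 + z * z1)"
      using e by (simp add: distrib_left flip: mult.assoc)
    then have "p * x1 + q * y1 + r * z1 \<noteq> 0" using t1(2) by auto
    then obtain k1 where k1: "k1 \<noteq> 0" "(x1 - k1 * p, y1 - k1 * q, z1 - k1 * r) \<in> icosahedron"
      using difference[OF T d t1(1)] by blast
    then have e1: "k1 * p = 2 * x1" "k1 * q = 2 * y1" "k1 * r = 2 * z1" using key[OF k1 t1(1)] n by blast+
    have "p = 2 * x / k" "q = 2 * y / k" "r = 2 * z / k" using e k(1) by (simp_all add: field_simps)
    then have "2 * x1 = 2 * (k1 / k * x)" "2 * y1 = 2 * (k1 / k * y)" "2 * z1 = 2 * (k1 / k * z)"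
      unfolding e1[symmetric] by simp_all
    then have "x1 = k1 / k * x" "y1 = k1 / k * y" "z1 = k1 / k * z" by linarith+
    then show False using np by blast
  qed
qed

lemma normals_proportional:
  assumes "comb a b c (p, q, r) \<in> mirror_normals u v w"
  shows "proportional_root m p q r"
  using m normals_proportional_1 normals_proportional_2 normals_proportional_3 normals_proportional_5 assms by blast

lemma reflection_arrangement_roots: "reflection_arrangement u v w = pline ` comb a b c ` roots m"
proof
  show "pline ` comb a b c ` roots m \<subseteq> reflection_arrangement u v w"
    unfolding reflection_arrangement_eq using roots_mirror_normals by (rule image_mono)
  show "reflection_arrangement u v w \<subseteq> pline ` comb a b c ` roots m"
    unfolding reflection_arrangement_eq
  proof
    fix L assume "L \<in> pline ` mirror_normals u v w"
    then obtain d where d: "L = pline d" "d \<in> mirror_normals u v w" by (rule imageE)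
    obtain p q r where e: "d = comb a b c (p, q, r)" by (rule comb_surj)
    from normals_proportional[OF d(2)[unfolded e], unfolded proportional_root_def]
    obtain j where j: "j \<noteq> 0 \<and> (j * p, j * q, j * r) \<in> roots m" ..
    have "L = pline (comb a b c (j * p, j * q, j * r))"
      unfolding d(1) e comb_scale[symmetric] using pline_scale[OF conjunct1[OF j]] by (rule sym)
    then show "L \<in> pline ` comb a b c ` roots m" using j by blast
  qed
qed

lemma reflection_arrangement_standard: "(standard m, reflection_arrangement u v w) \<in> projectively_equivalent"
  unfolding reflection_arrangement_roots by (rule comb_equivalent[OF inj_frame_map_orthonormal[OF orthonormal]])

lemma line_arrangement_reflections: "line_arrangement (reflection_arrangement u v w)"
  using reflection_arrangement_standard by (simp add: projectively_equivalent_def)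

lemma card_reflection_arrangement: "card (reflection_arrangement u v w) = 3 * m"
  using projectively_equivalent_card(1)[OF reflection_arrangement_standard] card_standard[OF m] by simp

section \<open>Reflection arrangements are special\<close>

abbreviation unit_roots :: "(real^3) set" where
  "unit_roots \<equiv> unit_normals (reflection_arrangement u v w)"

lemma unit_roots_normals: "x \<in> unit_roots \<longleftrightarrow> norm x = 1 \<and> x \<in> mirror_normals u v w"
proof
  assume "x \<in> unit_roots"
  then have x: "norm x = 1" "pline x \<in> pline ` mirror_normals u v w"
    unfolding unit_normals_def reflection_arrangement_eq by auto
  obtain d where d: "pline x = pline d" "d \<in> mirror_normals u v w" using x(2) by (rule imageE)
  have nz: "d \<noteq> 0" "x \<noteq> 0" using d(2) x(1) by (auto simp: mirror_normals_def)
  then obtain k where k: "x = k *\<^sub>R d" using pline_eq_iff[OF nz] d(1) by (auto simp: span_singleton)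
  then have "k \<noteq> 0" using nz by auto
  then have "x \<in> mirror_normals u v w"
    using reflection_closed_mirror_normals[of u v w] d(2) unfolding k reflection_closed_def by blast
  then show "norm x = 1 \<and> x \<in> mirror_normals u v w" using x(1) by blast
next
  assume "norm x = 1 \<and> x \<in> mirror_normals u v w"
  then show "x \<in> unit_roots" unfolding unit_normals_def reflection_arrangement_eq by blast
qed

lemma unit_roots_closed: "d \<in> mirror_normals u v w \<Longrightarrow> x \<in> unit_roots \<Longrightarrow> reflection d x \<in> unit_roots"
  using reflection_closed_mirror_normals[of u v w] reflection_dot[of d x x]
  unfolding unit_roots_normals reflection_closed_def norm_eq_1 by auto

text \<open>The frame operator of the unit roots as a bilinear form; the aim is to show that it is a
  multiple of the inner product.\<close>

definition form :: "real^3 \<Rightarrow> real^3 \<Rightarrow> real" where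
  "form y z = (\<Sum>x\<in>unit_roots. (x \<bullet> y) * (x \<bullet> z))"

lemma form_commute: "form y z = form z y"
  by (simp add: form_def mult.commute)

lemma form_add: "form y (z + z') = form y z + form y z'"
  by (simp add: form_def inner_right_distrib distrib_left sum.distrib)

lemma form_scale: "form y (k *\<^sub>R z) = k * form y z"
  by (simp add: form_def sum_distrib_left mult_ac)

text \<open>Every mirror normal is an eigenvector, by \<open>sum_reflection_orthogonal\<close>
  applied to the component of \<open>y\<close> orthogonal to it.\<close>

lemma form_normal:
  assumes d: "d \<in> mirror_normals u v w"
  shows "form d y = form d d / (d \<bullet> d) * (d \<bullet> y)"
proof -
  have d0: "d \<noteq> 0" using d by (simp add: mirror_normals_def)
  define k where "k = (d \<bullet> y) / (d \<bullet> d)"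
  have "d \<bullet> (y - k *\<^sub>R d) = 0" using d0 by (simp add: k_def inner_diff_right)
  then have "form d (y - k *\<^sub>R d) = 0"
    unfolding form_def using unit_roots_closed[OF d] d0 by (intro sum_reflection_orthogonal) auto
  then have "form d y = k * form d d" using form_add[of d "y - k *\<^sub>R d" "k *\<^sub>R d"] by (simp add: form_scale)
  then show ?thesis by (simp add: k_def)
qed

lemma form_eigenvalue_eq:
  assumes "d \<in> mirror_normals u v w" "e \<in> mirror_normals u v w" "d \<bullet> e \<noteq> 0"
  shows "form d d / (d \<bullet> d) = form e e / (e \<bullet> e)"
proof -
  have "form d d / (d \<bullet> d) * (d \<bullet> e) = form e e / (e \<bullet> e) * (d \<bullet> e)"
    using form_normal[OF assms(1), of e] form_normal[OF assms(2), of d, unfolded form_commute[of e d] inner_commute[of e d]]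
    by (rule trans[OF sym])
  from mult_right_cancel[OF assms(3), THEN iffD1, OF this] show ?thesis .
qed

text \<open>Schur's lemma by hand: non-orthogonal mirror normals have the same eigenvalue, so it is
  constant along the chain \<open>x\<close>, \<open>y\<close>, \<open>z\<close> of the Coxeter
  diagram.\<close>

lemma form_scalar:
  assumes x: "x \<in> mirror_normals u v w" and y: "y \<in> mirror_normals u v w" and z: "z \<in> mirror_normals u v w"
    and ne: "x \<bullet> y \<noteq> 0" "y \<bullet> z \<noteq> 0"
  obtains \<mu> where "subspace {h. \<forall>w. form h w = \<mu> * (h \<bullet> w)}" "{x, y, z} \<subseteq> {h. \<forall>w. form h w = \<mu> * (h \<bullet> w)}"
proof -
  define \<mu> where "\<mu> = form y y / (y \<bullet> y)"
  have "form x h = \<mu> * (x \<bullet> h)" for h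
    using form_normal[OF x, of h] unfolding form_eigenvalue_eq[OF x y ne(1)] \<mu>_def .
  moreover have "form y h = \<mu> * (y \<bullet> h)" for h using form_normal[OF y, of h] unfolding \<mu>_def .
  moreover have "form z h = \<mu> * (z \<bullet> h)" for h
    using form_normal[OF z, of h] unfolding form_eigenvalue_eq[OF y z ne(2), symmetric] \<mu>_def .
  ultimately have sub: "{x, y, z} \<subseteq> {h. \<forall>w. form h w = \<mu> * (h \<bullet> w)}" by blast
  have add: "form (h + h') e = form h e + form h' e" for h h' e
    using form_add[of e h h'] by (simp only: form_commute[of _ e])
  have scale: "form (k *\<^sub>R h) e = k * form h e" for k h e
    using form_scale[of e k h] by (simp only: form_commute[of _ e])
  have zero: "form 0 e = 0" for e using scale[of 0 0 e] by simp
  have "subspace {h. \<forall>w. form h w = \<mu> * (h \<bullet> w)}"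
    unfolding subspace_def by (auto simp: add scale zero inner_left_distrib algebra_simps)
  then show ?thesis using sub that by blast
qed

lemma simple_normal: "s \<in> simple_roots m \<Longrightarrow> comb a b c s \<in> mirror_normals u v w"
  using simple_mirror_normals by blast

text \<open>The trace determines the eigenvalue: the three diagonal values add up to the number
  \<open>6 * m\<close> of unit vectors.\<close>

lemma form_frame:
  assumes G: "subspace {h. \<forall>w. form h w = \<mu> * (h \<bullet> w)}" and abc: "{a, b, c} \<subseteq> {h. \<forall>w. form h w = \<mu> * (h \<bullet> w)}"
  shows "form y y = 2 * real m * (y \<bullet> y)"
proof -
  have on: "a \<bullet> a = 1" "b \<bullet> b = 1" "c \<bullet> c = 1" using orthonormal by (simp_all add: orthonormal_def)
  have "form a a + form b b + form c c = 3 * \<mu>" using abc on by simp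
  moreover have "form a a + form b b + form c c = (\<Sum>x\<in>unit_roots. (a \<bullet> x)\<^sup>2 + (b \<bullet> x)\<^sup>2 + (c \<bullet> x)\<^sup>2)"
    by (simp add: form_def sum.distrib power2_eq_square inner_commute[of _ a] inner_commute[of _ b] inner_commute[of _ c])
  also have "\<dots> = (\<Sum>x\<in>unit_roots. 1)"
    by (intro sum.cong refl) (simp add: orthonormal_square unit_normals_def norm_eq_1)
  also have "\<dots> = 6 * real m"
    using card_unit_normals[OF line_arrangement_reflections] by (simp add: card_reflection_arrangement)
  ultimately have \<mu>: "\<mu> = 2 * real m" by simp
  obtain p q r where y: "y = comb a b c (p, q, r)" by (rule comb_surj)
  have "y \<in> {h. \<forall>w. form h w = \<mu> * (h \<bullet> w)}" unfolding y comb_def prod.case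
    using abc by (intro subspace_add[OF G] subspace_scale[OF G]) auto
  then show ?thesis unfolding \<mu> by simp
qed

lemma frame: "form y y = 2 * real m * (y \<bullet> y)"
proof -
  have mm: "m = 1 \<or> m = 2 \<or> m = 3 \<or> m = 5" using m by simp
  have dot: "comb a b c (p, q, r) \<bullet> comb a b c (p', q', r') = p * p' + q * q' + r * r'" for p q r p' q' r'
    by (rule comb_dot[OF orthonormal])
  from mm show ?thesis
  proof (elim disjE)
    \<comment> \<open>The simple roots are mutually orthogonal here, so no chain joins them; the
      unit roots form an orthonormal basis up to sign, and the identity is Parseval's.\<close>
    assume m1: "m = 1"
    have on: "a \<bullet> a = 1" "b \<bullet> b = 1" "c \<bullet> c = 1" "a \<bullet> b = 0" "a \<bullet> c = 0" "b \<bullet> c = 0"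
      using orthonormal by (simp_all add: orthonormal_def)
    then have ne: "a \<noteq> b" "a \<noteq> c" "b \<noteq> c" "0 \<notin> {a, b, c}" by auto
    have n1: "norm a = 1" "norm b = 1" "norm c = 1" using on by (simp_all add: norm_eq_1)
    have V: "reflection_arrangement u v w = pline ` {a, b, c}"
      unfolding reflection_arrangement_roots m1 by (simp add: roots_def comb_def)
    have "card {a, b, c} = 3" using ne by simp
    then have inj: "inj_on pline {a, b, c}"
      using card_reflection_arrangement unfolding V m1 by (intro eq_card_imp_inj_on) simp_all
    have "form y y = 2 * ((a \<bullet> y)\<^sup>2 + (b \<bullet> y)\<^sup>2 + (c \<bullet> y)\<^sup>2)"
      unfolding form_def V using sum_unit_normals[OF _ ne(4) inj, of "\<lambda>x. (x \<bullet> y) * (x \<bullet> y)"] ne(1-3) n1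
      by (simp add: power2_eq_square)
    then show ?thesis unfolding orthonormal_square by (simp add: m1)
  next
    assume m2: "m = 2"
    have s: "comb a b c (1, -1, 0) \<in> mirror_normals u v w" "comb a b c (0, 1, -1) \<in> mirror_normals u v w"
      "comb a b c (0, 1, 1) \<in> mirror_normals u v w"
      by (simp_all add: simple_normal simple_roots_def m2)
    obtain \<mu> where G: "subspace {h. \<forall>w. form h w = \<mu> * (h \<bullet> w)}" (is "subspace ?G")
      and sub: "{comb a b c (0, 1, -1), comb a b c (1, -1, 0), comb a b c (0, 1, 1)} \<subseteq> {h. \<forall>w. form h w = \<mu> * (h \<bullet> w)}"
      by (rule form_scalar[OF s(2) s(1) s(3)]) (simp_all add: dot)
    have g: "b - c \<in> ?G" "a - b \<in> ?G" "b + c \<in> ?G" using sub by (simp_all only: insert_subset) (simp_all add: comb_def)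
    have "(1/2) *\<^sub>R ((b - c) + (b + c)) \<in> ?G" by (intro subspace_scale[OF G] subspace_add[OF G] g)
    moreover have "(1/2) *\<^sub>R ((b - c) + (b + c)) = b" by (simp flip: scaleR_2)
    ultimately have b: "b \<in> ?G" by (simp only:)
    have "(a - b) + b \<in> ?G" "(b + c) - b \<in> ?G" by (intro subspace_add[OF G] subspace_diff[OF G] g b)+
    then have "a \<in> ?G" "c \<in> ?G" by (simp_all only: diff_add_cancel add_diff_cancel_left')
    then show ?thesis using form_frame[OF G] b by blast
  next
    assume m3: "m = 3"
    have s: "comb a b c (1, -1, 0) \<in> mirror_normals u v w" "comb a b c (0, 1, -1) \<in> mirror_normals u v w"
      "comb a b c (0, 0, 1) \<in> mirror_normals u v w"
      by (simp_all add: simple_normal simple_roots_def m3)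
    obtain \<mu> where G: "subspace {h. \<forall>w. form h w = \<mu> * (h \<bullet> w)}" (is "subspace ?G")
      and sub: "{comb a b c (1, -1, 0), comb a b c (0, 1, -1), comb a b c (0, 0, 1)} \<subseteq> {h. \<forall>w. form h w = \<mu> * (h \<bullet> w)}"
      by (rule form_scalar[OF s]) (simp_all add: dot)
    have g: "a - b \<in> ?G" "b - c \<in> ?G" "c \<in> ?G" using sub by (simp_all only: insert_subset) (simp_all add: comb_def)
    have b: "(b - c) + c \<in> ?G" "(a - b) + ((b - c) + c) \<in> ?G" by (intro subspace_add[OF G] g)+
    then have "b \<in> ?G" "a \<in> ?G" by (simp_all only: diff_add_cancel)
    then show ?thesis using form_frame[OF G] g by blast
  next
    assume m5: "m = 5"
    have s: "comb a b c (1, 0, 0) \<in> mirror_normals u v w" "comb a b c (0, 1, 0) \<in> mirror_normals u v w"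
      "comb a b c (1, golden, golden - 1) \<in> mirror_normals u v w"
      by (simp_all add: simple_normal simple_roots_def m5)
    obtain \<mu> where G: "subspace {h. \<forall>w. form h w = \<mu> * (h \<bullet> w)}" (is "subspace ?G")
      and sub: "{comb a b c (1, 0, 0), comb a b c (1, golden, golden - 1), comb a b c (0, 1, 0)} \<subseteq> {h. \<forall>w. form h w = \<mu> * (h \<bullet> w)}"
      by (rule form_scalar[OF s(1) s(3) s(2)]) (use golden_gt_1 in \<open>simp_all add: dot\<close>)
    have g: "a \<in> ?G" "b \<in> ?G" "a + golden *\<^sub>R b + (golden - 1) *\<^sub>R c \<in> ?G"
      using sub by (simp_all only: insert_subset) (simp_all add: comb_def)
    have "(1 / (golden - 1)) *\<^sub>R ((a + golden *\<^sub>R b + (golden - 1) *\<^sub>R c) - (a + golden *\<^sub>R b)) \<in> ?G"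
      by (intro subspace_scale[OF G] subspace_diff[OF G] subspace_add[OF G] g)
    then have "c \<in> ?G" using golden_gt_1 by (simp only: add_diff_cancel_left') simp
    then show ?thesis using form_frame[OF G] g by blast
  qed
qed

theorem special_reflection_arrangement: "special m (reflection_arrangement u v w)"
proof -
  interpret unit_system unit_roots by (rule unit_system_unit_normals[OF line_arrangement_reflections])
  have fr: "(\<Sum>x\<in>unit_roots. (x \<bullet> y)\<^sup>2) = 2 * real m * (y \<bullet> y)" for y
    using frame[of y] by (simp add: form_def power2_eq_square)
  have cl: "reflection x y \<in> unit_roots" if "x \<in> unit_roots" "y \<in> unit_roots" for x y
    using unit_roots_closed[of x y] that unfolding unit_roots_normals[of x] by blast
  have cs: "card unit_roots = 6 * m"
    using card_unit_normals[OF line_arrangement_reflections] card_reflection_arrangement by simp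
  have "card (intersection_points (reflection_arrangement u v w) L) = m + 1" if L: "L \<in> reflection_arrangement u v w" for L
  proof -
    obtain x where x: "x \<in> unit_roots" "L = pline x"
      using L pline_unit_normals[OF line_arrangement_reflections] by (metis imageE)
    show ?thesis
      using card_planes_at[OF x(1)] reflection_closed_planes_at[OF cl cs fr x(1)]
      unfolding pline_unit_normals[OF line_arrangement_reflections] x(2) by simp
  qed
  then show ?thesis unfolding special_def
    using line_arrangement_reflections card_reflection_arrangement m by auto
qed

end

section \<open>Spherical triangles\<close>

lemma dim_3_noncollinear:
  fixes u v w :: "real^3"
  assumes "dim {u, v, w} = 3"
  shows "u \<noteq> 0" "v \<notin> span {u}" "w \<notin> span {u, v}"
proof -
  have e: "{u, v, w} = insert w (insert v {u})" "{v, u} = {u, v}" by auto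
  have "dim (insert w (insert v {u})) = 3" using assms unfolding e(1) .
  then show "w \<notin> span {u, v}" "v \<notin> span {u}" "u \<noteq> 0"
    unfolding dim_insert e(2)[symmetric] by (auto split: if_splits)
qed

lemma dim_3_triple_product:
  fixes u v w :: "real^3"
  assumes "w \<bullet> cross3 u v \<noteq> 0"
  shows "dim {u, v, w} = 3"
proof (rule ccontr)
  assume "dim {u, v, w} \<noteq> 3"
  then have "dim {u, v, w} < DIM(real^3)" using dim_subset_UNIV[of "{u, v, w}"] by simp
  then obtain a where a: "a \<noteq> 0" "span {u, v, w} \<subseteq> {x. a \<bullet> x = 0}" using lowdim_subset_hyperplane by blast
  then have z: "a \<bullet> u = 0" "a \<bullet> v = 0" "a \<bullet> w = 0" using span_superset[of "{u, v, w}"] by blast+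
  have "(w \<bullet> cross3 u v) *\<^sub>R a = (a \<bullet> cross3 v w) *\<^sub>R u + (a \<bullet> cross3 w u) *\<^sub>R v + (a \<bullet> cross3 u v) *\<^sub>R w"
    by (simp add: cross3_simps forall_3)
  then have "(w \<bullet> cross3 u v) * (a \<bullet> a) = 0"
    using z by (metis (no_types, lifting) inner_right_distrib inner_scaleR_right mult_zero_right add_0_right)
  then show False using assms a(1) by simp
qed

text \<open>The unit normal of a side; for the three sides in cyclic order, these are all inner or
  all outer normals of the triangle.\<close>

definition unit_cross :: "real^3 \<Rightarrow> real^3 \<Rightarrow> real^3" where
  "unit_cross x y = (1 / norm (cross3 x y)) *\<^sub>R cross3 x y"

text \<open>The cross product with the unit vector \<open>u\<close> turns tangential components at
  \<open>u\<close> by a quarter turn, which preserves lengths and angles. The minus sign comes from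
  the cyclic order \<open>w\<close>, \<open>u\<close> in the second factor.\<close>

lemma spherical_angle_unit_cross:
  assumes u: "norm u = 1"
  shows "spherical_angle u v w = arccos (- (unit_cross u v \<bullet> unit_cross w u))"
proof -
  have uu: "u \<bullet> u = 1" using u by (simp add: norm_eq_1)
  have dot: "side_direction u x \<bullet> side_direction u y = cross3 u x \<bullet> cross3 u y" for x y
    using uu by (simp add: side_direction_def dot_cross inner_diff_left inner_diff_right inner_commute algebra_simps)
  have "norm (side_direction u x) = norm (cross3 u x)" for x
    using dot[of x x] by (simp add: norm_eq_sqrt_inner)
  then have "spherical_angle u v w = arccos ((cross3 u v \<bullet> cross3 u w) / (norm (cross3 u v) * norm (cross3 u w)))"
    by (simp add: spherical_angle_def vector_angle_def dot)
  moreover have "cross3 u w = - cross3 w u" by (rule cross_skew)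
  ultimately show ?thesis by (simp add: unit_cross_def mult.commute[of "norm (cross3 w u)"])
qed

lemma abs_dot_unit_cross: "\<bar>unit_cross x y \<bullet> unit_cross z t\<bar> \<le> 1"
proof -
  have "norm (unit_cross a b) \<le> 1" for a b by (simp add: unit_cross_def)
  then have "norm (unit_cross x y) * norm (unit_cross z t) \<le> 1 * 1" by (intro mult_mono) simp_all
  then show ?thesis using Cauchy_Schwarz_ineq2[of "unit_cross x y" "unit_cross z t"] by simp
qed

lemma spherical_angle_dot:
  assumes "norm u = 1" "spherical_angle u v w = \<theta>"
  shows "unit_cross u v \<bullet> unit_cross w u = - cos \<theta>"
  using assms(2) abs_dot_unit_cross[of u v w u] unfolding spherical_angle_unit_cross[OF assms(1)]
  by (auto simp: abs_le_iff)

lemma unit_cross_side: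
  assumes "dim {u, v, w} = 3"
  shows "span {u, v} = mirror (unit_cross u v)" "unit_cross u v \<bullet> unit_cross u v = 1"
proof -
  note nc = dim_3_noncollinear[OF assms]
  have c: "cross3 u v \<noteq> 0" using cross3_nonzero[OF nc(1,2)] .
  have "span {u, v} = mirror (cross3 u v)"
    using span_pair_eq_hyperplane[OF nc(1,2) c] by (simp add: mirror_def dot_cross_self)
  then show "span {u, v} = mirror (unit_cross u v)" using c by (simp add: mirror_def unit_cross_def)
  have "norm (unit_cross u v) = 1" using c by (simp add: unit_cross_def)
  then show "unit_cross u v \<bullet> unit_cross u v = 1" by (simp only: norm_eq_1)
qed

definition angles :: "nat \<Rightarrow> real \<times> real \<times> real" where
  "angles m = (if m = 1 then (pi/2, pi/2, pi/2) else if m = 2 then (pi/2, pi/3, pi/3)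
     else if m = 3 then (pi/2, pi/3, pi/4) else (pi/2, pi/3, pi/5))"

lemma special_angles_eq: "special_angles = angles ` {1, 2, 3, 5}"
  by (auto simp: special_angles_def angles_def)

lemma inj_angles: "inj_on angles {1, 2, 3, 5}"
  by (auto simp: inj_on_def angles_def)

lemma mirror_scale: "k \<noteq> 0 \<Longrightarrow> mirror (k *\<^sub>R a) = mirror a"
  by (simp add: mirror_def)

text \<open>The angles fix all inner products of the unit normals of the sides, so the frame of the
  corresponding type provides the coordinates.\<close>

theorem triangle_coxeter:
  assumes tri: "spherical_triangle u v w" and ang: "triangle_angles u v w = angles m" and m: "m \<in> {1, 2, 3, 5}"
  obtains a b c where "coxeter_triangle u v w a b c m"
proof -
  have n: "norm u = 1" "norm v = 1" "norm w = 1" and d: "dim {u, v, w} = 3"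
    using tri by (auto simp: spherical_triangle_def)
  have d': "dim {v, w, u} = 3" "dim {w, u, v} = 3" using d by (simp_all add: insert_commute)
  define x y z where "x = unit_cross u v" and "y = unit_cross v w" and "z = unit_cross w u"
  have unit: "x \<bullet> x = 1" "y \<bullet> y = 1" "z \<bullet> z = 1"
    unfolding x_def y_def z_def using unit_cross_side(2) d d' by blast+
  have sides: "{span {u, v}, span {v, w}, span {w, u}} = {mirror x, mirror y, mirror z}"
    unfolding x_def y_def z_def using unit_cross_side(1)[OF d] unit_cross_side(1)[OF d'(1)] unit_cross_side(1)[OF d'(2)] by simp
  have dots: "x \<bullet> z = - cos \<alpha>" "x \<bullet> y = - cos \<beta>" "y \<bullet> z = - cos \<gamma>"
    if "angles m = (\<alpha>, \<beta>, \<gamma>)" for \<alpha> \<beta> \<gamma>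
  proof -
    have t: "spherical_angle u v w = \<alpha>" "spherical_angle v w u = \<beta>" "spherical_angle w u v = \<gamma>"
      using ang that by (simp_all add: triangle_angles_def)
    show "x \<bullet> z = - cos \<alpha>" "x \<bullet> y = - cos \<beta>" "y \<bullet> z = - cos \<gamma>"
      using spherical_angle_dot[OF n(1) t(1)] spherical_angle_dot[OF n(2) t(2)] spherical_angle_dot[OF n(3) t(3)]
      unfolding x_def y_def z_def by (simp_all add: inner_commute)
  qed
  have s2: "sqrt 2 \<noteq> 0" by simp
  consider "m = 1" | "m = 2" | "m = 3" | "m = 5" using m by blast
  then show ?thesis
  proof cases
    case 1
    have "orthonormal x y z" using unit dots[of "pi/2" "pi/2" "pi/2"] by (simp add: 1 angles_def orthonormal_def)
    then have "coxeter_triangle u v w x y z m"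
      by unfold_locales (simp_all add: 1 sides simple_roots_def comb_def)
    then show ?thesis using that by blast
  next
    case 2
    have g: "x \<bullet> y = - 1 / 2" "y \<bullet> z = - 1 / 2" "x \<bullet> z = 0"
      using dots[of "pi/2" "pi/3" "pi/3"] by (simp_all add: 2 angles_def cos_60)
    obtain a b c where on: "orthonormal a b c" and e: "comb a b c (1, -1, 0) = sqrt 2 *\<^sub>R y"
      "comb a b c (0, 1, -1) = sqrt 2 *\<^sub>R x" "comb a b c (0, 1, 1) = sqrt 2 *\<^sub>R z" using frame_A3[OF unit g] .
    have "{mirror x, mirror y, mirror z} = mirror ` comb a b c ` simple_roots m"
      by (auto simp: 2 simple_roots_def e mirror_scale[OF s2])
    then have "coxeter_triangle u v w a b c m"
      by unfold_locales (use on in \<open>simp_all only: sides, simp_all add: 2\<close>)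
    then show ?thesis using that by blast
  next
    case 3
    have g: "x \<bullet> y = - 1 / 2" "y \<bullet> z = - sqrt 2 / 2" "x \<bullet> z = 0"
      using dots[of "pi/2" "pi/3" "pi/4"] by (simp_all add: 3 angles_def cos_60 cos_45)
    obtain a b c where on: "orthonormal a b c" and e: "comb a b c (1, -1, 0) = sqrt 2 *\<^sub>R x"
      "comb a b c (0, 1, -1) = sqrt 2 *\<^sub>R y" "comb a b c (0, 0, 1) = z" using frame_B3[OF unit g] .
    have "coxeter_triangle u v w a b c m"
      by unfold_locales (use on in \<open>simp_all add: 3 sides simple_roots_def e mirror_scale[OF s2]\<close>)
    then show ?thesis using that by blast
  next
    case 4
    have g: "x \<bullet> y = - 1 / 2" "y \<bullet> z = - golden / 2" "x \<bullet> z = 0"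
      using dots[of "pi/2" "pi/3" "pi/5"] by (simp_all add: 4 angles_def cos_60 cos_pi_5)
    obtain a b c where on: "orthonormal a b c" and e: "comb a b c (1, 0, 0) = x"
      "comb a b c (0, 1, 0) = z" "comb a b c (1, golden, golden - 1) = (-2) *\<^sub>R y" using frame_H3[OF unit g] .
    have m2: "(-2::real) \<noteq> 0" by simp
    have "simple_roots m = {(1, 0, 0), (0, 1, 0), (1, golden, golden - 1)}" by (simp add: simple_roots_def 4)
    then have "{mirror x, mirror y, mirror z} = mirror ` comb a b c ` simple_roots m"
      by (simp only: image_insert image_empty e mirror_scale[OF m2] insert_commute)
    then have "coxeter_triangle u v w a b c m"
      by unfold_locales (use on in \<open>simp_all only: sides, simp_all add: 4\<close>)
    then show ?thesis using that by blast
  qed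
qed

text \<open>The polar triangle: its vertices are the normalised cross products of the given normals.
  Crossing these again returns positive multiples of the normals, with factors containing
  \<open>c \<bullet> cross3 a b\<close>.\<close>

lemma triangle_from_normals:
  assumes n: "norm a = 1" "norm b = 1" "norm c = 1" and D: "c \<bullet> cross3 a b > 0"
  shows "\<exists>u v w. spherical_triangle u v w \<and>
    triangle_angles u v w = (arccos (- (b \<bullet> c)), arccos (- (c \<bullet> a)), arccos (- (a \<bullet> b)))"
proof -
  let ?D = "c \<bullet> cross3 a b"
  have D': "a \<bullet> cross3 b c = ?D" "b \<bullet> cross3 c a = ?D" by (simp_all add: cross3_simps)
  have nz: "cross3 a b \<noteq> 0" "cross3 b c \<noteq> 0" "cross3 c a \<noteq> 0" using D D' by auto
  define u v w where "u = unit_cross b c" and "v = unit_cross c a" and "w = unit_cross a b"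
  have un: "norm u = 1" "norm v = 1" "norm w = 1" using nz by (simp_all add: u_def v_def w_def unit_cross_def)
  define k where "k = 1 / norm (cross3 a b)"
  define i where "i = 1 / norm (cross3 b c)"
  define j where "j = 1 / norm (cross3 c a)"
  have pos: "k > 0" "i > 0" "j > 0" using nz by (simp_all add: k_def i_def j_def)
  have cc: "cross3 (cross3 b c) (cross3 c a) = ?D *\<^sub>R c" "cross3 (cross3 c a) (cross3 a b) = ?D *\<^sub>R a"
    "cross3 (cross3 a b) (cross3 b c) = ?D *\<^sub>R b" by (simp_all add: cross3_simps forall_3)
  have uvw: "cross3 u v = (i * j * ?D) *\<^sub>R c" "cross3 v w = (j * k * ?D) *\<^sub>R a" "cross3 w u = (k * i * ?D) *\<^sub>R b"
    unfolding u_def v_def w_def unit_cross_def i_def[symmetric] j_def[symmetric] k_def[symmetric]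
    by (simp_all add: cross_mult_left cross_mult_right cc mult_ac)
  have unit: "unit_cross x y = e" if "cross3 x y = l *\<^sub>R e" "l > 0" "norm e = 1" for x y e :: "real^3" and l
    using that by (simp add: unit_cross_def)
  have U: "unit_cross u v = c" "unit_cross v w = a" "unit_cross w u = b"
    using unit[OF uvw(1)] unit[OF uvw(2)] unit[OF uvw(3)] pos D n by simp_all
  have "w \<bullet> cross3 u v = (k * (i * j * ?D)) * ?D" unfolding uvw w_def unit_cross_def k_def[symmetric]
    by (simp add: inner_commute)
  then have "dim {u, v, w} = 3" using pos D by (intro dim_3_triple_product) simp
  then have "spherical_triangle u v w" using un by (simp add: spherical_triangle_def)
  moreover have "triangle_angles u v w = (arccos (- (b \<bullet> c)), arccos (- (c \<bullet> a)), arccos (- (a \<bullet> b)))"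
    unfolding triangle_angles_def spherical_angle_unit_cross[OF un(1)] spherical_angle_unit_cross[OF un(2)]
      spherical_angle_unit_cross[OF un(3)] U by (simp add: inner_commute)
  ultimately show ?thesis by blast
qed

text \<open>Negating all three normals reverses the sign of the triple product and keeps every inner
  product.\<close>

lemma triangle_from_normals':
  assumes n: "norm a = 1" "norm b = 1" "norm c = 1" and D: "c \<bullet> cross3 a b \<noteq> 0"
  shows "\<exists>u v w. spherical_triangle u v w \<and>
    triangle_angles u v w = (arccos (- (b \<bullet> c)), arccos (- (c \<bullet> a)), arccos (- (a \<bullet> b)))"
proof (cases "c \<bullet> cross3 a b > 0")
  case True
  then show ?thesis by (rule triangle_from_normals[OF n])
next
  case False
  then have "(- c) \<bullet> cross3 (- a) (- b) > 0" using D by simp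
  from triangle_from_normals[OF _ _ _ this] show ?thesis using n by simp
qed

lemma triangle_exists:
  assumes "m \<in> {1, 2, 3, 5}"
  shows "\<exists>u v w. spherical_triangle u v w \<and> triangle_angles u v w = angles m"
proof -
  let ?v = "\<lambda>p q r. vector [p, q, r] :: real^3"
  have dot: "?v p q r \<bullet> ?v p' q' r' = p * p' + q * q' + r * r'" for p q r p' q' r'
    by (simp add: inner_vec_def sum_3 vector_3)
  have triple: "?v p q r \<bullet> cross3 (?v p' q' r') (?v p'' q'' r'')
    = p * (q' * r'' - r' * q'') + q * (r' * p'' - p' * r'') + r * (p' * q'' - q' * p'')" for p q r p' q' r' p'' q'' r''
    unfolding cross3_def dot by (simp add: dot vector_3)
  have key: "\<exists>u v w. spherical_triangle u v w \<and> triangle_angles u v w = (\<alpha>, \<beta>, \<gamma>)"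
    if "a \<bullet> a = 1" "b \<bullet> b = 1" "c \<bullet> c = 1" "c \<bullet> cross3 a b \<noteq> 0" "b \<bullet> c = - cos \<alpha>" "c \<bullet> a = - cos \<beta>" "a \<bullet> b = - cos \<gamma>"
      "0 \<le> \<alpha>" "\<alpha> \<le> pi" "0 \<le> \<beta>" "\<beta> \<le> pi" "0 \<le> \<gamma>" "\<gamma> \<le> pi" for a b c \<alpha> \<beta> \<gamma>
    using triangle_from_normals'[of a b c] that by (simp add: norm_eq_1 arccos_cos)
  define s where "s = sqrt 2 / 2"
  have s: "s * s = 1 / 2" "s \<noteq> 0" by (simp_all add: s_def)
  have gg: "golden * golden = golden + 1" by (rule golden_square)
  \<comment> \<open>The witnesses are the unit vectors along \<open>simple_roots m\<close>, with
    order and signs such that the inner products are minus the cosines of the angles.\<close>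
  consider "m = 1" | "m = 2" | "m = 3" | "m = 5" using assms by blast
  then show ?thesis
  proof cases
    case 1
    then show ?thesis using key[of "?v 1 0 0" "?v 0 1 0" "?v 0 0 1" "pi/2" "pi/2" "pi/2"]
      by (simp add: angles_def dot triple)
  next
    case 2
    then show ?thesis using key[of "?v s (-s) 0" "?v 0 s s" "?v 0 s (-s)" "pi/2" "pi/3" "pi/3"] s
      by (simp add: angles_def dot triple cos_60)
  next
    case 3
    then show ?thesis using key[of "?v 0 s (-s)" "?v 0 0 1" "?v s (-s) 0" "pi/2" "pi/3" "pi/4"] s
      by (simp add: angles_def dot triple cos_60 cos_45 s_def)
  next
    case 4
    then show ?thesis using key[of "?v (-1/2) (-golden/2) (-(golden-1)/2)" "?v 0 1 0" "?v 1 0 0" "pi/2" "pi/3" "pi/5"] gg golden_gt_1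
      by (simp add: angles_def dot triple cos_60 cos_pi_5 algebra_simps add_divide_distrib diff_divide_distrib)
  qed
qed

section \<open>Assembling the classification\<close>

lemma triangle_reflection_arrangement:
  assumes "spherical_triangle u v w" "triangle_angles u v w = angles m" "m \<in> {1, 2, 3, 5}"
  shows "special m (reflection_arrangement u v w)"
    "(standard m, reflection_arrangement u v w) \<in> projectively_equivalent"
proof -
  obtain a b c where "coxeter_triangle u v w a b c m" using triangle_coxeter[OF assms] .
  then interpret coxeter_triangle u v w a b c m .
  show "special m (reflection_arrangement u v w)" by (rule special_reflection_arrangement)
  show "(standard m, reflection_arrangement u v w) \<in> projectively_equivalent"
    by (rule reflection_arrangement_standard)
qed

lemma special_standard_arrangement:
  assumes m: "m \<in> {1, 2, 3, 5}"
  shows "special m (standard m)"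
proof -
  obtain u v w where "spherical_triangle u v w" "triangle_angles u v w = angles m"
    using triangle_exists[OF m] by blast
  note t = triangle_reflection_arrangement[OF this m]
  show ?thesis by (rule special_equivalent[OF equivalent_sym[OF t(2)] t(1)])
qed

text \<open>The four standard arrangements represent all classes by \<open>special_standard\<close>,
  and their numbers \<open>3 * m\<close> of lines tell them apart.\<close>

lemma special_quotient:
  "bij_betw (\<lambda>m. projectively_equivalent `` {standard m}) {1, 2, 3, 5}
     (special_arrangements // projectively_equivalent)"
  unfolding bij_betw_def
proof (intro conjI inj_onI equalityI subsetI)
  note ec = equiv_class_eq_iff[OF equiv_projectively_equivalent]
  fix m m' :: nat
  assume m: "m \<in> {1, 2, 3, 5}" "m' \<in> {1, 2, 3, 5}"
    and eq: "projectively_equivalent `` {standard m} = projectively_equivalent `` {standard m'}"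
  have "line_arrangement (standard m)" "line_arrangement (standard m')"
    using special_standard_arrangement m unfolding special_def by blast+
  then have "(standard m, standard m') \<in> projectively_equivalent" using eq unfolding ec by simp
  from projectively_equivalent_card(1)[OF this] show "m = m'"
    unfolding card_standard[OF m(1)] card_standard[OF m(2)] by simp
next
  fix X assume "X \<in> (\<lambda>m. projectively_equivalent `` {standard m}) ` {1, 2, 3, 5}"
  then obtain m where m: "m \<in> {1, 2, 3, 5}" "X = projectively_equivalent `` {standard m}" by (rule imageE)
  have "standard m \<in> special_arrangements"
    using special_standard_arrangement[OF m(1)] unfolding special_arrangements_eq by blast
  then show "X \<in> special_arrangements // projectively_equivalent" unfolding m(2) by (rule quotientI)
next
  fix X assume "X \<in> special_arrangements // projectively_equivalent"
  then obtain A where A: "A \<in> special_arrangements" "X = projectively_equivalent `` {A}" by (rule quotientE)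
  from A(1)[unfolded special_arrangements_eq mem_Collect_eq] obtain n where n: "special n A" ..
  have "X = projectively_equivalent `` {standard n}" unfolding A(2)
    using special_standard[OF n] equiv_class_eq[OF equiv_projectively_equivalent] by blast
  then show "X \<in> (\<lambda>m. projectively_equivalent `` {standard m}) ` {1, 2, 3, 5}"
    using special_standard[OF n] by blast
qed

theorem theorem1p1:
  shows "card (special_arrangements // projectively_equivalent) = 4 \<and>
    (\<exists>K. bij_betw K special_angles (special_arrangements // projectively_equivalent) \<and>
       (\<forall>t \<in> special_angles.
          (\<exists>u v w. spherical_triangle u v w \<and> triangle_angles u v w = t) \<and>
          (\<forall>u v w. spherical_triangle u v w \<and> triangle_angles u v w = t \<longrightarrow>
             reflection_arrangement u v w \<in> K t)))"
proof (intro conjI exI)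
  define orbit where "orbit m = projectively_equivalent `` {standard m}" for m
  let ?N = "{1, 2, 3, 5 :: nat}"
  have bij: "bij_betw orbit ?N (special_arrangements // projectively_equivalent)"
    using special_quotient unfolding orbit_def .
  show "card (special_arrangements // projectively_equivalent) = 4"
    using bij_betw_same_card[OF bij] by simp
  define K where "K = orbit \<circ> inv_into ?N angles"
  have "bij_betw angles ?N special_angles" using inj_angles by (simp add: bij_betw_def special_angles_eq)
  from bij_betw_trans[OF bij_betw_inv_into[OF this] bij]
  show "bij_betw K special_angles (special_arrangements // projectively_equivalent)" unfolding K_def .
  show "\<forall>t \<in> special_angles.
      (\<exists>u v w. spherical_triangle u v w \<and> triangle_angles u v w = t) \<and>
      (\<forall>u v w. spherical_triangle u v w \<and> triangle_angles u v w = t \<longrightarrow> reflection_arrangement u v w \<in> K t)"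
  proof
    fix t assume "t \<in> special_angles"
    then obtain m where m: "t = angles m" "m \<in> ?N" unfolding special_angles_eq by (rule imageE)
    have "K t = orbit m" unfolding K_def m(1) comp_def by (simp only: inv_into_f_f[OF inj_angles m(2)])
    then have "reflection_arrangement u v w \<in> K t"
      if "spherical_triangle u v w" "triangle_angles u v w = t" for u v w
      using triangle_reflection_arrangement(2)[OF that[unfolded m(1)] m(2)] by (simp add: orbit_def)
    then show "(\<exists>u v w. spherical_triangle u v w \<and> triangle_angles u v w = t) \<and>
      (\<forall>u v w. spherical_triangle u v w \<and> triangle_angles u v w = t \<longrightarrow> reflection_arrangement u v w \<in> K t)"
      using triangle_exists[OF m(2)] unfolding m(1) by blast
  qed
qed

end
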